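(* Let $d\ge 3$ and let $b\in\mathbf F_{\delta,g}$. Assume that $q>d$ and $\delta>0$ satisfy the following constraints: - if $d\in\{3,4\}$: $q=d+\varepsilon$ with $0<\varepsilon\le 2(\sqrt2-1)$ and $$\sqrt{\delta}<\Big(\sqrt{q-1}-\frac{q-2}{2}\Big)\frac{2}{q};$$ - if $d\ge 5$: $q=d+\varepsilon$ with $0<\varepsilon\le 1$ and $$\sqrt{\delta}<(1-\mu)\,\frac{q-1}{q-2}\,\frac1q$$ for some $0<\mu<1$ satisfying $16\mu>(1-\mu)^4\frac{(q-1)^2}{(q-2)^4}$. Let $\{b_n\}\in[b]^r$ be a regularizing sequence for $b$ and, for $0\le s<\infty$ and $h\in C_c^1(\mathbb R^d)$, let $u=u_n$ be the classical solution to the Cauchy problem $$(\partial_\tau-\Delta+b_n\cdot\nabla_x)u(\tau)=0,\quad s<\tau<\infty,\ x\in\mathbb R^d,\qquad u(s)=h.$$ Then there are constants $c_0,c_1>0$ and a finite function $c_2(t)$, all independent of $n$, such that for all $0\le s<t<\infty$ $$\sup_{s\le\tau\le t}\|\nabla u(\tau)\|_q^q+c_0\int_s^t\big\||\nabla u(\tau)|^{\frac{q-2}{2}}\partial_\tau u(\tau)\big\|_2^2\,d\tau+c_1\sum_{i=1}^d\int_s^t\big\langle|\nabla_i\nabla u(\tau)|^2,|\nabla u(\tau)|^{q-2}\big\rangle\,d\tau\le e^{c_2(t)}\|\nabla u(s)\|_q^q.$$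
   Context: Throughout $d\ge3$. $\|\cdot\|_p$ is the norm of $L^p(\mathbb R^d)$ in the spatial variable; $\langle f,g\rangle=\int_{\mathbb R^d}f\bar g\,dx$; $\nabla=\nabla_x$, $\nabla_i=\partial_{x_i}$ and $\Delta=\Delta_x$ act in the spatial variable; $\mathcal S(\mathbb R^{1+d})$ is the Schwartz space. Form-bounded vector fields. A Borel measurable vector field $b:\mathbb R^{1+d}\to\mathbb R^d$ belongs to $\mathbf F_{\delta,g}$ (is form-bounded with form-bound $\delta>0$) if $|b|\in L^2_{\rm loc}(\mathbb R^{1+d})$ and, for the function $0\le g=g_\delta\in L^1_{\rm loc}(\mathbb R)$, for all $t>0$ and all $f\in\mathcal S(\mathbb R^{1+d})$, $$\int_0^t\|b(\tau)f(\tau)\|_2^2\,d\tau\le\delta\int_0^t\|\nabla f(\tau)\|_2^2\,d\tau+\int_0^tg(\tau)\|f(\tau)\|_2^2\,d\tau.$$ Regularizing sequences. For $b\in\mathbf F_{\delta,g}$, $[b]^r$ is the collection of all sequences $\{b_n\}\subset[L^\infty(\mathbb R^{1+d})\cap C^\infty(\mathbb R^{1+d})]^d$ such that, for any $0<t<\infty$: (i) $\lim_{n}\|b_n-b\|_{L^2([0,t]\times K)}=0$ for every compact $K\subset\mathbb R^d$; (ii) there is a sequence of functions $0\le g_n\in L^1_{\rm loc}(\mathbb R)$ with $\sup_n\int_0^tg_n(\tau)\,d\tau=c_\delta(t)<\infty$; (iii) for all $n\ge1$ and $f\in\mathcal S(\mathbb R^{1+d})$, $\int_0^t\|b_n(\tau)f(\tau)\|_2^2\,d\tau\le\delta\int_0^t\|\nabla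 f(\tau)\|_2^2\,d\tau+\int_0^tg_n(\tau)\|f(\tau)\|_2^2\,d\tau$. "The classical solution" is understood as the bounded classical solution. *)

theory Defs
  imports "HOL-Analysis.Analysis"
begin

text \<open>
  Space-time \<open>\<real>\<^sup>1\<^sup>+\<^sup>d\<close> is the type \<^typ>\<open>real \<times> (real^'d)\<close>, with \<open>d = CARD('d)\<close>. Scalar functions
  are complex-valued (the pairing of the source is sesquilinear); vector fields such as
  \<open>b\<close> are real. The norm of \<^typ>\<open>complex^'d\<close> is the Euclidean one.
\<close>

subsection \<open>Derivatives and function spaces\<close>

definition dir_deriv ::
  "'a::real_normed_vector \<Rightarrow> ('a \<Rightarrow> 'b::real_normed_vector) \<Rightarrow> 'a \<Rightarrow> 'b" where
  "dir_deriv e f x = vector_derivative (\<lambda>r. f (x + r *\<^sub>R e)) (at 0)"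

definition partial :: "'d::finite \<Rightarrow> (real^'d \<Rightarrow> 'b::real_normed_vector) \<Rightarrow> real^'d \<Rightarrow> 'b" where
  "partial i = dir_deriv (axis i 1)"

definition grad :: "(real^'d::finite \<Rightarrow> 'b::real_normed_vector) \<Rightarrow> real^'d \<Rightarrow> 'b^'d" where
  "grad f x = (\<chi> i. partial i f x)"

definition laplacian :: "(real^'d::finite \<Rightarrow> 'b::real_normed_vector) \<Rightarrow> real^'d \<Rightarrow> 'b" where
  "laplacian f x = (\<Sum>i\<in>UNIV. partial i (partial i f) x)"

definition time_deriv :: "(real \<Rightarrow> 'a \<Rightarrow> 'b::real_normed_vector) \<Rightarrow> real \<Rightarrow> 'a \<Rightarrow> 'b" where
  "time_deriv u \<tau> x = vector_derivative (\<lambda>r. u r x) (at \<tau>)"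

primrec iter_deriv ::
  "'a::real_normed_vector list \<Rightarrow> ('a \<Rightarrow> 'b::real_normed_vector) \<Rightarrow> 'a \<Rightarrow> 'b" where
  "iter_deriv [] f = f"
| "iter_deriv (e # es) f = dir_deriv e (iter_deriv es f)"

text \<open>Differentiability of every iterated partial derivative also gives its continuity.\<close>

definition smooth :: "('a::euclidean_space \<Rightarrow> 'b::real_normed_vector) \<Rightarrow> bool" where
  "smooth f \<longleftrightarrow> (\<forall>es\<in>lists Basis. iter_deriv es f differentiable_on UNIV)"

definition schwartz :: "('a::euclidean_space \<Rightarrow> complex) \<Rightarrow> bool" where
  "schwartz f \<longleftrightarrow> smooth f \<and>
     (\<forall>es\<in>lists Basis. \<forall>k::nat. bounded (range (\<lambda>x. norm x ^ k *\<^sub>R iter_deriv es f x)))"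

definition C1_compact_support :: "(real^'d::finite \<Rightarrow> complex) \<Rightarrow> bool" where
  "C1_compact_support h \<longleftrightarrow>
     h differentiable_on UNIV \<and> continuous_on UNIV (grad h) \<and> compact (closure {x. h x \<noteq> 0})"

text \<open>
  The \<open>p\<close>-th power of the \<open>L\<^sup>p\<close> norm, in \<^typ>\<open>ennreal\<close>, so that a finite bound on it
  includes membership in \<open>L\<^sup>p\<close>.
\<close>

definition Lp_norm_pow :: "real \<Rightarrow> ('a::euclidean_space \<Rightarrow> 'b::real_normed_vector) \<Rightarrow> ennreal" where
  "Lp_norm_pow p f = (\<integral>\<^sup>+x. ennreal (norm (f x) powr p) \<partial>lborel)"

definition Lp_loc :: "real \<Rightarrow> ('a::euclidean_space \<Rightarrow> 'b::real_normed_vector) \<Rightarrow> bool" where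
  "Lp_loc p f \<longleftrightarrow> f \<in> borel_measurable borel \<and>
     (\<forall>K. compact K \<longrightarrow> set_integrable lborel K (\<lambda>x. norm (f x) powr p))"

subsection \<open>Form-bounded vector fields and regularizing sequences\<close>

definition form_ineq ::
  "real \<Rightarrow> (real \<Rightarrow> real) \<Rightarrow> (real \<times> (real^'d::finite) \<Rightarrow> real^'d) \<Rightarrow> real
    \<Rightarrow> (real \<times> (real^'d) \<Rightarrow> complex) \<Rightarrow> bool" where
  "form_ineq \<delta> g b t f \<longleftrightarrow>
     (\<integral>\<^sup>+\<tau>\<in>{0..t}. Lp_norm_pow 2 (\<lambda>x. \<chi> i. b (\<tau>, x) $ i *\<^sub>R f (\<tau>, x)) \<partial>lborel)
       \<le> ennreal \<delta> * (\<integral>\<^sup>+\<tau>\<in>{0..t}. Lp_norm_pow 2 (grad (\<lambda>x. f (\<tau>, x))) \<partial>lborel)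
         + (\<integral>\<^sup>+\<tau>\<in>{0..t}. ennreal (g \<tau>) * Lp_norm_pow 2 (\<lambda>x. f (\<tau>, x)) \<partial>lborel)"

definition form_bounded ::
  "real \<Rightarrow> (real \<Rightarrow> real) \<Rightarrow> (real \<times> (real^'d::finite) \<Rightarrow> real^'d) set" where
  "form_bounded \<delta> g = {b.
     0 < \<delta> \<and> (\<forall>\<tau>. 0 \<le> g \<tau>) \<and> Lp_loc 1 g \<and>
     b \<in> borel_measurable borel \<and> Lp_loc 2 b \<and>
     (\<forall>t>0. \<forall>f. schwartz f \<longrightarrow> form_ineq \<delta> g b t f)}"

text \<open>
  A continuous field is in \<open>L\<^sup>\<infinity>\<close> iff it is bounded. Convergence in \<open>L\<^sup>2([0,t] \<times> K)\<close>
  is stated for the squared norm. The functions \<open>G n\<close> may depend on \<open>t\<close>.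
\<close>

definition regularizing_seqs ::
  "real \<Rightarrow> (real \<times> (real^'d::finite) \<Rightarrow> real^'d) \<Rightarrow> (nat \<Rightarrow> real \<times> (real^'d) \<Rightarrow> real^'d) set" where
  "regularizing_seqs \<delta> b = {bs.
     (\<forall>n. bounded (range (bs n)) \<and> smooth (bs n)) \<and>
     (\<forall>t>0.
       (\<forall>K. compact K \<longrightarrow>
         (\<lambda>n. \<integral>\<^sup>+z\<in>{0..t} \<times> K. ennreal (norm (bs n z - b z) ^ 2) \<partial>lborel) \<longlonglongrightarrow> 0) \<and>
       (\<exists>G. (\<forall>n \<tau>. 0 \<le> G n \<tau>) \<and> (\<forall>n. Lp_loc 1 (G n)) \<and>
         (SUP n. \<integral>\<^sup>+\<tau>\<in>{0..t}. ennreal (G n \<tau>) \<partial>lborel) < \<infinity> \<and>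
         (\<forall>n f. schwartz f \<longrightarrow> form_ineq \<delta> (G n) (bs n) t f)))}"

subsection \<open>Bounded classical solutions of the Cauchy problem\<close>

text \<open>
  The class is \<open>C([s,\<infinity>) \<times> \<real>\<^sup>d) \<inter> C\<^sup>1\<^sup>,\<^sup>2((s,\<infinity>) \<times> \<real>\<^sup>d)\<close> with \<open>u\<close> bounded; nothing is assumed of the
  derivatives of \<open>u\<close> up to time \<open>s\<close>. Values of \<open>u\<close> before time \<open>s\<close> are irrelevant.
\<close>

definition bounded_classical_solution ::
  "(real \<times> (real^'d::finite) \<Rightarrow> real^'d) \<Rightarrow> real \<Rightarrow> (real^'d \<Rightarrow> complex)
    \<Rightarrow> (real \<Rightarrow> real^'d \<Rightarrow> complex) \<Rightarrow> bool" where
  "bounded_classical_solution b s h u \<longleftrightarrow>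
     continuous_on ({s..} \<times> UNIV) (\<lambda>(\<tau>, x). u \<tau> x) \<and>
     bounded ((\<lambda>(\<tau>, x). u \<tau> x) ` ({s..} \<times> UNIV)) \<and>
     (\<forall>\<tau>>s. \<forall>x. (\<lambda>r. u r x) differentiable (at \<tau>)) \<and>
     (\<forall>\<tau>>s. u \<tau> differentiable_on UNIV \<and> grad (u \<tau>) differentiable_on UNIV) \<and>
     continuous_on ({s<..} \<times> UNIV) (\<lambda>(\<tau>, x). time_deriv u \<tau> x) \<and>
     continuous_on ({s<..} \<times> UNIV) (\<lambda>(\<tau>, x). grad (u \<tau>) x) \<and>
     (\<forall>i. continuous_on ({s<..} \<times> UNIV) (\<lambda>(\<tau>, x). partial i (grad (u \<tau>)) x)) \<and>
     (\<forall>\<tau>>s. \<forall>x. time_deriv u \<tau> x - laplacian (u \<tau>) x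
        + (\<Sum>i\<in>UNIV. b (\<tau>, x) $ i *\<^sub>R partial i (u \<tau>) x) = 0) \<and>
     (\<forall>x. u s x = h x)"

end

theory Submission
  imports Defs "HOL-Real_Asymp.Real_Asymp"
begin

text \<open>
  Let \<open>w = \<nabla>u\<close>, and test the equation with the divergence of \<open>\<eta>\<^sup>2|w|\<^sup>q\<^sup>-\<^sup>2w\<close>. The drift enters only
  through \<open>|b|\<^sup>2|w|\<^sup>q\<close>, which the form bound for \<open>f = \<eta>|w|\<^sup>q\<^sup>/\<^sup>2\<close> absorbs into the second-order term as soon
  as \<open>q\<surd>\<delta>/2 < 1\<close>; this is all that is used of the smallness conditions on \<open>\<delta>\<close>, in every dimension.

  A classical solution is only \<open>C\<^sup>1\<^sup>,\<^sup>2\<close> and only \<open>u\<close> itself is bounded. So the boundedness of \<open>w\<close>, and its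
  uniform convergence to \<open>\<nabla>h\<close> at the initial time, come from the maximum principle for
  \<open>u(\<tau>,x) - u(\<tau>,y)\<close>; and \<open>\<integral>\<eta>\<^sup>2|w|\<^sup>q\<close> is differentiated in time without \<open>\<partial>\<^sub>\<tau>w\<close>, by the convexity of
  \<open>|w|\<^sup>q\<close> and an integration by parts. The cutoff \<open>\<eta>\<close> is removed at the end along weights whose
  gradients are small compared with the weights themselves.
\<close>

subsection \<open>Directional derivatives and integration by parts\<close>

text \<open>The difficulty is uniformity in n. The maximum principle bounds the gradient only by a
  constant that contains sup |b_n|. That constant may enter solely as \<open>K\<close> in the error
  made by the cutoff, which tends to zero; every surviving constant comes from \<delta>, q, d, t and
  the integrals of the functions g_n. The threshold arises as follows. The form bound for |w|^(q/2)
  costs \<delta> q^2/4 times the integral of |w|^(q-2) |grad |w||^2. The pointwise estimate with a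
  parameter \<beta> < 1 pays for |b|^2 |w|^q with the factor (q-1)/(2 \<beta>) and leaves (q-1)
  \<beta>/2 of that integral. So \<delta> q^2/4 < \<beta>^2 is what has to hold, and \<beta> may be
  as close to 1 as desired. The g_n are bounded in L^1 only, so exp(c2(t)) is found by counting
  pieces of kernel mass 1/2. The class of solutions says nothing about w at the initial time, so the
  energy is started at a time \<open>s1\<close> > \<open>s\<close>, and \<open>s1\<close> tends to
  \<open>s\<close> in the same limit that removes the cutoff.\<close>

definition has_dir_deriv ::
  "'a::real_normed_vector \<Rightarrow> ('a \<Rightarrow> 'b::real_normed_vector) \<Rightarrow> ('a \<Rightarrow> 'b) \<Rightarrow> bool" where
  "has_dir_deriv e f f' \<longleftrightarrow> (\<forall>x. ((\<lambda>r. f (x + r *\<^sub>R e)) has_vector_derivative f' x) (at 0))"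

text \<open>Since the derivative is demanded at every base point, shifting the parameter yields it
  along the whole line.\<close>

lemma has_dir_deriv_shift:
  assumes "has_dir_deriv e f f'"
  shows "((\<lambda>r. f (x + r *\<^sub>R e)) has_vector_derivative f' (x + r0 *\<^sub>R e)) (at r0 within S)"
proof -
  have "((\<lambda>r. f ((x + r0 *\<^sub>R e) + r *\<^sub>R e)) has_vector_derivative f' (x + r0 *\<^sub>R e)) (at 0)"
    using assms unfolding has_dir_deriv_def by blast
  then have "((\<lambda>r. f ((x + r0 *\<^sub>R e) + r *\<^sub>R e)) has_vector_derivative f' (x + r0 *\<^sub>R e)) (at (r0 - r0))"
    by simp
  then have *: "((\<lambda>r. f ((x + r0 *\<^sub>R e) + r *\<^sub>R e)) has_vector_derivative f' (x + r0 *\<^sub>R e))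
      (at ((\<lambda>r. r - r0) r0) within (\<lambda>r. r - r0) ` UNIV)"
    by (auto intro: has_vector_derivative_within_subset)
  have "((\<lambda>r. f ((x + r0 *\<^sub>R e) + r *\<^sub>R e)) \<circ> (\<lambda>r. r - r0) has_vector_derivative 1 *\<^sub>R f' (x + r0 *\<^sub>R e)) (at r0 within UNIV)"
    by (rule vector_diff_chain_within[OF _ *]) (auto intro!: derivative_eq_intros)
  then show ?thesis
    by (auto simp: o_def algebra_simps scaleR_diff_left intro: has_vector_derivative_at_within)
qed

lemma has_dir_deriv_dir_deriv: "has_dir_deriv e f f' \<Longrightarrow> dir_deriv e f x = f' x"
  unfolding has_dir_deriv_def dir_deriv_def by (rule vector_derivative_at) blast

lemma has_dir_deriv_from_derivative:
  assumes "\<And>x. (f has_derivative f' x) (at x)"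
  shows "has_dir_deriv e f (\<lambda>x. f' x e)"
  unfolding has_dir_deriv_def
proof
  fix x
  have "((\<lambda>r. x + r *\<^sub>R e) has_derivative (\<lambda>r. r *\<^sub>R e)) (at 0)"
    by (auto intro!: derivative_eq_intros)
  moreover have "(f has_derivative f' x) (at (x + 0 *\<^sub>R e))" using assms by simp
  ultimately have "(f \<circ> (\<lambda>r. x + r *\<^sub>R e) has_derivative f' x \<circ> (\<lambda>r. r *\<^sub>R e)) (at 0)"
    by (rule diff_chain_at)
  moreover have "f' x \<circ> (\<lambda>r. r *\<^sub>R e) = (\<lambda>r. r *\<^sub>R f' x e)"
    using assms[of x] by (auto simp: o_def linear_simps has_derivative_bounded_linear linear_scale bounded_linear.linear)
  ultimately show "((\<lambda>r. f (x + r *\<^sub>R e)) has_vector_derivative f' x e) (at 0)"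
    by (simp add: has_vector_derivative_def o_def)
qed

lemma integral_UNIV_eq_cbox:
  fixes f :: "'a::euclidean_space \<Rightarrow> 'b::banach"
  assumes "\<And>x. x \<notin> cbox a b \<Longrightarrow> f x = 0"
  shows "integral UNIV f = integral (cbox a b) f"
proof -
  have "integral UNIV f = integral UNIV (\<lambda>x. if x \<in> cbox a b then f x else 0)"
    by (rule integral_cong) (use assms in auto)
  also have "\<dots> = integral (cbox a b) f" by (rule integral_restrict_UNIV)
  finally show ?thesis .
qed

lemma integral_UNIV_translate:
  fixes f :: "'a::euclidean_space \<Rightarrow> 'b::banach"
  assumes "\<And>x. x \<notin> cbox a b \<Longrightarrow> f x = 0"
  shows "integral UNIV (\<lambda>x. f (x + c)) = integral UNIV f"
proof -
  have "x + c \<in> cbox a b \<longleftrightarrow> x \<in> cbox (a - c) (b - c)" for x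
    by (auto simp: mem_box algebra_simps)
  then have "integral UNIV (\<lambda>x. f (x + c)) = integral (cbox (a - c) (b - c)) (\<lambda>x. f (x + c))"
    by (intro integral_UNIV_eq_cbox) (use assms in auto)
  also have "\<dots> = integral (cbox a b) f"
    using integral_shift_cbox_plus[of "a - c" "b - c" f c] by (simp add: o_def add.commute)
  also have "\<dots> = integral UNIV f" using integral_UNIV_eq_cbox[of a b f] assms by simp
  finally show ?thesis .
qed

lemma bounded_bilinear_has_vector_derivative_left:
  assumes "bounded_bilinear B" "(f has_vector_derivative f') F"
  shows "((\<lambda>r. B (f r) c) has_vector_derivative B f' c) F"
  using bounded_linear.has_vector_derivative[OF bounded_bilinear.bounded_linear_left[OF assms(1)] assms(2)] .

text \<open>The source of all integrations by parts below. Only \<open>f\<close> is translated, so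
  only \<open>f\<close> has to be differentiable; the support of \<open>g\<close> keeps the domain
  of integration fixed while \<open>r\<close> varies.\<close>

lemma leibniz_translate:
  fixes f :: "'a::euclidean_space \<Rightarrow> 'b::real_normed_vector" and g :: "'a \<Rightarrow> 'c::real_normed_vector"
    and B :: "'b \<Rightarrow> 'c \<Rightarrow> 'd::banach"
  assumes d: "has_dir_deriv e f f'" and B: "bounded_bilinear B"
    and cf: "continuous_on UNIV f" and cf': "continuous_on UNIV f'" and cg: "continuous_on UNIV g"
    and supp: "\<And>x. x \<notin> cbox a b \<Longrightarrow> g x = 0"
  shows "((\<lambda>r. integral UNIV (\<lambda>x. B (f (x + r *\<^sub>R e)) (g x))) has_vector_derivative
           integral UNIV (\<lambda>x. B (f' x) (g x))) (at 0)"
proof -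
  note [continuous_intros] = bounded_bilinear.continuous_on[OF B]
  have "((\<lambda>r. integral (cbox a b) (\<lambda>x. B (f (x + r *\<^sub>R e)) (g x))) has_vector_derivative
           integral (cbox a b) (\<lambda>x. B (f' (x + 0 *\<^sub>R e)) (g x))) (at 0 within UNIV)"
  proof (rule leibniz_rule_vector_derivative[where fx="\<lambda>r x. B (f' (x + r *\<^sub>R e)) (g x)"])
    fix r :: real and x assume "x \<in> cbox a b"
    show "((\<lambda>r. B (f (x + r *\<^sub>R e)) (g x)) has_vector_derivative B (f' (x + r *\<^sub>R e)) (g x)) (at r within UNIV)"
      by (rule bounded_bilinear_has_vector_derivative_left[OF B has_dir_deriv_shift[OF d]])
  next
    fix r :: real
    have "continuous_on (cbox a b) (\<lambda>x. B (f (x + r *\<^sub>R e)) (g x))"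
      by (intro continuous_intros continuous_on_compose2[OF cf] continuous_on_subset[OF cg]) auto
    then show "(\<lambda>x. B (f (x + r *\<^sub>R e)) (g x)) integrable_on cbox a b" by (rule integrable_continuous)
  next
    show "continuous_on (UNIV \<times> cbox a b) (\<lambda>(r, x). B (f' (x + r *\<^sub>R e)) (g x))"
      unfolding split_beta
      by (intro continuous_intros continuous_on_compose2[OF cf'] continuous_on_compose2[OF cg]) auto
  qed auto
  moreover have "B y 0 = 0" for y by (rule bounded_bilinear.zero_right[OF B])
  ultimately show ?thesis
    by (subst (1 2) integral_UNIV_eq_cbox[where a=a and b=b]) (auto simp: supp)
qed

lemma has_dir_deriv_outside_support:
  assumes d: "has_dir_deriv e f f'" and supp: "\<And>x. x \<notin> cbox a b \<Longrightarrow> f x = 0" and x: "x \<notin> cbox a b"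
  shows "f' x = 0"
proof -
  have *: "open (- cbox a b)" by (intro open_Compl closed_cbox)
  have "open ((\<lambda>r. x + r *\<^sub>R e) -` (- cbox a b))"
    by (rule open_vimage[OF *]) (auto intro!: continuous_intros)
  then have "((\<lambda>r. f (x + r *\<^sub>R e)) has_vector_derivative f' x) (at 0) \<longleftrightarrow>
     ((\<lambda>r. 0) has_vector_derivative f' x) (at 0)"
    using x supp by (intro has_vector_derivative_cong_ev)
      (auto simp: eventually_nhds intro!: exI[of _ "(\<lambda>r. x + r *\<^sub>R e) -` (- cbox a b)"])
  then have "((\<lambda>r. 0) has_vector_derivative f' x) (at 0)"
    using d by (simp add: has_dir_deriv_def)
  then show ?thesis using has_vector_derivative_const vector_derivative_unique_at by blast
qed

text \<open>Continuity is enough for this cutoff, since it only occurs as the factor of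
  \<open>leibniz_translate\<close> that is not differentiated.\<close>

lemma exists_bump_one_on_cbox:
  fixes a b :: "'a::euclidean_space"
  obtains g :: "'a \<Rightarrow> real" and c d where "continuous_on UNIV g" "\<And>x. x \<in> cbox a b \<Longrightarrow> g x = 1"
    "\<And>x. x \<notin> cbox c d \<Longrightarrow> g x = 0"
proof -
  define c where "c = a - One" define d where "d = b + One"
  have sub: "cbox a b \<subseteq> box c d"
    by (force simp: c_def d_def mem_box inner_diff_left inner_add_left)
  obtain g :: "'a \<Rightarrow> real" where g: "continuous_on UNIV g" "\<And>x. g x \<in> closed_segment 1 0"
     "\<And>x. x \<in> cbox a b \<Longrightarrow> g x = 1" "\<And>x. x \<in> - box c d \<Longrightarrow> g x = 0"
    using Urysohn[of "cbox a b" "- box c d" "1::real" 0] sub by (auto simp: disjoint_iff)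
  show ?thesis
  proof (rule that[OF g(1,3)])
    show "g x = 0" if "x \<notin> cbox c d" for x
      using g(4)[of x] that box_subset_cbox by blast
  qed
qed

text \<open>By translation invariance the integral of \<open>f (x + r e)\<close> does not depend on
  \<open>r\<close>, and its derivative at \<open>r = 0\<close> is the integral of \<open>f'\<close>.
  No iterated integration along the direction \<open>e\<close> is involved.\<close>

lemma integral_dir_deriv_eq_0:
  fixes f :: "'a::euclidean_space \<Rightarrow> 'b::banach"
  assumes d: "has_dir_deriv e f f'" and cf: "continuous_on UNIV f" and cf': "continuous_on UNIV f'"
    and supp: "\<And>x. x \<notin> cbox a b \<Longrightarrow> f x = 0"
  shows "integral UNIV f' = 0"
proof -
  \<comment> \<open>\<open>S\<close> contains the supports of all translates with |r| \<le> 1. A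
    cutoff that is 1 on \<open>S\<close> changes nothing for such \<open>r\<close> and supplies the
    fixed compactly supported factor.\<close>
  define S where "S = (\<lambda>(r, x). x - r *\<^sub>R e) ` ({-1..1} \<times> cbox a b)"
  have "compact S"
    unfolding S_def by (intro compact_continuous_image compact_Times)
      (auto intro!: continuous_intros simp: split_beta)
  then have "bounded S" by (rule compact_imp_bounded)
  then obtain c' d' where S: "S \<subseteq> cbox c' d'" using bounded_subset_cbox_symmetric by metis
  obtain g :: "'a \<Rightarrow> real" and c d where g: "continuous_on UNIV g"
    "\<And>x. x \<in> cbox c' d' \<Longrightarrow> g x = 1" "\<And>x. x \<notin> cbox c d \<Longrightarrow> g x = 0"
    using exists_bump_one_on_cbox by metis
  have g1: "g x = 1" if "x + r *\<^sub>R e \<in> cbox a b" "\<bar>r\<bar> \<le> 1" for x r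
  proof -
    have "x = (\<lambda>(r, x). x - r *\<^sub>R e) (r, x + r *\<^sub>R e)" by simp
    moreover have "(r, x + r *\<^sub>R e) \<in> {-1..1} \<times> cbox a b" using that by auto
    ultimately have "x \<in> S" unfolding S_def by (metis imageI)
    then show ?thesis using S g(2) by blast
  qed
  have eq: "integral UNIV (\<lambda>x. g x *\<^sub>R f (x + r *\<^sub>R e)) = integral UNIV f" if "\<bar>r\<bar> \<le> 1" for r
  proof -
    have "(\<lambda>x. g x *\<^sub>R f (x + r *\<^sub>R e)) = (\<lambda>x. f (x + r *\<^sub>R e))"
      using g1[OF _ that] supp by (metis scaleR_one scaleR_zero_right)
    then show ?thesis using integral_UNIV_translate[OF supp] by simp
  qed
  have "((\<lambda>r. integral UNIV (\<lambda>x. (\<lambda>y c. c *\<^sub>R y) (f (x + r *\<^sub>R e)) (g x))) has_vector_derivative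
           integral UNIV (\<lambda>x. (\<lambda>y c. c *\<^sub>R y) (f' x) (g x))) (at 0)"
    by (rule leibniz_translate[OF d _ cf cf' g(1,3)])
       (rule bounded_bilinear.flip[OF bounded_bilinear_scaleR])
  then have "((\<lambda>r. integral UNIV f) has_vector_derivative
           integral UNIV (\<lambda>x. (\<lambda>y c. c *\<^sub>R y) (f' x) (g x))) (at 0)"
    by (rule has_vector_derivative_transform_within_open[where S="{-1<..<1}"]) (use eq in auto)
  then have "integral UNIV (\<lambda>x. g x *\<^sub>R f' x) = 0"
    using has_vector_derivative_const vector_derivative_unique_at by blast
  moreover have "g x *\<^sub>R f' x = f' x" for x
    using g1[of x 0] has_dir_deriv_outside_support[of e f f' a b x, OF d supp] by (cases "x \<in> cbox a b") auto
  ultimately show ?thesis by simp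
qed

lemma integral_by_parts_dir_deriv:
  fixes f g :: "'a::euclidean_space \<Rightarrow> 'b::{real_inner, banach}"
  assumes df: "has_dir_deriv e f f'" and dg: "has_dir_deriv e g g'"
    and cf: "continuous_on UNIV f" and cf': "continuous_on UNIV f'"
    and cg: "continuous_on UNIV g" and cg': "continuous_on UNIV g'"
    and supp: "\<And>x. x \<notin> cbox a b \<Longrightarrow> g x = 0"
  shows "integral UNIV (\<lambda>x. inner (f' x) (g x)) = - integral UNIV (\<lambda>x. inner (f x) (g' x))"
proof -
  have supp': "\<And>x. x \<notin> cbox a b \<Longrightarrow> g' x = 0"
    by (rule has_dir_deriv_outside_support[OF dg supp])
  have "has_dir_deriv e (\<lambda>x. inner (f x) (g x)) (\<lambda>x. inner (f x) (g' x) + inner (f' x) (g x))"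
    unfolding has_dir_deriv_def
  proof
    fix x
    show "((\<lambda>r. inner (f (x + r *\<^sub>R e)) (g (x + r *\<^sub>R e))) has_vector_derivative
         inner (f x) (g' x) + inner (f' x) (g x)) (at 0)"
      using bounded_bilinear.has_vector_derivative[OF bounded_bilinear_inner
         has_dir_deriv_shift[OF df, of x 0 UNIV] has_dir_deriv_shift[OF dg, of x 0 UNIV]] by simp
  qed
  then have 0: "integral UNIV (\<lambda>x. inner (f x) (g' x) + inner (f' x) (g x)) = 0"
    by (rule integral_dir_deriv_eq_0[where a=a and b=b])
      (auto intro!: continuous_intros cf cf' cg cg' simp: supp)
  have i: "(\<lambda>x. inner (f1 x) (g1 x)) integrable_on UNIV"
    if "continuous_on UNIV f1" "continuous_on UNIV g1" "\<And>x. x \<notin> cbox a b \<Longrightarrow> g1 x = 0"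
    for f1 g1 :: "'a \<Rightarrow> 'b"
  proof -
    have "(\<lambda>x. inner (f1 x) (g1 x)) integrable_on cbox a b"
      by (intro integrable_continuous continuous_intros continuous_on_subset[OF that(1)] continuous_on_subset[OF that(2)]) auto
    then show ?thesis
      by (rule integrable_on_superset) (auto simp: that(3))
  qed
  show ?thesis using 0 i[OF cf cg' supp'] i[OF cf' cg supp]
    by (subst (asm) integral_add) auto
qed

text \<open>Both sides are derivatives of an integral against a translate, so second derivatives, which need
  not exist, do not appear.\<close>

lemma integral_exchange_dir_deriv:
  fixes f g :: "'a::euclidean_space \<Rightarrow> 'b::{real_inner, banach}"
  assumes f1: "has_dir_deriv d f f1" and f2: "has_dir_deriv e f f2"
    and g1: "has_dir_deriv d g g1" and g2: "has_dir_deriv e g g2"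
    and c: "continuous_on UNIV f" "continuous_on UNIV f1" "continuous_on UNIV f2"
      "continuous_on UNIV g" "continuous_on UNIV g1" "continuous_on UNIV g2"
    and supp: "\<And>x. x \<notin> cbox a b \<Longrightarrow> g x = 0"
  shows "integral UNIV (\<lambda>x. inner (f1 x) (g2 x)) = integral UNIV (\<lambda>x. inner (f2 x) (g1 x))"
proof -
  have supp1: "\<And>x. x \<notin> cbox a b \<Longrightarrow> g1 x = 0"
    by (rule has_dir_deriv_outside_support[OF g1 supp])
  have supp2: "\<And>x. x \<notin> cbox a b \<Longrightarrow> g2 x = 0"
    by (rule has_dir_deriv_outside_support[OF g2 supp])
  have tr: "integral UNIV (\<lambda>x. inner (h (x - r *\<^sub>R e)) (k x)) = integral UNIV (\<lambda>x. inner (h x) (k (x + r *\<^sub>R e)))"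
    if "\<And>x. x \<notin> cbox a b \<Longrightarrow> k x = 0" for h k :: "'a \<Rightarrow> 'b" and r
    using integral_UNIV_translate[of a b "\<lambda>x. inner (h (x - r *\<^sub>R e)) (k x)" "r *\<^sub>R e"] that by simp
  \<comment> \<open>Translation along \<open>e\<close> commutes with differentiation along
    \<open>d\<close>, so the integration by parts holds for each translate of
    \<open>f\<close>.\<close>
  have eq: "integral UNIV (\<lambda>x. inner (f1 (x + r *\<^sub>R (-e))) (g x)) = - integral UNIV (\<lambda>x. inner (f (x + r *\<^sub>R (-e))) (g1 x))" for r
  proof (rule integral_by_parts_dir_deriv[OF _ g1 _ _ c(4) c(5) supp])
    show "has_dir_deriv d (\<lambda>x. f (x + r *\<^sub>R (-e))) (\<lambda>x. f1 (x + r *\<^sub>R (-e)))"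
      unfolding has_dir_deriv_def
    proof
      fix x
      show "((\<lambda>r'. f (x + r' *\<^sub>R d + r *\<^sub>R (-e))) has_vector_derivative f1 (x + r *\<^sub>R (-e))) (at 0)"
        using has_dir_deriv_shift[OF f1, of "x + r *\<^sub>R (-e)" 0 UNIV] by (simp add: algebra_simps)
    qed
  qed (auto intro!: continuous_on_compose2[OF c(1)] continuous_on_compose2[OF c(2)] continuous_intros)
  have A: "((\<lambda>r. integral UNIV (\<lambda>x. inner (g (x + r *\<^sub>R e)) (f1 x))) has_vector_derivative
           integral UNIV (\<lambda>x. inner (g2 x) (f1 x))) (at 0)"
  proof -
    \<comment> \<open>Here the compactly supported \<open>g\<close> is the function that moves. The
      fixed factor \<open>f1\<close> has no compact support and is cut off outside all translates of
      the support of \<open>g\<close>.\<close>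
    define S where "S = (\<lambda>(r, x). x - r *\<^sub>R e) ` ({-1..1} \<times> cbox a b)"
    have "compact S"
      unfolding S_def by (intro compact_continuous_image compact_Times)
        (auto intro!: continuous_intros simp: split_beta)
    then have "bounded S" by (rule compact_imp_bounded)
    then obtain c' d' where S: "S \<subseteq> cbox c' d'" using bounded_subset_cbox_symmetric by metis
    obtain k :: "'a \<Rightarrow> real" and cc dd where k: "continuous_on UNIV k"
      "\<And>x. x \<in> cbox c' d' \<Longrightarrow> k x = 1" "\<And>x. x \<notin> cbox cc dd \<Longrightarrow> k x = 0"
      using exists_bump_one_on_cbox by metis
    have k1: "k x = 1" if "x + r *\<^sub>R e \<in> cbox a b" "\<bar>r\<bar> \<le> 1" for x r
    proof -
      have "x = (\<lambda>(r, x). x - r *\<^sub>R e) (r, x + r *\<^sub>R e)" by simp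
      moreover have "(r, x + r *\<^sub>R e) \<in> {-1..1} \<times> cbox a b" using that by auto
      ultimately have "x \<in> S" unfolding S_def by (metis imageI)
      then show ?thesis using S k(2) by blast
    qed
    have *: "((\<lambda>r. integral UNIV (\<lambda>x. inner (g (x + r *\<^sub>R e)) (k x *\<^sub>R f1 x))) has_vector_derivative
           integral UNIV (\<lambda>x. inner (g2 x) (k x *\<^sub>R f1 x))) (at 0)"
      by (rule leibniz_translate[OF g2 bounded_bilinear_inner c(4) c(6), where a=cc and b=dd])
        (auto intro!: continuous_intros c k)
    have e0: "inner (g (x + r *\<^sub>R e)) (k x *\<^sub>R f1 x) = inner (g (x + r *\<^sub>R e)) (f1 x)" if "\<bar>r\<bar> \<le> 1" for x r
      using k1[OF _ that] supp by (cases "x + r *\<^sub>R e \<in> cbox a b") auto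
    have e2: "inner (g2 x) (k x *\<^sub>R f1 x) = inner (g2 x) (f1 x)" for x
      using k1[of x 0] supp2 by (cases "x \<in> cbox a b") auto
    show ?thesis
      using * unfolding e2
      by (rule has_vector_derivative_transform_within_open[where S="{-1<..<1}"])
        (use e0 in \<open>auto simp del: inner_scaleR_right\<close>)
  qed
  have B: "((\<lambda>r. integral UNIV (\<lambda>x. inner (f (x + r *\<^sub>R (-e))) (g1 x))) has_vector_derivative
           integral UNIV (\<lambda>x. inner (- f2 x) (g1 x))) (at 0)"
  proof (rule leibniz_translate[OF _ bounded_bilinear_inner c(1) _ c(5) supp1])
    show "has_dir_deriv (- e) f (\<lambda>x. - f2 x)"
      unfolding has_dir_deriv_def
    proof
      fix x
      have *: "((\<lambda>r. f (x + r *\<^sub>R e)) has_vector_derivative f2 x) (at ((\<lambda>r::real. - r) 0))"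
        using f2 by (simp add: has_dir_deriv_def)
      show "((\<lambda>r. f (x + r *\<^sub>R - e)) has_vector_derivative - f2 x) (at 0)"
        using vector_diff_chain_at[OF has_vector_derivative_minus[OF has_vector_derivative_id] *]
        by (simp add: o_def)
    qed
  qed (auto intro!: continuous_intros c)
  have "integral UNIV (\<lambda>x. inner (g (x + r *\<^sub>R e)) (f1 x)) = - integral UNIV (\<lambda>x. inner (f (x + r *\<^sub>R (-e))) (g1 x))" for r
    using eq[of r] tr[where h=f1 and k=g and r=r] supp by (simp add: inner_commute)
  then have "((\<lambda>r. - integral UNIV (\<lambda>x. inner (f (x + r *\<^sub>R (-e))) (g1 x))) has_vector_derivative
           integral UNIV (\<lambda>x. inner (g2 x) (f1 x))) (at 0)"
    using A by simp
  moreover have "((\<lambda>r. - integral UNIV (\<lambda>x. inner (f (x + r *\<^sub>R (-e))) (g1 x))) has_vector_derivative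
           - integral UNIV (\<lambda>x. inner (- f2 x) (g1 x))) (at 0)"
    by (intro has_vector_derivative_minus B)
  ultimately have "integral UNIV (\<lambda>x. inner (g2 x) (f1 x)) = - integral UNIV (\<lambda>x. inner (- f2 x) (g1 x))"
    using vector_derivative_unique_at by blast
  then show ?thesis by (simp add: inner_commute)
qed

subsection \<open>Approximation by Schwartz functions\<close>

text \<open>The powers of 1/s close the family exp(-1/s)/s^k under differentiation, which replaces
  formulas for the higher derivatives of exp(-1/s).\<close>

definition bump_fun :: "nat \<Rightarrow> real \<Rightarrow> real" where
  "bump_fun k s = (if 0 < s then exp (- (1 / s)) / s ^ k else 0)"

lemma power_div_fact_le_exp:
  fixes x :: real
  assumes "0 \<le> x"
  shows "x ^ n / fact n \<le> exp x"
proof -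
  have "x ^ n /\<^sub>R fact n \<le> (\<Sum>k. x ^ k /\<^sub>R fact k)"
    using sum_le_suminf[OF summable_exp_generic[of x], of "{n}"] assms by auto
  then show ?thesis by (simp add: exp_def divide_inverse_commute)
qed

text \<open>One term of the exponential series at 1/s beats the k powers in the denominator with two
  to spare. The quadratic bound gives derivative zero at s = 0.\<close>

lemma bump_fun_le: "bump_fun k s \<le> fact (k + 2) * s\<^sup>2"
proof (cases "0 < s")
  case True
  have "(1 / s) ^ (k + 2) / fact (k + 2) \<le> exp (1 / s)"
    by (rule power_div_fact_le_exp) (use True in auto)
  then have "1 \<le> exp (1 / s) * (fact (k + 2) * s ^ (k + 2))"
    using True by (simp only: power_one_over) (simp only: divide_divide_eq_left pos_divide_le_eq zero_less_power
       fact_gt_zero mult_pos_pos mult.commute)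
  then have "exp (- (1 / s)) \<le> fact (k + 2) * s ^ (k + 2)"
    by (simp only: exp_minus) (metis exp_gt_zero inverse_eq_divide mult.commute pos_divide_le_eq)
  then show ?thesis
    using True by (simp add: bump_fun_def divide_le_eq power_add power2_eq_square mult_ac del: fact_Suc)
qed (simp add: bump_fun_def)

lemma bump_fun_nonneg: "0 \<le> bump_fun k s"
  by (simp add: bump_fun_def)

lemma has_real_derivative_bump_fun:
  "(bump_fun k has_real_derivative (bump_fun (k + 2) s - k * bump_fun (k + 1) s)) (at s)"
proof -
  consider "s > 0" | "s < 0" | "s = 0" by linarith
  then show ?thesis
  proof cases
    case 1
    have "((\<lambda>s. exp (- (1 / s)) / s ^ k) has_real_derivative (bump_fun (k + 2) s - k * bump_fun (k + 1) s)) (at s)"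
    proof -
      have E: "((\<lambda>s. exp (- (1 / s))) has_real_derivative exp (- (1 / s)) / s\<^sup>2) (at s)"
        using 1 by (auto intro!: derivative_eq_intros simp: power2_eq_square)
      have P: "((\<lambda>s. s ^ k) has_real_derivative real k * s ^ (k - 1)) (at s)"
        using DERIV_pow[of k s UNIV] by simp
      have "(exp (- (1 / s)) / s\<^sup>2 * s ^ k - exp (- (1 / s)) * (real k * s ^ (k - 1))) / (s ^ k * s ^ k)
          = bump_fun (k + 2) s - k * bump_fun (k + 1) s"
        using 1 by (cases k) (auto simp: bump_fun_def field_simps power2_eq_square)
      with DERIV_divide[OF E P] 1 show ?thesis by simp
    qed
    then show ?thesis
      by (rule DERIV_cong_ev[THEN iffD1, rotated 3])
        (use 1 in \<open>auto simp: eventually_nhds bump_fun_def intro!: exI[of _ "{0<..}"]\<close>)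
  next
    case 2
    have "((\<lambda>s. 0) has_real_derivative (bump_fun (k + 2) s - k * bump_fun (k + 1) s)) (at s)"
      using 2 by (simp add: bump_fun_def)
    then show ?thesis
      by (rule DERIV_cong_ev[THEN iffD1, rotated 3])
        (use 2 in \<open>auto simp: eventually_nhds bump_fun_def intro!: exI[of _ "{..<0}"]\<close>)
  next
    case 3
    have "((\<lambda>h. (bump_fun k (0 + h) - bump_fun k 0) / h) \<longlongrightarrow> 0) (at 0)"
    proof (rule Lim_null_comparison)
      show "\<forall>\<^sub>F h in at 0. norm ((bump_fun k (0 + h) - bump_fun k 0) / h) \<le> fact (k + 2) * \<bar>h\<bar>"
      proof (rule always_eventually, rule allI)
        fix h :: real
        have "bump_fun k h / \<bar>h\<bar> \<le> fact (k + 2) * \<bar>h\<bar>"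
          using bump_fun_le[of k h]
          by (cases "h = 0") (auto simp: divide_le_eq power2_eq_square mult.assoc simp del: fact_Suc)
        then show "norm ((bump_fun k (0 + h) - bump_fun k 0) / h) \<le> fact (k + 2) * \<bar>h\<bar>"
          using bump_fun_nonneg[of k h] by (simp add: abs_divide) (simp add: bump_fun_def)
      qed
      show "((\<lambda>h. fact (k + 2) * \<bar>h\<bar>) \<longlongrightarrow> 0) (at (0::real))"
        by (auto intro!: tendsto_eq_intros)
    qed
    then show ?thesis using 3 by (simp add: DERIV_def bump_fun_def)
  qed
qed

text \<open>This class is closed under directional derivatives, so convolving with its members gives smooth
  functions without any formula for the higher derivatives.\<close>

inductive bump_class :: "real \<Rightarrow> ('a::euclidean_space \<Rightarrow> real) \<Rightarrow> bool" for a where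
  base: "bump_class a (\<lambda>z. bump_fun k (1 - a * (z \<bullet> z)))"
| mult: "bump_class a g \<Longrightarrow> bump_class a (\<lambda>z. (z \<bullet> e) * g z)"
| cmul: "bump_class a g \<Longrightarrow> bump_class a (\<lambda>z. c * g z)"
| add: "bump_class a g \<Longrightarrow> bump_class a h \<Longrightarrow> bump_class a (\<lambda>z. g z + h z)"

lemma bump_class_has_derivative:
  assumes "bump_class a g"
  shows "\<exists>g'. (\<forall>z. (g has_derivative g' z) (at z)) \<and> (\<forall>e. bump_class a (\<lambda>z. g' z e))"
  using assms
proof induction
  case (base k)
  let ?d = "\<lambda>s. bump_fun (k + 2) s - k * bump_fun (k + 1) s"
  let ?g' = "\<lambda>z v. ?d (1 - a * (z \<bullet> z)) * (- 2 * a * (z \<bullet> v))"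
  have "((\<lambda>z. bump_fun k (1 - a * (z \<bullet> z))) has_derivative ?g' z) (at z)" for z
    using has_real_derivative_bump_fun[of k "1 - a * (z \<bullet> z)"]
    by (auto intro!: derivative_eq_intros has_derivative_compose[OF _ has_real_derivative_bump_fun[unfolded has_field_derivative_def], THEN has_derivative_eq_rhs]
       simp: inner_commute algebra_simps)
  moreover have "bump_class a (\<lambda>z. ?g' z e)" for e
  proof -
    have "?g' z e = -2 * a * ((z \<bullet> e) * bump_fun (k + 2) (1 - a * (z \<bullet> z))) + 2 * a * k * ((z \<bullet> e) * bump_fun (k + 1) (1 - a * (z \<bullet> z)))" for z
      by (simp add: algebra_simps)
    moreover have "bump_class a (\<lambda>z. -2 * a * ((z \<bullet> e) * bump_fun (k + 2) (1 - a * (z \<bullet> z))) + 2 * a * k * ((z \<bullet> e) * bump_fun (k + 1) (1 - a * (z \<bullet> z))))"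
      by (intro bump_class.intros)
    ultimately show ?thesis by presburger
  qed
  ultimately show ?case by (intro exI[of _ ?g']) blast
next
  case (mult g e)
  then obtain g' where g': "\<And>z. (g has_derivative g' z) (at z)" "\<And>e. bump_class a (\<lambda>z. g' z e)" by blast
  have "((\<lambda>z. (z \<bullet> e) * g z) has_derivative (\<lambda>v. (z \<bullet> e) * g' z v + (v \<bullet> e) * g z)) (at z)" for z
    by (auto intro!: derivative_eq_intros g')
  moreover have "bump_class a (\<lambda>z. (z \<bullet> e) * g' z v + (v \<bullet> e) * g z)" for v
    by (intro bump_class.intros g' mult)
  ultimately show ?case by (intro exI[of _ "\<lambda>z v. (z \<bullet> e) * g' z v + (v \<bullet> e) * g z"]) blast
next
  case (cmul g c)
  then obtain g' where g': "\<And>z. (g has_derivative g' z) (at z)" "\<And>e. bump_class a (\<lambda>z. g' z e)" by blast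
  have "((\<lambda>z. c * g z) has_derivative (\<lambda>v. c * g' z v)) (at z)" for z
    by (auto intro!: derivative_eq_intros g')
  moreover have "bump_class a (\<lambda>z. c * g' z v)" for v
    by (intro bump_class.intros g')
  ultimately show ?case by (intro exI[of _ "\<lambda>z v. c * g' z v"]) blast
next
  case (add g h)
  then obtain g' h' where g': "\<And>z. (g has_derivative g' z) (at z)" "\<And>e. bump_class a (\<lambda>z. g' z e)"
    and h': "\<And>z. (h has_derivative h' z) (at z)" "\<And>e. bump_class a (\<lambda>z. h' z e)" by blast
  have "((\<lambda>z. g z + h z) has_derivative (\<lambda>v. g' z v + h' z v)) (at z)" for z
    by (auto intro!: derivative_eq_intros g' h')
  moreover have "bump_class a (\<lambda>z. g' z v + h' z v)" for v
    by (intro bump_class.intros g' h')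
  ultimately show ?case by (intro exI[of _ "\<lambda>z v. g' z v + h' z v"]) blast
qed

lemma bump_class_continuous: "bump_class a g \<Longrightarrow> continuous_on S g"
  using bump_class_has_derivative[of a g]
  by (meson has_derivative_continuous continuous_at_imp_continuous_on)

lemma bump_class_outside: "bump_class a g \<Longrightarrow> 1 \<le> a * (z \<bullet> z) \<Longrightarrow> g z = 0"
  by (induction rule: bump_class.induct) (auto simp: bump_fun_def)

section \<open>Mollification with compactly supported smooth kernels\<close>

definition convolve :: "('a::euclidean_space \<Rightarrow> 'b::banach) \<Rightarrow> ('a \<Rightarrow> real) \<Rightarrow> 'a \<Rightarrow> 'b" where
  "convolve f g z = integral UNIV (\<lambda>y. g (z - y) *\<^sub>R f y)"

text \<open>The derivative falls on the kernel, so \<open>f\<close> need only be continuous, and the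
  new kernel again belongs to the class; iterating gives smoothness.\<close>

lemma convolve_differentiable:
  fixes f :: "'a::euclidean_space \<Rightarrow> 'b::banach"
  assumes g: "bump_class a g" and cf: "continuous_on UNIV f"
    and supp: "\<And>x. x \<notin> cbox c d \<Longrightarrow> f x = 0"
  shows "convolve f g differentiable_on UNIV"
    "\<exists>h. bump_class a h \<and> has_dir_deriv e (convolve f g) (convolve f h)"
proof -
  obtain g' where g': "\<And>z. (g has_derivative g' z) (at z)" "\<And>e. bump_class a (\<lambda>z. g' z e)"
    using bump_class_has_derivative[OF g] by blast
  have eq: "convolve f h = (\<lambda>z. integral (cbox c d) (\<lambda>y. h (z - y) *\<^sub>R f y))" for h
    unfolding convolve_def by (rule ext, rule integral_UNIV_eq_cbox) (simp add: supp)
  \<comment> \<open>Assembling the derivative from its values on the basis reduces continuity in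
    operator norm to continuity of finitely many members of the class.\<close>
  define fx where "fx z y = (\<Sum>e\<in>Basis. blinfun_scaleR_left (g' (z - y) e *\<^sub>R f y) o\<^sub>L blinfun_inner_left e)" for z y
  have fx: "blinfun_apply (fx z y) v = g' (z - y) v *\<^sub>R f y" for z y v
  proof -
    have lin: "linear (g' (z - y))" using g' has_derivative_linear by blast
    have "g' (z - y) v = g' (z - y) (\<Sum>e\<in>Basis. (v \<bullet> e) *\<^sub>R e)" by (simp add: euclidean_representation)
    also have "\<dots> = (\<Sum>e\<in>Basis. (v \<bullet> e) * g' (z - y) e)"
      by (simp add: linear_sum[OF lin] linear_scale[OF lin])
    finally show ?thesis
      by (simp add: fx_def blinfun.sum_left scaleR_sum_left[symmetric])
  qed
  have cint: "(\<lambda>y. h (z - y) *\<^sub>R f y) integrable_on cbox c d" if "bump_class a h" for h z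
    by (intro integrable_continuous continuous_intros continuous_on_subset[OF cf]
      continuous_on_compose2[OF bump_class_continuous[OF that, of UNIV]]) auto
  have der: "((\<lambda>z. integral (cbox c d) (\<lambda>y. g (z - y) *\<^sub>R f y)) has_derivative integral (cbox c d) (fx z)) (at z)" for z
  proof (rule leibniz_rule[where U=UNIV, simplified])
    fix z y
    have "((\<lambda>z. g (z - y)) has_derivative g' (z - y)) (at z)"
      by (rule has_derivative_compose[OF _ g'(1), THEN has_derivative_eq_rhs]) (auto intro!: derivative_eq_intros)
    then have "((\<lambda>z. g (z - y) *\<^sub>R f y) has_derivative (\<lambda>v. g' (z - y) v *\<^sub>R f y)) (at z)"
      by (rule has_derivative_scaleR_left)
    then show "((\<lambda>z. g (z - y) *\<^sub>R f y) has_derivative blinfun_apply (fx z y)) (at z)"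
      by (simp add: fx[abs_def])
  next
    show "(\<lambda>y. g (z - y) *\<^sub>R f y) integrable_on cbox c d" for z by (rule cint[OF g])
  next
    show "continuous_on (UNIV \<times> cbox c d) (\<lambda>(z, y). fx z y)"
      unfolding fx_def split_beta
      by (intro continuous_intros continuous_on_subset[OF cf]
         continuous_on_compose2[OF bump_class_continuous[OF g'(2), of UNIV]] continuous_on_compose2[OF cf]) auto
  qed
  then show "convolve f g differentiable_on UNIV"
    unfolding eq differentiable_on_def differentiable_def by (auto intro!: exI)
  have "has_dir_deriv e (convolve f g) (\<lambda>z. integral (cbox c d) (fx z) e)"
    unfolding eq using has_dir_deriv_from_derivative[OF der] .
  moreover have "integral (cbox c d) (fx z) e = convolve f (\<lambda>z. g' z e) z" for z
  proof -
    have "fx z integrable_on cbox c d"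
      unfolding fx_def
      by (intro integrable_continuous continuous_intros continuous_on_subset[OF cf]
         continuous_on_compose2[OF bump_class_continuous[OF g'(2), of UNIV]]) auto
    then have "integral (cbox c d) (fx z) e = integral (cbox c d) (\<lambda>y. fx z y e)"
      by (rule blinfun_apply_integral)
    then show ?thesis by (simp add: fx eq)
  qed
  ultimately show "\<exists>h. bump_class a h \<and> has_dir_deriv e (convolve f g) (convolve f h)"
    using g'(2)[of e] by auto
qed

lemma convolve_iter_deriv:
  fixes f :: "'a::euclidean_space \<Rightarrow> 'b::banach"
  assumes g: "bump_class a g" and cf: "continuous_on UNIV f"
    and supp: "\<And>x. x \<notin> cbox c d \<Longrightarrow> f x = 0"
  shows "\<exists>h. bump_class a h \<and> iter_deriv es (convolve f g) = convolve f h"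
proof (induction es)
  case (Cons e es)
  then obtain h where h: "bump_class a h" "iter_deriv es (convolve f g) = convolve f h" by blast
  obtain k where k: "bump_class a k" "has_dir_deriv e (convolve f h) (convolve f k)"
    using convolve_differentiable(2)[OF h(1) cf, where e=e] supp by blast
  then show ?case by (auto simp: h(2) has_dir_deriv_dir_deriv intro!: exI[of _ k])
qed (use g in auto)

lemma convolve_swap:
  fixes f :: "'a::euclidean_space \<Rightarrow> 'b::banach"
  assumes supp: "\<And>x. x \<notin> cbox c d \<Longrightarrow> g x = 0"
  shows "convolve f g z = integral (cbox c d) (\<lambda>y. g y *\<^sub>R f (z - y))"
proof -
  let ?k = "\<lambda>y. g y *\<^sub>R f (z - y)"
  have neg: "x \<in> cbox (- d) (- c) \<longleftrightarrow> - x \<in> cbox c d" for x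
    by (auto simp: mem_box)
  have "convolve f g z = integral UNIV (\<lambda>y. (\<lambda>y. ?k (- y)) (y + (- z)))"
    by (simp add: convolve_def)
  also have "\<dots> = integral UNIV (\<lambda>y. ?k (- y))"
    by (rule integral_UNIV_translate[of "-d" "-c"]) (simp add: supp neg)
  also have "\<dots> = integral (cbox (-d) (-c)) (\<lambda>y. ?k (- y))"
    by (rule integral_UNIV_eq_cbox) (simp add: supp neg)
  also have "\<dots> = integral (cbox c d) ?k"
    by (rule integral_reflect)
  finally show ?thesis .
qed

text \<open>The counterpart of \<open>convolve_differentiable\<close>, with the derivative on
  \<open>f\<close> instead of the kernel: closeness of the derivatives of the mollified function
  then reduces to uniform continuity of \<open>f'\<close>.\<close>

lemma convolve_dir_deriv:
  fixes f :: "'a::euclidean_space \<Rightarrow> 'b::banach"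
  assumes cg: "continuous_on UNIV g" and supp: "\<And>x. x \<notin> cbox c d \<Longrightarrow> g x = 0"
    and df: "has_dir_deriv e f f'" and cf: "continuous_on UNIV f" and cf': "continuous_on UNIV f'"
  shows "has_dir_deriv e (convolve f g) (convolve f' g)"
  unfolding has_dir_deriv_def
proof
  fix z
  have U: "integral UNIV (\<lambda>y. g y *\<^sub>R f (z - y)) = integral (cbox c d) (\<lambda>y. g y *\<^sub>R f (z - y))" for f :: "'a \<Rightarrow> 'b" and z
    by (rule integral_UNIV_eq_cbox) (auto simp: supp)
  have "((\<lambda>r. integral UNIV (\<lambda>x. (\<lambda>a b. b *\<^sub>R a) (f (z - (x + r *\<^sub>R (-e)))) (g x))) has_vector_derivative
          integral UNIV (\<lambda>x. (\<lambda>a b. b *\<^sub>R a) (f' (z - x)) (g x))) (at 0)"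
  proof (rule leibniz_translate[where f="\<lambda>x. f (z - x)" and f'="\<lambda>x. f' (z - x)"])
    show "has_dir_deriv (- e) (\<lambda>x. f (z - x)) (\<lambda>x. f' (z - x))"
      unfolding has_dir_deriv_def
    proof
      fix x
      show "((\<lambda>r. f (z - (x + r *\<^sub>R - e))) has_vector_derivative f' (z - x)) (at 0)"
        using df[unfolded has_dir_deriv_def, THEN spec, of "z - x"] by (simp add: algebra_simps)
    qed
    show "bounded_bilinear (\<lambda>a b. b *\<^sub>R (a::'b))" by (rule bounded_bilinear.flip[OF bounded_bilinear_scaleR])
  qed (auto intro!: continuous_intros cg continuous_on_compose2[OF cf] continuous_on_compose2[OF cf'] supp)
  then show "((\<lambda>r. convolve f g (z + r *\<^sub>R e)) has_vector_derivative convolve f' g z) (at 0)"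
    by (simp add: convolve_swap[of c d g, OF supp] U[symmetric] algebra_simps)
qed

lemma compact_support_uniform:
  fixes f :: "'a::euclidean_space \<Rightarrow> 'b::real_normed_vector"
  assumes cf: "continuous_on UNIV f" and supp: "\<And>x. x \<notin> cbox c d \<Longrightarrow> f x = 0" and e: "0 < e"
  shows "\<exists>r>0. \<forall>x y. norm y < r \<longrightarrow> norm (f (x - y) - f x) \<le> e"
proof -
  let ?K = "cbox (c - One) (d + One)"
  have "uniformly_continuous_on ?K f"
    by (rule compact_uniformly_continuous[OF continuous_on_subset[OF cf]]) auto
  then obtain r where r: "0 < r" "\<And>x x'. x \<in> ?K \<Longrightarrow> x' \<in> ?K \<Longrightarrow> dist x' x < r \<Longrightarrow> dist (f x') (f x) < e"
    unfolding uniformly_continuous_on_def using e by blast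
  have in_K: "y \<in> ?K" if "x \<in> cbox c d" "norm (y - x) \<le> 1" for x y
  proof -
    have "\<bar>(y - x) \<bullet> i\<bar> \<le> 1" if "i \<in> Basis" for i
      using Basis_le_norm[OF that, of "y - x"] \<open>norm (y - x) \<le> 1\<close> by linarith
    then show ?thesis using that(1)
      by (fastforce simp: mem_box inner_diff_left inner_add_left abs_le_iff)
  qed
  have "norm (f (x - y) - f x) \<le> e" if "norm y < min r 1" for x y
  proof (cases "x \<in> cbox c d \<or> x - y \<in> cbox c d")
    case True
    then have "x \<in> ?K" "x - y \<in> ?K"
      using in_K[of x x] in_K[of x "x - y"] in_K[of "x - y" x] in_K[of "x - y" "x - y"] that by auto
    then show ?thesis using r(2)[of x "x - y"] that by (simp add: dist_norm)
  qed (use supp e in auto)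
  then show ?thesis using r(1) by (intro exI[of _ "min r 1"]) auto
qed

lemma convolve_close:
  fixes f :: "'a::euclidean_space \<Rightarrow> 'b::banach"
  assumes cf: "continuous_on UNIV f" and cg: "continuous_on UNIV g"
    and supp: "\<And>x. x \<notin> cbox c d \<Longrightarrow> g x = 0" and nonneg: "\<And>x. 0 \<le> g x"
    and close: "\<And>y. g y \<noteq> 0 \<Longrightarrow> norm (f (z - y) - f z) \<le> e"
  shows "norm (convolve f g z - integral (cbox c d) g *\<^sub>R f z) \<le> e * integral (cbox c d) g"
proof -
  have i: "(\<lambda>y. g y *\<^sub>R f (z - y)) integrable_on cbox c d" "(\<lambda>y. g y *\<^sub>R f z) integrable_on cbox c d"
     "(\<lambda>y. e * g y) integrable_on cbox c d"
    by (intro integrable_continuous continuous_intros continuous_on_subset[OF cg]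
      continuous_on_compose2[OF cf]; simp)+
  have gi: "g integrable_on cbox c d" by (intro integrable_continuous continuous_on_subset[OF cg]) auto
  have "convolve f g z - integral (cbox c d) g *\<^sub>R f z = integral (cbox c d) (\<lambda>y. g y *\<^sub>R f (z - y) - g y *\<^sub>R f z)"
    using integral_linear[OF gi bounded_linear_scaleR_left[of "f z"]] integral_diff[OF i(1,2)]
    by (simp add: convolve_swap[of c d g, OF supp] o_def)
  also have "norm \<dots> \<le> integral (cbox c d) (\<lambda>y. e * g y)"
  proof (rule integral_norm_bound_integral[OF integrable_diff[OF i(1,2)] i(3)])
    fix y
    have "norm (g y *\<^sub>R f (z - y) - g y *\<^sub>R f z) = g y * norm (f (z - y) - f z)"
      using nonneg[of y] by (simp add: scaleR_diff_right[symmetric])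
    also have "\<dots> \<le> e * g y"
      using close[of y] nonneg[of y] by (cases "g y = 0") (auto simp: mult.commute intro: mult_left_mono)
    finally show "norm (g y *\<^sub>R f (z - y) - g y *\<^sub>R f z) \<le> e * g y" .
  qed
  finally show ?thesis by simp
qed

text \<open>For \<open>a\<close> \<ge> 1 the kernel lives in the unit ball, so the convolution and
  all its derivatives vanish outside one fixed box, and the decay conditions become boundedness on a
  compact set.\<close>

lemma schwartz_convolve:
  fixes f :: "'a::euclidean_space \<Rightarrow> complex"
  assumes g: "bump_class a g" and a: "1 \<le> a" and cf: "continuous_on UNIV f"
    and supp: "\<And>x. x \<notin> cbox c d \<Longrightarrow> f x = 0"
  shows "schwartz (convolve f g)" "\<And>z. z \<notin> cbox (c - One) (d + One) \<Longrightarrow> convolve f g z = 0"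
proof -
  have out: "convolve f h z = 0" if h: "bump_class a h" and z: "z \<notin> cbox (c - One) (d + One)" for h z
  proof -
    have "h (z - y) *\<^sub>R f y = 0" for y
    proof (cases "y \<in> cbox c d")
      case True
      obtain i where i: "i \<in> Basis" "\<not> (c \<bullet> i - 1 \<le> z \<bullet> i \<and> z \<bullet> i \<le> d \<bullet> i + 1)"
        using z by (auto simp: mem_box inner_diff_left inner_add_left)
      have "c \<bullet> i \<le> y \<bullet> i" "y \<bullet> i \<le> d \<bullet> i" using True i(1) by (auto simp: mem_box)
      then have "1 \<le> \<bar>(z - y) \<bullet> i\<bar>" using i(2) by (auto simp: inner_diff_left)
      also have "\<dots> \<le> norm (z - y)" by (rule Basis_le_norm[OF i(1)])
      finally have "1 \<le> (z - y) \<bullet> (z - y)"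
        by (simp add: dot_square_norm one_le_power)
      then have "1 \<le> a * ((z - y) \<bullet> (z - y))" using a
        by (metis mult_le_one mult_mono mult_1 zero_le_one inner_ge_zero order_trans)
      then show ?thesis using bump_class_outside[OF h] by simp
    qed (simp add: supp)
    then show ?thesis by (simp only: convolve_def integral_0)
  qed
  then show "\<And>z. z \<notin> cbox (c - One) (d + One) \<Longrightarrow> convolve f g z = 0" using g by blast
  have it: "\<exists>h. bump_class a h \<and> iter_deriv es (convolve f g) = convolve f h" for es
    using convolve_iter_deriv[OF g cf] supp by blast
  have sm: "smooth (convolve f g)"
    unfolding smooth_def
  proof
    fix es :: "'a list"
    obtain h where "bump_class a h" "iter_deriv es (convolve f g) = convolve f h" using it by blast
    then show "iter_deriv es (convolve f g) differentiable_on UNIV"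
      using convolve_differentiable(1)[OF _ cf, of a h c d] supp by auto
  qed
  have "bounded (range (\<lambda>x. norm x ^ k *\<^sub>R iter_deriv es (convolve f g) x))" for k es
  proof -
    obtain h where h: "bump_class a h" "iter_deriv es (convolve f g) = convolve f h" using it by blast
    have "convolve f h differentiable_on UNIV"
      using convolve_differentiable(1)[OF h(1) cf, of c d] supp by auto
    then have "continuous_on UNIV (convolve f h)" by (rule differentiable_imp_continuous_on)
    then have "compact ((\<lambda>x. norm x ^ k *\<^sub>R convolve f h x) ` cbox (c - One) (d + One))"
      by (intro compact_continuous_image continuous_intros) (auto intro: continuous_on_subset)
    then have b: "bounded (insert 0 ((\<lambda>x. norm x ^ k *\<^sub>R convolve f h x) ` cbox (c - One) (d + One)))"
      using compact_imp_bounded by auto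
    have "range (\<lambda>x. norm x ^ k *\<^sub>R convolve f h x) \<subseteq> insert 0 ((\<lambda>x. norm x ^ k *\<^sub>R convolve f h x) ` cbox (c - One) (d + One))"
    proof
      fix w assume "w \<in> range (\<lambda>x. norm x ^ k *\<^sub>R convolve f h x)"
      then obtain x where x: "w = norm x ^ k *\<^sub>R convolve f h x" by auto
      show "w \<in> insert 0 ((\<lambda>x. norm x ^ k *\<^sub>R convolve f h x) ` cbox (c - One) (d + One))"
        using out[OF h(1), of x] x by (cases "x \<in> cbox (c - One) (d + One)") auto
    qed
    then show ?thesis unfolding h(2) by (rule bounded_subset[OF b])
  qed
  then show "schwartz (convolve f g)" using sm by (auto simp: schwartz_def)
qed

text \<open>The functions to be inserted in the form bound are continuous in time and C^1 only in
  space. Hence only derivatives along a chosen finite set \<open>E\<close> are approximated. The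
  support grows by at most one unit however small \<open>eps\<close> is, which later gives a common
  majorant.\<close>

lemma schwartz_approximation:
  fixes f :: "'a::euclidean_space \<Rightarrow> complex" and f' :: "'a \<Rightarrow> 'a \<Rightarrow> complex"
  assumes cf: "continuous_on UNIV f" and supp: "\<And>x. x \<notin> cbox c d \<Longrightarrow> f x = 0"
    and E: "finite E" and df: "\<And>e. e \<in> E \<Longrightarrow> has_dir_deriv e f (f' e)"
    and cf': "\<And>e. e \<in> E \<Longrightarrow> continuous_on UNIV (f' e)" and eps: "0 < eps"
  obtains F F' where "schwartz F" "\<And>z. norm (F z - f z) \<le> eps"
    "\<And>z. z \<notin> cbox (c - One) (d + One) \<Longrightarrow> F z = 0"
    "\<And>e. e \<in> E \<Longrightarrow> has_dir_deriv e F (F' e)"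
    "\<And>e z. e \<in> E \<Longrightarrow> norm (F' e z - f' e z) \<le> eps"
proof -
  obtain r0 where r0: "0 < r0" "\<And>x y. norm y < r0 \<Longrightarrow> norm (f (x - y) - f x) \<le> eps"
    using compact_support_uniform[OF cf supp eps] by blast
  have "\<forall>e\<in>E. \<exists>r>0. \<forall>x y. norm y < r \<longrightarrow> norm (f' e (x - y) - f' e x) \<le> eps"
  proof
    fix e assume e: "e \<in> E"
    show "\<exists>r>0. \<forall>x y. norm y < r \<longrightarrow> norm (f' e (x - y) - f' e x) \<le> eps"
      by (rule compact_support_uniform[of "f' e" c d, OF cf'[OF e] _ eps])
        (rule has_dir_deriv_outside_support[of e f "f' e" c d, OF df[OF e] supp])
  qed
  then obtain r where r: "\<And>e. e \<in> E \<Longrightarrow> 0 < r e"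
    "\<And>e x y. e \<in> E \<Longrightarrow> norm y < r e \<Longrightarrow> norm (f' e (x - y) - f' e x) \<le> eps" by metis
  \<comment> \<open>One radius that works for \<open>f\<close> and all its derivatives along
    \<open>E\<close>; the entry 1 keeps the support within one unit. With \<open>a = 1 / R^2\<close>
    the kernel vanishes for |z| \<ge> \<open>R\<close>.\<close>
  define R where "R = Min (insert 1 (insert r0 (r ` E)))"
  have R: "0 < R" "R \<le> 1" "R \<le> r0" "\<And>e. e \<in> E \<Longrightarrow> R \<le> r e"
    unfolding R_def using E r(1) r0(1) by (auto simp: Min_gr_iff simp del: Min_insert intro!: Min_le)
  define a where "a = 1 / R\<^sup>2"
  have a: "1 \<le> a" using R by (simp add: a_def power_le_one)
  define g :: "'a \<Rightarrow> real" where "g z = bump_fun 0 (1 - a * (z \<bullet> z))" for z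
  have g: "bump_class a g" unfolding g_def by (rule bump_class.base)
  have cg: "continuous_on UNIV g" by (rule bump_class_continuous[OF g])
  have nonneg: "0 \<le> g y" for y by (simp add: g_def bump_fun_nonneg)
  have small: "norm y < R" if "g y \<noteq> 0" for y
  proof (rule ccontr)
    assume "\<not> norm y < R"
    then have "R\<^sup>2 \<le> y \<bullet> y" using R(1) by (simp add: dot_square_norm power_mono)
    then have "1 \<le> a * (y \<bullet> y)" using R(1) by (simp add: a_def field_simps)
    then show False using bump_class_outside[OF g] that by blast
  qed
  have gs: "g x = 0" if "x \<notin> cbox (- One) One" for x
  proof (rule ccontr)
    assume "g x \<noteq> 0"
    then have "norm x \<le> 1" using small R(2) by force
    then have "\<bar>x \<bullet> i\<bar> \<le> 1" if "i \<in> Basis" for i using Basis_le_norm[OF that, of x] by linarith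
    then show False using that by (fastforce simp: mem_box abs_le_iff)
  qed
  define C where "C = integral (cbox (- One) One) g"
  have gi: "g integrable_on cbox (- One) One" by (intro integrable_continuous continuous_on_subset[OF cg]) auto
  \<comment> \<open>A nonnegative continuous function with integral zero vanishes identically, but
    the kernel is positive at the origin.\<close>
  have "C \<noteq> 0"
  proof
    assume "C = 0"
    then have "(g has_integral 0) (cbox (- One) One)" using gi unfolding C_def by (metis integrable_integral)
    then have "g 0 = 0"
      by (intro has_integral_0_cbox_imp_0[of "- One" One g]) (use cg nonneg in \<open>auto intro: continuous_on_subset simp: box_ne_empty mem_box\<close>)
    then show False by (simp add: g_def bump_fun_def)
  qed
  moreover have "0 \<le> C" unfolding C_def by (rule integral_nonneg[OF gi]) (use nonneg in auto)
  ultimately have C: "0 < C" by simp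
  define \<rho> where "\<rho> z = (1 / C) * g z" for z
  have \<rho>: "bump_class a \<rho>" unfolding \<rho>_def[abs_def] by (rule bump_class.cmul[OF g])
  have cr: "continuous_on UNIV \<rho>" by (rule bump_class_continuous[OF \<rho>])
  have rs: "\<And>x. x \<notin> cbox (- One) One \<Longrightarrow> \<rho> x = 0" using gs by (simp add: \<rho>_def)
  have r1: "integral (cbox (- One) One) \<rho> = 1"
    unfolding \<rho>_def[abs_def] using C by (simp add: C_def)
  have rn: "0 \<le> \<rho> y" for y using nonneg[of y] C by (simp add: \<rho>_def)
  have rz: "norm y < R" if "\<rho> y \<noteq> 0" for y using small that by (auto simp: \<rho>_def)
  show ?thesis
  proof (rule that)
    show "schwartz (convolve f \<rho>)" by (rule schwartz_convolve(1)[OF \<rho> a cf supp])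
    show "\<And>z. z \<notin> cbox (c - One) (d + One) \<Longrightarrow> convolve f \<rho> z = 0"
      by (rule schwartz_convolve(2)[OF \<rho> a cf supp])
    show "has_dir_deriv e (convolve f \<rho>) (convolve (f' e) \<rho>)" if "e \<in> E" for e
      by (rule convolve_dir_deriv[OF cr rs df[OF that] cf cf'[OF that]])
    show "norm (convolve f \<rho> z - f z) \<le> eps" for z
      using convolve_close[OF cf cr rs rn, where z=z and e=eps] rz r0(2) R(3) r1 by fastforce
    show "norm (convolve (f' e) \<rho> z - f' e z) \<le> eps" if "e \<in> E" for e z
      using convolve_close[OF cf'[OF that] cr rs rn, where z=z and e=eps] rz r(2)[OF that] R(4)[OF that] r1 by fastforce
  qed
qed

subsection \<open>The form bound on time slabs\<close>

text \<open>The gradient is a separate function \<open>D\<close> and all terms are integrals over a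
  slab. In this form the inequality makes sense for, and passes to, limits that are not
  smooth.\<close>

definition space_time_form_ineq ::
  "real \<Rightarrow> (real \<Rightarrow> real) \<Rightarrow> (real \<times> (real^'d::finite) \<Rightarrow> real^'d) \<Rightarrow> real
    \<Rightarrow> (real \<times> (real^'d) \<Rightarrow> complex) \<Rightarrow> (real \<times> (real^'d) \<Rightarrow> complex^'d) \<Rightarrow> bool" where
  "space_time_form_ineq \<delta> g b t f D \<longleftrightarrow>
     (\<integral>\<^sup>+z\<in>{0..t} \<times> UNIV. ennreal ((norm (b z) * norm (f z))\<^sup>2) \<partial>lborel)
       \<le> ennreal \<delta> * (\<integral>\<^sup>+z\<in>{0..t} \<times> UNIV. ennreal ((norm (D z))\<^sup>2) \<partial>lborel)
         + (\<integral>\<^sup>+z\<in>{0..t} \<times> UNIV. ennreal (g (fst z) * (norm (f z))\<^sup>2) \<partial>lborel)"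

lemma borel_measurable_fst_borel:
  fixes g :: "'a::second_countable_topology \<Rightarrow> 'b::topological_space"
  assumes "g \<in> borel_measurable borel"
  shows "(\<lambda>z. g (fst (z :: 'a \<times> 'c::second_countable_topology))) \<in> borel_measurable borel"
  by (rule measurable_compose[OF _ assms]) (auto intro!: borel_measurable_continuous_onI continuous_intros)

lemma borel_measurable_snd_borel:
  fixes g :: "'a::second_countable_topology \<Rightarrow> 'b::topological_space"
  assumes "g \<in> borel_measurable borel"
  shows "(\<lambda>z. g (snd (z :: 'c::second_countable_topology \<times> 'a))) \<in> borel_measurable borel"
  by (rule measurable_compose[OF _ assms]) (auto intro!: borel_measurable_continuous_onI continuous_intros)

lemma nn_integral_space_time:
  fixes h :: "real \<times> ('a::euclidean_space) \<Rightarrow> ennreal"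
  assumes [measurable]: "h \<in> borel_measurable borel" and S[measurable]: "S \<in> sets borel"
  shows "(\<integral>\<^sup>+z\<in>S \<times> UNIV. h z \<partial>lborel) = (\<integral>\<^sup>+\<tau>\<in>S. (\<integral>\<^sup>+x. h (\<tau>, x) \<partial>lborel) \<partial>lborel)"
proof -
  have S': "S \<times> (UNIV :: 'a set) \<in> sets borel"
    using S by (intro borel_Times) auto
  have m: "(\<lambda>z. h z * indicator (S \<times> UNIV) z) \<in> borel_measurable (lborel \<Otimes>\<^sub>M lborel)"
    unfolding lborel_prod using S' by (auto intro!: borel_measurable_times borel_measurable_indicator assms(1))
  have "(\<integral>\<^sup>+z\<in>S \<times> UNIV. h z \<partial>lborel) = (\<integral>\<^sup>+z. h z * indicator (S \<times> UNIV) z \<partial>(lborel \<Otimes>\<^sub>M lborel))"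
    by (simp add: lborel_prod)
  also have "\<dots> = (\<integral>\<^sup>+\<tau>. (\<integral>\<^sup>+x. h (\<tau>, x) * indicator (S \<times> UNIV) (\<tau>, x) \<partial>lborel) \<partial>lborel)"
    by (rule lborel.nn_integral_fst[OF m, symmetric])
  also have "\<dots> = (\<integral>\<^sup>+\<tau>\<in>S. (\<integral>\<^sup>+x. h (\<tau>, x) \<partial>lborel) \<partial>lborel)"
    by (intro nn_integral_cong) (auto simp: indicator_def)
  finally show ?thesis .
qed

lemma Lp_norm_pow_2: "Lp_norm_pow 2 f = (\<integral>\<^sup>+x. ennreal ((norm (f x))\<^sup>2) \<partial>lborel)"
  unfolding Lp_norm_pow_def by (intro nn_integral_cong) (auto simp: powr_numeral)

lemma norm_vec_scaleR: "norm (\<chi> i. (b::real^'d::finite) $ i *\<^sub>R (c::complex)) = norm b * norm c"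
proof -
  have "(\<Sum>i\<in>UNIV. (norm (b $ i *\<^sub>R c))\<^sup>2) = (\<Sum>i\<in>UNIV. (b $ i)\<^sup>2) * (norm c)\<^sup>2"
    by (simp add: power_mult_distrib sum_distrib_right)
  then show ?thesis
    by (simp add: norm_vec_def L2_set_def real_sqrt_mult)
qed

lemma space_time_form_ineq_schwartz:
  fixes b :: "real \<times> (real^'d::finite) \<Rightarrow> real^'d"
  assumes ineq: "form_ineq \<delta> g b t f" and f: "schwartz f"
    and D: "\<And>i. has_dir_deriv (0, axis i 1) f (\<lambda>z. D z $ i)"
    and [measurable]: "b \<in> borel_measurable borel" "g \<in> borel_measurable borel" and g: "\<And>\<tau>. 0 \<le> g \<tau>"
  shows "space_time_form_ineq \<delta> g b t f D"
proof -
  note [measurable] = borel_measurable_fst_borel[OF \<open>g \<in> borel_measurable borel\<close>]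
  have "iter_deriv [] f differentiable_on UNIV"
    using f unfolding schwartz_def smooth_def by blast
  then have "continuous_on UNIV f" by (simp add: differentiable_imp_continuous_on)
  then have [measurable]: "f \<in> borel_measurable borel" by (rule borel_measurable_continuous_onI)
  have "continuous_on UNIV (\<lambda>z. D z $ i)" for i
  proof -
    have "[(0, axis i 1)] \<in> lists (Basis :: (real \<times> (real^'d)) set)"
      by (auto simp: Basis_prod_def axis_in_Basis_iff)
    then have "iter_deriv [(0, axis i 1)] f differentiable_on UNIV"
      using f unfolding schwartz_def smooth_def by blast
    moreover have "iter_deriv [(0, axis i 1)] f = (\<lambda>z. D z $ i)"
      using has_dir_deriv_dir_deriv[OF D[of i]] by auto
    ultimately show ?thesis using differentiable_imp_continuous_on by metis
  qed
  then have "continuous_on UNIV (\<lambda>z. \<chi> i. D z $ i)" by (intro continuous_on_vec_lambda)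
  then have [measurable]: "D \<in> borel_measurable borel"
    by (intro borel_measurable_continuous_onI) (simp add: vec_nth_inverse)
  have gr: "grad (\<lambda>x. f (\<tau>, x)) x = D (\<tau>, x)" for \<tau> x
  proof -
    have "((\<lambda>r. f (\<tau>, x + r *\<^sub>R axis i 1)) has_vector_derivative D (\<tau>, x) $ i) (at 0)" for i
      using D[of i] unfolding has_dir_deriv_def by (drule_tac x="(\<tau>, x)" in spec) simp
    then show ?thesis
      by (auto simp: vec_eq_iff grad_def partial_def dir_deriv_def intro!: vector_derivative_at)
  qed
  have 1: "(\<integral>\<^sup>+\<tau>\<in>{0..t}. Lp_norm_pow 2 (\<lambda>x. \<chi> i. b (\<tau>, x) $ i *\<^sub>R f (\<tau>, x)) \<partial>lborel)
     = (\<integral>\<^sup>+z\<in>{0..t} \<times> UNIV. ennreal ((norm (b z) * norm (f z))\<^sup>2) \<partial>lborel)"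
    by (subst nn_integral_space_time) (auto simp: Lp_norm_pow_2 norm_vec_scaleR)
  have 2: "(\<integral>\<^sup>+\<tau>\<in>{0..t}. Lp_norm_pow 2 (grad (\<lambda>x. f (\<tau>, x))) \<partial>lborel)
     = (\<integral>\<^sup>+z\<in>{0..t} \<times> UNIV. ennreal ((norm (D z))\<^sup>2) \<partial>lborel)"
    by (subst nn_integral_space_time) (auto simp: Lp_norm_pow_2 gr)
  have 3: "(\<integral>\<^sup>+\<tau>\<in>{0..t}. ennreal (g \<tau>) * Lp_norm_pow 2 (\<lambda>x. f (\<tau>, x)) \<partial>lborel)
     = (\<integral>\<^sup>+z\<in>{0..t} \<times> UNIV. ennreal (g (fst z) * (norm (f z))\<^sup>2) \<partial>lborel)"
    by (subst nn_integral_space_time)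
      (auto simp: Lp_norm_pow_2 g ennreal_mult nn_integral_cmult)
  show ?thesis
    using ineq unfolding form_ineq_def space_time_form_ineq_def 1 2 3 .
qed

lemma emeasure_space_time_cbox_finite: "emeasure lborel (cbox a b) < \<infinity>"
  by (simp add: emeasure_lborel_cbox_eq)

text \<open>Dominated convergence in each of the three terms, with majorants living on the common
  box. The bound \<open>M\<close> of the field enters these majorants only, so the limit inequality
  keeps the same \<delta> and \<open>g\<close>.\<close>

lemma space_time_form_ineq_limit:
  fixes b :: "real \<times> (real^'d::finite) \<Rightarrow> real^'d"
  assumes ineq: "\<And>j. space_time_form_ineq \<delta> g b t (f j) (D j)"
    and [measurable]: "b \<in> borel_measurable borel" "g \<in> borel_measurable borel"
      "\<And>j. f j \<in> borel_measurable borel" "\<And>j. D j \<in> borel_measurable borel"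
    and fl: "\<And>z. (\<lambda>j. f j z) \<longlonglongrightarrow> F z" and Dl: "\<And>z. (\<lambda>j. D j z) \<longlonglongrightarrow> E z"
    and bound: "\<And>j z. norm (f j z) \<le> C" "\<And>j z. norm (D j z) \<le> C"
    and supp: "\<And>j z. snd z \<notin> cbox c d \<Longrightarrow> f j z = 0" "\<And>j z. snd z \<notin> cbox c d \<Longrightarrow> D j z = 0"
    and bM: "\<And>z. norm (b z) \<le> M" and g: "\<And>\<tau>. 0 \<le> g \<tau>"
    and gfin: "(\<integral>\<^sup>+\<tau>\<in>{0..t}. ennreal (g \<tau>) \<partial>lborel) < \<infinity>"
  shows "space_time_form_ineq \<delta> g b t F E"
proof -
  have "(indicator (cbox c d) :: _ \<Rightarrow> ennreal) \<in> borel_measurable borel" by measurable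
  note [measurable] = borel_measurable_fst_borel[OF \<open>g \<in> borel_measurable borel\<close>]
    borel_measurable_snd_borel[OF this]
  let ?S = "{0..t} \<times> (UNIV :: (real^'d) set)"
  let ?Q = "{0..t} \<times> cbox c d"
  have C: "0 \<le> C" using bound(1)[of 0 undefined] norm_ge_zero order_trans by blast
  have M: "0 \<le> M" using bM[of undefined] norm_ge_zero order_trans by blast
  have S[measurable]: "?S \<in> sets borel"
    by (intro borel_closed closed_Times) auto
  have Q[measurable]: "?Q \<in> sets borel"
    by (intro borel_closed closed_Times) auto
  have Qfin: "emeasure lborel ?Q < \<infinity>"
    using emeasure_space_time_cbox_finite[of "(0, c)" "(t, d)"] by (simp add: cbox_Pair_eq)
  have [measurable]: "F \<in> borel_measurable borel"
    by (rule borel_measurable_LIMSEQ_metric[OF _ fl]) measurable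
  have [measurable]: "E \<in> borel_measurable borel"
    by (rule borel_measurable_LIMSEQ_metric[OF _ Dl]) measurable
  have T1: "(\<lambda>j. \<integral>\<^sup>+z\<in>?S. ennreal ((norm (b z) * norm (f j z))\<^sup>2) \<partial>lborel)
     \<longlonglongrightarrow> (\<integral>\<^sup>+z\<in>?S. ennreal ((norm (b z) * norm (F z))\<^sup>2) \<partial>lborel)"
  proof (rule nn_integral_dominated_convergence[where w="\<lambda>z. ennreal ((M * C)\<^sup>2) * indicator ?Q z"])
    show "(\<integral>\<^sup>+z. ennreal ((M * C)\<^sup>2) * indicator ?Q z \<partial>lborel) < \<infinity>"
      using Qfin by (simp add: nn_integral_cmult ennreal_mult_less_top)
    have "ennreal ((norm (b z) * norm (f j z))\<^sup>2) * indicator ?S z \<le> ennreal ((M * C)\<^sup>2) * indicator ?Q z" for j z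
      using bM[of z] bound(1)[of j z] supp(1)[of z j] M C
      by (auto simp: indicator_def mem_Times_iff intro!: ennreal_leI power_mono mult_mono)
    then show "AE z in lborel. ennreal ((norm (b z) * norm (f j z))\<^sup>2) * indicator ?S z \<le> ennreal ((M * C)\<^sup>2) * indicator ?Q z" for j
      by auto
    have "(\<lambda>j. ennreal ((norm (b z) * norm (f j z))\<^sup>2) * indicator ?S z) \<longlonglongrightarrow> ennreal ((norm (b z) * norm (F z))\<^sup>2) * indicator ?S z" for z
      by (auto simp: indicator_def intro!: tendsto_ennrealI tendsto_intros fl)
    then show "AE z in lborel. (\<lambda>j. ennreal ((norm (b z) * norm (f j z))\<^sup>2) * indicator ?S z) \<longlonglongrightarrow> ennreal ((norm (b z) * norm (F z))\<^sup>2) * indicator ?S z"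
      by auto
  qed measurable
  have T2: "(\<lambda>j. \<integral>\<^sup>+z\<in>?S. ennreal ((norm (D j z))\<^sup>2) \<partial>lborel)
     \<longlonglongrightarrow> (\<integral>\<^sup>+z\<in>?S. ennreal ((norm (E z))\<^sup>2) \<partial>lborel)"
  proof (rule nn_integral_dominated_convergence[where w="\<lambda>z. ennreal (C\<^sup>2) * indicator ?Q z"])
    show "(\<integral>\<^sup>+z. ennreal (C\<^sup>2) * indicator ?Q z \<partial>lborel) < \<infinity>"
      using Qfin by (simp add: nn_integral_cmult ennreal_mult_less_top)
    have "ennreal ((norm (D j z))\<^sup>2) * indicator ?S z \<le> ennreal (C\<^sup>2) * indicator ?Q z" for j z
      using bound(2)[of j z] supp(2)[of z j] C
      by (auto simp: indicator_def mem_Times_iff intro!: ennreal_leI power_mono)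
    then show "AE z in lborel. ennreal ((norm (D j z))\<^sup>2) * indicator ?S z \<le> ennreal (C\<^sup>2) * indicator ?Q z" for j
      by auto
    have "(\<lambda>j. ennreal ((norm (D j z))\<^sup>2) * indicator ?S z) \<longlonglongrightarrow> ennreal ((norm (E z))\<^sup>2) * indicator ?S z" for z
      by (auto simp: indicator_def intro!: tendsto_ennrealI tendsto_intros Dl)
    then show "AE z in lborel. (\<lambda>j. ennreal ((norm (D j z))\<^sup>2) * indicator ?S z) \<longlonglongrightarrow> ennreal ((norm (E z))\<^sup>2) * indicator ?S z"
      by auto
  qed measurable
  have T3: "(\<lambda>j. \<integral>\<^sup>+z\<in>?S. ennreal (g (fst z) * (norm (f j z))\<^sup>2) \<partial>lborel)
     \<longlonglongrightarrow> (\<integral>\<^sup>+z\<in>?S. ennreal (g (fst z) * (norm (F z))\<^sup>2) \<partial>lborel)"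
  proof (rule nn_integral_dominated_convergence[where w="\<lambda>z. ennreal (g (fst z) * C\<^sup>2) * indicator ?Q z"])
    have "(\<integral>\<^sup>+z. ennreal (g (fst z) * C\<^sup>2) * indicator ?Q z \<partial>lborel) =
        (\<integral>\<^sup>+z\<in>?S. ennreal (C\<^sup>2) * (ennreal (g (fst z)) * indicator (cbox c d) (snd z)) \<partial>lborel)"
      by (intro nn_integral_cong) (auto simp: indicator_def ennreal_mult g mult_ac)
    also have "\<dots> = (\<integral>\<^sup>+\<tau>\<in>{0..t}. (\<integral>\<^sup>+x. ennreal (C\<^sup>2) * (ennreal (g \<tau>) * indicator (cbox c d) x) \<partial>lborel) \<partial>lborel)"
      by (subst nn_integral_space_time) auto
    also have "\<dots> = (\<integral>\<^sup>+\<tau>. (ennreal (C\<^sup>2) * emeasure lborel (cbox c d)) * (ennreal (g \<tau>) * indicator {0..t} \<tau>) \<partial>lborel)"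
      by (intro nn_integral_cong) (simp add: nn_integral_cmult, simp add: mult_ac)
    also have "\<dots> = (ennreal (C\<^sup>2) * emeasure lborel (cbox c d)) * (\<integral>\<^sup>+\<tau>\<in>{0..t}. ennreal (g \<tau>) \<partial>lborel)"
      by (rule nn_integral_cmult) auto
    also have "\<dots> < \<infinity>"
      using gfin emeasure_space_time_cbox_finite[of c d] by (simp add: ennreal_mult_less_top)
    finally show "(\<integral>\<^sup>+z. ennreal (g (fst z) * C\<^sup>2) * indicator ?Q z \<partial>lborel) < \<infinity>" .
    have "ennreal (g (fst z) * (norm (f j z))\<^sup>2) * indicator ?S z \<le> ennreal (g (fst z) * C\<^sup>2) * indicator ?Q z" for j z
      using bound(1)[of j z] supp(1)[of z j] C
      by (auto simp: indicator_def mem_Times_iff g intro!: ennreal_leI mult_left_mono power_mono)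
    then show "AE z in lborel. ennreal (g (fst z) * (norm (f j z))\<^sup>2) * indicator ?S z \<le> ennreal (g (fst z) * C\<^sup>2) * indicator ?Q z" for j
      by auto
    have "(\<lambda>j. ennreal (g (fst z) * (norm (f j z))\<^sup>2) * indicator ?S z) \<longlonglongrightarrow> ennreal (g (fst z) * (norm (F z))\<^sup>2) * indicator ?S z" for z
      by (auto simp: indicator_def intro!: tendsto_ennrealI tendsto_intros fl)
    then show "AE z in lborel. (\<lambda>j. ennreal (g (fst z) * (norm (f j z))\<^sup>2) * indicator ?S z) \<longlonglongrightarrow> ennreal (g (fst z) * (norm (F z))\<^sup>2) * indicator ?S z"
      by auto
  qed measurable
  have T4: "(\<lambda>j. ennreal \<delta> * (\<integral>\<^sup>+z\<in>?S. ennreal ((norm (D j z))\<^sup>2) \<partial>lborel) + (\<integral>\<^sup>+z\<in>?S. ennreal (g (fst z) * (norm (f j z))\<^sup>2) \<partial>lborel))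
    \<longlonglongrightarrow> ennreal \<delta> * (\<integral>\<^sup>+z\<in>?S. ennreal ((norm (E z))\<^sup>2) \<partial>lborel) + (\<integral>\<^sup>+z\<in>?S. ennreal (g (fst z) * (norm (F z))\<^sup>2) \<partial>lborel)"
    by (intro tendsto_add T3 ennreal_tendsto_cmult T2) auto
  show ?thesis
    unfolding space_time_form_ineq_def
    by (rule LIMSEQ_le[OF T1 T4]) (use ineq in \<open>auto simp: space_time_form_ineq_def\<close>)
qed

lemma space_time_form_ineq_C1:
  fixes b :: "real \<times> (real^'d::finite) \<Rightarrow> real^'d" and f :: "real \<times> (real^'d) \<Rightarrow> complex"
  assumes form: "\<And>f. schwartz f \<Longrightarrow> form_ineq \<delta> g b t f"
    and m: "b \<in> borel_measurable borel" "g \<in> borel_measurable borel"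
    and bM: "\<And>z. norm (b z) \<le> M" and g: "\<And>\<tau>. 0 \<le> g \<tau>"
    and gfin: "(\<integral>\<^sup>+\<tau>\<in>{0..t}. ennreal (g \<tau>) \<partial>lborel) < \<infinity>"
    and cf: "continuous_on UNIV f" and cD: "continuous_on UNIV D"
    and D: "\<And>i. has_dir_deriv (0, axis i 1) f (\<lambda>z. D z $ i)"
    and supp: "\<And>z. z \<notin> cbox c d \<Longrightarrow> f z = 0"
  shows "space_time_form_ineq \<delta> g b t f D"
proof -
  let ?e = "\<lambda>i::'d. (0::real, axis i (1::real))"
  \<comment> \<open>The approximation is indexed by directions, the components of \<open>D\<close>
    by coordinates; the inverse of the injection \<open>?e\<close> translates between them.\<close>
  have "inj ?e" by (auto simp: inj_on_def axis_eq_axis)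
  then have the: "the_inv ?e (?e i) = i" for i using the_inv_f_f[OF \<open>inj ?e\<close>, of i] by blast
  have "\<exists>F E. schwartz F \<and> (\<forall>z. norm (F z - f z) \<le> 1 / Suc j) \<and> (\<forall>z. z \<notin> cbox (c - One) (d + One) \<longrightarrow> F z = 0)
     \<and> (\<forall>i. has_dir_deriv (?e i) F (\<lambda>z. E z $ i)) \<and> (\<forall>i z. norm (E z $ i - D z $ i) \<le> 1 / Suc j)" for j :: nat
  proof -
    obtain F F' where F: "schwartz F" "\<And>z. norm (F z - f z) \<le> 1 / Suc j"
      "\<And>z. z \<notin> cbox (c - One) (d + One) \<Longrightarrow> F z = 0"
      "\<And>e. e \<in> range ?e \<Longrightarrow> has_dir_deriv e F (F' e)"
      "\<And>e z. e \<in> range ?e \<Longrightarrow> norm (F' e z - D z $ (the_inv ?e e)) \<le> 1 / Suc j"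
    proof (rule schwartz_approximation[of f c d "range ?e" "\<lambda>e z. D z $ (the_inv ?e e)" "1 / Suc j"])
      show "has_dir_deriv e f (\<lambda>z. D z $ the_inv ?e e)" if "e \<in> range ?e" for e
        using that the D by auto
    qed (auto intro!: cf supp continuous_intros cD)
    have "norm (F' (?e i) z - D z $ i) \<le> 1 / Suc j" for i z
      using F(5)[OF rangeI[of ?e i], of z] unfolding the .
    then show ?thesis
      by (intro exI[of _ F] exI[of _ "\<lambda>z. \<chi> i. F' (?e i) z"]) (use F(1-4) in \<open>auto simp del: of_nat_Suc\<close>)
  qed
  then obtain F E where F: "\<And>j. schwartz (F j)" "\<And>j z. norm (F j z - f z) \<le> 1 / Suc j"
    "\<And>j z. z \<notin> cbox (c - One) (d + One) \<Longrightarrow> F j z = 0"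
    "\<And>j i. has_dir_deriv (?e i) (F j) (\<lambda>z. E j z $ i)" "\<And>j i z. norm (E j z $ i - D z $ i) \<le> 1 / Suc j"
    by metis
  have inv: "(\<lambda>j. 1 / real (Suc j)) \<longlonglongrightarrow> 0"
    using LIMSEQ_inverse_real_of_nat by (simp add: inverse_eq_divide)
  have cF: "continuous_on UNIV (F j)" for j
  proof -
    have "iter_deriv [] (F j) differentiable_on UNIV"
      using F(1)[of j] unfolding schwartz_def smooth_def by blast
    then show ?thesis by (simp add: differentiable_imp_continuous_on)
  qed
  have cE: "continuous_on UNIV (E j)" for j
  proof -
    have "continuous_on UNIV (\<lambda>z. E j z $ i)" for i
    proof -
      have "[?e i] \<in> lists (Basis :: (real \<times> (real^'d)) set)"
        by (auto simp: Basis_prod_def axis_in_Basis_iff)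
      then have "iter_deriv [?e i] (F j) differentiable_on UNIV"
        using F(1)[of j] unfolding schwartz_def smooth_def by blast
      moreover have "iter_deriv [?e i] (F j) = (\<lambda>z. E j z $ i)"
        using has_dir_deriv_dir_deriv[OF F(4)[of i j]] by auto
      ultimately show ?thesis using differentiable_imp_continuous_on by metis
    qed
    then have "continuous_on UNIV (\<lambda>z. \<chi> i. E j z $ i)" by (intro continuous_on_vec_lambda)
    then show ?thesis by simp
  qed
  have Dsupp: "D z = 0" if "z \<notin> cbox c d" for z
    using has_dir_deriv_outside_support[OF D supp that] by (auto simp: vec_eq_iff)
  have Esupp: "E j z = 0" if "z \<notin> cbox (c - One) (d + One)" for j z
    using has_dir_deriv_outside_support[OF F(4) F(3) that] by (auto simp: vec_eq_iff)
  have "bounded (f ` cbox c d)" "bounded (D ` cbox c d)"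
    by (intro compact_imp_bounded compact_continuous_image continuous_on_subset[OF cf] continuous_on_subset[OF cD]; auto)+
  then obtain C1 C2 where C1: "\<And>z. z \<in> cbox c d \<Longrightarrow> norm (f z) \<le> C1" and C2: "\<And>z. z \<in> cbox c d \<Longrightarrow> norm (D z) \<le> C2"
    unfolding bounded_iff by auto
  have C1: "norm (f z) \<le> \<bar>C1\<bar>" for z using C1[of z] supp[of z] by (cases "z \<in> cbox c d") auto
  have C2: "norm (D z) \<le> \<bar>C2\<bar>" for z using C2[of z] Dsupp[of z] by (cases "z \<in> cbox c d") auto
  have small: "1 / real (Suc j) \<le> 1" for j by simp
  have bF: "norm (F j z) \<le> \<bar>C1\<bar> + 1" for j z
    using norm_triangle_ineq2[of "F j z" "f z"] F(2)[of j z] small[of j] C1[of z] by linarith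
  have nE: "norm (E j z - D z) \<le> real CARD('d) * (1 / Suc j)" for j z
  proof -
    have "norm (E j z - D z) \<le> (\<Sum>i\<in>UNIV. norm ((E j z - D z) $ i))" unfolding norm_vec_def by (rule L2_set_le_sum) auto
    also have "\<dots> \<le> (\<Sum>i\<in>(UNIV::'d set). 1 / Suc j)" by (rule sum_mono) (use F(5) in auto)
    finally show ?thesis by simp
  qed
  have bE: "norm (E j z) \<le> \<bar>C2\<bar> + real CARD('d)" for j z
  proof -
    have "real CARD('d) * (1 / Suc j) \<le> real CARD('d) * 1" by (intro mult_left_mono small) auto
    then show ?thesis using norm_triangle_ineq2[of "E j z" "D z"] nE[of j z] C2[of z] by linarith
  qed
  show ?thesis
  proof (rule space_time_form_ineq_limit[where f=F and D=E and C="\<bar>C1\<bar> + 1 + (\<bar>C2\<bar> + real CARD('d))" and M=M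
        and c="snd (c - One)" and d="snd (d + One)"])
    show "space_time_form_ineq \<delta> g b t (F j) (E j)" for j
      by (rule space_time_form_ineq_schwartz[OF form[OF F(1)] F(1) F(4) m g])
    show "norm (F j z) \<le> \<bar>C1\<bar> + 1 + (\<bar>C2\<bar> + real CARD('d))" for j z using bF[of j z] by linarith
    show "norm (E j z) \<le> \<bar>C1\<bar> + 1 + (\<bar>C2\<bar> + real CARD('d))" for j z using bE[of j z] by linarith
    have out: "z \<notin> cbox (c - One) (d + One)" if "snd z \<notin> cbox (snd (c - One)) (snd (d + One))" for z
    proof -
      have "cbox (c - One) (d + One) = cbox (fst (c - One)) (fst (d + One)) \<times> cbox (snd (c - One)) (snd (d + One))"
        by (metis cbox_Pair_eq prod.collapse)
      then show ?thesis using that by (simp only: mem_Times_iff) blast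
    qed
    show "F j z = 0" if "snd z \<notin> cbox (snd (c - One)) (snd (d + One))" for j z using F(3)[OF out[OF that]] .
    show "E j z = 0" if "snd z \<notin> cbox (snd (c - One)) (snd (d + One))" for j z using Esupp[OF out[OF that]] .
    show "(\<lambda>j. F j z) \<longlonglongrightarrow> f z" for z
      by (rule LIM_zero_cancel, rule Lim_null_comparison[OF _ inv]) (use F(2) in auto)
    show "(\<lambda>j. E j z) \<longlonglongrightarrow> D z" for z
      by (rule LIM_zero_cancel, rule Lim_null_comparison[OF _ tendsto_mult_right_zero[OF inv, of "real CARD('d)"]]) (use nE in auto)
  qed (use m bM g gfin in \<open>auto intro: borel_measurable_continuous_onI cF cE\<close>)
qed

section \<open>Integrals of continuous functions over time slabs\<close>

lemma continuous_on_slice: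
  assumes "continuous_on (S \<times> T) (\<lambda>(\<tau>, x). k \<tau> x)" "\<tau> \<in> S"
  shows "continuous_on T (k \<tau>)"
proof -
  have "continuous_on T (\<lambda>x. (\<tau>, x))" by (intro continuous_intros)
  from continuous_on_compose2[OF assms(1) this] assms(2) show ?thesis by auto
qed

lemma integral_nonneg_total:
  fixes f :: "'a::euclidean_space \<Rightarrow> real"
  assumes "\<And>x. x \<in> S \<Longrightarrow> 0 \<le> f x"
  shows "0 \<le> integral S f"
  using integral_nonneg[of f S] assms not_integrable_integral[of f S] by fastforce

lemma nn_integral_continuous_cbox:
  fixes h :: "'a::euclidean_space \<Rightarrow> real"
  assumes ch: "continuous_on (cbox a b) h" and nonneg: "\<And>x. x \<in> cbox a b \<Longrightarrow> 0 \<le> h x"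
  shows "(\<integral>\<^sup>+x\<in>cbox a b. ennreal (h x) \<partial>lborel) = ennreal (integral (cbox a b) h)"
  by (rule nn_integral_has_integral_lebesgue'[OF nonneg integrable_integral[OF integrable_continuous[OF ch]]])

lemma nn_integral_continuous_supp:
  fixes h :: "'a::euclidean_space \<Rightarrow> real"
  assumes ch: "continuous_on UNIV h" and nonneg: "\<And>x. 0 \<le> h x" and supp: "\<And>x. x \<notin> cbox a b \<Longrightarrow> h x = 0"
  shows "(\<integral>\<^sup>+x. ennreal (h x) \<partial>lborel) = ennreal (integral UNIV h)"
proof -
  have "(\<integral>\<^sup>+x. ennreal (h x) \<partial>lborel) = (\<integral>\<^sup>+x\<in>cbox a b. ennreal (h x) \<partial>lborel)"
    by (rule nn_integral_cong) (use supp in \<open>auto simp: indicator_def\<close>)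
  also have "\<dots> = ennreal (integral (cbox a b) h)"
    by (rule nn_integral_continuous_cbox) (use nonneg in \<open>auto intro: continuous_on_subset[OF ch]\<close>)
  finally show ?thesis by (simp add: integral_UNIV_eq_cbox[OF supp])
qed

lemma continuous_on_integral_supp:
  fixes h :: "'t::topological_space \<times> 'a::euclidean_space \<Rightarrow> 'b::banach"
  assumes ch: "continuous_on (S \<times> UNIV) h" and supp: "\<And>\<tau> x. \<tau> \<in> S \<Longrightarrow> x \<notin> cbox a b \<Longrightarrow> h (\<tau>, x) = 0"
  shows "continuous_on S (\<lambda>\<tau>. integral UNIV (\<lambda>x. h (\<tau>, x)))"
proof -
  have "continuous_on S (\<lambda>\<tau>. integral (cbox a b) (\<lambda>x. h (\<tau>, x)))"
    by (rule integral_continuous_on_param) (auto intro: continuous_on_subset[OF ch])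
  then show ?thesis
    by (rule continuous_on_eq) (use supp in \<open>auto intro!: integral_UNIV_eq_cbox[symmetric]\<close>)
qed

lemma nn_integral_space_time_continuous:
  fixes h :: "real \<times> 'a::euclidean_space \<Rightarrow> real"
  assumes ch: "continuous_on ({s1..t1} \<times> UNIV) h" and nonneg: "\<And>\<tau> x. \<tau> \<in> {s1..t1} \<Longrightarrow> 0 \<le> h (\<tau>, x)"
    and supp: "\<And>\<tau> x. \<tau> \<in> {s1..t1} \<Longrightarrow> x \<notin> cbox a b \<Longrightarrow> h (\<tau>, x) = 0"
  shows "(\<integral>\<^sup>+z\<in>{s1..t1} \<times> UNIV. ennreal (h z) \<partial>lborel) = ennreal (integral {s1..t1} (\<lambda>\<tau>. integral UNIV (\<lambda>x. h (\<tau>, x))))"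
proof -
  have ch': "continuous_on (cbox (s1, a) (t1, b)) h"
    by (rule continuous_on_subset[OF ch]) (auto simp: cbox_Pair_eq)
  have "(\<integral>\<^sup>+z\<in>{s1..t1} \<times> UNIV. ennreal (h z) \<partial>lborel) = (\<integral>\<^sup>+z\<in>cbox (s1, a) (t1, b). ennreal (h z) \<partial>lborel)"
  proof (rule nn_integral_cong)
    fix z :: "real \<times> 'a"
    show "ennreal (h z) * indicator ({s1..t1} \<times> UNIV) z = ennreal (h z) * indicator (cbox (s1, a) (t1, b)) z"
      using supp[of "fst z" "snd z"]
      by (cases z; cases "snd z \<in> cbox a b") (auto simp: indicator_def cbox_Pair_eq)
  qed
  also have "\<dots> = ennreal (integral (cbox (s1, a) (t1, b)) h)"
    by (rule nn_integral_continuous_cbox[OF ch']) (use nonneg in \<open>auto simp: cbox_Pair_eq\<close>)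
  also have "integral (cbox (s1, a) (t1, b)) h = integral {s1..t1} (\<lambda>\<tau>. integral (cbox a b) (\<lambda>x. h (\<tau>, x)))"
    using integral_prod_continuous[OF ch'] by simp
  also have "\<dots> = integral {s1..t1} (\<lambda>\<tau>. integral UNIV (\<lambda>x. h (\<tau>, x)))"
    by (rule integral_cong) (use supp in \<open>auto intro!: integral_UNIV_eq_cbox[symmetric]\<close>)
  finally show ?thesis .
qed

text \<open>The weight \<open>g\<close> is merely measurable with finite Lebesgue integral, while
  the energies are handled by gauge integrals; this is the passage between the two.\<close>

lemma integrable_weighted_continuous:
  fixes g \<Phi> :: "real \<Rightarrow> real"
  assumes gm: "g \<in> borel_measurable borel" and g: "\<And>\<tau>. 0 \<le> g \<tau>"
    and gfin: "(\<integral>\<^sup>+\<tau>\<in>{s1..t1}. ennreal (g \<tau>) \<partial>lborel) < \<infinity>"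
    and c: "continuous_on {s1..t1} \<Phi>" and nonneg: "\<And>\<tau>. \<tau> \<in> {s1..t1} \<Longrightarrow> 0 \<le> \<Phi> \<tau>"
  shows "(\<lambda>\<tau>. g \<tau> * \<Phi> \<tau>) integrable_on {s1..t1}"
    "(\<integral>\<^sup>+\<tau>\<in>{s1..t1}. ennreal (g \<tau> * \<Phi> \<tau>) \<partial>lborel) = ennreal (integral {s1..t1} (\<lambda>\<tau>. g \<tau> * \<Phi> \<tau>))"
proof -
  have "bounded (\<Phi> ` {s1..t1})" by (intro compact_imp_bounded compact_continuous_image c) auto
  then obtain K where K: "\<And>\<tau>. \<tau> \<in> {s1..t1} \<Longrightarrow> \<Phi> \<tau> \<le> K"
    unfolding bounded_iff by (metis abs_ge_self image_eqI order_trans real_norm_def)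
  have im: "(\<lambda>\<tau>. indicator {s1..t1} \<tau> *\<^sub>R \<Phi> \<tau>) \<in> borel_measurable borel"
    by (rule borel_measurable_continuous_on_indicator[OF _ c]) auto
  let ?F = "\<lambda>\<tau>. g \<tau> * (indicator {s1..t1} \<tau> *\<^sub>R \<Phi> \<tau>)"
  have Fm: "?F \<in> borel_measurable borel" using gm im by measurable
  have Fn: "0 \<le> ?F \<tau>" for \<tau> using g[of \<tau>] nonneg[of \<tau>] by (auto simp: indicator_def)
  have "(\<integral>\<^sup>+\<tau>. ennreal (?F \<tau>) \<partial>lborel) \<le> (\<integral>\<^sup>+\<tau>. ennreal \<bar>K\<bar> * (ennreal (g \<tau>) * indicator {s1..t1} \<tau>) \<partial>lborel)"
  proof (rule nn_integral_mono)
    fix \<tau>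
    show "ennreal (?F \<tau>) \<le> ennreal \<bar>K\<bar> * (ennreal (g \<tau>) * indicator {s1..t1} \<tau>)"
    proof (cases "\<tau> \<in> {s1..t1}")
      case True
      have "g \<tau> * \<Phi> \<tau> \<le> \<bar>K\<bar> * g \<tau>"
        using mult_left_mono[OF _ g[of \<tau>], of "\<Phi> \<tau>" "\<bar>K\<bar>"] K[OF True] by (simp add: mult.commute)
      then show ?thesis using True g[of \<tau>] by (simp add: ennreal_mult[symmetric] ennreal_leI)
    qed simp
  qed
  also have "\<dots> = ennreal \<bar>K\<bar> * (\<integral>\<^sup>+\<tau>\<in>{s1..t1}. ennreal (g \<tau>) \<partial>lborel)"
    by (rule nn_integral_cmult) (use gm in measurable)
  also have "\<dots> < \<infinity>" using gfin by (simp add: ennreal_mult_less_top)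
  finally have fin: "(\<integral>\<^sup>+\<tau>. ennreal (?F \<tau>) \<partial>lborel) < \<infinity>" .
  have eq: "?F = (\<lambda>\<tau>. if \<tau> \<in> {s1..t1} then g \<tau> * \<Phi> \<tau> else 0)" by (auto simp: indicator_def)
  have "?F integrable_on UNIV" by (rule nn_integral_integrable_on[OF Fm Fn fin])
  then show "(\<lambda>\<tau>. g \<tau> * \<Phi> \<tau>) integrable_on {s1..t1}" unfolding eq integrable_restrict_UNIV .
  have "(\<integral>\<^sup>+\<tau>. ennreal (?F \<tau>) \<partial>lborel) = ennreal (integral UNIV ?F)"
    by (rule nn_integral_lborel_eq_integral[OF Fm Fn fin])
  also have "integral UNIV ?F = integral {s1..t1} (\<lambda>\<tau>. g \<tau> * \<Phi> \<tau>)"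
    unfolding eq integral_restrict_UNIV ..
  also have "(\<integral>\<^sup>+\<tau>. ennreal (?F \<tau>) \<partial>lborel) = (\<integral>\<^sup>+\<tau>\<in>{s1..t1}. ennreal (g \<tau> * \<Phi> \<tau>) \<partial>lborel)"
    by (intro nn_integral_cong) (auto simp: indicator_def)
  finally show "(\<integral>\<^sup>+\<tau>\<in>{s1..t1}. ennreal (g \<tau> * \<Phi> \<tau>) \<partial>lborel) = ennreal (integral {s1..t1} (\<lambda>\<tau>. g \<tau> * \<Phi> \<tau>))" .
qed

text \<open>The form bound is given on [0,t], but the solution has derivatives only after time
  \<open>s\<close>. Since no time derivative occurs in the inequality, a function on the slab may be
  cut off sharply in time at no cost.\<close>

lemma form_bound_time_slab:
  fixes B :: "real \<times> (real^'d::finite) \<Rightarrow> real^'d" and k :: "real \<Rightarrow> real^'d \<Rightarrow> real"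
  assumes form: "\<And>f. schwartz f \<Longrightarrow> form_ineq \<delta> g B t f"
    and cB: "continuous_on UNIV B" and gm: "g \<in> borel_measurable borel"
    and bM: "\<And>z. norm (B z) \<le> M" and g: "\<And>\<tau>. 0 \<le> g \<tau>" and \<delta>: "0 \<le> \<delta>"
    and gfin: "(\<integral>\<^sup>+\<tau>\<in>{0..t}. ennreal (g \<tau>) \<partial>lborel) < \<infinity>"
    and st: "0 \<le> s1" "s1 \<le> t1" "t1 \<le> t"
    and ck: "continuous_on ({s1..t1} \<times> UNIV) (\<lambda>(\<tau>, x). k \<tau> x)"
    and cD: "continuous_on ({s1..t1} \<times> UNIV) (\<lambda>(\<tau>, x). D \<tau> x)"
    and D: "\<And>\<tau> i. \<tau> \<in> {s1..t1} \<Longrightarrow> has_dir_deriv (axis i 1) (k \<tau>) (\<lambda>x. D \<tau> x $ i)"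
    and supp: "\<And>\<tau> x. \<tau> \<in> {s1..t1} \<Longrightarrow> x \<notin> cbox a b \<Longrightarrow> k \<tau> x = 0"
  shows "integral {s1..t1} (\<lambda>\<tau>. integral UNIV (\<lambda>x. (norm (B (\<tau>, x)))\<^sup>2 * (k \<tau> x)\<^sup>2))
     \<le> \<delta> * integral {s1..t1} (\<lambda>\<tau>. integral UNIV (\<lambda>x. (norm (D \<tau> x :: real^'d))\<^sup>2))
       + integral {s1..t1} (\<lambda>\<tau>. g \<tau> * integral UNIV (\<lambda>x. (k \<tau> x)\<^sup>2))"
proof -
  \<comment> \<open>Clamping the time extends \<open>k\<close> and \<open>D\<close> continuously, as
    constants in time, beyond the slab.\<close>
  define cl where "cl \<tau> = max s1 (min t1 \<tau>)" for \<tau> :: real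
  have cl: "cl \<tau> \<in> {s1..t1}" for \<tau> using st by (auto simp: cl_def)
  have cl_id: "cl \<tau> = \<tau>" if "\<tau> \<in> {s1..t1}" for \<tau> using that by (auto simp: cl_def)
  have ccl: "continuous_on S cl" for S unfolding cl_def by (intro continuous_intros)
  \<comment> \<open>Piecewise linear cutoffs of slope \<open>Suc j\<close>, equal to 1 on the slab
    and decreasing to its indicator function; \<open>I\<close> below is their limit.\<close>
  define \<theta> where "\<theta> j \<tau> = max 0 (1 - real (Suc j) * \<bar>\<tau> - cl \<tau>\<bar>)" for j \<tau>
  have c\<theta>: "continuous_on S (\<theta> j)" for S j unfolding \<theta>_def by (intro continuous_intros ccl)
  have \<theta>01: "0 \<le> \<theta> j \<tau>" "\<theta> j \<tau> \<le> 1" for j \<tau> by (auto simp: \<theta>_def)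
  have \<theta>0: "\<theta> j \<tau> = 0" if "\<tau> \<notin> {s1 - 1..t1 + 1}" for j \<tau>
  proof -
    have "1 \<le> \<bar>\<tau> - cl \<tau>\<bar>" using that st by (auto simp: cl_def)
    moreover have "1 \<le> real (Suc j)" by simp
    ultimately have "1 * 1 \<le> real (Suc j) * \<bar>\<tau> - cl \<tau>\<bar>" by (intro mult_mono) auto
    then show ?thesis by (simp add: \<theta>_def)
  qed
  have \<theta>lim: "(\<lambda>j. \<theta> j \<tau>) \<longlonglongrightarrow> (if \<tau> \<in> {s1..t1} then 1 else 0)" for \<tau>
  proof (cases "\<tau> \<in> {s1..t1}")
    case True then show ?thesis by (simp add: \<theta>_def cl_id)
  next
    case False
    then have pos: "0 < \<bar>\<tau> - cl \<tau>\<bar>" using cl[of \<tau>] by auto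
    obtain N :: nat where N: "1 / \<bar>\<tau> - cl \<tau>\<bar> < real N" using reals_Archimedean2 by blast
    have "\<theta> j \<tau> = 0" if "N \<le> j" for j
    proof -
      have "1 / \<bar>\<tau> - cl \<tau>\<bar> < real (Suc j)" using N that by linarith
      then have "1 < real (Suc j) * \<bar>\<tau> - cl \<tau>\<bar>" using pos by (simp add: divide_less_eq)
      then show ?thesis by (simp add: \<theta>_def)
    qed
    then have "\<forall>\<^sub>F j in sequentially. \<theta> j \<tau> = 0" by (auto simp: eventually_sequentially)
    then have "(\<lambda>j. \<theta> j \<tau>) \<longlonglongrightarrow> 0" by (rule tendsto_eventually)
    then show ?thesis using False by (simp only: if_False)
  qed
  define f where "f j z = complex_of_real (\<theta> j (fst z) * k (cl (fst z)) (snd z))" for j z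
  define E where "E j z = (\<chi> i. complex_of_real (\<theta> j (fst z) * D (cl (fst z)) (snd z) $ i))" for j z
  have cp: "continuous_on UNIV (\<lambda>z :: real \<times> (real^'d). (cl (fst z), snd z))"
    by (intro continuous_intros continuous_on_compose2[OF ccl]) auto
  have rp: "range (\<lambda>z :: real \<times> (real^'d). (cl (fst z), snd z)) \<subseteq> {s1..t1} \<times> UNIV"
    using cl by blast
  have ckc: "continuous_on UNIV (\<lambda>z. k (cl (fst z)) (snd z))"
    using continuous_on_compose2[OF ck cp rp] by simp
  have cDc: "continuous_on UNIV (\<lambda>z. D (cl (fst z)) (snd z))"
    using continuous_on_compose2[OF cD cp rp] by simp
  have cf: "continuous_on UNIV (f j)" for j
    unfolding f_def[abs_def] by (intro continuous_intros ckc continuous_on_compose2[OF c\<theta>]) auto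
  have cE: "continuous_on UNIV (E j)" for j
    unfolding E_def[abs_def] by (intro continuous_intros cDc continuous_on_compose2[OF c\<theta>]) auto
  have Dsupp: "D \<tau> x = 0" if "\<tau> \<in> {s1..t1}" "x \<notin> cbox a b" for \<tau> x
  proof -
    have "D \<tau> x $ i = 0" for i
      by (rule has_dir_deriv_outside_support[OF D[OF that(1)], of a b]) (use supp that in auto)
    then show ?thesis by (auto simp: vec_eq_iff)
  qed
  have fE: "has_dir_deriv (0, axis i 1) (f j) (\<lambda>z. E j z $ i)" for i j
    unfolding has_dir_deriv_def
  proof
    fix z :: "real \<times> (real^'d)"
    have "((\<lambda>r. k (cl (fst z)) (snd z + r *\<^sub>R axis i 1)) has_vector_derivative D (cl (fst z)) (snd z) $ i) (at 0)"
      using D[OF cl[of "fst z"], of i] unfolding has_dir_deriv_def by blast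
    then have "((\<lambda>r. of_real (\<theta> j (fst z) * k (cl (fst z)) (snd z + r *\<^sub>R axis i 1)) :: complex) has_vector_derivative
       of_real (\<theta> j (fst z) * D (cl (fst z)) (snd z) $ i)) (at 0)"
      by (intro bounded_linear.has_vector_derivative[OF bounded_linear_of_real]
        bounded_linear.has_vector_derivative[OF bounded_linear_mult_right])
    then show "((\<lambda>r. f j (z + r *\<^sub>R (0, axis i 1))) has_vector_derivative E j z $ i) (at 0)"
      by (simp add: f_def E_def)
  qed
  have fsupp: "f j z = 0" if "z \<notin> cbox (s1 - 1, a) (t1 + 1, b)" for j z
    using that \<theta>0[of "fst z" j] supp[OF cl, of "snd z" "fst z"]
    by (cases z) (auto simp: f_def cbox_Pair_eq)
  have mB: "B \<in> borel_measurable borel" by (rule borel_measurable_continuous_onI[OF cB])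
  have ineq: "space_time_form_ineq \<delta> g B t (f j) (E j)" for j
    by (rule space_time_form_ineq_C1[OF form mB gm bM g gfin cf cE fE fsupp])
  have "bounded ((\<lambda>(\<tau>, x). k \<tau> x) ` ({s1..t1} \<times> cbox a b))" "bounded ((\<lambda>(\<tau>, x). D \<tau> x) ` ({s1..t1} \<times> cbox a b))"
    by (intro compact_imp_bounded compact_continuous_image continuous_on_subset[OF ck] continuous_on_subset[OF cD] compact_Times; auto)+
  then obtain C1 C2 where C1: "\<And>\<tau> x. \<tau> \<in> {s1..t1} \<Longrightarrow> x \<in> cbox a b \<Longrightarrow> \<bar>k \<tau> x\<bar> \<le> C1"
    and C2: "\<And>\<tau> x. \<tau> \<in> {s1..t1} \<Longrightarrow> x \<in> cbox a b \<Longrightarrow> norm (D \<tau> x) \<le> C2"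
    unfolding bounded_iff by (auto simp: split_beta) (metis atLeastAtMost_iff mem_Sigma_iff)
  have C1: "\<bar>k \<tau> x\<bar> \<le> \<bar>C1\<bar>" if "\<tau> \<in> {s1..t1}" for \<tau> x
    using C1[OF that, of x] supp[OF that, of x] by (cases "x \<in> cbox a b") auto
  have C2: "norm (D \<tau> x) \<le> \<bar>C2\<bar>" if "\<tau> \<in> {s1..t1}" for \<tau> x
    using C2[OF that, of x] Dsupp[OF that, of x] by (cases "x \<in> cbox a b") auto
  have nE: "norm (\<chi> i. complex_of_real (v $ i)) = norm v" for v :: "real^'d"
    by (simp add: norm_vec_def)
  have Eeq: "E j z = \<theta> j (fst z) *\<^sub>R (\<chi> i. complex_of_real (D (cl (fst z)) (snd z) $ i))" for j z
    unfolding E_def vec_eq_iff vector_scaleR_component vec_lambda_beta by (simp add: scaleR_conv_of_real)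
  have feq: "f j z = \<theta> j (fst z) *\<^sub>R complex_of_real (k (cl (fst z)) (snd z))" for j z
    by (auto simp: f_def scaleR_conv_of_real)
  define I where "I \<tau> = (if \<tau> \<in> {s1..t1} then 1 else 0 :: real)" for \<tau>
  have lim: "space_time_form_ineq \<delta> g B t (\<lambda>z. I (fst z) *\<^sub>R complex_of_real (k (cl (fst z)) (snd z)))
     (\<lambda>z. I (fst z) *\<^sub>R (\<chi> i. complex_of_real (D (cl (fst z)) (snd z) $ i)))"
  proof (rule space_time_form_ineq_limit[where f=f and D=E and C="\<bar>C1\<bar> + \<bar>C2\<bar>" and M=M and c=a and d=b])
    show "norm (f j z) \<le> \<bar>C1\<bar> + \<bar>C2\<bar>" for j z
      using mult_mono[OF \<theta>01(2)[of j "fst z"] C1[OF cl[of "fst z"], of "snd z"]] \<theta>01(1)[of j "fst z"]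
      by (simp add: feq)
    show "norm (E j z) \<le> \<bar>C1\<bar> + \<bar>C2\<bar>" for j z
      using mult_mono[OF \<theta>01(2)[of j "fst z"] C2[OF cl[of "fst z"], of "snd z"]] \<theta>01(1)[of j "fst z"]
      by (simp add: Eeq nE)
    show "(\<lambda>j. f j z) \<longlonglongrightarrow> I (fst z) *\<^sub>R complex_of_real (k (cl (fst z)) (snd z))" for z
      unfolding feq I_def by (intro tendsto_intros \<theta>lim)
    show "(\<lambda>j. E j z) \<longlonglongrightarrow> I (fst z) *\<^sub>R (\<chi> i. complex_of_real (D (cl (fst z)) (snd z) $ i))" for z
      unfolding Eeq I_def by (intro tendsto_intros \<theta>lim)
    show "f j z = 0" if "snd z \<notin> cbox a b" for j z using supp[OF cl that] by (simp add: feq)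
    show "E j z = 0" if "snd z \<notin> cbox a b" for j z using Dsupp[OF cl that] by (simp add: E_def vec_eq_iff)
  qed (use ineq mB gm bM g gfin in \<open>auto intro: borel_measurable_continuous_onI cf cE\<close>)
  let ?S = "{s1..t1} \<times> (UNIV :: (real^'d) set)"
  have sub: "{s1..t1} \<subseteq> {0..t}" using st by auto
  have e1: "(\<integral>\<^sup>+z\<in>{0..t} \<times> UNIV. ennreal ((norm (B z) * norm (I (fst z) *\<^sub>R complex_of_real (k (cl (fst z)) (snd z))))\<^sup>2) \<partial>lborel)
     = (\<integral>\<^sup>+z\<in>?S. ennreal ((norm (B z))\<^sup>2 * (k (fst z) (snd z))\<^sup>2) \<partial>lborel)"
    using sub by (intro nn_integral_cong) (auto simp: indicator_def I_def cl_id power_mult_distrib)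
  have e2: "(\<integral>\<^sup>+z\<in>{0..t} \<times> UNIV. ennreal ((norm (I (fst z) *\<^sub>R (\<chi> i. complex_of_real (D (cl (fst z)) (snd z) $ i))))\<^sup>2) \<partial>lborel)
     = (\<integral>\<^sup>+z\<in>?S. ennreal ((norm (D (fst z) (snd z)))\<^sup>2) \<partial>lborel)"
    using sub by (intro nn_integral_cong) (auto simp: indicator_def I_def cl_id nE)
  have e3: "(\<integral>\<^sup>+z\<in>{0..t} \<times> UNIV. ennreal (g (fst z) * (norm (I (fst z) *\<^sub>R complex_of_real (k (cl (fst z)) (snd z))))\<^sup>2) \<partial>lborel)
     = (\<integral>\<^sup>+z\<in>?S. ennreal (g (fst z) * (k (cl (fst z)) (snd z))\<^sup>2) \<partial>lborel)"
    using sub by (intro nn_integral_cong) (auto simp: indicator_def I_def cl_id)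
  have ck': "continuous_on ?S (\<lambda>z. k (fst z) (snd z))" using ck by (simp add: split_beta)
  have cD': "continuous_on ?S (\<lambda>z. D (fst z) (snd z))" using cD by (simp add: split_beta)
  have i1: "(\<integral>\<^sup>+z\<in>?S. ennreal ((norm (B z))\<^sup>2 * (k (fst z) (snd z))\<^sup>2) \<partial>lborel)
     = ennreal (integral {s1..t1} (\<lambda>\<tau>. integral UNIV (\<lambda>x. (norm (B (\<tau>, x)))\<^sup>2 * (k \<tau> x)\<^sup>2)))"
    by (subst nn_integral_space_time_continuous[where a=a and b=b])
      (auto intro!: continuous_intros ck' continuous_on_subset[OF cB] simp: supp)
  have i2: "(\<integral>\<^sup>+z\<in>?S. ennreal ((norm (D (fst z) (snd z)))\<^sup>2) \<partial>lborel)
     = ennreal (integral {s1..t1} (\<lambda>\<tau>. integral UNIV (\<lambda>x. (norm (D \<tau> x))\<^sup>2)))"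
    by (subst nn_integral_space_time_continuous[where a=a and b=b])
      (auto intro!: continuous_intros cD' simp: Dsupp)
  define \<Phi> where "\<Phi> \<tau> = integral UNIV (\<lambda>x. (k \<tau> x)\<^sup>2)" for \<tau>
  have c\<Phi>: "continuous_on {s1..t1} \<Phi>"
    using continuous_on_integral_supp[of "{s1..t1}" "\<lambda>z. (k (fst z) (snd z))\<^sup>2" a b]
      continuous_on_power[OF ck'] supp by (simp add: \<Phi>_def[abs_def])
  have \<Phi>0: "0 \<le> \<Phi> \<tau>" if "\<tau> \<in> {s1..t1}" for \<tau>
    unfolding \<Phi>_def
    by (intro integral_nonneg_total) auto
  have gfin': "(\<integral>\<^sup>+\<tau>\<in>{s1..t1}. ennreal (g \<tau>) \<partial>lborel) < \<infinity>"
    by (rule le_less_trans[OF nn_integral_mono gfin]) (use sub in \<open>auto simp: indicator_def\<close>)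
  have "(\<lambda>z. g (fst z) * (k (cl (fst z)) (snd z))\<^sup>2) \<in> borel_measurable borel"
    by (intro borel_measurable_times borel_measurable_fst_borel[OF gm] borel_measurable_power
      borel_measurable_continuous_onI[OF ckc])
  then have i3: "(\<integral>\<^sup>+z\<in>?S. ennreal (g (fst z) * (k (cl (fst z)) (snd z))\<^sup>2) \<partial>lborel)
     = (\<integral>\<^sup>+\<tau>\<in>{s1..t1}. (\<integral>\<^sup>+x. ennreal (g \<tau> * (k (cl \<tau>) x)\<^sup>2) \<partial>lborel) \<partial>lborel)"
    by (subst nn_integral_space_time) auto
  also have "\<dots> = (\<integral>\<^sup>+\<tau>\<in>{s1..t1}. ennreal (g \<tau> * \<Phi> \<tau>) \<partial>lborel)"
  proof (rule nn_integral_cong)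
    fix \<tau>
    show "(\<integral>\<^sup>+x. ennreal (g \<tau> * (k (cl \<tau>) x)\<^sup>2) \<partial>lborel) * indicator {s1..t1} \<tau> = ennreal (g \<tau> * \<Phi> \<tau>) * indicator {s1..t1} \<tau>"
    proof (cases "\<tau> \<in> {s1..t1}")
      case True
      have "continuous_on UNIV (\<lambda>x. k \<tau> x)"
        using continuous_on_slice[OF ck True] .
      then have "(\<integral>\<^sup>+x. ennreal (g \<tau> * (k \<tau> x)\<^sup>2) \<partial>lborel) = ennreal (integral UNIV (\<lambda>x. g \<tau> * (k \<tau> x)\<^sup>2))"
        by (intro nn_integral_continuous_supp[where a=a and b=b]) (auto intro!: continuous_intros simp: g supp[OF True])
      then show ?thesis by (simp add: cl_id[OF True] \<Phi>_def)
    qed simp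
  qed
  also have "\<dots> = ennreal (integral {s1..t1} (\<lambda>\<tau>. g \<tau> * \<Phi> \<tau>))"
    by (rule integrable_weighted_continuous(2)[OF gm g gfin' c\<Phi> \<Phi>0])
  finally have i3: "(\<integral>\<^sup>+z\<in>?S. ennreal (g (fst z) * (k (cl (fst z)) (snd z))\<^sup>2) \<partial>lborel) = ennreal (integral {s1..t1} (\<lambda>\<tau>. g \<tau> * \<Phi> \<tau>))" .
  have n2: "0 \<le> integral {s1..t1} (\<lambda>\<tau>. integral UNIV (\<lambda>x. (norm (D \<tau> x))\<^sup>2))"
    by (intro integral_nonneg_total) auto
  have n3: "0 \<le> integral {s1..t1} (\<lambda>\<tau>. g \<tau> * \<Phi> \<tau>)"
    by (rule integral_nonneg[OF integrable_weighted_continuous(1)[OF gm g gfin' c\<Phi> \<Phi>0]]) (use g \<Phi>0 in auto)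
  show ?thesis
    using lim n2 n3 \<delta> unfolding space_time_form_ineq_def e1 e2 e3 i1 i2 i3
    by (simp add: ennreal_mult[symmetric] ennreal_plus[symmetric] \<Phi>_def del: ennreal_plus)
qed

subsection \<open>Gradient bounds by doubling of variables\<close>

text \<open>The second derivative exists at the maximum alone. If it were positive, the first
  derivative would be positive just to the right, contradicting maximality.\<close>

lemma second_derivative_at_local_max:
  fixes \<phi> :: "real \<Rightarrow> real"
  assumes d: "0 < d" and d1: "\<And>r. \<bar>r\<bar> < d \<Longrightarrow> (\<phi> has_real_derivative \<phi>1 r) (at r)"
    and d2: "(\<phi>1 has_real_derivative l) (at 0)" and mx: "\<And>r. \<bar>r\<bar> < d \<Longrightarrow> \<phi> r \<le> \<phi> 0"
  shows "l \<le> 0"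
proof (rule ccontr)
  assume "\<not> l \<le> 0"
  then obtain d' where d': "0 < d'" "\<And>h. 0 < h \<Longrightarrow> h < d' \<Longrightarrow> \<phi>1 0 < \<phi>1 (0 + h)"
    using DERIV_pos_inc_right[OF d2] by auto
  have "\<phi>1 0 = 0"
    by (rule DERIV_local_max[OF d1[of 0] d]) (use d mx in auto)
  define h where "h = min d d' / 2"
  have h: "0 < h" "h < d" "h < d'" using d d'(1) by (auto simp: h_def)
  have "\<phi> 0 < \<phi> h"
  proof (rule DERIV_pos_imp_increasing_open[OF h(1)])
    fix r assume r: "0 < r" "r < h"
    show "\<exists>y. (\<phi> has_real_derivative y) (at r) \<and> 0 < y"
      using d1[of r] d'(2)[of r] r h \<open>\<phi>1 0 = 0\<close> by auto
  next
    have "\<And>r. r \<in> {0..h} \<Longrightarrow> (\<phi> has_real_derivative \<phi>1 r) (at r)" using d1 h by auto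
    then show "continuous_on {0..h} \<phi>"
      by (meson DERIV_isCont continuous_at_imp_continuous_on)
  qed
  then show False using mx[of h] h by auto
qed

text \<open>A real scalar model for one component of \<open>u - k\<close> with \<open>k\<close>
  smooth. The source \<open>F\<close> is what subtracting \<open>k\<close> produces, and is zero for
  \<open>u\<close> itself; \<open>T\<close> is a finite horizon.\<close>

locale drift_diffusion =
  fixes v :: "real \<Rightarrow> 'a::euclidean_space \<Rightarrow> real" and vt :: "real \<Rightarrow> 'a \<Rightarrow> real"
    and G :: "real \<Rightarrow> 'a \<Rightarrow> 'a" and Hs :: "real \<Rightarrow> 'a \<Rightarrow> 'a \<Rightarrow> 'a"
    and b :: "real \<Rightarrow> 'a \<Rightarrow> 'a" and F :: "real \<Rightarrow> 'a \<Rightarrow> real" and s T M CF H :: real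
  assumes vt: "\<And>\<tau> x. s < \<tau> \<Longrightarrow> \<tau> \<le> T \<Longrightarrow> ((\<lambda>r. v r x) has_real_derivative vt \<tau> x) (at \<tau>)"
    and vG: "\<And>\<tau> x. s < \<tau> \<Longrightarrow> \<tau> \<le> T \<Longrightarrow> (v \<tau> has_derivative (\<lambda>h. G \<tau> x \<bullet> h)) (at x)"
    and GH: "\<And>\<tau> x. s < \<tau> \<Longrightarrow> \<tau> \<le> T \<Longrightarrow> (G \<tau> has_derivative Hs \<tau> x) (at x)"
    and pde: "\<And>\<tau> x. s < \<tau> \<Longrightarrow> \<tau> \<le> T \<Longrightarrow>
       vt \<tau> x = (\<Sum>e\<in>Basis. Hs \<tau> x e \<bullet> e) - b \<tau> x \<bullet> G \<tau> x + F \<tau> x"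
    and bM: "\<And>\<tau> x. norm (b \<tau> x) \<le> M" and FC: "\<And>\<tau> x. s < \<tau> \<Longrightarrow> \<tau> \<le> T \<Longrightarrow> \<bar>F \<tau> x\<bar> \<le> CF"
    and cv: "continuous_on ({s..T} \<times> UNIV) (\<lambda>(\<tau>, x). v \<tau> x)"
    and vH: "\<And>\<tau> x. s \<le> \<tau> \<Longrightarrow> \<tau> \<le> T \<Longrightarrow> \<bar>v \<tau> x\<bar> \<le> H"
begin

text \<open>The map e - 2 (e . n) n is a reflection, hence orthogonal, and the trace is invariant
  under orthogonal changes of basis. It allows the Hessian at the second point to be tested along
  reflected directions.\<close>

lemma trace_reflection:
  fixes n :: 'a and L :: "'a \<Rightarrow> 'a"
  assumes n: "norm n = 1" and L: "linear L"
  shows "(\<Sum>e\<in>Basis. L (e - (2 * (e \<bullet> n)) *\<^sub>R n) \<bullet> (e - (2 * (e \<bullet> n)) *\<^sub>R n)) = (\<Sum>e\<in>Basis. L e \<bullet> e)"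
proof -
  have nn: "(\<Sum>e\<in>Basis. (e \<bullet> n) *\<^sub>R e) = n"
    using euclidean_representation[of n] by (simp add: inner_commute)
  have 1: "(\<Sum>e\<in>Basis. (e \<bullet> n) * (L e \<bullet> n)) = L n \<bullet> n"
  proof -
    have "L n = (\<Sum>e\<in>Basis. (e \<bullet> n) *\<^sub>R L e)"
      by (subst nn[symmetric]) (simp add: linear_sum[OF L] linear_scale[OF L])
    then show ?thesis by (simp add: inner_sum_left)
  qed
  have 2: "(\<Sum>e\<in>Basis. (e \<bullet> n) * (L n \<bullet> e)) = L n \<bullet> n"
    by (subst (4) nn[symmetric]) (simp add: inner_sum_right)
  have 3: "(\<Sum>e\<in>Basis. (e \<bullet> n) * (e \<bullet> n)) = 1"
    using n by (metis (no_types, lifting) euclidean_inner inner_commute norm_eq_1 sum.cong)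
  have "L (e - (2 * (e \<bullet> n)) *\<^sub>R n) \<bullet> (e - (2 * (e \<bullet> n)) *\<^sub>R n) =
     L e \<bullet> e - 2 * ((e \<bullet> n) * (L e \<bullet> n)) - 2 * ((e \<bullet> n) * (L n \<bullet> e)) + 4 * ((e \<bullet> n) * (e \<bullet> n)) * (L n \<bullet> n)" for e
    by (simp add: linear_diff[OF L] linear_scale[OF L] inner_diff_left inner_diff_right algebra_simps)
  then have "(\<Sum>e\<in>Basis. L (e - (2 * (e \<bullet> n)) *\<^sub>R n) \<bullet> (e - (2 * (e \<bullet> n)) *\<^sub>R n)) =
     (\<Sum>e\<in>Basis. L e \<bullet> e) - 2 * (\<Sum>e\<in>Basis. (e \<bullet> n) * (L e \<bullet> n)) - 2 * (\<Sum>e\<in>Basis. (e \<bullet> n) * (L n \<bullet> e)) + 4 * (\<Sum>e\<in>Basis. (e \<bullet> n) * (e \<bullet> n)) * (L n \<bullet> n)"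
    by (simp add: sum.distrib sum_subtractf sum_distrib_left sum_distrib_right mult_ac)
  then show ?thesis unfolding 1 2 3 by simp
qed

text \<open>Doubling of variables with the reflection coupling: at a maximum of
  \<open>v(t,x) - v(t,y) - \<psi>(t,|x-y|)\<close> the second variation is tested in the directions \<open>(e, R e)\<close>,
  where \<open>R\<close> is the reflection in the hyperplane orthogonal to \<open>x - y\<close>.\<close>

lemma modulus_of_continuity:
  fixes \<alpha> \<beta> \<gamma> \<Lambda> r0 :: real
  defines "\<psi> \<equiv> \<lambda>t r. \<alpha> * r - \<beta> * r\<^sup>2 + \<gamma> * r ^ 3 + \<Lambda> * (t - s) * r"
  assumes nonneg: "\<And>t r. s \<le> t \<Longrightarrow> t \<le> T \<Longrightarrow> 0 \<le> r \<Longrightarrow> r \<le> r0 \<Longrightarrow> 0 \<le> \<psi> t r"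
    and init: "\<And>x y. norm (x - y) \<le> r0 \<Longrightarrow> v s x - v s y \<le> \<psi> s (norm (x - y))"
    and lat: "\<And>t x y. s \<le> t \<Longrightarrow> t \<le> T \<Longrightarrow> norm (x - y) = r0 \<Longrightarrow> v t x - v t y \<le> \<psi> t r0"
    and super: "\<And>t r. s < t \<Longrightarrow> t \<le> T \<Longrightarrow> 0 < r \<Longrightarrow> r < r0 \<Longrightarrow>
       4 * (6 * \<gamma> * r - 2 * \<beta>) + 2 * M * \<bar>\<alpha> - 2 * \<beta> * r + 3 * \<gamma> * r\<^sup>2 + \<Lambda> * (t - s)\<bar> + 2 * CF \<le> \<Lambda> * r"
    and t: "s \<le> t" "t \<le> T" and xy: "norm (x - y) \<le> r0"
  shows "v t x - v t y \<le> \<psi> t (norm (x - y))"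
proof (rule ccontr)
  assume "\<not> ?thesis"
  then have pos: "0 < v t x - v t y - \<psi> t (norm (x - y))" by simp
  have M0: "0 \<le> M" using bM[of 0 0] norm_ge_zero order_trans by blast
  let ?N = "real DIM('a)"
  \<comment> \<open>The exponential rate has to beat what the quadratic penalty contributes, namely
    2N from the Laplacians and \<open>M\<close> from the drift; the extra 1 is the contradiction at
    the end.\<close>
  define C where "C = 2 * ?N + M + 1"
  have C0: "0 < C" using M0 by (simp add: C_def)
  define E where "E t = exp (C * (t - s))" for t
  have E0: "0 < E t" for t by (simp add: E_def)
  \<comment> \<open>The quadratic penalty forces the maximum over the unbounded space to be
    attained. Its constant 2 makes \<open>Q\<close> dominate both the constant and the linear terms
    that its derivatives create.\<close>
  define Q where "Q x y = 2 + norm x ^ 2 + norm y ^ 2" for x y :: 'a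
  have Q0: "2 \<le> Q x y" for x y by (simp add: Q_def)
  \<comment> \<open>Half of the assumed excess, so that the penalized function is still positive at
    the given point.\<close>
  define \<epsilon> where "\<epsilon> = (v t x - v t y - \<psi> t (norm (x - y))) / (2 * E t * Q x y)"
  have \<epsilon>0: "0 < \<epsilon>" unfolding \<epsilon>_def by (intro divide_pos_pos pos mult_pos_pos) (use E0 Q0[of x y] in auto)
  define \<Phi> where "\<Phi> t x y = v t x - v t y - \<psi> t (norm (x - y)) - \<epsilon> * E t * Q x y" for t x y
  have pos2: "0 < \<Phi> t x y"
  proof -
    have "\<epsilon> * E t * Q x y = (v t x - v t y - \<psi> t (norm (x - y))) / 2"
      using E0[of t] Q0[of x y] by (simp add: \<epsilon>_def)
    then show ?thesis using pos by (simp add: \<Phi>_def)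
  qed
  \<comment> \<open>Where the penalized function is positive the penalty is below 2
    \<open>H\<close>, which confines both points to this radius. The maximum over the compact set
    \<open>K\<close> is therefore interior in the spatial variables.\<close>
  define Rb where "Rb = 1 + norm x + norm y + 2 * H / \<epsilon>"
  have E1: "1 \<le> E t" if "s \<le> t" for t using C0 that by (simp add: E_def)
  have inner: "norm x' < Rb \<and> norm y' < Rb"
    if "s \<le> t'" "t' \<le> T" "norm (x' - y') \<le> r0" "0 < \<Phi> t' x' y'" for t' x' y'
  proof -
    have "\<epsilon> * E t' * Q x' y' < 2 * H"
      using that(4) vH[OF that(1,2), of x'] vH[OF that(1,2), of y'] nonneg[OF that(1,2) norm_ge_zero that(3)]
      by (simp add: \<Phi>_def)
    moreover have "\<epsilon> * 1 * Q x' y' \<le> \<epsilon> * E t' * Q x' y'"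
      using E1[OF that(1)] \<epsilon>0 Q0[of x' y'] by (intro mult_right_mono mult_left_mono) auto
    ultimately have "\<epsilon> * Q x' y' < 2 * H" by linarith
    then have q: "Q x' y' < 2 * H / \<epsilon>" using \<epsilon>0 by (simp add: field_simps)
    have "norm x' \<le> 1 + norm x' ^ 2" "norm y' \<le> 1 + norm y' ^ 2"
      using zero_le_power2[of "norm x' - 1/2"] zero_le_power2[of "norm y' - 1/2"]
      by (simp_all add: power2_diff power_one_over)
    moreover have "0 \<le> norm x ^ 2" "0 \<le> norm y'^2" "0 \<le> norm x' ^ 2" by auto
    ultimately show ?thesis using q unfolding Q_def Rb_def
      by (smt (verit) norm_ge_zero)
  qed
  define K where "K = {z :: real \<times> 'a \<times> 'a. fst z \<in> {s..T} \<and> fst (snd z) \<in> cball 0 Rb \<and> snd (snd z) \<in> cball 0 Rb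
    \<and> norm (fst (snd z) - snd (snd z)) \<le> r0}"
  have Kin: "(t', x', y') \<in> K \<longleftrightarrow> t' \<in> {s..T} \<and> norm x' \<le> Rb \<and> norm y' \<le> Rb \<and> norm (x' - y') \<le> r0" for t' x' y'
    by (simp add: K_def)
  have "compact ({s..T} \<times> cball (0::'a) Rb \<times> cball (0::'a) Rb)"
    by (intro compact_Times compact_cball compact_Icc)
  moreover have "closed {z :: real \<times> 'a \<times> 'a. norm (fst (snd z) - snd (snd z)) \<le> r0}"
    by (intro closed_Collect_le continuous_intros)
  moreover have "K = ({s..T} \<times> cball 0 Rb \<times> cball 0 Rb) \<inter> {z. norm (fst (snd z) - snd (snd z)) \<le> r0}"
    by (auto simp: K_def)
  ultimately have cK: "compact K" by (simp only: compact_Int_closed)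
  have tK: "(t, x, y) \<in> K"
    using t xy inner[OF t xy pos2] by (simp add: Kin)
  have c1: "continuous_on K (\<lambda>z. v (fst z) (fst (snd z)))"
  proof -
    have p: "continuous_on K (\<lambda>z. (fst z, fst (snd z)))" by (intro continuous_intros)
    have r: "(\<lambda>z. (fst z, fst (snd z))) ` K \<subseteq> {s..T} \<times> UNIV" by (auto simp: K_def)
    show ?thesis using continuous_on_compose2[OF cv p r] by simp
  qed
  have c2: "continuous_on K (\<lambda>z. v (fst z) (snd (snd z)))"
  proof -
    have p: "continuous_on K (\<lambda>z. (fst z, snd (snd z)))" by (intro continuous_intros)
    have r: "(\<lambda>z. (fst z, snd (snd z))) ` K \<subseteq> {s..T} \<times> UNIV" by (auto simp: K_def)
    show ?thesis using continuous_on_compose2[OF cv p r] by simp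
  qed
  have "continuous_on K (\<lambda>z. \<Phi> (fst z) (fst (snd z)) (snd (snd z)))"
    unfolding \<Phi>_def \<psi>_def E_def Q_def by (intro continuous_intros c1 c2)
  from continuous_attains_sup[OF cK _ this] tK obtain z0 where z0: "z0 \<in> K"
    "\<And>z. z \<in> K \<Longrightarrow> \<Phi> (fst z) (fst (snd z)) (snd (snd z)) \<le> \<Phi> (fst z0) (fst (snd z0)) (snd (snd z0))" by blast
  obtain t0 x0 y0 where z0eq: "z0 = (t0, x0, y0)" by (metis prod.collapse)
  have mx: "\<Phi> t' x' y' \<le> \<Phi> t0 x0 y0" if "(t', x', y') \<in> K" for t' x' y'
    using z0(2)[OF that] by (simp add: z0eq)
  have P0: "0 < \<Phi> t0 x0 y0" using mx[OF tK] pos2 by linarith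
  have K0: "s \<le> t0" "t0 \<le> T" "norm (x0 - y0) \<le> r0" using z0(1) by (auto simp: z0eq Kin)
  have in0: "norm x0 < Rb" "norm y0 < Rb" using inner[OF K0 P0] by auto
  have pen: "0 < \<epsilon> * E t0 * Q x0 y0" using \<epsilon>0 E0[of t0] Q0[of x0 y0] by (auto intro!: mult_pos_pos)
  \<comment> \<open>The maximum can lie neither at the initial time nor on the diagonal nor at
    distance \<open>r0\<close>: there the difference is at most \<psi>, and the penalty makes the
    value negative.\<close>
  have t0s: "s < t0"
  proof (rule ccontr)
    assume "\<not> s < t0"
    then have "t0 = s" using K0 by simp
    then show False using init[OF K0(3)] P0 pen by (simp add: \<Phi>_def)
  qed
  define \<rho> where "\<rho> = norm (x0 - y0)"
  have \<rho>0: "0 < \<rho>"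
  proof (rule ccontr)
    assume "\<not> 0 < \<rho>"
    then have "x0 = y0" by (simp add: \<rho>_def)
    then show False using P0 pen by (simp add: \<Phi>_def \<psi>_def)
  qed
  have \<rho>r: "\<rho> < r0"
  proof (rule ccontr)
    assume "\<not> \<rho> < r0"
    then have "norm (x0 - y0) = r0" using K0 by (simp add: \<rho>_def)
    then show False using lat[OF K0(1,2), of x0 y0] P0 pen by (simp add: \<Phi>_def)
  qed
  define n where "n = sgn (x0 - y0)"
  have n1: "norm n = 1" using \<rho>0 by (simp add: n_def norm_sgn \<rho>_def)
  have xyn: "x0 - y0 = \<rho> *\<^sub>R n" using \<rho>0 by (simp add: n_def \<rho>_def sgn_div_norm)
  define \<psi>1 where "\<psi>1 r = \<alpha> - 2 * \<beta> * r + 3 * \<gamma> * r\<^sup>2 + \<Lambda> * (t0 - s)" for r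
  have d\<psi>: "(\<psi> t0 has_real_derivative \<psi>1 r) (at r within S)" for r S
    unfolding \<psi>_def \<psi>1_def by (auto intro!: derivative_eq_intros simp: algebra_simps power2_eq_square)
  define d where "d = min (min (Rb - norm x0) (Rb - norm y0)) ((r0 - \<rho>) / 2)"
  have d0: "0 < d" using in0 \<rho>r by (simp add: d_def)
  have mxl: "\<Phi> t0 x' y' \<le> \<Phi> t0 x0 y0" if "norm (x' - x0) < d" "norm (y' - y0) < d" for x' y'
  proof (rule mx)
    have "norm x' \<le> norm x0 + norm (x' - x0)" "norm y' \<le> norm y0 + norm (y' - y0)"
      using norm_triangle_ineq[of x0 "x' - x0"] norm_triangle_ineq[of y0 "y' - y0"] by simp_all
    moreover have "norm (x' - y') \<le> norm (x' - x0) + \<rho> + norm (y' - y0)"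
    proof -
      have "norm (x' - y') = norm (((x' - x0) + (x0 - y0)) - (y' - y0))" by simp
      also have "\<dots> \<le> norm ((x' - x0) + (x0 - y0)) + norm (y' - y0)" by (rule norm_triangle_ineq4)
      also have "\<dots> \<le> (norm (x' - x0) + norm (x0 - y0)) + norm (y' - y0)"
        by (intro add_right_mono norm_triangle_ineq)
      finally show ?thesis by (simp add: \<rho>_def)
    qed
    ultimately show "(t0, x', y') \<in> K" using that K0 unfolding Kin d_def by auto
  qed
  \<comment> \<open>The maximum may sit at the final time, so only earlier times are compared and an
    inequality results.\<close>
  have dt: "0 \<le> vt t0 x0 - vt t0 y0 - \<Lambda> * \<rho> - C * (\<epsilon> * E t0 * Q x0 y0)"
  proof (rule ccontr)
    assume neg: "\<not> ?thesis"
    have "((\<lambda>t. \<Phi> t x0 y0) has_real_derivative (vt t0 x0 - vt t0 y0 - \<Lambda> * \<rho> - C * (\<epsilon> * E t0 * Q x0 y0))) (at t0)"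
      unfolding \<Phi>_def \<psi>_def E_def
      by (auto intro!: derivative_eq_intros vt[OF t0s K0(2)] simp: \<rho>_def)
    from DERIV_neg_dec_left[OF this] neg obtain d' where d': "0 < d'" "\<And>h. 0 < h \<Longrightarrow> h < d' \<Longrightarrow> \<Phi> t0 x0 y0 < \<Phi> (t0 - h) x0 y0"
      by auto
    define h where "h = min (d' / 2) (t0 - s)"
    have "0 < h" "h < d'" using d' t0s by (auto simp: h_def)
    moreover have "(t0 - h, x0, y0) \<in> K"
      using z0(1) t0s \<open>0 < h\<close> by (auto simp: z0eq Kin h_def)
    ultimately show False using mx[of "t0 - h" x0 y0] d'(2)[of h] by fastforce
  qed
  let ?P = "\<epsilon> * E t0"
  have Gx: "G t0 x0 = \<psi>1 \<rho> *\<^sub>R n + (2 * ?P) *\<^sub>R x0"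
  proof -
    have "((\<lambda>x. \<Phi> t0 x y0) has_derivative (\<lambda>h. G t0 x0 \<bullet> h - \<psi>1 \<rho> * (h \<bullet> n) - ?P * (2 * (x0 \<bullet> h)))) (at x0)"
    proof -
      have nd: "((\<lambda>x. norm (x - y0)) has_derivative (\<lambda>h. h \<bullet> n)) (at x0)"
        by (rule has_derivative_compose[OF _ has_derivative_norm, THEN has_derivative_eq_rhs])
          (use \<rho>0 in \<open>auto intro!: derivative_eq_intros simp: n_def \<rho>_def\<close>)
      have "((\<lambda>x. \<psi> t0 (norm (x - y0))) has_derivative (\<lambda>h. \<psi>1 \<rho> * (h \<bullet> n))) (at x0)"
        using has_derivative_compose[OF nd, of "\<psi> t0" "(*) (\<psi>1 \<rho>)"] d\<psi>[of \<rho> UNIV]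
        by (simp add: has_field_derivative_def \<rho>_def)
      then show ?thesis
        unfolding \<Phi>_def Q_def
        by (auto intro!: derivative_eq_intros vG[OF t0s K0(2)] simp: power2_norm_eq_inner inner_commute)
    qed
    from differential_zero_maxmin[of x0 "ball x0 d", OF _ open_ball this] d0 mxl
    have "(\<lambda>h. G t0 x0 \<bullet> h - \<psi>1 \<rho> * (h \<bullet> n) - ?P * (2 * (x0 \<bullet> h))) = (\<lambda>h. 0)"
      by (auto simp: dist_norm norm_minus_commute)
    then have "(G t0 x0 - (\<psi>1 \<rho> *\<^sub>R n + (2 * ?P) *\<^sub>R x0)) \<bullet> h = 0" for h
      by (drule_tac x=h in fun_cong) (simp add: inner_diff_left inner_add_left inner_commute algebra_simps)
    then show ?thesis by (metis inner_eq_zero_iff right_minus_eq)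
  qed
  have Gy: "G t0 y0 = \<psi>1 \<rho> *\<^sub>R n - (2 * ?P) *\<^sub>R y0"
  proof -
    have "((\<lambda>y. \<Phi> t0 x0 y) has_derivative (\<lambda>h. - (G t0 y0 \<bullet> h) + \<psi>1 \<rho> * (h \<bullet> n) - ?P * (2 * (y0 \<bullet> h)))) (at y0)"
    proof -
      have nd: "((\<lambda>y. norm (x0 - y)) has_derivative (\<lambda>h. - (h \<bullet> n))) (at y0)"
        by (rule has_derivative_compose[OF _ has_derivative_norm, THEN has_derivative_eq_rhs])
          (use \<rho>0 in \<open>auto intro!: derivative_eq_intros simp: n_def \<rho>_def\<close>)
      have "((\<lambda>y. \<psi> t0 (norm (x0 - y))) has_derivative (\<lambda>h. \<psi>1 \<rho> * (- (h \<bullet> n)))) (at y0)"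
        using has_derivative_compose[OF nd, of "\<psi> t0" "(*) (\<psi>1 \<rho>)"] d\<psi>[of \<rho> UNIV]
        by (simp add: has_field_derivative_def \<rho>_def)
      then show ?thesis
        unfolding \<Phi>_def Q_def
        by (auto intro!: derivative_eq_intros vG[OF t0s K0(2)] simp: power2_norm_eq_inner inner_commute)
    qed
    from differential_zero_maxmin[of y0 "ball y0 d", OF _ open_ball this] d0 mxl
    have "(\<lambda>h. - (G t0 y0 \<bullet> h) + \<psi>1 \<rho> * (h \<bullet> n) - ?P * (2 * (y0 \<bullet> h))) = (\<lambda>h. 0)"
      by (auto simp: dist_norm norm_minus_commute)
    then have "(G t0 y0 - (\<psi>1 \<rho> *\<^sub>R n - (2 * ?P) *\<^sub>R y0)) \<bullet> h = 0" for h
      by (drule_tac x=h in fun_cong) (simp add: inner_diff_left inner_add_left inner_commute algebra_simps)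
    then show ?thesis by (metis inner_eq_zero_iff right_minus_eq)
  qed
  let ?R = "\<lambda>e. e - (2 * (e \<bullet> n)) *\<^sub>R n"
  have R1: "norm (?R e) = 1" if "e \<in> Basis" for e
  proof -
    have "?R e \<bullet> ?R e = e \<bullet> e - 4 * (e \<bullet> n)^2 + 4 * (e \<bullet> n)^2 * (n \<bullet> n)"
      by (simp add: inner_diff_left inner_diff_right inner_commute algebra_simps power2_eq_square)
    then show ?thesis using that n1 by (simp add: norm_eq_1)
  qed
  \<comment> \<open>Moving the points along \<open>e\<close> and its reflection changes their
    difference only along \<open>n\<close>, by 2 (e . n) r. The distance is thus an affine function
    of \<open>r\<close>, and \<psi> contributes its second derivative times (2 (e . n))^2 with no
    curvature term.\<close>
  have d2: "Hs t0 x0 e \<bullet> e - Hs t0 y0 (?R e) \<bullet> ?R e - 4 * (e \<bullet> n)\<^sup>2 * (6 * \<gamma> * \<rho> - 2 * \<beta>) - 4 * ?P \<le> 0"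
    if e: "e \<in> Basis" for e
  proof -
    \<comment> \<open>The bound \<rho>/2 keeps the affine distance nonnegative, so that it equals
      the norm.\<close>
    define d' where "d' = min d (\<rho> / 2)"
    have d'0: "0 < d'" using d0 \<rho>0 by (simp add: d'_def)
    have en: "\<bar>e \<bullet> n\<bar> \<le> 1" using Cauchy_Schwarz_ineq2[of e n] n1 e by simp
    define \<phi> where "\<phi> r = v t0 (x0 + r *\<^sub>R e) - v t0 (y0 + r *\<^sub>R ?R e) - \<psi> t0 (\<rho> + 2 * (e \<bullet> n) * r)
      - ?P * (2 + (x0 + r *\<^sub>R e) \<bullet> (x0 + r *\<^sub>R e) + (y0 + r *\<^sub>R ?R e) \<bullet> (y0 + r *\<^sub>R ?R e))" for r
    define \<phi>1 where "\<phi>1 r = G t0 (x0 + r *\<^sub>R e) \<bullet> e - G t0 (y0 + r *\<^sub>R ?R e) \<bullet> ?R e - 2 * (e \<bullet> n) * \<psi>1 (\<rho> + 2 * (e \<bullet> n) * r)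
      - ?P * (2 * ((x0 + r *\<^sub>R e) \<bullet> e) + 2 * ((y0 + r *\<^sub>R ?R e) \<bullet> ?R e))" for r
    have line: "((\<lambda>r. p + r *\<^sub>R c) has_derivative (\<lambda>h. h *\<^sub>R c)) (at r)" for p c :: 'a and r
      by (auto intro!: derivative_eq_intros)
    have dv: "((\<lambda>r. v t0 (p + r *\<^sub>R c)) has_real_derivative G t0 (p + r *\<^sub>R c) \<bullet> c) (at r)" for p c r
      unfolding has_field_derivative_def
      by (rule has_derivative_eq_rhs[OF has_derivative_compose[OF line[of p c r] vG[OF t0s K0(2), of "p + r *\<^sub>R c"]]])
        (simp add: fun_eq_iff)
    have dG: "((\<lambda>r. G t0 (p + r *\<^sub>R c) \<bullet> c) has_real_derivative Hs t0 p c \<bullet> c) (at 0)" for p c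
    proof -
      have lin: "linear (Hs t0 p)" using GH[OF t0s K0(2)] has_derivative_linear by blast
      have "((\<lambda>r. G t0 (p + r *\<^sub>R c)) has_derivative (\<lambda>h. Hs t0 p (h *\<^sub>R c))) (at 0)"
        using has_derivative_compose[OF line[of p c 0] GH[OF t0s K0(2), of "p + 0 *\<^sub>R c"]] by simp
      from has_derivative_inner_left[OF this, of c]
      show ?thesis
        unfolding has_field_derivative_def
        by (rule has_derivative_eq_rhs) (simp add: fun_eq_iff linear_scale[OF lin])
    qed
    have dq: "((\<lambda>r. (p + r *\<^sub>R c) \<bullet> (p + r *\<^sub>R c)) has_real_derivative 2 * ((p + r *\<^sub>R c) \<bullet> c)) (at r)" for p c :: 'a and r
      unfolding has_field_derivative_def
      by (auto intro!: derivative_eq_intros simp: fun_eq_iff inner_add_left inner_add_right inner_commute[of c p] algebra_simps)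
    have dq1: "((\<lambda>r. (p + r *\<^sub>R c) \<bullet> c) has_real_derivative c \<bullet> c) (at r)" for p c :: 'a and r
      unfolding has_field_derivative_def
      by (auto intro!: derivative_eq_intros simp: fun_eq_iff)
    have l2: "((\<lambda>r. \<rho> + 2 * (e \<bullet> n) * r) has_real_derivative 2 * (e \<bullet> n)) (at r)" for r
      by (auto intro!: derivative_eq_intros)
    have "Hs t0 x0 e \<bullet> e - Hs t0 y0 (?R e) \<bullet> ?R e - 2 * (e \<bullet> n) * ((6 * \<gamma> * \<rho> - 2 * \<beta>) * (2 * (e \<bullet> n)))
      - ?P * (2 * (e \<bullet> e) + 2 * (?R e \<bullet> ?R e)) \<le> 0"
    proof (rule second_derivative_at_local_max[OF d'0, of \<phi> \<phi>1])
      fix r :: real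
      have "((\<lambda>r. \<psi> t0 (\<rho> + 2 * (e \<bullet> n) * r)) has_real_derivative \<psi>1 (\<rho> + 2 * (e \<bullet> n) * r) * (2 * (e \<bullet> n))) (at r)"
        by (rule DERIV_chain2[OF d\<psi> l2])
      then show "(\<phi> has_real_derivative \<phi>1 r) (at r)"
        unfolding \<phi>_def \<phi>1_def
        by (auto intro!: derivative_eq_intros dv dq simp: mult_ac)
    next
      have "(\<psi>1 has_real_derivative (6 * \<gamma> * r - 2 * \<beta>)) (at r)" for r
        unfolding \<psi>1_def by (auto intro!: derivative_eq_intros)
      from DERIV_chain2[OF this l2, of 0]
      have "((\<lambda>r. \<psi>1 (\<rho> + 2 * (e \<bullet> n) * r)) has_real_derivative (6 * \<gamma> * \<rho> - 2 * \<beta>) * (2 * (e \<bullet> n))) (at 0)" by simp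
      then show "(\<phi>1 has_real_derivative (Hs t0 x0 e \<bullet> e - Hs t0 y0 (?R e) \<bullet> ?R e - 2 * (e \<bullet> n) * ((6 * \<gamma> * \<rho> - 2 * \<beta>) * (2 * (e \<bullet> n)))
          - ?P * (2 * (e \<bullet> e) + 2 * (?R e \<bullet> ?R e)))) (at 0)"
        unfolding \<phi>1_def
        by (intro DERIV_diff DERIV_add DERIV_cmult dG dq1)
    next
      fix r assume r: "\<bar>r\<bar> < d'"
      have eq: "\<phi> r = \<Phi> t0 (x0 + r *\<^sub>R e) (y0 + r *\<^sub>R ?R e)" if r: "\<bar>r\<bar> < d'" for r
      proof -
        have "x0 + r *\<^sub>R e - (y0 + r *\<^sub>R ?R e) = (x0 - y0) + (2 * (e \<bullet> n) * r) *\<^sub>R n"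
          by (simp add: algebra_simps)
        also have "\<dots> = (\<rho> + 2 * (e \<bullet> n) * r) *\<^sub>R n" by (simp add: xyn scaleR_add_left)
        finally have "norm (x0 + r *\<^sub>R e - (y0 + r *\<^sub>R ?R e)) = \<bar>\<rho> + 2 * (e \<bullet> n) * r\<bar>" by (simp add: n1)
        moreover have "\<bar>2 * (e \<bullet> n) * r\<bar> \<le> \<rho>"
        proof -
          have "\<bar>e \<bullet> n\<bar> * \<bar>r\<bar> \<le> 1 * (\<rho> / 2)" using en r by (intro mult_mono) (auto simp: d'_def)
          then show ?thesis by (simp add: abs_mult)
        qed
        ultimately have "norm (x0 + r *\<^sub>R e - (y0 + r *\<^sub>R ?R e)) = \<rho> + 2 * (e \<bullet> n) * r" by linarith
        then show ?thesis unfolding \<phi>_def \<Phi>_def Q_def power2_norm_eq_inner by simp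
      qed
      have "\<phi> r \<le> \<Phi> t0 x0 y0"
        unfolding eq[OF r] by (rule mxl) (use r R1[OF e] e in \<open>auto simp: d'_def\<close>)
      then show "\<phi> r \<le> \<phi> 0" using eq[of 0] d'0 by simp
    qed
    then have i1: ?thesis if "?P * (2 * (e \<bullet> e) + 2 * (?R e \<bullet> ?R e)) = 4 * ?P"
      "2 * (e \<bullet> n) * ((6 * \<gamma> * \<rho> - 2 * \<beta>) * (2 * (e \<bullet> n))) = 4 * (e \<bullet> n)\<^sup>2 * (6 * \<gamma> * \<rho> - 2 * \<beta>)"
      unfolding that .
    have RR: "?R e \<bullet> ?R e = 1" "e \<bullet> e = 1" using R1[OF e] e by (auto simp: norm_eq_1)
    show ?thesis by (rule i1) (simp_all only: RR, simp_all add: power2_eq_square)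
  qed
  have sumn: "(\<Sum>e\<in>Basis. (e \<bullet> n)\<^sup>2) = 1"
    using n1 by (metis (no_types, lifting) euclidean_inner inner_commute norm_eq_1 power2_eq_square sum.cong)
  \<comment> \<open>Summing over the basis, the squares (e . n)^2 add up to 1, so four times the
    second derivative of \<psi> is gained, and the two traces are the Laplacians.\<close>
  have "(\<Sum>e\<in>Basis. Hs t0 x0 e \<bullet> e - Hs t0 y0 (?R e) \<bullet> ?R e - 4 * (e \<bullet> n)\<^sup>2 * (6 * \<gamma> * \<rho> - 2 * \<beta>) - 4 * ?P) \<le> 0"
    by (rule sum_nonpos) (rule d2)
  then have lap: "(\<Sum>e\<in>Basis. Hs t0 x0 e \<bullet> e) - (\<Sum>e\<in>Basis. Hs t0 y0 e \<bullet> e) \<le> 4 * (6 * \<gamma> * \<rho> - 2 * \<beta>) + 4 * ?N * ?P"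
    using trace_reflection[OF n1 has_derivative_linear[OF GH[OF t0s K0(2)]], of y0]
    by (simp add: sum_subtractf sum_distrib_left[symmetric] sum_distrib_right[symmetric] sumn mult_ac)
  have bG: "\<bar>b t0 z \<bullet> G t0 z\<bar> \<le> M * norm (G t0 z)" for z
    using Cauchy_Schwarz_ineq2[of "b t0 z" "G t0 z"] mult_right_mono[OF bM[of t0 z] norm_ge_zero[of "G t0 z"]] by linarith
  have P00: "0 < ?P" using \<epsilon>0 E0 by simp
  have nGx: "norm (G t0 x0) \<le> \<bar>\<psi>1 \<rho>\<bar> + 2 * ?P * norm x0"
    unfolding Gx using norm_triangle_ineq[of "\<psi>1 \<rho> *\<^sub>R n" "(2 * ?P) *\<^sub>R x0"] n1 P00 by simp
  have nGy: "norm (G t0 y0) \<le> \<bar>\<psi>1 \<rho>\<bar> + 2 * ?P * norm y0"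
    unfolding Gy using norm_triangle_ineq4[of "\<psi>1 \<rho> *\<^sub>R n" "(2 * ?P) *\<^sub>R y0"] n1 P00 by simp
  have "vt t0 x0 - vt t0 y0 \<le> 4 * (6 * \<gamma> * \<rho> - 2 * \<beta>) + 4 * ?N * ?P + M * (\<bar>\<psi>1 \<rho>\<bar> + 2 * ?P * norm x0)
     + M * (\<bar>\<psi>1 \<rho>\<bar> + 2 * ?P * norm y0) + 2 * CF"
    using lap bG[of x0] bG[of y0] mult_left_mono[OF nGx M0] mult_left_mono[OF nGy M0]
      FC[OF t0s K0(2), of x0] FC[OF t0s K0(2), of y0]
    unfolding pde[OF t0s K0(2)] by linarith
  moreover have "4 * (6 * \<gamma> * \<rho> - 2 * \<beta>) + 2 * M * \<bar>\<psi>1 \<rho>\<bar> + 2 * CF \<le> \<Lambda> * \<rho>"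
    using super[OF t0s K0(2) \<rho>0 \<rho>r] unfolding \<psi>1_def .
  ultimately have "C * (?P * Q x0 y0) \<le> 4 * ?N * ?P + 2 * M * ?P * (norm x0 + norm y0)"
    using dt by (simp add: algebra_simps)
  also have "\<dots> = ?P * (4 * ?N + M * (2 * norm x0 + 2 * norm y0))" by (simp add: algebra_simps)
  also have "\<dots> \<le> ?P * (2 * ?N * Q x0 y0 + M * Q x0 y0)"
  proof -
    have "2 * norm x0 + 2 * norm y0 \<le> Q x0 y0"
      using zero_le_power2[of "norm x0 - 1"] zero_le_power2[of "norm y0 - 1"] by (simp add: Q_def power2_diff)
    then have "M * (2 * norm x0 + 2 * norm y0) \<le> M * Q x0 y0" by (rule mult_left_mono[OF _ M0])
    moreover have "2 * ?N * 2 \<le> 2 * ?N * Q x0 y0" by (rule mult_left_mono[OF Q0]) auto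
    ultimately have "4 * ?N + M * (2 * norm x0 + 2 * norm y0) \<le> 2 * ?N * Q x0 y0 + M * Q x0 y0"
      by linarith
    then show ?thesis using P00 by (intro mult_left_mono) auto
  qed
  finally have "?P * Q x0 y0 * C \<le> ?P * Q x0 y0 * (2 * ?N + M)" by (simp add: algebra_simps)
  then have "C \<le> 2 * ?N + M" using P00 Q0[of x0 y0] by (simp add: mult_le_cancel_left)
  then show False by (simp add: C_def)
qed

end

section \<open>From moduli of continuity to gradient bounds\<close>

context drift_diffusion
begin

text \<open>The quadratic and cubic terms of the modulus disappear in the difference quotient as r
  tends to 0.\<close>

lemma gradient_bound_of_modulus:
  assumes t: "s < t" "t \<le> T" and r0: "0 < r0"
    and modulus: "\<And>x y. norm (x - y) \<le> r0 \<Longrightarrow> v t x - v t y \<le>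
      \<alpha> * norm (x - y) - \<beta> * (norm (x - y))\<^sup>2 + \<gamma> * (norm (x - y)) ^ 3 + \<Lambda> * (t - s) * norm (x - y)"
  shows "norm (G t x) \<le> \<alpha> + \<Lambda> * (t - s)"
proof (cases "G t x = 0")
  \<comment> \<open>With vanishing gradient only the sign of the right side is at stake. The modulus
    in both orders of the two points adds up to zero on the left, which shows that it is
    nonnegative.\<close>
  case True
  obtain e :: 'a where e: "norm e = 1" using vector_choose_size[of 1] by auto
  have "((\<lambda>r. \<alpha> - \<beta> * r + \<gamma> * r\<^sup>2 + \<Lambda> * (t - s)) \<longlongrightarrow> \<alpha> - \<beta> * 0 + \<gamma> * 0\<^sup>2 + \<Lambda> * (t - s)) (at_right 0)"
    by (intro tendsto_intros)
  moreover have "\<forall>\<^sub>F r in at_right 0. 0 \<le> \<alpha> - \<beta> * r + \<gamma> * r\<^sup>2 + \<Lambda> * (t - s)"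
  proof (rule eventually_at_rightI[of 0 r0])
    fix r assume r: "r \<in> {0<..<r0}"
    have "0 \<le> (v t (x + r *\<^sub>R e) - v t x) + (v t x - v t (x + r *\<^sub>R e))" by simp
    also have "\<dots> \<le> 2 * (\<alpha> * r - \<beta> * r\<^sup>2 + \<gamma> * r ^ 3 + \<Lambda> * (t - s) * r)"
      using modulus[of "x + r *\<^sub>R e" x] modulus[of x "x + r *\<^sub>R e"] r e by simp
    also have "\<dots> = (2 * r) * (\<alpha> - \<beta> * r + \<gamma> * r\<^sup>2 + \<Lambda> * (t - s))"
      by (simp add: algebra_simps power2_eq_square power3_eq_cube)
    finally show "0 \<le> \<alpha> - \<beta> * r + \<gamma> * r\<^sup>2 + \<Lambda> * (t - s)"
      using r by (simp add: zero_le_mult_iff)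
  qed (use r0 in auto)
  ultimately have "0 \<le> \<alpha> - \<beta> * 0 + \<gamma> * 0\<^sup>2 + \<Lambda> * (t - s)"
    by (intro tendsto_lowerbound) auto
  then show ?thesis using True by simp
next
  case False
  define e where "e = sgn (G t x)"
  have e: "norm e = 1" "G t x \<bullet> e = norm (G t x)"
    using False by (simp_all add: e_def norm_sgn sgn_div_norm power2_norm_eq_inner[symmetric] power2_eq_square)
  have "((\<lambda>r. x + r *\<^sub>R e) has_derivative (\<lambda>h. h *\<^sub>R e)) (at 0)" by (auto intro!: derivative_eq_intros)
  moreover have "(v t has_derivative (\<lambda>h. G t x \<bullet> h)) (at (x + 0 *\<^sub>R e))" using vG[OF t, of x] by simp
  ultimately have "((\<lambda>r. v t (x + r *\<^sub>R e)) has_derivative (\<lambda>h. G t x \<bullet> (h *\<^sub>R e))) (at 0)"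
    by (rule has_derivative_compose)
  then have "((\<lambda>r. v t (x + r *\<^sub>R e)) has_real_derivative norm (G t x)) (at 0)"
    unfolding has_field_derivative_def by (rule has_derivative_eq_rhs) (simp add: fun_eq_iff e)
  then have "((\<lambda>r. (v t (x + r *\<^sub>R e) - v t x) / r) \<longlongrightarrow> norm (G t x)) (at 0)"
    by (simp add: DERIV_def)
  then have 1: "((\<lambda>r. (v t (x + r *\<^sub>R e) - v t x) / r) \<longlongrightarrow> norm (G t x)) (at_right 0)"
    by (rule tendsto_within_subset) auto
  have 2: "((\<lambda>r. \<alpha> - \<beta> * r + \<gamma> * r\<^sup>2 + \<Lambda> * (t - s)) \<longlongrightarrow> \<alpha> - \<beta> * 0 + \<gamma> * 0\<^sup>2 + \<Lambda> * (t - s)) (at_right 0)"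
    by (intro tendsto_intros)
  have 3: "\<forall>\<^sub>F r in at_right 0. (v t (x + r *\<^sub>R e) - v t x) / r \<le> \<alpha> - \<beta> * r + \<gamma> * r\<^sup>2 + \<Lambda> * (t - s)"
  proof (rule eventually_at_rightI[of 0 r0])
    fix r assume r: "r \<in> {0<..<r0}"
    have "v t (x + r *\<^sub>R e) - v t x \<le> \<alpha> * r - \<beta> * r\<^sup>2 + \<gamma> * r ^ 3 + \<Lambda> * (t - s) * r"
      using modulus[of "x + r *\<^sub>R e" x] r e by simp
    then show "(v t (x + r *\<^sub>R e) - v t x) / r \<le> \<alpha> - \<beta> * r + \<gamma> * r\<^sup>2 + \<Lambda> * (t - s)"
      using r by (subst pos_divide_le_eq) (auto simp: algebra_simps power2_eq_square power3_eq_cube)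
  qed (use r0 in auto)
  show ?thesis using tendsto_le[OF _ 2 1 3] by simp
qed

text \<open>A modulus independent of time, \<alpha> r - \<beta> r^2 on [0, 1/(M+1)]. There it lies
  above \<alpha> r/2, which covers the initial slope \<open>L\<close> and, at the right end, the
  oscillation 2 \<open>H\<close>. Its slope stays within \<alpha>, so the drift costs at most 2 M
  \<alpha>, below 8 \<beta> = 2 (M+1) \<alpha>. The bound does not depend on
  \<open>T\<close>.\<close>

lemma gradient_bound:
  assumes CF: "CF = 0" and lip: "\<And>x y. v s x - v s y \<le> L * norm (x - y)" and L: "0 \<le> L"
    and t: "s < t" "t \<le> T"
  shows "norm (G t x) \<le> 4 * H * (M + 1) + 2 * L"
proof -
  have M0: "0 \<le> M" using bM[of 0 0] norm_ge_zero order_trans by blast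
  have H0: "0 \<le> H" using vH[of t x] t by linarith
  define \<alpha> where "\<alpha> = 4 * H * (M + 1) + 2 * L"
  define \<beta> where "\<beta> = (M + 1) * \<alpha> / 4"
  define r0 where "r0 = 1 / (M + 1)"
  have \<alpha>0: "0 \<le> \<alpha>" unfolding \<alpha>_def using M0 H0 L by (intro add_nonneg_nonneg mult_nonneg_nonneg) auto
  have r00: "0 < r0" using M0 by (simp add: r0_def)
  have \<beta>r: "\<beta> * r \<le> \<alpha> / 4" if "r \<le> r0" for r
  proof -
    have "(M + 1) * r \<le> 1" using that M0 by (simp add: r0_def field_simps)
    then have "\<alpha> * ((M + 1) * r) \<le> \<alpha> * 1" using \<alpha>0 by (intro mult_left_mono) auto
    then show ?thesis by (simp add: \<beta>_def field_simps)
  qed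
  have low: "\<alpha> / 2 * r \<le> \<alpha> * r - \<beta> * r\<^sup>2" if "0 \<le> r" "r \<le> r0" for r
  proof -
    have "(\<beta> * r) * r \<le> (\<alpha> / 4) * r" by (rule mult_right_mono[OF \<beta>r[OF that(2)] that(1)])
    moreover have "0 \<le> \<alpha> / 4 * r" using \<alpha>0 that by auto
    ultimately show ?thesis by (simp add: power2_eq_square)
  qed
  have modul: "v t x - v t y \<le> \<alpha> * norm (x - y) - \<beta> * (norm (x - y))\<^sup>2 + 0 * (norm (x - y)) ^ 3 + 0 * (t - s) * norm (x - y)"
    if "norm (x - y) \<le> r0" for x y
  proof (rule modulus_of_continuity[where ?r0.0=r0])
    fix t r assume "s \<le> t" "t \<le> T" "0 \<le> r" "r \<le> r0"
    then show "0 \<le> \<alpha> * r - \<beta> * r\<^sup>2 + 0 * r ^ 3 + 0 * (t - s) * r"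
      using low[of r] \<alpha>0 by (smt (verit, best) divide_nonneg_nonneg mult_nonneg_nonneg mult_zero_left)
  next
    fix x y :: 'a assume "norm (x - y) \<le> r0"
    then have "\<alpha> / 2 * norm (x - y) \<le> \<alpha> * norm (x - y) - \<beta> * (norm (x - y))\<^sup>2" by (intro low) auto
    moreover have "L * norm (x - y) \<le> \<alpha> / 2 * norm (x - y)"
      using H0 M0 by (intro mult_right_mono) (auto simp: \<alpha>_def)
    ultimately show "v s x - v s y \<le> \<alpha> * norm (x - y) - \<beta> * (norm (x - y))\<^sup>2 + 0 * norm (x - y) ^ 3 + 0 * (s - s) * norm (x - y)"
      using lip[of x y] by simp
  next
    fix t x y assume t: "s \<le> t" "t \<le> T"
    have "2 * H * (M + 1) * r0 \<le> \<alpha> / 2 * r0" using L r00 by (intro mult_right_mono) (auto simp: \<alpha>_def)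
    then have "2 * H \<le> \<alpha> / 2 * r0" using M0 by (simp add: r0_def)
    then show "v t x - v t y \<le> \<alpha> * r0 - \<beta> * r0\<^sup>2 + 0 * r0 ^ 3 + 0 * (t - s) * r0"
      using low[of r0] r00 vH[OF t, of x] vH[OF t, of y] by simp
  next
    fix t r assume "s < t" "t \<le> T" and r: "0 < r" "r < r0"
    have \<beta>0: "0 \<le> \<beta>" using M0 \<alpha>0 by (simp add: \<beta>_def)
    then have "0 \<le> \<beta> * r" using r by simp
    then have "\<bar>\<alpha> - 2 * \<beta> * r\<bar> \<le> \<alpha>" using \<beta>r[of r] r \<alpha>0 by (simp add: abs_le_iff)
    then have "M * \<bar>\<alpha> - 2 * \<beta> * r\<bar> \<le> M * \<alpha>" by (rule mult_left_mono[OF _ M0])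
    then show "4 * (6 * 0 * r - 2 * \<beta>) + 2 * M * \<bar>\<alpha> - 2 * \<beta> * r + 3 * 0 * r\<^sup>2 + 0 * (t - s)\<bar> + 2 * CF \<le> 0 * r"
      using CF \<alpha>0 by (simp add: \<beta>_def algebra_simps)
  qed (use t that in auto)
  have "norm (G t x) \<le> \<alpha> + 0 * (t - s)"
    by (rule gradient_bound_of_modulus[OF t r00 modul])
  then show ?thesis by (simp add: \<alpha>_def)
qed

text \<open>A small initial Lipschitz constant stays small for a short time in spite of the source.
  The value of \<beta> satisfies 8 \<beta> = 4 M \<alpha> + 2 CF and so pays for source and drift;
  \<gamma> completes a square, which keeps the modulus above \<sigma> r for all r; \<Lambda> absorbs
  the terms that remain of order r; and \<open>r0\<close> makes \<sigma> r0 exceed the oscillation 2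
  \<open>H\<close>.\<close>

lemma small_time_gradient_bound:
  assumes \<sigma>: "0 < \<sigma>" and lip: "\<And>x y. v s x - v s y \<le> \<sigma> * norm (x - y)" and CF: "0 \<le> CF" and sT: "s < T"
  shows "\<exists>d>0. \<forall>t x. s < t \<longrightarrow> t < s + d \<longrightarrow> t \<le> T \<longrightarrow> norm (G t x) \<le> 4 * \<sigma>"
proof -
  have M0: "0 \<le> M" using bM[of 0 0] norm_ge_zero order_trans by blast
  have H0: "0 \<le> H" using vH[of s 0] sT by linarith
  define \<alpha> where "\<alpha> = 2 * \<sigma>"
  define \<beta> where "\<beta> = (4 * M * \<alpha> + 2 * CF) / 8"
  define \<gamma> where "\<gamma> = \<beta>\<^sup>2 / (4 * \<sigma>)"
  define r0 where "r0 = 2 * H / \<sigma> + 1"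
  define \<Lambda> where "\<Lambda> = 24 * \<gamma> + 2 * M * (2 * \<beta> + 3 * \<gamma> * r0) + 1"
  have pos: "0 < \<alpha>" "0 \<le> \<beta>" "0 \<le> \<gamma>" "0 < r0" using \<sigma> M0 CF H0 by (auto simp: \<alpha>_def \<beta>_def \<gamma>_def r0_def add_nonneg_pos)
  have \<Lambda>0: "0 < \<Lambda>" unfolding \<Lambda>_def using pos M0 by (intro add_nonneg_pos add_nonneg_nonneg mult_nonneg_nonneg) auto
  have low: "\<sigma> * r \<le> \<alpha> * r - \<beta> * r\<^sup>2 + \<gamma> * r ^ 3" if "0 \<le> r" for r
  proof -
    \<comment> \<open>The identity that determines \<gamma>: the excess over \<sigma> r is r times a
      perfect square divided by \<sigma>.\<close>
    have "\<alpha> * r - \<beta> * r\<^sup>2 + \<gamma> * r ^ 3 - \<sigma> * r = r * ((\<sigma> - \<beta> * r / 2)\<^sup>2 / \<sigma>)"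
      using \<sigma> by (simp add: \<alpha>_def \<gamma>_def field_simps power2_eq_square power3_eq_cube)
    moreover have "0 \<le> r * ((\<sigma> - \<beta> * r / 2)\<^sup>2 / \<sigma>)" using \<sigma> that by simp
    ultimately show ?thesis by linarith
  qed
  have bound: "norm (G t x) \<le> 4 * \<sigma>" if t: "s < t" "t < s + \<alpha> / \<Lambda>" "t \<le> T" for t x
  proof -
    \<comment> \<open>The horizon is replaced by \<open>t\<close> itself, so that \<Lambda> (t' - s)
      \<le> \<alpha> throughout, as the supersolution condition requires.\<close>
    interpret E: drift_diffusion v vt G Hs b F s t M CF H
      by unfold_locales (use vt vG GH pde bM FC vH t in \<open>auto intro: continuous_on_subset[OF cv]\<close>)
    have \<Lambda>t: "\<Lambda> * (t' - s) \<le> \<alpha>" if "t' \<le> t" for t'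
    proof -
      have "t' - s \<le> \<alpha> / \<Lambda>" using that t by linarith
      then show ?thesis using \<Lambda>0 by (simp add: field_simps)
    qed
    have modul: "v t x - v t y \<le> \<alpha> * norm (x - y) - \<beta> * (norm (x - y))\<^sup>2 + \<gamma> * (norm (x - y)) ^ 3 + \<Lambda> * (t - s) * norm (x - y)"
      if "norm (x - y) \<le> r0" for x y
    proof (rule E.modulus_of_continuity[where ?r0.0=r0])
      fix t' r assume "s \<le> t'" "t' \<le> t" "0 \<le> r" "r \<le> r0"
      then show "0 \<le> \<alpha> * r - \<beta> * r\<^sup>2 + \<gamma> * r ^ 3 + \<Lambda> * (t' - s) * r"
        using low[of r] \<sigma> \<Lambda>0 by (smt (verit, best) mult_nonneg_nonneg)
    next
      fix x y :: 'a
      show "v s x - v s y \<le> \<alpha> * norm (x - y) - \<beta> * (norm (x - y))\<^sup>2 + \<gamma> * norm (x - y) ^ 3 + \<Lambda> * (s - s) * norm (x - y)"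
        using lip[of x y] low[of "norm (x - y)"] by simp
    next
      fix t' x y assume t': "s \<le> t'" "t' \<le> t"
      have "2 * H \<le> \<sigma> * r0" using \<sigma> by (simp add: r0_def field_simps)
      moreover have "0 \<le> \<Lambda> * (t' - s) * r0" using \<Lambda>0 t' pos by simp
      ultimately show "v t' x - v t' y \<le> \<alpha> * r0 - \<beta> * r0\<^sup>2 + \<gamma> * r0 ^ 3 + \<Lambda> * (t' - s) * r0"
        using low[of r0] pos E.vH[OF t', of x] E.vH[OF t', of y] by linarith
    next
      fix t' r assume t': "s < t'" "t' \<le> t" and r: "0 < r" "r < r0"
      have "\<bar>\<alpha> - 2 * \<beta> * r + 3 * \<gamma> * r\<^sup>2 + \<Lambda> * (t' - s)\<bar> \<le> 2 * \<alpha> + (2 * \<beta> + 3 * \<gamma> * r0) * r"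
      proof -
        have "\<gamma> * r * r \<le> \<gamma> * r0 * r" using r pos by (intro mult_right_mono mult_left_mono) auto
        moreover have "0 \<le> \<beta> * r" "0 \<le> \<gamma> * r * r" "0 \<le> \<gamma> * r0 * r" "0 \<le> \<Lambda> * (t' - s)" using pos r \<Lambda>0 t' by auto
        moreover have "\<alpha> - 2 * \<beta> * r + 3 * \<gamma> * r\<^sup>2 + \<Lambda> * (t' - s) = \<alpha> - 2 * (\<beta> * r) + 3 * (\<gamma> * r * r) + \<Lambda> * (t' - s)"
          "2 * \<alpha> + (2 * \<beta> + 3 * \<gamma> * r0) * r = 2 * \<alpha> + 2 * (\<beta> * r) + 3 * (\<gamma> * r0 * r)"
          by (simp_all add: power2_eq_square algebra_simps)
        ultimately show ?thesis using \<Lambda>t[OF t'(2)] pos by linarith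
      qed
      from mult_left_mono[OF this M0]
      have "2 * M * \<bar>\<alpha> - 2 * \<beta> * r + 3 * \<gamma> * r\<^sup>2 + \<Lambda> * (t' - s)\<bar> \<le> 2 * (M * (2 * \<alpha> + (2 * \<beta> + 3 * \<gamma> * r0) * r))" by linarith
      moreover have "\<Lambda> * r = 24 * \<gamma> * r + 2 * (M * ((2 * \<beta> + 3 * \<gamma> * r0) * r)) + r"
        unfolding \<Lambda>_def by (simp add: algebra_simps)
      moreover have "8 * \<beta> = 4 * M * \<alpha> + 2 * CF" by (simp add: \<beta>_def)
      ultimately show "4 * (6 * \<gamma> * r - 2 * \<beta>) + 2 * M * \<bar>\<alpha> - 2 * \<beta> * r + 3 * \<gamma> * r\<^sup>2 + \<Lambda> * (t' - s)\<bar> + 2 * CF \<le> \<Lambda> * r"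
        using r by (simp add: algebra_simps)
    qed (use t that in auto)
    have "norm (G t x) \<le> \<alpha> + \<Lambda> * (t - s)"
      by (rule gradient_bound_of_modulus[OF t(1) t(3) pos(4) modul])
    also have "\<dots> \<le> 4 * \<sigma>" using \<Lambda>t[of t] by (simp add: \<alpha>_def)
    finally show ?thesis .
  qed
  then show ?thesis using pos \<Lambda>0 by (intro exI[of _ "\<alpha> / \<Lambda>"]) auto
qed

end

section \<open>Partial derivatives as coordinates of the derivative\<close>

lemma has_vector_derivative_line:
  assumes "(f has_derivative f') (at x)"
  shows "((\<lambda>r. f (x + r *\<^sub>R e)) has_vector_derivative f' e) (at 0)"
proof -
  have "((\<lambda>r. x + r *\<^sub>R e) has_derivative (\<lambda>r. r *\<^sub>R e)) (at 0)"
    by (auto intro!: derivative_eq_intros)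
  moreover have "(f has_derivative f') (at (x + 0 *\<^sub>R e))" using assms by simp
  ultimately have "((\<lambda>r. f (x + r *\<^sub>R e)) has_derivative (\<lambda>r. f' (r *\<^sub>R e))) (at 0)"
    by (rule has_derivative_compose)
  moreover have "linear f'" using assms has_derivative_linear by blast
  ultimately show ?thesis by (simp add: has_vector_derivative_def linear_scale)
qed

lemma partial_eq:
  assumes "(f has_derivative f') (at x)"
  shows "partial i f x = f' (axis i 1)"
  unfolding partial_def dir_deriv_def
  by (rule vector_derivative_at[OF has_vector_derivative_line[OF assms]])

lemma has_derivative_partial:
  fixes f :: "real^'d::finite \<Rightarrow> 'b::real_normed_vector"
  assumes "f differentiable (at x)"
  shows "(f has_derivative (\<lambda>v. \<Sum>i\<in>UNIV. v $ i *\<^sub>R partial i f x)) (at x)"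
proof -
  obtain f' where f': "(f has_derivative f') (at x)" using assms differentiable_def by blast
  have lin: "linear f'" using f' has_derivative_linear by blast
  have "f' v = (\<Sum>i\<in>UNIV. v $ i *\<^sub>R partial i f x)" for v
  proof -
    have "f' v = f' (\<Sum>i\<in>UNIV. v $ i *\<^sub>R axis i 1)"
      by (subst basis_expansion[of v, symmetric]) (simp add: scalar_mult_eq_scaleR)
    also have "\<dots> = (\<Sum>i\<in>UNIV. v $ i *\<^sub>R f' (axis i 1))"
      by (simp add: linear_sum[OF lin] linear_scale[OF lin])
    finally show ?thesis by (simp add: partial_eq[OF f'])
  qed
  then have "f' = (\<lambda>v. \<Sum>i\<in>UNIV. v $ i *\<^sub>R partial i f x)" by auto
  then show ?thesis using f' by simp
qed

lemma grad_nth: "grad f x $ i = partial i f x"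
  by (simp add: grad_def)

lemma partial_grad_nth:
  fixes f :: "real^'d::finite \<Rightarrow> 'b::real_normed_vector"
  assumes "grad f differentiable (at x)"
  shows "partial i (grad f) x $ j = partial i (partial j f) x"
proof -
  have eq: "partial j f = (\<lambda>x. grad f x $ j)" by (simp add: grad_nth)
  have "((\<lambda>x. grad f x $ j) has_derivative (\<lambda>v. (\<Sum>i\<in>UNIV. v $ i *\<^sub>R partial i (grad f) x) $ j)) (at x)"
    by (rule bounded_linear.has_derivative[OF bounded_linear_vec_nth has_derivative_partial[OF assms]])
  from partial_eq[OF this, of i] show ?thesis
    unfolding eq by (simp add: axis_def if_distrib[of "\<lambda>c. c *\<^sub>R _"] cong: if_cong)
qed

lemma has_dir_deriv_partial:
  assumes "\<And>x. f differentiable (at x)"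
  shows "has_dir_deriv (axis i 1) f (partial i f)"
  unfolding has_dir_deriv_def
proof
  fix x
  obtain f' where f': "(f has_derivative f') (at x)" using assms differentiable_def by blast
  show "((\<lambda>r. f (x + r *\<^sub>R axis i 1)) has_vector_derivative partial i f x) (at 0)"
    using has_vector_derivative_line[OF f'] partial_eq[OF f'] by metis
qed

subsection \<open>Bounded classical solutions\<close>

lemma norm_sum_scaleR_le:
  fixes v :: "real^'d::finite" and z :: "'b::real_normed_vector^'d"
  shows "norm (\<Sum>i\<in>UNIV. v $ i *\<^sub>R z $ i) \<le> norm v * norm z"
proof -
  have "norm (\<Sum>i\<in>UNIV. v $ i *\<^sub>R z $ i) \<le> (\<Sum>i\<in>UNIV. \<bar>norm (v $ i)\<bar> * \<bar>norm (z $ i)\<bar>)"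
    by (rule order_trans[OF norm_sum]) simp
  also have "\<dots> \<le> L2_set (\<lambda>i. norm (v $ i)) UNIV * L2_set (\<lambda>i. norm (z $ i)) UNIV"
    by (rule L2_set_mult_ineq)
  finally show ?thesis by (simp add: norm_vec_def)
qed

lemma lipschitz_of_grad_bound:
  fixes f :: "real^'d::finite \<Rightarrow> 'b::real_normed_vector"
  assumes "\<And>x. f differentiable (at x)" "\<And>x. norm (grad f x) \<le> L"
  shows "norm (f x - f y) \<le> L * norm (x - y)"
proof (rule differentiable_bound[where S=UNIV and f'="\<lambda>x v. \<Sum>i\<in>UNIV. v $ i *\<^sub>R partial i f x"])
  show "(f has_derivative (\<lambda>v. \<Sum>i\<in>UNIV. v $ i *\<^sub>R partial i f x)) (at x within UNIV)" for x
    using has_derivative_partial[OF assms(1)] by simp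
  show "onorm (\<lambda>v. \<Sum>i\<in>UNIV. v $ i *\<^sub>R partial i f x) \<le> L" for x
  proof (rule onorm_le)
    fix v :: "real^'d"
    have "norm (\<Sum>i\<in>UNIV. v $ i *\<^sub>R grad f x $ i) \<le> norm v * norm (grad f x)" by (rule norm_sum_scaleR_le)
    also have "\<dots> \<le> norm v * L" by (rule mult_left_mono[OF assms(2)]) simp
    finally show "norm (\<Sum>i\<in>UNIV. v $ i *\<^sub>R partial i f x) \<le> L * norm v" by (simp add: grad_nth mult.commute)
  qed
qed auto

text \<open>The real inner products with 1 and with the imaginary unit are the real and imaginary
  part, so two scalar real estimates control a complex gradient.\<close>

lemma norm_complex_vec_le:
  fixes z :: "complex^'d::finite"
  assumes "norm (\<chi> i. 1 \<bullet> (z $ i)) \<le> a" "norm (\<chi> i. \<i> \<bullet> (z $ i)) \<le> b"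
  shows "norm z \<le> a + b"
proof -
  have "norm z = norm ((\<chi> i. complex_of_real (Re (z $ i))) + (\<chi> i. \<i> * complex_of_real (Im (z $ i))))"
    by (rule arg_cong[of _ _ norm]) (simp add: vec_eq_iff complex_eq)
  also have "\<dots> \<le> norm (\<chi> i. complex_of_real (Re (z $ i))) + norm (\<chi> i. \<i> * complex_of_real (Im (z $ i)))"
    by (rule norm_triangle_ineq)
  also have "norm (\<chi> i. complex_of_real (Re (z $ i))) = norm (\<chi> i. 1 \<bullet> (z $ i))"
    by (simp add: norm_vec_def inner_complex_def)
  also have "norm (\<chi> i. \<i> * complex_of_real (Im (z $ i))) = norm (\<chi> i. \<i> \<bullet> (z $ i))"
    by (simp add: norm_vec_def inner_complex_def norm_mult)
  finally show ?thesis using assms by linarith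
qed

lemma schwartz_bounds:
  fixes k :: "real^'d::finite \<Rightarrow> complex"
  assumes k: "schwartz k"
  shows "k differentiable (at x)" "grad k differentiable (at x)"
    "\<exists>K. \<forall>x. norm (k x) \<le> K \<and> norm (grad k x) \<le> K \<and> (\<forall>i. norm (partial i (grad k) x) \<le> K)"
proof -
  have ax: "axis i (1::real) \<in> (Basis :: (real^'d) set)" for i by (simp add: axis_in_Basis_iff)
  have sm: "iter_deriv es k differentiable_on UNIV" if "es \<in> lists Basis" for es
    using k that unfolding schwartz_def smooth_def by blast
  have bd: "bounded (range (iter_deriv es k))" if "es \<in> lists Basis" for es
  proof -
    have "bounded (range (\<lambda>x. norm x ^ 0 *\<^sub>R iter_deriv es k x))"
      using k that unfolding schwartz_def by blast
    then show ?thesis by simp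
  qed
  have it1: "iter_deriv [axis i 1] k = partial i k" for i by (simp add: partial_def)
  have it2: "iter_deriv [axis i 1, axis j 1] k = partial i (partial j k)" for i j by (simp add: partial_def)
  show "k differentiable (at x)" using sm[of "[]"] by (simp add: differentiable_on_def)
  have d1: "partial i k differentiable (at x)" for i x
    using sm[of "[axis i 1]"] ax by (simp add: it1[symmetric] differentiable_on_def)
  show dg: "grad k differentiable (at x)" for x
  proof -
    have "linear (axis j :: complex \<Rightarrow> complex^'d)" for j
      by (auto simp: linear_iff axis_def vec_eq_iff)
    then have "bounded_linear (axis j :: complex \<Rightarrow> complex^'d)" for j by (simp add: linear_conv_bounded_linear)
    then have "(\<lambda>x. axis j (partial j k x) :: complex^'d) differentiable (at x)" for j
      using d1[of j x] bounded_linear.has_derivative unfolding differentiable_def by blast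
    then have "(\<lambda>x. \<Sum>j\<in>UNIV. axis j (partial j k x) :: complex^'d) differentiable (at x)" by simp
    moreover have "(\<lambda>x. \<Sum>j\<in>UNIV. axis j (partial j k x) :: complex^'d) = grad k"
      by (auto simp: vec_eq_iff fun_eq_iff grad_nth axis_def)
    ultimately show ?thesis by simp
  qed
  have "\<exists>K. \<forall>x. norm (partial j k x) \<le> K" for j
  proof -
    have "bounded (range (partial j k))" unfolding it1[symmetric] by (rule bd) (use ax in simp)
    then show ?thesis by (simp add: bounded_iff)
  qed
  then obtain K1 where K1: "\<And>j x. norm (partial j k x) \<le> K1 j" by metis
  have "\<exists>K. \<forall>x. norm (partial i (partial j k) x) \<le> K" for i j
  proof -
    have "bounded (range (partial i (partial j k)))" unfolding it2[symmetric] by (rule bd) (use ax in simp)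
    then show ?thesis by (simp add: bounded_iff)
  qed
  then obtain K2 where K2: "\<And>i j x. norm (partial i (partial j k) x) \<le> K2 i j" by metis
  have "bounded (range k)" using bd[of "[]"] by simp
  then obtain K0 where K0: "\<And>x. norm (k x) \<le> K0" by (auto simp: bounded_iff)
  have vec: "norm z \<le> (\<Sum>i\<in>UNIV. norm (z $ i))" for z :: "complex^'d"
    unfolding norm_vec_def by (rule L2_set_le_sum) auto
  have g1: "norm (grad k x) \<le> (\<Sum>j\<in>UNIV. \<bar>K1 j\<bar>)" for x
    by (rule order_trans[OF vec], rule sum_mono) (simp add: grad_nth order_trans[OF K1 abs_ge_self])
  have g2: "norm (partial i (grad k) x) \<le> (\<Sum>j\<in>UNIV. \<bar>K2 i j\<bar>)" for i x
    by (rule order_trans[OF vec], rule sum_mono)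
      (simp add: partial_grad_nth[OF dg] order_trans[OF K2 abs_ge_self])
  have g3: "(\<Sum>j\<in>UNIV. \<bar>K2 i j\<bar>) \<le> (\<Sum>i\<in>UNIV. \<Sum>j\<in>UNIV. \<bar>K2 i j\<bar>)" for i
    by (rule member_le_sum) (auto intro: sum_nonneg)
  let ?K = "\<bar>K0\<bar> + (\<Sum>j\<in>UNIV. \<bar>K1 j\<bar>) + (\<Sum>i\<in>UNIV. \<Sum>j\<in>UNIV. \<bar>K2 i j\<bar>)"
  have n: "0 \<le> (\<Sum>j\<in>UNIV. \<bar>K1 j\<bar>)" "0 \<le> (\<Sum>i\<in>UNIV. \<Sum>j\<in>UNIV. \<bar>K2 i j\<bar>)" by (auto intro!: sum_nonneg)
  have "norm (k x) \<le> ?K \<and> norm (grad k x) \<le> ?K \<and> (\<forall>i. norm (partial i (grad k) x) \<le> ?K)" for x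
  proof (intro conjI allI)
    show "norm (k x) \<le> ?K" using K0[of x] n by linarith
    show "norm (grad k x) \<le> ?K" using g1[of x] n by linarith
    show "norm (partial i (grad k) x) \<le> ?K" for i using g2[of i x] g3[of i] n by linarith
  qed
  then show "\<exists>K. \<forall>x. norm (k x) \<le> K \<and> norm (grad k x) \<le> K \<and> (\<forall>i. norm (partial i (grad k) x) \<le> K)" by blast
qed

lemma sum_Basis_vec:
  fixes f :: "real^'d::finite \<Rightarrow> 'b::comm_monoid_add"
  shows "(\<Sum>e\<in>Basis. f e) = (\<Sum>i\<in>UNIV. f (axis i 1))"
proof -
  have "Basis = range (\<lambda>i::'d. axis i (1::real))"
    by (auto simp: Basis_vec_def)
  moreover have "inj (\<lambda>i::'d. axis i (1::real))" by (auto simp: inj_on_def axis_eq_axis)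
  ultimately show ?thesis using sum.reindex[of "\<lambda>i::'d. axis i (1::real)" UNIV f] by (simp add: o_def)
qed

text \<open>One member of the regularizing sequence with its own bound \<open>M\<close>. This bound
  varies along the sequence and must not survive in the final constants.\<close>

locale cauchy_solution =
  fixes B :: "real \<times> (real^'d::finite) \<Rightarrow> real^'d" and s :: real and h :: "real^'d \<Rightarrow> complex"
    and u :: "real \<Rightarrow> real^'d \<Rightarrow> complex" and M :: real
  assumes sol: "bounded_classical_solution B s h u"
    and BM: "\<And>z. norm (B z) \<le> M" and cB: "continuous_on UNIV B"
    and h: "C1_compact_support h"
begin

lemma u_differentiable: "s < \<tau> \<Longrightarrow> u \<tau> differentiable (at x)"
  using sol unfolding bounded_classical_solution_def differentiable_on_def by auto

lemma grad_differentiable: "s < \<tau> \<Longrightarrow> grad (u \<tau>) differentiable (at x)"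
  using sol unfolding bounded_classical_solution_def differentiable_on_def by auto

lemma u_time: "s < \<tau> \<Longrightarrow> ((\<lambda>r. u r x) has_vector_derivative time_deriv u \<tau> x) (at \<tau>)"
  using sol unfolding bounded_classical_solution_def time_deriv_def
  by (auto simp: vector_derivative_works[symmetric])

lemma u_init: "u s = h"
  using sol unfolding bounded_classical_solution_def by blast

lemma cont_u: "continuous_on ({s..} \<times> UNIV) (\<lambda>(\<tau>, x). u \<tau> x)"
  using sol unfolding bounded_classical_solution_def by blast

lemma cont_time_deriv: "continuous_on ({s<..} \<times> UNIV) (\<lambda>(\<tau>, x). time_deriv u \<tau> x)"
  using sol unfolding bounded_classical_solution_def by blast

lemma cont_grad: "continuous_on ({s<..} \<times> UNIV) (\<lambda>(\<tau>, x). grad (u \<tau>) x)"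
  using sol unfolding bounded_classical_solution_def by blast

lemma cont_hess: "continuous_on ({s<..} \<times> UNIV) (\<lambda>(\<tau>, x). partial i (grad (u \<tau>)) x)"
  using sol unfolding bounded_classical_solution_def by blast

lemma u_bounded: "\<exists>K. \<forall>\<tau> x. s \<le> \<tau> \<longrightarrow> norm (u \<tau> x) \<le> K"
proof -
  have "bounded ((\<lambda>(\<tau>, x). u \<tau> x) ` ({s..} \<times> UNIV))"
    using sol unfolding bounded_classical_solution_def by (elim conjE)
  then obtain K where K: "\<And>y. y \<in> (\<lambda>(\<tau>, x). u \<tau> x) ` ({s..} \<times> UNIV) \<Longrightarrow> norm y \<le> K"
    unfolding bounded_iff by blast
  have "norm (u \<tau> x) \<le> K" if "s \<le> \<tau>" for \<tau> x
    by (rule K, rule image_eqI[of _ _ "(\<tau>, x)"]) (use that in auto)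
  then show ?thesis by blast
qed

lemma pde:
  assumes "s < \<tau>"
  shows "time_deriv u \<tau> x = (\<Sum>i\<in>UNIV. partial i (grad (u \<tau>)) x $ i) - (\<Sum>i\<in>UNIV. B (\<tau>, x) $ i *\<^sub>R grad (u \<tau>) x $ i)"
proof -
  have "laplacian (u \<tau>) x = (\<Sum>i\<in>UNIV. partial i (grad (u \<tau>)) x $ i)"
    unfolding laplacian_def by (simp add: partial_grad_nth[OF grad_differentiable[OF assms]])
  moreover have "time_deriv u \<tau> x - laplacian (u \<tau>) x + (\<Sum>i\<in>UNIV. B (\<tau>, x) $ i *\<^sub>R partial i (u \<tau>) x) = 0"
    using sol assms unfolding bounded_classical_solution_def by blast
  ultimately show ?thesis by (simp add: grad_nth algebra_simps add_eq_0_iff)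
qed

lemma h_facts:
  "h differentiable (at x)" "continuous_on UNIV (grad h)"
  "\<exists>a b. \<forall>x. x \<notin> cbox a b \<longrightarrow> h x = 0"
proof -
  show "h differentiable (at x)" "continuous_on UNIV (grad h)"
    using h unfolding C1_compact_support_def differentiable_on_def by auto
  have "bounded (closure {x. h x \<noteq> 0})"
    using h unfolding C1_compact_support_def by (blast intro: compact_imp_bounded)
  then obtain a where "closure {x. h x \<noteq> 0} \<subseteq> cbox (-a) a" using bounded_subset_cbox_symmetric by blast
  then have "h x = 0" if "x \<notin> cbox (-a) a" for x
    using that closure_subset[of "{x. h x \<noteq> 0}"] by blast
  then show "\<exists>a b. \<forall>x. x \<notin> cbox a b \<longrightarrow> h x = 0" by blast
qed

text \<open>Since \<open>B\<close> is real, the inner product with a fixed unit \<open>c\<close>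
  commutes with the equation. Subtracting \<open>k\<close> leaves its Laplacian minus
  \<open>B\<close> times its gradient as the source, which is bounded because \<open>k\<close> has
  bounded derivatives.\<close>

lemma component_drift_diffusion:
  fixes c :: complex and k :: "real^'d \<Rightarrow> complex"
  assumes c: "norm c = 1" and T: "s < T"
    and dk: "\<And>x. k differentiable (at x)" and dgk: "\<And>x. grad k differentiable (at x)"
    and K1: "\<And>x. norm (k x) \<le> K1" and K2: "\<And>x. norm (grad k x) \<le> K2"
    and K3: "\<And>i x. norm (partial i (grad k) x) \<le> K3"
    and K: "\<And>\<tau> x. s \<le> \<tau> \<Longrightarrow> norm (u \<tau> x) \<le> K"
  shows "drift_diffusion (\<lambda>\<tau> x. c \<bullet> (u \<tau> x - k x)) (\<lambda>\<tau> x. c \<bullet> time_deriv u \<tau> x)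
     (\<lambda>\<tau> x. \<chi> i. c \<bullet> (grad (u \<tau>) x $ i - grad k x $ i))
     (\<lambda>\<tau> x v. \<chi> j. \<Sum>i\<in>UNIV. v $ i * (c \<bullet> (partial i (grad (u \<tau>)) x $ j - partial i (grad k) x $ j)))
     (\<lambda>\<tau> x. B (\<tau>, x))
     (\<lambda>\<tau> x. c \<bullet> ((\<Sum>i\<in>UNIV. partial i (grad k) x $ i) - (\<Sum>i\<in>UNIV. B (\<tau>, x) $ i *\<^sub>R grad k x $ i)))
     s T M (real CARD('d) * K3 + M * K2) (K + K1)"
proof
  fix \<tau> x assume t: "s < \<tau>" "\<tau> \<le> T"
  have "((\<lambda>r. u r x - k x) has_vector_derivative time_deriv u \<tau> x) (at \<tau>)"
    using has_vector_derivative_diff[OF u_time[OF t(1)] has_vector_derivative_const] by simp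
  from bounded_linear.has_vector_derivative[OF bounded_linear_inner_right this]
  show "((\<lambda>r. c \<bullet> (u r x - k x)) has_real_derivative c \<bullet> time_deriv u \<tau> x) (at \<tau>)"
    by (simp add: has_real_derivative_iff_has_vector_derivative)
  have "((\<lambda>x. u \<tau> x - k x) has_derivative (\<lambda>v. (\<Sum>i\<in>UNIV. v $ i *\<^sub>R partial i (u \<tau>) x) - (\<Sum>i\<in>UNIV. v $ i *\<^sub>R partial i k x))) (at x)"
    by (intro has_derivative_diff has_derivative_partial u_differentiable t dk)
  from bounded_linear.has_derivative[OF bounded_linear_inner_right this]
  show "((\<lambda>x. c \<bullet> (u \<tau> x - k x)) has_derivative (\<lambda>v. (\<chi> i. c \<bullet> (grad (u \<tau>) x $ i - grad k x $ i)) \<bullet> v)) (at x)"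
    by (rule has_derivative_eq_rhs)
      (auto simp: fun_eq_iff inner_vec_def grad_nth inner_diff_right inner_sum_right algebra_simps sum_subtractf)
  have gd: "((\<lambda>x. grad (u \<tau>) x - grad k x) has_derivative (\<lambda>v. (\<Sum>i\<in>UNIV. v $ i *\<^sub>R partial i (grad (u \<tau>)) x) - (\<Sum>i\<in>UNIV. v $ i *\<^sub>R partial i (grad k) x))) (at x)"
    by (intro has_derivative_diff has_derivative_partial grad_differentiable t dgk)
  have bl: "bounded_linear (\<lambda>z::complex^'d. \<chi> i. c \<bullet> (z $ i))"
    unfolding linear_conv_bounded_linear[symmetric] by (auto simp: linear_iff vec_eq_iff inner_add_right)
  from bounded_linear.has_derivative[OF bl gd]
  show "((\<lambda>x. \<chi> i. c \<bullet> (grad (u \<tau>) x $ i - grad k x $ i)) has_derivative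
       (\<lambda>v. \<chi> j. \<Sum>i\<in>UNIV. v $ i * (c \<bullet> (partial i (grad (u \<tau>)) x $ j - partial i (grad k) x $ j)))) (at x)"
    by (simp add: inner_diff_right inner_sum_right algebra_simps sum_subtractf)
  show "c \<bullet> time_deriv u \<tau> x = (\<Sum>e\<in>Basis. (\<chi> j. \<Sum>i\<in>UNIV. e $ i * (c \<bullet> (partial i (grad (u \<tau>)) x $ j - partial i (grad k) x $ j))) \<bullet> e) -
       B (\<tau>, x) \<bullet> (\<chi> i. c \<bullet> (grad (u \<tau>) x $ i - grad k x $ i)) +
       c \<bullet> ((\<Sum>i\<in>UNIV. partial i (grad k) x $ i) - (\<Sum>i\<in>UNIV. B (\<tau>, x) $ i *\<^sub>R grad k x $ i))"
    unfolding sum_Basis_vec pde[OF t(1)]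
    by (simp add: inner_axis axis_def if_distrib[of "\<lambda>c. c * _"] inner_vec_def inner_diff_right inner_sum_right sum_subtractf algebra_simps cong: if_cong)
  have M0: "0 \<le> M" using BM[of undefined] norm_ge_zero order_trans by blast
  have "norm (\<Sum>i\<in>UNIV. partial i (grad k) x $ i) \<le> (\<Sum>i\<in>(UNIV::'d set). K3)"
    by (rule order_trans[OF norm_sum], rule sum_mono) (use K3 Finite_Cartesian_Product.norm_nth_le order_trans in blast)
  moreover have "norm (\<Sum>i\<in>UNIV. B (\<tau>, x) $ i *\<^sub>R grad k x $ i) \<le> M * K2"
    by (rule order_trans[OF norm_sum_scaleR_le]) (intro mult_mono BM K2 M0 norm_ge_zero)
  moreover note norm_triangle_ineq4[of "\<Sum>i\<in>UNIV. partial i (grad k) x $ i" "\<Sum>i\<in>UNIV. B (\<tau>, x) $ i *\<^sub>R grad k x $ i"]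
  ultimately have nF: "norm ((\<Sum>i\<in>UNIV. partial i (grad k) x $ i) - (\<Sum>i\<in>UNIV. B (\<tau>, x) $ i *\<^sub>R grad k x $ i)) \<le> real CARD('d) * K3 + M * K2"
    by simp
  show "\<bar>c \<bullet> ((\<Sum>i\<in>UNIV. partial i (grad k) x $ i) - (\<Sum>i\<in>UNIV. B (\<tau>, x) $ i *\<^sub>R grad k x $ i))\<bar> \<le> real CARD('d) * K3 + M * K2"
    by (rule order_trans[OF Cauchy_Schwarz_ineq2]) (use c nF in simp)
next
  show "norm (B (\<tau>, x)) \<le> M" for \<tau> x by (rule BM)
next
  have "continuous_on UNIV k"
    using dk by (intro differentiable_imp_continuous_on) (simp add: differentiable_on_def)
  then have ck: "continuous_on ({s..T} \<times> UNIV) (\<lambda>z. k (snd z))"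
    by (rule continuous_on_compose2) (auto intro!: continuous_intros)
  have "continuous_on ({s..T} \<times> UNIV) (\<lambda>(\<tau>, x). u \<tau> x)"
    by (rule continuous_on_subset[OF cont_u]) auto
  from continuous_on_inner[OF continuous_on_const[of _ c] continuous_on_diff[OF this ck]]
  show "continuous_on ({s..T} \<times> UNIV) (\<lambda>(\<tau>, x). c \<bullet> (u \<tau> x - k x))"
    by (simp add: split_beta)
next
  fix \<tau> x assume t: "s \<le> \<tau>" "\<tau> \<le> T"
  have "\<bar>c \<bullet> (u \<tau> x - k x)\<bar> \<le> norm (u \<tau> x - k x)"
    using Cauchy_Schwarz_ineq2[of c "u \<tau> x - k x"] c by simp
  also have "\<dots> \<le> norm (u \<tau> x) + norm (k x)" by (rule norm_triangle_ineq4)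
  also have "\<dots> \<le> K + K1" using K[OF t(1)] K1 by (intro add_mono)
  finally show "\<bar>c \<bullet> (u \<tau> x - k x)\<bar> \<le> K + K1" .
qed

text \<open>\<open>gradient_bound\<close> with \<open>k = 0\<close> for the real and for the
  imaginary part. The bound involves \<open>M\<close>; it is used only qualitatively, in errors that
  vanish with the cutoff.\<close>

lemma grad_bounded: "\<exists>K. \<forall>\<tau> x. s < \<tau> \<longrightarrow> norm (grad (u \<tau>) x) \<le> K"
proof -
  obtain a b where ab: "\<And>x. x \<notin> cbox a b \<Longrightarrow> h x = 0" using h_facts(3) by blast
  have supp: "grad h x = 0" if "x \<notin> cbox a b" for x
    unfolding vec_eq_iff
    using has_dir_deriv_outside_support[OF has_dir_deriv_partial[OF h_facts(1)] ab that] by (simp add: grad_nth)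
  have "bounded (grad h ` cbox a b)"
    by (intro compact_imp_bounded compact_continuous_image continuous_on_subset[OF h_facts(2)]) auto
  then obtain L where L: "\<And>x. x \<in> cbox a b \<Longrightarrow> norm (grad h x) \<le> L" unfolding bounded_iff by auto
  have L: "norm (grad h x) \<le> \<bar>L\<bar>" for x using L[of x] supp[of x] by (cases "x \<in> cbox a b") auto
  obtain K where K: "\<And>\<tau> x. s \<le> \<tau> \<Longrightarrow> norm (u \<tau> x) \<le> K" using u_bounded by blast
  have bound: "norm (\<chi> i. c \<bullet> (grad (u \<tau>) x $ i)) \<le> 4 * K * (M + 1) + 2 * \<bar>L\<bar>" if c: "norm c = 1" and t: "s < \<tau>" for c \<tau> x
  proof -
    have g0: "grad (\<lambda>x::real^'d. 0::complex) = (\<lambda>x. 0)"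
      by (auto simp: grad_def vec_eq_iff partial_def dir_deriv_def fun_eq_iff)
    have p0: "partial i (\<lambda>x::real^'d. 0::complex^'d) x = 0" for i x by (simp add: partial_def dir_deriv_def)
    interpret drift_diffusion "\<lambda>\<tau> x. c \<bullet> (u \<tau> x - 0)" "\<lambda>\<tau> x. c \<bullet> time_deriv u \<tau> x"
     "\<lambda>\<tau> x. \<chi> i. c \<bullet> (grad (u \<tau>) x $ i - grad (\<lambda>x. 0) x $ i)"
     "\<lambda>\<tau> x v. \<chi> j. \<Sum>i\<in>UNIV. v $ i * (c \<bullet> (partial i (grad (u \<tau>)) x $ j - partial i (grad (\<lambda>x. 0)) x $ j))"
     "\<lambda>\<tau> x. B (\<tau>, x)"
     "\<lambda>\<tau> x. c \<bullet> ((\<Sum>i\<in>UNIV. partial i (grad (\<lambda>x. 0)) x $ i) - (\<Sum>i\<in>UNIV. B (\<tau>, x) $ i *\<^sub>R grad (\<lambda>x. 0) x $ i))"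
     s \<tau> M "real CARD('d) * 0 + M * 0" "K + 0"
      by (rule component_drift_diffusion[OF c t]) (auto simp: g0 p0 K)
    have "norm (\<chi> i. c \<bullet> (grad (u \<tau>) x $ i - grad (\<lambda>x. 0) x $ i)) \<le> 4 * (K + 0) * (M + 1) + 2 * \<bar>L\<bar>"
    proof (rule gradient_bound)
      fix x y
      have "c \<bullet> (u s x - 0) - c \<bullet> (u s y - 0) = c \<bullet> (h x - h y)" by (simp add: u_init inner_diff_right)
      also have "\<dots> \<le> norm (h x - h y)" using Cauchy_Schwarz_ineq2[of c "h x - h y"] c by simp
      also have "\<dots> \<le> \<bar>L\<bar> * norm (x - y)" by (rule lipschitz_of_grad_bound[OF h_facts(1) L])
      finally show "c \<bullet> (u s x - 0) - c \<bullet> (u s y - 0) \<le> \<bar>L\<bar> * norm (x - y)" .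
    qed (use t in auto)
    then show ?thesis by (simp add: g0)
  qed
  have "norm (grad (u \<tau>) x) \<le> (4 * K * (M + 1) + 2 * \<bar>L\<bar>) + (4 * K * (M + 1) + 2 * \<bar>L\<bar>)" if "s < \<tau>" for \<tau> x
    by (rule norm_complex_vec_le) (rule bound[OF _ that]; simp)+
  then show ?thesis by blast
qed

text \<open>The datum is only C^1, so \<open>h\<close> cannot be subtracted as a smooth
  \<open>k\<close>. A Schwartz function whose gradient is uniformly \<sigma>-close to that of
  \<open>h\<close> is subtracted instead, and the difference starts with Lipschitz constant
  \<sigma>.\<close>

lemma grad_initial_uniform:
  assumes \<epsilon>: "0 < \<epsilon>"
  shows "\<exists>d>0. \<forall>\<tau> x. s < \<tau> \<longrightarrow> \<tau> < s + d \<longrightarrow> norm (grad (u \<tau>) x - grad h x) \<le> \<epsilon>"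
proof -
  obtain a b where ab: "\<And>x. x \<notin> cbox a b \<Longrightarrow> h x = 0" using h_facts(3) by blast
  obtain K where K: "\<And>\<tau> x. s \<le> \<tau> \<Longrightarrow> norm (u \<tau> x) \<le> K" using u_bounded by blast
  \<comment> \<open>Nine shares: four each for the real and the imaginary part, and one for the
    distance between the gradients of \<open>k\<close> and \<open>h\<close>.\<close>
  define \<sigma> where "\<sigma> = \<epsilon> / 9"
  have \<sigma>: "0 < \<sigma>" using \<epsilon> by (simp add: \<sigma>_def)
  define \<eta> where "\<eta> = \<sigma> / real CARD('d)"
  have \<eta>: "0 < \<eta>" using \<sigma> by (simp add: \<eta>_def)
  let ?e = "\<lambda>i::'d. axis i (1::real)"
  have "inj ?e" by (auto simp: inj_on_def axis_eq_axis)
  then have the: "the_inv ?e (?e i) = i" for i using the_inv_f_f[OF \<open>inj ?e\<close>, of i] by blast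
  have ch: "continuous_on UNIV h"
    using h_facts(1) by (intro differentiable_imp_continuous_on) (simp add: differentiable_on_def)
  obtain k k' where k: "schwartz k"
    "\<And>e. e \<in> range ?e \<Longrightarrow> has_dir_deriv e k (k' e)"
    "\<And>e x. e \<in> range ?e \<Longrightarrow> norm (k' e x - grad h x $ (the_inv ?e e)) \<le> \<eta>"
  proof (rule schwartz_approximation[of h a b "range ?e" "\<lambda>e x. grad h x $ (the_inv ?e e)" \<eta>])
    show "has_dir_deriv e h (\<lambda>x. grad h x $ the_inv ?e e)" if "e \<in> range ?e" for e
      using that the has_dir_deriv_partial[OF h_facts(1)] by (auto simp: grad_nth)
  qed (use ch ab \<eta> in \<open>auto intro!: continuous_intros h_facts(2)\<close>)
  have k': "k' (?e i) x = grad k x $ i" for i x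
    using has_dir_deriv_dir_deriv[OF k(2)[OF rangeI]] by (simp add: grad_nth partial_def)
  have close: "norm (grad k x - grad h x) \<le> \<sigma>" for x
  proof -
    have "norm (grad k x - grad h x) \<le> (\<Sum>i\<in>UNIV. norm ((grad k x - grad h x) $ i))"
      unfolding norm_vec_def by (rule L2_set_le_sum) auto
    also have "\<dots> \<le> (\<Sum>i\<in>(UNIV::'d set). \<eta>)"
    proof (rule sum_mono)
      fix i
      show "norm ((grad k x - grad h x) $ i) \<le> \<eta>"
        using k(3)[OF rangeI[of ?e i], of x] unfolding the k' by simp
    qed
    finally show ?thesis by (simp add: \<eta>_def)
  qed
  obtain K' where K': "\<And>x. norm (k x) \<le> K'" "\<And>x. norm (grad k x) \<le> K'" "\<And>i x. norm (partial i (grad k) x) \<le> K'"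
    using schwartz_bounds(3)[OF k(1)] by blast
  note dk = schwartz_bounds(1,2)[OF k(1)]
  have K'0: "0 \<le> K'" using K'(1)[of 0] norm_ge_zero order_trans by blast
  have M0: "0 \<le> M" using BM[of undefined] norm_ge_zero order_trans by blast
  have ghk: "grad (\<lambda>x. h x - k x) x = grad h x - grad k x" for x
  proof -
    have "((\<lambda>x. h x - k x) has_derivative (\<lambda>v. (\<Sum>i\<in>UNIV. v $ i *\<^sub>R partial i h x) - (\<Sum>i\<in>UNIV. v $ i *\<^sub>R partial i k x))) (at x)"
      by (intro has_derivative_diff has_derivative_partial h_facts dk)
    from partial_eq[OF this] show ?thesis
      by (simp add: vec_eq_iff grad_nth axis_def if_distrib[of "\<lambda>c. c *\<^sub>R _"] cong: if_cong)
  qed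
  have "\<exists>d>0. \<forall>t x. s < t \<longrightarrow> t < s + d \<longrightarrow> t \<le> s + 1 \<longrightarrow> norm (\<chi> i. c \<bullet> (grad (u t) x $ i - grad k x $ i)) \<le> 4 * \<sigma>"
    if c: "norm c = 1" for c
  proof -
    have T: "s < s + 1" by simp
    interpret drift_diffusion "\<lambda>\<tau> x. c \<bullet> (u \<tau> x - k x)" "\<lambda>\<tau> x. c \<bullet> time_deriv u \<tau> x"
     "\<lambda>\<tau> x. \<chi> i. c \<bullet> (grad (u \<tau>) x $ i - grad k x $ i)"
     "\<lambda>\<tau> x v. \<chi> j. \<Sum>i\<in>UNIV. v $ i * (c \<bullet> (partial i (grad (u \<tau>)) x $ j - partial i (grad k) x $ j))"
     "\<lambda>\<tau> x. B (\<tau>, x)"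
     "\<lambda>\<tau> x. c \<bullet> ((\<Sum>i\<in>UNIV. partial i (grad k) x $ i) - (\<Sum>i\<in>UNIV. B (\<tau>, x) $ i *\<^sub>R grad k x $ i))"
     s "s + 1" M "real CARD('d) * K' + M * K'" "K + K'"
      by (rule component_drift_diffusion[OF c T dk K' K])
    show ?thesis
    proof (rule small_time_gradient_bound[OF \<sigma>])
      fix x y
      have "c \<bullet> (u s x - k x) - c \<bullet> (u s y - k y) = c \<bullet> ((h x - k x) - (h y - k y))" by (simp add: u_init inner_diff_right)
      also have "\<dots> \<le> norm ((h x - k x) - (h y - k y))" using Cauchy_Schwarz_ineq2[of c "(h x - k x) - (h y - k y)"] c by simp
      also have "\<dots> \<le> \<sigma> * norm (x - y)"
      proof (rule lipschitz_of_grad_bound[of "\<lambda>x. h x - k x"])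
        show "(\<lambda>x. h x - k x) differentiable (at x)" for x by (intro differentiable_diff h_facts dk)
        show "norm (grad (\<lambda>x. h x - k x) x) \<le> \<sigma>" for x unfolding ghk using close[of x] by (simp add: norm_minus_commute)
      qed
      finally show "c \<bullet> (u s x - k x) - c \<bullet> (u s y - k y) \<le> \<sigma> * norm (x - y)" .
    qed (use K'0 M0 in auto)
  qed
  from this[of 1] this[of \<i>] obtain d1 d2 where d1: "0 < d1" "\<And>t x. s < t \<Longrightarrow> t < s + d1 \<Longrightarrow> t \<le> s + 1 \<Longrightarrow> norm (\<chi> i. 1 \<bullet> (grad (u t) x $ i - grad k x $ i)) \<le> 4 * \<sigma>"
    and d2: "0 < d2" "\<And>t x. s < t \<Longrightarrow> t < s + d2 \<Longrightarrow> t \<le> s + 1 \<Longrightarrow> norm (\<chi> i. \<i> \<bullet> (grad (u t) x $ i - grad k x $ i)) \<le> 4 * \<sigma>"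
    by auto
  have "norm (grad (u t) x - grad h x) \<le> \<epsilon>" if "s < t" "t < s + min 1 (min d1 d2)" for t x
  proof -
    have "norm (grad (u t) x - grad k x) \<le> 4 * \<sigma> + 4 * \<sigma>"
      using norm_complex_vec_le[of "grad (u t) x - grad k x" "4 * \<sigma>" "4 * \<sigma>"] d1(2)[of t x] d2(2)[of t x] that by simp
    then show ?thesis using close[of x] norm_triangle_ineq[of "grad (u t) x - grad k x" "grad k x - grad h x"]
      by (simp add: \<sigma>_def)
  qed
  then show ?thesis using d1(1) d2(1) by (intro exI[of _ "min 1 (min d1 d2)"]) auto
qed

end

subsection \<open>Powers of the norm of the gradient\<close>

lemma continuous_on_norm_powr:
  fixes f :: "'z::topological_space \<Rightarrow> 'a::real_normed_vector"
  assumes "continuous_on S f" "0 < m"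
  shows "continuous_on S (\<lambda>z. norm (f z) powr m)"
  by (rule continuous_on_powr') (use assms in \<open>auto intro!: continuous_intros\<close>)

text \<open>The sign is discontinuous at zeros of \<open>f\<close>, but it is bounded and the
  positive power of the norm vanishes there.\<close>

lemma continuous_on_norm_powr_sgn:
  fixes f g :: "'z::topological_space \<Rightarrow> 'a::real_inner"
  assumes cf: "continuous_on S f" and cg: "continuous_on S g" and m: "0 < m"
  shows "continuous_on S (\<lambda>z. norm (f z) powr m * (sgn (f z) \<bullet> g z))"
    "continuous_on S (\<lambda>z. (norm (f z) powr m * (sgn (f z) \<bullet> g z)) *\<^sub>R sgn (f z))"
proof -
  have np: "((\<lambda>z. norm (f z) powr m) \<longlongrightarrow> norm (f z0) powr m) (at z0 within S)" if "z0 \<in> S" for z0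
    using continuous_on_norm_powr[OF cf m] that by (simp add: continuous_on_def)
  have fl: "(f \<longlongrightarrow> f z0) (at z0 within S)" and gl: "(g \<longlongrightarrow> g z0) (at z0 within S)" if "z0 \<in> S" for z0
    using cf cg that by (simp_all add: continuous_on_def)
  have bound: "\<bar>norm y powr m * (sgn y \<bullet> v)\<bar> \<le> norm y powr m * norm v" for y v :: 'a
  proof -
    have "\<bar>sgn y \<bullet> v\<bar> \<le> 1 * norm v"
      by (rule order_trans[OF Cauchy_Schwarz_ineq2]) (intro mult_right_mono, auto simp: norm_sgn)
    then show ?thesis by (simp add: abs_mult mult_left_mono)
  qed
  have bound2: "norm ((norm y powr m * (sgn y \<bullet> v)) *\<^sub>R sgn y) \<le> norm y powr m * norm v" for y v :: 'a
  proof -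
    have "norm ((norm y powr m * (sgn y \<bullet> v)) *\<^sub>R sgn y) \<le> \<bar>norm y powr m * (sgn y \<bullet> v)\<bar> * 1"
      unfolding norm_scaleR by (intro mult_left_mono) (auto simp: norm_sgn)
    then show ?thesis using bound[of y v] by linarith
  qed
  have lim0: "((\<lambda>z. norm (f z) powr m * norm (g z)) \<longlongrightarrow> 0) (at z0 within S)" if "z0 \<in> S" "f z0 = 0" for z0
    using tendsto_mult[OF np[OF that(1)] tendsto_norm[OF gl[OF that(1)]]] that(2) by simp
  show "continuous_on S (\<lambda>z. norm (f z) powr m * (sgn (f z) \<bullet> g z))"
    unfolding continuous_on_def
  proof
    fix z0 assume z0: "z0 \<in> S"
    show "((\<lambda>z. norm (f z) powr m * (sgn (f z) \<bullet> g z)) \<longlongrightarrow> norm (f z0) powr m * (sgn (f z0) \<bullet> g z0)) (at z0 within S)"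
    proof (cases "f z0 = 0")
      case True
      show ?thesis using True
        by (simp, intro Lim_null_comparison[OF always_eventually lim0[OF z0 True]]) (use bound in auto)
    next
      case False
      then show ?thesis by (intro tendsto_intros np fl gl z0) auto
    qed
  qed
  show "continuous_on S (\<lambda>z. (norm (f z) powr m * (sgn (f z) \<bullet> g z)) *\<^sub>R sgn (f z))"
    unfolding continuous_on_def
  proof
    fix z0 assume z0: "z0 \<in> S"
    show "((\<lambda>z. (norm (f z) powr m * (sgn (f z) \<bullet> g z)) *\<^sub>R sgn (f z)) \<longlongrightarrow> (norm (f z0) powr m * (sgn (f z0) \<bullet> g z0)) *\<^sub>R sgn (f z0)) (at z0 within S)"
    proof (cases "f z0 = 0")
      case True
      show ?thesis using True
        by (simp, intro Lim_null_comparison[OF always_eventually lim0[OF z0 True]]) (use bound2 in auto)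
    next
      case False
      then show ?thesis by (intro tendsto_intros np fl gl z0) auto
    qed
  qed
qed

text \<open>Written with \<open>sgn\<close>, which is 0 at 0, the formula also holds at the zeros of
  the gradient, where the derivative is 0 because \<open>a\<close> > 1. So |w| never has to be
  regularized near its zeros.\<close>

lemma has_derivative_norm_powr:
  fixes y :: "'a::real_inner"
  assumes a: "1 < a"
  shows "((\<lambda>y. norm y powr a) has_derivative (\<lambda>v. a * norm y powr (a - 1) * (sgn y \<bullet> v))) (at y)"
proof (cases "y = 0")
  case True
  have "((\<lambda>h::'a. norm h powr (a - 1)) \<longlongrightarrow> 0) (at 0)"
    using continuous_on_norm_powr[OF continuous_on_id, of "a - 1" UNIV] a
    by (simp add: continuous_on_def) (drule_tac x=0 in spec, simp)
  moreover have "norm (norm h powr a) / norm h = norm h powr (a - 1)" for h :: 'a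
    by (cases "h = 0") (auto simp: powr_diff)
  ultimately show ?thesis
    unfolding True has_derivative_at by (simp add: bounded_linear_zero)
next
  case False
  have "((\<lambda>r. r powr a) has_real_derivative a * norm y powr (a - 1)) (at (norm y))"
    using False by (intro has_real_derivative_powr) auto
  from has_derivative_compose[OF has_derivative_norm[OF False] this[unfolded has_field_derivative_def]]
  show ?thesis by (simp add: inner_commute)
qed

lemma has_derivative_norm_powr_scaleR:
  fixes y :: "'a::real_inner"
  assumes q: "2 < q"
  shows "((\<lambda>y. norm y powr (q - 2) *\<^sub>R y) has_derivative
     (\<lambda>v. norm y powr (q - 2) *\<^sub>R v + ((q - 2) * (norm y powr (q - 2) * (sgn y \<bullet> v))) *\<^sub>R sgn y)) (at y)"
proof (cases "y = 0")
  case True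
  have "((\<lambda>h::'a. norm h powr (q - 2)) \<longlongrightarrow> 0) (at 0)"
    using continuous_on_norm_powr[OF continuous_on_id, of "q - 2" UNIV] q
    by (simp add: continuous_on_def) (drule_tac x=0 in spec, simp)
  moreover have "norm (norm h powr (q - 2) *\<^sub>R h) / norm h = norm h powr (q - 2)" for h :: 'a
    by (cases "h = 0") auto
  ultimately show ?thesis
    unfolding True has_derivative_at by (simp add: bounded_linear_zero)
next
  case False
  have "((\<lambda>r. r powr (q - 2)) has_real_derivative (q - 2) * norm y powr (q - 2 - 1)) (at (norm y))"
    using False by (intro has_real_derivative_powr) auto
  from has_derivative_compose[OF has_derivative_norm[OF False] this[unfolded has_field_derivative_def]]
  have "((\<lambda>y. norm y powr (q - 2)) has_derivative (\<lambda>v. (q - 2) * norm y powr (q - 2 - 1) * (v \<bullet> sgn y))) (at y)" .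
  from has_derivative_scaleR[OF this has_derivative_ident]
  have *: "((\<lambda>y. norm y powr (q - 2) *\<^sub>R y) has_derivative
     (\<lambda>v. norm y powr (q - 2) *\<^sub>R v + ((q - 2) * norm y powr (q - 2 - 1) * (v \<bullet> sgn y)) *\<^sub>R y)) (at y)" .
  have y: "y = norm y *\<^sub>R sgn y" using False by (simp add: sgn_div_norm)
  have "norm y powr (q - 2 - 1) * norm y = norm y powr (q - 2)" using powr_mult_base[of "norm y" "q - 2 - 1"]
    by (simp add: mult.commute)
  then have "((q - 2) * norm y powr (q - 2 - 1) * (v \<bullet> sgn y)) *\<^sub>R y = ((q - 2) * (norm y powr (q - 2) * (sgn y \<bullet> v))) *\<^sub>R sgn y" for v
    by (subst (3) y) (simp add: inner_commute mult_ac)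
  then show ?thesis using * by simp
qed

text \<open>The tangent plane inequality for the convex function |y|^q, from Young's inequality with
  exponents q/(q-1) and q.\<close>

lemma norm_powr_convex:
  fixes y z :: "'a::real_inner"
  assumes q: "2 < q"
  shows "q * ((norm y powr (q - 2) *\<^sub>R y) \<bullet> (z - y)) \<le> norm z powr q - norm y powr q"
proof (cases "y = 0")
  case False
  have "(norm y powr (q - 1)) * norm z \<le> (norm y powr (q - 1)) powr (q / (q - 1)) / (q / (q - 1)) + norm z powr q / q"
    by (rule Youngs_inequality) (use q in \<open>auto simp: field_simps\<close>)
  also have "(norm y powr (q - 1)) powr (q / (q - 1)) = norm y powr q" using q by (simp add: powr_powr)
  finally have 1: "q * (norm y powr (q - 1) * norm z) \<le> (q - 1) * norm y powr q + norm z powr q"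
    using q by (simp add: field_simps)
  have 2: "norm y powr (q - 2) * (y \<bullet> z) \<le> norm y powr (q - 1) * norm z"
  proof -
    have "norm y powr (q - 2) * (y \<bullet> z) \<le> norm y powr (q - 2) * (norm y * norm z)"
      by (intro mult_left_mono norm_cauchy_schwarz) auto
    also have "\<dots> = (norm y powr (q - 2) * norm y powr 1) * norm z" using False by simp
    also have "\<dots> = norm y powr (q - 1) * norm z" by (subst powr_add[symmetric]) simp
    finally show ?thesis .
  qed
  have 3: "norm y powr (q - 2) * (y \<bullet> y) = norm y powr q"
  proof -
    have "norm y powr (q - 2) * (y \<bullet> y) = norm y powr (q - 2) * norm y powr 2"
      using False by (simp add: power2_norm_eq_inner[symmetric] powr_numeral)
    also have "\<dots> = norm y powr q" by (subst powr_add[symmetric]) simp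
    finally show ?thesis .
  qed
  have "q * (norm y powr (q - 2) * (y \<bullet> z)) \<le> q * (norm y powr (q - 1) * norm z)"
    using 2 q by (intro mult_left_mono) auto
  then have "q * (norm y powr (q - 2) * (y \<bullet> z)) - q * norm y powr q \<le> norm z powr q - norm y powr q"
    using 1 by (simp add: algebra_simps)
  then show ?thesis using 3 by (simp add: inner_diff_right right_diff_distrib)
qed (use q in simp)

text \<open>The increment of \<open>f\<close> along \<open>e\<close> is the integral of
  \<open>f1\<close>; differentiating it along \<open>d\<close> under the integral and then dividing
  by the length gives \<open>f12\<close>. This way only one of the mixed derivatives is asked to be
  continuous.\<close>

lemma mixed_partials_commute:
  fixes f :: "'a::euclidean_space \<Rightarrow> 'b::banach"
  assumes f1: "has_dir_deriv e f f1" and f2: "has_dir_deriv d f f2"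
    and f12: "has_dir_deriv d f1 f12" and f21: "has_dir_deriv e f2 f21"
    and c: "continuous_on UNIV f1" "continuous_on UNIV f12"
  shows "f12 x = f21 x"
proof -
  have FTC: "((\<lambda>\<rho>. f1 (x + \<sigma> *\<^sub>R d + \<rho> *\<^sub>R e)) has_integral (f (x + \<sigma> *\<^sub>R d + r *\<^sub>R e) - f (x + \<sigma> *\<^sub>R d))) {0..r}"
    if "0 \<le> r" for r \<sigma>
    using fundamental_theorem_of_calculus[OF that, of "\<lambda>\<rho>. f (x + \<sigma> *\<^sub>R d + \<rho> *\<^sub>R e)" "\<lambda>\<rho>. f1 (x + \<sigma> *\<^sub>R d + \<rho> *\<^sub>R e)"]
      has_dir_deriv_shift[OF f1] by simp
  have leib: "((\<lambda>\<sigma>. integral (cbox 0 r) (\<lambda>\<rho>. f1 (x + \<sigma> *\<^sub>R d + \<rho> *\<^sub>R e))) has_vector_derivative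
     integral (cbox 0 r) (\<lambda>\<rho>. f12 (x + 0 *\<^sub>R d + \<rho> *\<^sub>R e))) (at 0 within UNIV)" if "0 \<le> r" for r :: real
  proof (rule leibniz_rule_vector_derivative[where fx="\<lambda>\<sigma> \<rho>. f12 (x + \<sigma> *\<^sub>R d + \<rho> *\<^sub>R e)"])
    fix \<sigma> \<rho> :: real
    show "((\<lambda>\<sigma>. f1 (x + \<sigma> *\<^sub>R d + \<rho> *\<^sub>R e)) has_vector_derivative f12 (x + \<sigma> *\<^sub>R d + \<rho> *\<^sub>R e)) (at \<sigma> within UNIV)"
      using has_dir_deriv_shift[OF f12, of "x + \<rho> *\<^sub>R e" \<sigma> UNIV] by (simp add: add_ac)
    show "(\<lambda>\<rho>. f1 (x + \<sigma> *\<^sub>R d + \<rho> *\<^sub>R e)) integrable_on cbox 0 r"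
      by (intro integrable_continuous continuous_on_compose2[OF c(1)] continuous_intros) auto
  next
    show "continuous_on (UNIV \<times> cbox 0 r) (\<lambda>(\<sigma>, \<rho>). f12 (x + \<sigma> *\<^sub>R d + \<rho> *\<^sub>R e))"
      unfolding split_beta by (intro continuous_on_compose2[OF c(2)] continuous_intros) auto
  qed auto
  have eq: "f2 (x + r *\<^sub>R e) - f2 x = integral {0..r} (\<lambda>\<rho>. f12 (x + \<rho> *\<^sub>R e))" if r: "0 \<le> r" for r
  proof -
    have "((\<lambda>\<sigma>. f (x + \<sigma> *\<^sub>R d + r *\<^sub>R e) - f (x + \<sigma> *\<^sub>R d)) has_vector_derivative
       integral {0..r} (\<lambda>\<rho>. f12 (x + \<rho> *\<^sub>R e))) (at 0)"
      using leib[OF r] integral_unique[OF FTC[OF r]] by simp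
    moreover have "((\<lambda>\<sigma>. f (x + r *\<^sub>R e + \<sigma> *\<^sub>R d) - f (x + \<sigma> *\<^sub>R d)) has_vector_derivative f2 (x + r *\<^sub>R e) - f2 x) (at 0)"
      using f2 unfolding has_dir_deriv_def by (intro has_vector_derivative_diff) blast+
    ultimately show ?thesis using vector_derivative_unique_at by (simp add: add_ac) blast
  qed
  \<comment> \<open>The formula for the increment of \<open>f2\<close> is available for r \<ge> 0,
    so derivatives at 0 are compared from the right.\<close>
  have "((\<lambda>r. integral {0..r} (\<lambda>\<rho>. f12 (x + \<rho> *\<^sub>R e))) has_vector_derivative f12 (x + 0 *\<^sub>R e)) (at 0 within {0..1})"
    by (rule integral_has_vector_derivative) (auto intro!: continuous_on_compose2[OF c(2)] continuous_intros)
  then have "((\<lambda>r. integral {0..r} (\<lambda>\<rho>. f12 (x + \<rho> *\<^sub>R e))) has_vector_derivative f12 x) (at 0 within {0..1})"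
    by (simp only: scaleR_zero_left add_0_right)
  then have "((\<lambda>r. f2 (x + r *\<^sub>R e) - f2 x) has_vector_derivative f12 x) (at 0 within {0..1})"
    by (rule has_vector_derivative_transform_within[where d=1]) (auto simp: eq)
  moreover have "((\<lambda>r. f2 (x + r *\<^sub>R e) - f2 x) has_vector_derivative f21 x - 0) (at 0 within {0..1})"
    using has_dir_deriv_shift[OF f21, of x 0 "{0..1}"] by (intro has_vector_derivative_diff has_vector_derivative_const) simp
  ultimately show ?thesis
    using vector_derivative_unique_within_closed_interval[of 0 1 0] by simp
qed

subsection \<open>The localized energy\<close>

lemma integrable_supp:
  fixes f :: "'a::euclidean_space \<Rightarrow> 'b::banach"
  assumes "continuous_on UNIV f" "\<And>x. x \<notin> cbox a b \<Longrightarrow> f x = 0"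
  shows "f integrable_on UNIV"
proof -
  have "f integrable_on cbox a b" by (rule integrable_continuous[OF continuous_on_subset[OF assms(1)]]) simp
  then show ?thesis by (rule integrable_on_superset) (use assms(2) in auto)
qed

lemma continuous_on_slice_pair:
  assumes "continuous_on (S \<times> UNIV) F" "\<tau> \<in> S"
  shows "continuous_on UNIV (\<lambda>x. F (\<tau>, x))"
proof -
  have "continuous_on UNIV (\<lambda>x. (\<tau>, x))" by (intro continuous_intros)
  from continuous_on_compose2[OF assms(1) this] assms(2) show ?thesis by auto
qed

locale cutoff_energy = cauchy_solution B s h u M
  for B :: "real \<times> (real^'d::finite) \<Rightarrow> real^'d" and s :: real and h :: "real^'d \<Rightarrow> complex"
    and u :: "real \<Rightarrow> real^'d \<Rightarrow> complex" and M :: real +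
  fixes \<eta> :: "real^'d \<Rightarrow> real" and d\<eta> :: "real^'d \<Rightarrow> real^'d" and a b :: "real^'d" and q :: real
  assumes d\<eta>: "\<And>i. has_dir_deriv (axis i 1) \<eta> (\<lambda>x. d\<eta> x $ i)"
    and c\<eta>: "continuous_on UNIV \<eta>" and cd\<eta>: "continuous_on UNIV d\<eta>"
    and supp\<eta>: "\<And>x. x \<notin> cbox a b \<Longrightarrow> \<eta> x = 0" and q2: "2 < q"
begin

abbreviation "ST \<equiv> {s<..} \<times> (UNIV :: (real^'d) set)"

text \<open>\<open>V\<close> is the Laplacian of u and \<open>BW\<close> the drift term.
  \<open>X\<close> is the test field, \<open>dX i\<close> its i-th partial derivative and
  \<open>Dv\<close> its divergence. The cutoff enters squared so that its derivative keeps one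
  factor \<eta>, which Young's inequality can absorb. Space and time are one argument because joint
  continuity is needed.\<close>

definition W :: "real \<times> (real^'d) \<Rightarrow> complex^'d" where "W z = grad (u (fst z)) (snd z)"
definition HH :: "'d \<Rightarrow> real \<times> (real^'d) \<Rightarrow> complex^'d" where "HH i z = partial i (grad (u (fst z))) (snd z)"
definition P :: "real \<times> (real^'d) \<Rightarrow> complex" where "P z = time_deriv u (fst z) (snd z)"
definition V :: "real \<times> (real^'d) \<Rightarrow> complex" where "V z = (\<Sum>i\<in>UNIV. HH i z $ i)"
definition BW :: "real \<times> (real^'d) \<Rightarrow> complex" where "BW z = (\<Sum>i\<in>UNIV. B z $ i *\<^sub>R W z $ i)"
definition X :: "real \<times> (real^'d) \<Rightarrow> complex^'d" where
  "X z = (\<eta> (snd z))\<^sup>2 *\<^sub>R (norm (W z) powr (q - 2) *\<^sub>R W z)"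
definition dX :: "'d \<Rightarrow> real \<times> (real^'d) \<Rightarrow> complex^'d" where
  "dX i z = (\<eta> (snd z))\<^sup>2 *\<^sub>R (norm (W z) powr (q - 2) *\<^sub>R HH i z
       + ((q - 2) * (norm (W z) powr (q - 2) * (sgn (W z) \<bullet> HH i z))) *\<^sub>R sgn (W z))
     + (2 * \<eta> (snd z) * d\<eta> (snd z) $ i) *\<^sub>R (norm (W z) powr (q - 2) *\<^sub>R W z)"
definition Dv :: "real \<times> (real^'d) \<Rightarrow> complex" where "Dv z = (\<Sum>i\<in>UNIV. dX i z $ i)"
definition \<Phi> :: "real \<Rightarrow> real" where
  "\<Phi> \<tau> = integral UNIV (\<lambda>x. (\<eta> x)\<^sup>2 * norm (W (\<tau>, x)) powr q)"

lemma d\<eta>_supp: "x \<notin> cbox a b \<Longrightarrow> d\<eta> x = 0"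
  unfolding vec_eq_iff using has_dir_deriv_outside_support[OF d\<eta> supp\<eta>] by simp

lemma cW: "continuous_on ST W" using cont_grad by (simp add: W_def[abs_def] split_beta)
lemma cHH: "continuous_on ST (HH i)" using cont_hess by (simp add: HH_def[abs_def] split_beta)
lemma cP: "continuous_on ST P" using cont_time_deriv by (simp add: P_def[abs_def] split_beta)
lemma cV: "continuous_on ST V" unfolding V_def[abs_def] by (intro continuous_intros cHH)
lemma cB': "continuous_on S B" using cB continuous_on_subset by blast
lemma c\<eta>': "continuous_on S (\<lambda>z. \<eta> (snd z))"
  by (rule continuous_on_compose2[OF c\<eta>]) (auto intro!: continuous_intros)
lemma cd\<eta>': "continuous_on S (\<lambda>z. d\<eta> (snd z))"
  by (rule continuous_on_compose2[OF cd\<eta>]) (auto intro!: continuous_intros)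

lemma cX: "continuous_on ST X"
  unfolding X_def[abs_def] using q2
  by (intro continuous_intros continuous_on_norm_powr cW c\<eta>') auto

lemma cdX: "continuous_on ST (dX i)"
proof -
  have "continuous_on ST (\<lambda>z. (q - 2) *\<^sub>R ((norm (W z) powr (q - 2) * (sgn (W z) \<bullet> HH i z)) *\<^sub>R sgn (W z)))"
    using q2 by (intro continuous_on_scaleR continuous_on_const continuous_on_norm_powr_sgn(2) cW cHH) auto
  then have "continuous_on ST (\<lambda>z. ((q - 2) * (norm (W z) powr (q - 2) * (sgn (W z) \<bullet> HH i z))) *\<^sub>R sgn (W z))"
    by simp
  note c2 = this
  have c1: "continuous_on ST (\<lambda>z. norm (W z) powr (q - 2))"
    using q2 by (intro continuous_on_norm_powr cW) auto
  have c3: "continuous_on ST (\<lambda>z. 2 * \<eta> (snd z) * d\<eta> (snd z) $ i)"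
    by (intro continuous_intros c\<eta>' cd\<eta>')
  show ?thesis
    unfolding dX_def[abs_def]
    by (rule continuous_on_add[OF continuous_on_scaleR[OF continuous_on_power[OF c\<eta>']
       continuous_on_add[OF continuous_on_scaleR[OF c1 cHH] c2]] continuous_on_scaleR[OF c3 continuous_on_scaleR[OF c1 cW]]])
qed

lemma cDv: "continuous_on ST Dv" unfolding Dv_def[abs_def] by (intro continuous_intros cdX)

lemma X_supp: "snd z \<notin> cbox a b \<Longrightarrow> X z = 0" by (simp add: X_def supp\<eta>)
lemma dX_supp: "snd z \<notin> cbox a b \<Longrightarrow> dX i z = 0" by (simp add: dX_def supp\<eta>)
lemma Dv_supp: "snd z \<notin> cbox a b \<Longrightarrow> Dv z = 0" by (simp add: Dv_def dX_supp)

lemma slice: "continuous_on ST F \<Longrightarrow> s < \<tau> \<Longrightarrow> continuous_on UNIV (\<lambda>x. F (\<tau>, x))"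
  by (rule continuous_on_slice_pair) auto

lemma int: "continuous_on ST F \<Longrightarrow> s < \<tau> \<Longrightarrow> (\<And>z. snd z \<notin> cbox a b \<Longrightarrow> F z = 0) \<Longrightarrow> (\<lambda>x. F (\<tau>, x)) integrable_on UNIV"
  for F :: "real \<times> (real^'d) \<Rightarrow> 'z::banach"
  by (rule integrable_supp[OF slice]) auto

lemma pde': "s < fst z \<Longrightarrow> P z = V z - BW z"
  unfolding P_def V_def BW_def HH_def W_def using pde[of "fst z" "snd z"] by simp

lemma W_deriv: "s < \<tau> \<Longrightarrow> has_dir_deriv (axis i 1) (\<lambda>x. W (\<tau>, x)) (\<lambda>x. HH i (\<tau>, x))"
  unfolding W_def HH_def using has_dir_deriv_partial[OF grad_differentiable] by simp

lemma u_deriv: "s < \<tau> \<Longrightarrow> has_dir_deriv (axis i 1) (u \<tau>) (\<lambda>x. W (\<tau>, x) $ i)"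
  unfolding W_def using has_dir_deriv_partial[OF u_differentiable] by (simp add: grad_nth)

lemma has_dir_deriv_nth: "has_dir_deriv e f f' \<Longrightarrow> has_dir_deriv e (\<lambda>x. f x $ j) (\<lambda>x. f' x $ j)"
  for f :: "'z::real_normed_vector \<Rightarrow> 'y::real_normed_vector^'d"
  unfolding has_dir_deriv_def
  using bounded_linear.has_vector_derivative[OF bounded_linear_vec_nth] by blast

lemma X_deriv:
  assumes t: "s < \<tau>"
  shows "has_dir_deriv (axis i 1) (\<lambda>x. X (\<tau>, x)) (\<lambda>x. dX i (\<tau>, x))"
  unfolding has_dir_deriv_def
proof
  fix x
  let ?l = "\<lambda>r. x + r *\<^sub>R axis i (1::real)"
  have dw: "((\<lambda>r. W (\<tau>, ?l r)) has_derivative (\<lambda>r. r *\<^sub>R HH i (\<tau>, x))) (at 0)"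
    using W_deriv[OF t, of i] unfolding has_dir_deriv_def has_vector_derivative_def by blast
  have de: "((\<lambda>r. \<eta> (?l r)) has_derivative (\<lambda>r. r *\<^sub>R d\<eta> x $ i)) (at 0)"
    using d\<eta>[of i] unfolding has_dir_deriv_def has_vector_derivative_def by blast
  have "((\<lambda>r. norm (W (\<tau>, ?l r)) powr (q - 2) *\<^sub>R W (\<tau>, ?l r)) has_derivative
    (\<lambda>r. norm (W (\<tau>, x)) powr (q - 2) *\<^sub>R (r *\<^sub>R HH i (\<tau>, x)) +
       ((q - 2) * (norm (W (\<tau>, x)) powr (q - 2) * (sgn (W (\<tau>, x)) \<bullet> (r *\<^sub>R HH i (\<tau>, x))))) *\<^sub>R sgn (W (\<tau>, x)))) (at 0)"
    using has_derivative_compose[OF dw has_derivative_norm_powr_scaleR[OF q2]] by simp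
  from has_derivative_scaleR[OF has_derivative_power[OF de, of 2] this]
  show "((\<lambda>r. X (\<tau>, ?l r)) has_vector_derivative dX i (\<tau>, x)) (at 0)"
    unfolding has_vector_derivative_def X_def dX_def snd_conv
    by (rule has_derivative_eq_rhs) (auto simp: fun_eq_iff algebra_simps)
qed

lemma hess_symmetric:
  assumes t: "s < \<tau>"
  shows "HH i (\<tau>, x) $ j = HH j (\<tau>, x) $ i"
proof (rule mixed_partials_commute[of "axis j 1" "u \<tau>" "\<lambda>x. W (\<tau>, x) $ j" "axis i 1" "\<lambda>x. W (\<tau>, x) $ i"
    "\<lambda>x. HH i (\<tau>, x) $ j" "\<lambda>x. HH j (\<tau>, x) $ i"])
qed (auto intro!: u_deriv t has_dir_deriv_nth W_deriv continuous_on_component slice cW cHH)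

text \<open>Integrating by parts twice in the classical way would produce third derivatives of u.
  \<open>integral_exchange_dir_deriv\<close> swaps the two derivatives in one stroke, and the
  symmetry of the Hessian arranges the indices.\<close>

lemma laplacian_divergence:
  assumes t: "s < \<tau>"
  shows "integral UNIV (\<lambda>x. V (\<tau>, x) \<bullet> Dv (\<tau>, x)) = integral UNIV (\<lambda>x. \<Sum>i\<in>UNIV. HH i (\<tau>, x) \<bullet> dX i (\<tau>, x))"
proof -
  have sl: "continuous_on UNIV (\<lambda>x. HH i (\<tau>, x) $ k)" "continuous_on UNIV (\<lambda>x. dX i (\<tau>, x) $ k)"
    "continuous_on UNIV (\<lambda>x. W (\<tau>, x) $ k)" "continuous_on UNIV (\<lambda>x. X (\<tau>, x) $ k)" for i k
    by (intro continuous_on_component slice[OF _ t] cHH cdX cW cX)+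
  have i1: "(\<lambda>x. HH i (\<tau>, x) $ k \<bullet> dX j (\<tau>, x) $ l) integrable_on UNIV" for i j k l
    by (rule integrable_supp[where a=a and b=b]) (auto intro!: continuous_on_inner sl simp: dX_supp)
  have ex: "integral UNIV (\<lambda>x. HH i (\<tau>, x) $ i \<bullet> dX j (\<tau>, x) $ j) = integral UNIV (\<lambda>x. HH i (\<tau>, x) $ j \<bullet> dX i (\<tau>, x) $ j)" for i j
  proof -
    have "integral UNIV (\<lambda>x. HH i (\<tau>, x) $ i \<bullet> dX j (\<tau>, x) $ j) = integral UNIV (\<lambda>x. HH j (\<tau>, x) $ i \<bullet> dX i (\<tau>, x) $ j)"
      by (rule integral_exchange_dir_deriv[of "axis i 1" "\<lambda>x. W (\<tau>, x) $ i" _ "axis j 1" _ "\<lambda>x. X (\<tau>, x) $ j" _ _ a b])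
         (auto intro!: has_dir_deriv_nth W_deriv X_deriv t sl simp: X_supp)
    also have "\<dots> = integral UNIV (\<lambda>x. HH i (\<tau>, x) $ j \<bullet> dX i (\<tau>, x) $ j)"
      by (simp add: hess_symmetric[OF t, of j _ i])
    finally show ?thesis .
  qed
  have "integral UNIV (\<lambda>x. V (\<tau>, x) \<bullet> Dv (\<tau>, x)) = integral UNIV (\<lambda>x. \<Sum>i\<in>UNIV. \<Sum>j\<in>UNIV. HH i (\<tau>, x) $ i \<bullet> dX j (\<tau>, x) $ j)"
    by (simp only: V_def inner_sum_left) (simp only: Dv_def inner_sum_right)
  also have "\<dots> = (\<Sum>i\<in>UNIV. \<Sum>j\<in>UNIV. integral UNIV (\<lambda>x. HH i (\<tau>, x) $ i \<bullet> dX j (\<tau>, x) $ j))"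
    by (simp add: integral_sum integrable_sum i1)
  also have "\<dots> = (\<Sum>i\<in>UNIV. \<Sum>j\<in>UNIV. integral UNIV (\<lambda>x. HH i (\<tau>, x) $ j \<bullet> dX i (\<tau>, x) $ j))"
    by (intro sum.cong refl ex)
  also have "\<dots> = integral UNIV (\<lambda>x. \<Sum>i\<in>UNIV. \<Sum>j\<in>UNIV. HH i (\<tau>, x) $ j \<bullet> dX i (\<tau>, x) $ j)"
    by (simp add: integral_sum integrable_sum i1)
  finally show ?thesis by (simp add: inner_vec_def)
qed

lemma \<Phi>_cont_integrand: "continuous_on ST (\<lambda>z. (\<eta> (snd z))\<^sup>2 * norm (W z) powr q)"
  using q2 by (intro continuous_intros continuous_on_norm_powr cW c\<eta>') auto

text \<open>Convexity of \<open>|w|\<^sup>q\<close> squeezes the difference quotients of \<open>\<Phi>\<close>, so that \<open>\<partial>\<^sub>\<tau>w\<close>, which need not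
  exist, is avoided.\<close>

lemma \<Phi>_convexity:
  assumes t: "s < \<tau>" "s < \<sigma>"
  shows "- q * integral UNIV (\<lambda>x. Dv (\<tau>, x) \<bullet> (u \<sigma> x - u \<tau> x)) \<le> \<Phi> \<sigma> - \<Phi> \<tau>"
proof -
  have i0: "(\<lambda>x. (\<eta> x)\<^sup>2 * norm (W (t, x)) powr q) integrable_on UNIV" if "s < t" for t
    using int[OF \<Phi>_cont_integrand that] supp\<eta> by simp
  have cu: "continuous_on UNIV (u t)" if "s < t" for t
    using u_differentiable[OF that] by (intro differentiable_imp_continuous_on) (simp add: differentiable_on_def)
  have sl: "continuous_on UNIV (\<lambda>x. X (\<tau>, x) $ k)" "continuous_on UNIV (\<lambda>x. dX i (\<tau>, x) $ k)" for i k
    by (intro continuous_on_component slice[OF _ t(1)] cdX cX)+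
  have slW: "continuous_on UNIV (\<lambda>x. W (\<sigma>, x) $ k - W (\<tau>, x) $ k)" for k
    by (intro continuous_on_diff continuous_on_component slice cW t)
  have i1: "(\<lambda>x. (W (\<sigma>, x) $ k - W (\<tau>, x) $ k) \<bullet> X (\<tau>, x) $ k) integrable_on UNIV" for k
    by (rule integrable_supp[where a=a and b=b]) (auto intro!: continuous_on_inner sl slW simp: X_supp)
  have i2: "(\<lambda>x. (u \<sigma> x - u \<tau> x) \<bullet> dX k (\<tau>, x) $ k) integrable_on UNIV" for k
    by (rule integrable_supp[where a=a and b=b]) (auto intro!: continuous_on_inner sl continuous_on_diff cu t simp: dX_supp)
  have ibp: "integral UNIV (\<lambda>x. (W (\<sigma>, x) $ k - W (\<tau>, x) $ k) \<bullet> X (\<tau>, x) $ k) = - integral UNIV (\<lambda>x. (u \<sigma> x - u \<tau> x) \<bullet> dX k (\<tau>, x) $ k)" for k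
  proof (rule integral_by_parts_dir_deriv[of "axis k 1" _ _ _ _ a b])
    show "has_dir_deriv (axis k 1) (\<lambda>x. u \<sigma> x - u \<tau> x) (\<lambda>x. W (\<sigma>, x) $ k - W (\<tau>, x) $ k)"
      using u_deriv[OF t(1), of k] u_deriv[OF t(2), of k] unfolding has_dir_deriv_def by (auto intro!: has_vector_derivative_diff)
  qed (auto intro!: has_dir_deriv_nth X_deriv t sl slW continuous_on_diff cu simp: X_supp)
  have eq: "integral UNIV (\<lambda>x. (W (\<sigma>, x) - W (\<tau>, x)) \<bullet> X (\<tau>, x)) = - integral UNIV (\<lambda>x. Dv (\<tau>, x) \<bullet> (u \<sigma> x - u \<tau> x))"
  proof -
    have "integral UNIV (\<lambda>x. (W (\<sigma>, x) - W (\<tau>, x)) \<bullet> X (\<tau>, x)) = (\<Sum>k\<in>UNIV. integral UNIV (\<lambda>x. (W (\<sigma>, x) $ k - W (\<tau>, x) $ k) \<bullet> X (\<tau>, x) $ k))"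
      by (simp add: inner_vec_def integral_sum i1)
    also have "\<dots> = - (\<Sum>k\<in>UNIV. integral UNIV (\<lambda>x. (u \<sigma> x - u \<tau> x) \<bullet> dX k (\<tau>, x) $ k))"
      unfolding ibp by (simp add: sum_negf)
    also have "\<dots> = - integral UNIV (\<lambda>x. Dv (\<tau>, x) \<bullet> (u \<sigma> x - u \<tau> x))"
    proof -
      have "Dv (\<tau>, x) \<bullet> v = (\<Sum>k\<in>UNIV. v \<bullet> dX k (\<tau>, x) $ k)" for x v
        unfolding Dv_def inner_sum_left by (rule sum.cong) (auto simp: inner_commute)
      then show ?thesis by (simp add: integral_sum i2)
    qed
    finally show ?thesis .
  qed
  have i3: "(\<lambda>x. (W (\<sigma>, x) - W (\<tau>, x)) \<bullet> X (\<tau>, x)) integrable_on UNIV"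
    using integrable_sum[OF finite_class.finite_UNIV i1] by (simp add: inner_vec_def)
  have "q * integral UNIV (\<lambda>x. (W (\<sigma>, x) - W (\<tau>, x)) \<bullet> X (\<tau>, x)) = integral UNIV (\<lambda>x. q * ((W (\<sigma>, x) - W (\<tau>, x)) \<bullet> X (\<tau>, x)))"
    by simp
  also have "\<dots> \<le> integral UNIV (\<lambda>x. (\<eta> x)\<^sup>2 * norm (W (\<sigma>, x)) powr q - (\<eta> x)\<^sup>2 * norm (W (\<tau>, x)) powr q)"
  proof (rule integral_le)
    show "(\<lambda>x. q * ((W (\<sigma>, x) - W (\<tau>, x)) \<bullet> X (\<tau>, x))) integrable_on UNIV" using integrable_cmul[OF i3, of q] by simp
    show "(\<lambda>x. (\<eta> x)\<^sup>2 * norm (W (\<sigma>, x)) powr q - (\<eta> x)\<^sup>2 * norm (W (\<tau>, x)) powr q) integrable_on UNIV"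
      by (intro integrable_diff i0 t)
    fix x
    show "q * ((W (\<sigma>, x) - W (\<tau>, x)) \<bullet> X (\<tau>, x)) \<le> (\<eta> x)\<^sup>2 * norm (W (\<sigma>, x)) powr q - (\<eta> x)\<^sup>2 * norm (W (\<tau>, x)) powr q"
      using mult_left_mono[OF norm_powr_convex[OF q2, of "W (\<tau>, x)" "W (\<sigma>, x)"], of "(\<eta> x)\<^sup>2"]
      by (simp add: X_def inner_commute algebra_simps)
  qed
  also have "\<dots> = \<Phi> \<sigma> - \<Phi> \<tau>" unfolding \<Phi>_def by (intro integral_diff i0 t)
  finally show ?thesis unfolding eq by simp
qed

text \<open>The convexity inequality is used twice, with the tangent taken at \<tau> and at
  \<sigma>. The difference quotient is caught between \<alpha> and \<beta>, which are continuous and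
  agree at \<tau>.\<close>

lemma \<Phi>_derivative:
  assumes t: "s < \<tau>"
  shows "(\<Phi> has_real_derivative - q * integral UNIV (\<lambda>x. Dv (\<tau>, x) \<bullet> P (\<tau>, x))) (at \<tau>)"
proof -
  \<comment> \<open>The mean of the time derivative over the segment from \<tau> to the current
    time: the difference quotient of u in a form that is continuous also at \<tau>.\<close>
  define U where "U z = integral (cbox 0 1) (\<lambda>\<theta>. P (\<tau> + \<theta> * (fst z - \<tau>), snd z))" for z
  have seg: "s < \<tau> + \<theta> * (\<sigma> - \<tau>)" if "s < \<sigma>" "0 \<le> \<theta>" "\<theta> \<le> 1" for \<sigma> \<theta>
  proof -
    have "\<tau> + \<theta> * (\<sigma> - \<tau>) = (1 - \<theta>) * \<tau> + \<theta> * \<sigma>" by (simp add: algebra_simps)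
    moreover have "(1 - \<theta>) * s + \<theta> * s < (1 - \<theta>) * \<tau> + \<theta> * \<sigma>"
      using that t by (cases "\<theta> = 0") (auto intro!: add_le_less_mono mult_left_mono mult_strict_left_mono)
    ultimately show ?thesis by (simp add: algebra_simps)
  qed
  have cU: "continuous_on ST U"
  proof -
    have "continuous_on (ST \<times> cbox 0 1) (\<lambda>y. (\<tau> + snd y * (fst (fst y) - \<tau>), snd (fst y)))"
      by (intro continuous_intros)
    moreover have "(\<lambda>y. (\<tau> + snd y * (fst (fst y) - \<tau>), snd (fst y))) ` (ST \<times> cbox 0 1) \<subseteq> ST"
      using seg by auto
    ultimately have "continuous_on (ST \<times> cbox 0 1) (\<lambda>y. P (\<tau> + snd y * (fst (fst y) - \<tau>), snd (fst y)))"
      by (rule continuous_on_compose2[OF cP])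
    then show ?thesis unfolding U_def[abs_def]
      by (intro integral_continuous_on_param) (simp add: split_beta)
  qed
  have U\<tau>: "U (\<tau>, x) = P (\<tau>, x)" for x by (simp add: U_def)
  have Ueq: "u \<sigma> x - u \<tau> x = (\<sigma> - \<tau>) *\<^sub>R U (\<sigma>, x)" if \<sigma>: "s < \<sigma>" for \<sigma> x
  proof -
    have "((\<lambda>\<theta>. u (\<tau> + \<theta> * (\<sigma> - \<tau>)) x) has_vector_derivative (\<sigma> - \<tau>) *\<^sub>R P (\<tau> + \<theta> * (\<sigma> - \<tau>), x)) (at \<theta> within {0..1})"
      if \<theta>: "\<theta> \<in> {0..1}" for \<theta>
    proof -
      have 1: "((\<lambda>\<theta>. \<tau> + \<theta> * (\<sigma> - \<tau>)) has_vector_derivative (\<sigma> - \<tau>)) (at \<theta>)"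
        by (auto intro!: derivative_eq_intros simp: has_real_derivative_iff_has_vector_derivative[symmetric])
      have 2: "((\<lambda>r. u r x) has_vector_derivative P (\<tau> + \<theta> * (\<sigma> - \<tau>), x)) (at (\<tau> + \<theta> * (\<sigma> - \<tau>)))"
        unfolding P_def fst_conv snd_conv using \<theta> by (intro u_time seg \<sigma>) auto
      show ?thesis
        using vector_diff_chain_at[OF 1 2] by (auto simp: o_def intro: has_vector_derivative_at_within)
    qed
    from fundamental_theorem_of_calculus[OF _ this]
    have "((\<lambda>\<theta>. (\<sigma> - \<tau>) *\<^sub>R P (\<tau> + \<theta> * (\<sigma> - \<tau>), x)) has_integral (u \<sigma> x - u \<tau> x)) {0..1}" by simp
    then show ?thesis unfolding U_def by (metis fst_conv snd_conv integral_cmul integral_unique cbox_interval)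
  qed
  define \<alpha> where "\<alpha> \<sigma> = - q * integral UNIV (\<lambda>x. Dv (\<tau>, x) \<bullet> U (\<sigma>, x))" for \<sigma>
  define \<beta> where "\<beta> \<sigma> = - q * integral UNIV (\<lambda>x. Dv (\<sigma>, x) \<bullet> U (\<sigma>, x))" for \<sigma>
  have cDt: "continuous_on ST (\<lambda>z. Dv (\<tau>, snd z))"
    by (rule continuous_on_compose2[OF slice[OF cDv t]]) (auto intro!: continuous_intros)
  have c\<alpha>: "continuous_on {s<..} \<alpha>"
    unfolding \<alpha>_def[abs_def]
    using continuous_on_integral_supp[OF continuous_on_inner[OF cDt cU], of a b] Dv_supp
    by (intro continuous_on_mult continuous_on_const) simp
  have c\<beta>: "continuous_on {s<..} \<beta>"
    unfolding \<beta>_def[abs_def]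
    using continuous_on_integral_supp[OF continuous_on_inner[OF cDv cU], of a b] Dv_supp
    by (intro continuous_on_mult continuous_on_const) simp
  let ?L = "- q * integral UNIV (\<lambda>x. Dv (\<tau>, x) \<bullet> P (\<tau>, x))"
  have op: "open {s<..}" by simp
  have l\<alpha>: "(\<alpha> \<longlongrightarrow> ?L) (at \<tau>)"
  proof -
    have "isCont \<alpha> \<tau>" using c\<alpha> t continuous_on_eq_continuous_at[OF op, of \<alpha>] by blast
    moreover have "\<alpha> \<tau> = ?L" by (simp add: \<alpha>_def U\<tau>)
    ultimately show ?thesis by (simp only: isCont_def)
  qed
  have l\<beta>: "(\<beta> \<longlongrightarrow> ?L) (at \<tau>)"
  proof -
    have "isCont \<beta> \<tau>" using c\<beta> t continuous_on_eq_continuous_at[OF op, of \<beta>] by blast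
    moreover have "\<beta> \<tau> = ?L" by (simp add: \<beta>_def U\<tau>)
    ultimately show ?thesis by (simp only: isCont_def)
  qed
  have ge: "(\<sigma> - \<tau>) * \<alpha> \<sigma> \<le> \<Phi> \<sigma> - \<Phi> \<tau>" if "s < \<sigma>" for \<sigma>
    using \<Phi>_convexity[OF t that] by (simp add: Ueq[OF that] \<alpha>_def mult_ac)
  have le: "\<Phi> \<sigma> - \<Phi> \<tau> \<le> (\<sigma> - \<tau>) * \<beta> \<sigma>" if "s < \<sigma>" for \<sigma>
  proof -
    have e: "u \<tau> x - u \<sigma> x = (\<tau> - \<sigma>) *\<^sub>R U (\<sigma>, x)" for x
      using Ueq[OF that, of x] by (metis minus_diff_eq scaleR_minus_left)
    have "- q * ((\<tau> - \<sigma>) * integral UNIV (\<lambda>x. Dv (\<sigma>, x) \<bullet> U (\<sigma>, x))) \<le> \<Phi> \<tau> - \<Phi> \<sigma>"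
      using \<Phi>_convexity[OF that t] by (simp only: e inner_scaleR_right integral_mult_right)
    then show ?thesis by (simp add: \<beta>_def algebra_simps)
  qed
  have quot: "min (\<alpha> \<sigma>) (\<beta> \<sigma>) \<le> (\<Phi> \<sigma> - \<Phi> \<tau>) / (\<sigma> - \<tau>) \<and> (\<Phi> \<sigma> - \<Phi> \<tau>) / (\<sigma> - \<tau>) \<le> max (\<alpha> \<sigma>) (\<beta> \<sigma>)"
    if "s < \<sigma>" "\<sigma> \<noteq> \<tau>" for \<sigma>
  proof (cases "\<tau> < \<sigma>")
    case True
    then have "\<alpha> \<sigma> \<le> (\<Phi> \<sigma> - \<Phi> \<tau>) / (\<sigma> - \<tau>)" "(\<Phi> \<sigma> - \<Phi> \<tau>) / (\<sigma> - \<tau>) \<le> \<beta> \<sigma>"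
      using ge[OF that(1)] le[OF that(1)] by (simp_all add: pos_le_divide_eq pos_divide_le_eq mult.commute)
    then show ?thesis by auto
  next
    case False
    \<comment> \<open>For \<sigma> < \<tau> the division reverses the inequalities, so \<alpha> and
      \<beta> exchange roles; hence the minimum and maximum.\<close>
    then have "\<beta> \<sigma> \<le> (\<Phi> \<sigma> - \<Phi> \<tau>) / (\<sigma> - \<tau>)" "(\<Phi> \<sigma> - \<Phi> \<tau>) / (\<sigma> - \<tau>) \<le> \<alpha> \<sigma>"
      using ge[OF that(1)] le[OF that(1)] that(2) by (simp_all add: neg_le_divide_eq neg_divide_le_eq mult.commute)
    then show ?thesis by auto
  qed
  have ev: "\<forall>\<^sub>F \<sigma> in at \<tau>. s < \<sigma> \<and> \<sigma> \<noteq> \<tau>"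
    unfolding eventually_at_topological using t by (intro exI[of _ "{s<..}"]) auto
  have "((\<lambda>\<sigma>. (\<Phi> \<sigma> - \<Phi> \<tau>) / (\<sigma> - \<tau>)) \<longlongrightarrow> ?L) (at \<tau>)"
  proof (rule tendsto_sandwich)
    show "((\<lambda>\<sigma>. min (\<alpha> \<sigma>) (\<beta> \<sigma>)) \<longlongrightarrow> ?L) (at \<tau>)" using tendsto_min[OF l\<alpha> l\<beta>] by simp
    show "((\<lambda>\<sigma>. max (\<alpha> \<sigma>) (\<beta> \<sigma>)) \<longlongrightarrow> ?L) (at \<tau>)" using tendsto_max[OF l\<alpha> l\<beta>] by simp
  qed (rule eventually_mono[OF ev], use quot in blast)+
  then show ?thesis by (simp add: has_field_derivative_iff)
qed

end

section \<open>Pointwise bound for the energy density\<close>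

lemma inner_Young:
  fixes x y :: "'a::real_inner"
  assumes "0 < \<epsilon>"
  shows "2 * (x \<bullet> y) \<le> \<epsilon> * (norm x)\<^sup>2 + (norm y)\<^sup>2 / \<epsilon>"
proof -
  have "0 \<le> (norm (\<epsilon> *\<^sub>R x - y))\<^sup>2 / \<epsilon>" using assms by simp
  also have "(norm (\<epsilon> *\<^sub>R x - y))\<^sup>2 = \<epsilon>\<^sup>2 * (norm x)\<^sup>2 - 2 * \<epsilon> * (x \<bullet> y) + (norm y)\<^sup>2"
    unfolding power2_norm_eq_inner by (simp add: inner_diff_left inner_diff_right inner_commute power2_eq_square algebra_simps)
  also have "(\<epsilon>\<^sup>2 * (norm x)\<^sup>2 - 2 * \<epsilon> * (x \<bullet> y) + (norm y)\<^sup>2) / \<epsilon> = \<epsilon> * (norm x)\<^sup>2 - 2 * (x \<bullet> y) + (norm y)\<^sup>2 / \<epsilon>"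
    using assms by (simp add: field_simps power2_eq_square)
  finally show ?thesis by simp
qed

lemma norm_sum_sq_le:
  fixes x y :: "'a::real_inner"
  assumes "0 < \<epsilon>"
  shows "(norm (x + y))\<^sup>2 \<le> (1 + \<epsilon>) * (norm x)\<^sup>2 + (1 + 1 / \<epsilon>) * (norm y)\<^sup>2"
proof -
  have "(norm (x + y))\<^sup>2 = (norm x)\<^sup>2 + 2 * (x \<bullet> y) + (norm y)\<^sup>2"
    unfolding power2_norm_eq_inner by (simp add: inner_add_left inner_add_right inner_commute)
  then show ?thesis using inner_Young[OF assms, of x y] by (simp add: algebra_simps)
qed

text \<open>With \<open>V = \<Delta>u\<close>, \<open>Y = b \<cdot> \<nabla>u\<close> and \<open>\<partial>\<^sub>\<tau>u = V - Y\<close>, the energy identity is the combination, with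
  weights \<open>1 - \<kappa>\<close> and \<open>\<kappa>\<close>, of the two ways of testing the equation: one produces the full
  second-order term, the other the term with \<open>\<partial>\<^sub>\<tau>u\<close>. The choice \<open>\<kappa> = \<beta>/q\<close> is optimal, and
  makes \<open>\<beta> < 1\<close> sufficient.\<close>

lemma energy_density_core:
  fixes V Y Q :: "'a::real_inner" and I J m \<beta> :: real
  assumes m: "0 < m" and \<beta>: "0 < \<beta>" "\<beta> < 1" and QJ: "(norm Q)\<^sup>2 \<le> J" and JI: "J \<le> I"
  defines "q \<equiv> m + 2"
  defines "\<kappa> \<equiv> \<beta> / q"
  shows "(Y - \<kappa> *\<^sub>R V) \<bullet> (V + m *\<^sub>R Q) - (1 - \<kappa>) * (I + m * J)
    \<le> (q - 1) / (2 * \<beta>) * (norm Y)\<^sup>2 - (q - 1) / 2 * \<beta> * J - (1 - \<beta>) * I"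
proof -
  have q: "0 < q" using m by (simp add: q_def)
  have \<kappa>: "0 < \<kappa>" using \<beta> q by (simp add: \<kappa>_def)
  have J0: "0 \<le> J" using QJ zero_le_power2 order_trans by blast
  \<comment> \<open>Completing the square in \<open>V\<close>: the term -\<kappa> |V|^2 bounds
    everything that depends on \<open>V\<close>.\<close>
  have "(Y - \<kappa> *\<^sub>R V) \<bullet> (V + m *\<^sub>R Q) = (norm (Y + (\<kappa> * m) *\<^sub>R Q))\<^sup>2 / (4 * \<kappa>) - (norm ((2 * \<kappa>) *\<^sub>R V - (Y - (\<kappa> * m) *\<^sub>R Q)))\<^sup>2 / (4 * \<kappa>)"
    using \<kappa> unfolding power2_norm_eq_inner
    by (simp add: inner_diff_left inner_diff_right inner_add_left inner_add_right inner_commute field_simps)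
  also have "\<dots> \<le> (norm (Y + (\<kappa> * m) *\<^sub>R Q))\<^sup>2 / (4 * \<kappa>)" using \<kappa> by simp
  \<comment> \<open>The splitting ratio m/q is the one that turns the coefficient of |Y|^2 into
    (q-1)/(2 \<beta>), since q + m = 2 (q-1).\<close>
  also have "\<dots> \<le> ((1 + m / q) * (norm Y)\<^sup>2 + (1 + 1 / (m / q)) * (norm ((\<kappa> * m) *\<^sub>R Q))\<^sup>2) / (4 * \<kappa>)"
    using m q \<kappa> by (intro divide_right_mono norm_sum_sq_le) auto
  also have "\<dots> = (q - 1) / (2 * \<beta>) * (norm Y)\<^sup>2 + \<beta> * m * (m + 1) / (2 * q) * (norm Q)\<^sup>2"
    using m q \<beta> by (simp add: \<kappa>_def power_mult_distrib field_simps power2_eq_square) (simp add: q_def algebra_simps)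
  also have "\<dots> \<le> (q - 1) / (2 * \<beta>) * (norm Y)\<^sup>2 + \<beta> * m * (m + 1) / (2 * q) * J"
    using m q \<beta> QJ by (intro add_left_mono mult_left_mono) auto
  finally have 1: "(Y - \<kappa> *\<^sub>R V) \<bullet> (V + m *\<^sub>R Q) \<le> (q - 1) / (2 * \<beta>) * (norm Y)\<^sup>2 + \<beta> * m * (m + 1) / (2 * q) * J" .
  have "\<kappa> \<le> \<beta>" using \<beta> q m by (simp add: \<kappa>_def q_def divide_le_eq)
  \<comment> \<open>Of the available (1 - \<kappa>) I the part (1 - \<beta>) I is kept; the rest is
    lowered to \<open>J\<close>, where it helps to pay for the drift.\<close>
  then have "(\<beta> - \<kappa>) * J \<le> (\<beta> - \<kappa>) * I" using JI by (intro mult_left_mono) auto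
  then have 2: "(1 - \<beta>) * I + (\<beta> - \<kappa> + (1 - \<kappa>) * m) * J \<le> (1 - \<kappa>) * (I + m * J)"
    by (simp add: algebra_simps)
  \<comment> \<open>What is left of the coefficient of \<open>J\<close> is exactly m (1 - \<beta>),
    which is nonnegative.\<close>
  have "(\<beta> - \<kappa> + (1 - \<kappa>) * m) - \<beta> * m * (m + 1) / (2 * q) - (q - 1) / 2 * \<beta> = m * (1 - \<beta>)"
  proof -
    have "\<kappa> * (1 + m) + \<beta> * m * (m + 1) / (2 * q) = \<beta> * (m + 1) / 2"
      using q by (simp add: \<kappa>_def field_simps) (simp add: q_def algebra_simps)
    moreover have "(q - 1) / 2 * \<beta> = \<beta> * (m + 1) / 2" by (simp add: q_def)
    moreover have "\<beta> - \<kappa> + (1 - \<kappa>) * m = \<beta> + m - \<kappa> * (1 + m)" by (simp add: algebra_simps)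
    moreover have "m * (1 - \<beta>) = \<beta> + m - \<beta> * (m + 1) / 2 - \<beta> * (m + 1) / 2" by (simp add: field_simps)
    ultimately show ?thesis by linarith
  qed
  then have "\<beta> * m * (m + 1) / (2 * q) + (q - 1) / 2 * \<beta> \<le> \<beta> - \<kappa> + (1 - \<kappa>) * m"
    using mult_nonneg_nonneg[of m "1 - \<beta>"] m \<beta> by linarith
  then have "(\<beta> * m * (m + 1) / (2 * q) + (q - 1) / 2 * \<beta>) * J \<le> (\<beta> - \<kappa> + (1 - \<kappa>) * m) * J"
    using J0 by (rule mult_right_mono)
  then show ?thesis using 1 2 by (simp add: algebra_simps)
qed

text \<open>A share \<epsilon> of the coercive terms buys two things: the terms in which the cutoff
  is differentiated (\<open>S\<close> and \<open>R\<close>), and -\<epsilon> |V - Y|^2, which is the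
  square of the time derivative. In 4 d + 1, the mixed cutoff term and |V - Y|^2 account for 2 d
  each, and the term with \<open>R\<close> for 1. The weight |w|^(q-2) is already divided
  out.\<close>

lemma energy_density_bound:
  fixes V Y Q S :: "'a::real_inner" and I J m \<beta> e g w R d :: real
  assumes m: "0 < m" and \<beta>: "0 < \<beta>" "\<beta> < 1" and QJ: "(norm Q)\<^sup>2 \<le> J" and JI: "J \<le> I"
    and VI: "(norm V)\<^sup>2 \<le> d * I" and S: "norm S \<le> g * w" and R: "R\<^sup>2 \<le> (g * w)\<^sup>2 * J" and \<epsilon>: "0 < \<epsilon>"
  defines "q \<equiv> m + 2"
  defines "\<kappa> \<equiv> \<beta> / q"
  shows "(Y - \<kappa> *\<^sub>R V) \<bullet> (e\<^sup>2 *\<^sub>R (V + m *\<^sub>R Q) + (2 * e) *\<^sub>R S) - (1 - \<kappa>) * (e\<^sup>2 * (I + m * J) + 2 * e * R)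
    \<le> e\<^sup>2 * (((q - 1) / (2 * \<beta>) + 4 * \<epsilon>) * (norm Y)\<^sup>2 - (q - 1) / 2 * \<beta> * J - (1 - \<beta> - \<epsilon> * (4 * d + 1)) * I - \<epsilon> * (norm (V - Y))\<^sup>2)
      + 2 / \<epsilon> * (g\<^sup>2 * w\<^sup>2)"
proof -
  have q: "0 < q" using m by (simp add: q_def)
  have \<kappa>: "0 \<le> \<kappa>" "\<kappa> \<le> 1" using \<beta> m by (simp_all add: \<kappa>_def q_def divide_le_eq)
  have core: "e\<^sup>2 * ((Y - \<kappa> *\<^sub>R V) \<bullet> (V + m *\<^sub>R Q) - (1 - \<kappa>) * (I + m * J))
    \<le> e\<^sup>2 * ((q - 1) / (2 * \<beta>) * (norm Y)\<^sup>2 - (q - 1) / 2 * \<beta> * J - (1 - \<beta>) * I)"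
    unfolding \<kappa>_def q_def by (intro mult_left_mono energy_density_core m \<beta> QJ JI) auto
  have dbl: "(norm (x - y))\<^sup>2 \<le> 2 * (norm x)\<^sup>2 + 2 * (norm y)\<^sup>2" for x y :: 'a
    using norm_sum_sq_le[of 1 x "- y"] by simp
  have "(norm (Y - \<kappa> *\<^sub>R V))\<^sup>2 \<le> 2 * (norm Y)\<^sup>2 + 2 * (norm (\<kappa> *\<^sub>R V))\<^sup>2" by (rule dbl)
  also have "(norm (\<kappa> *\<^sub>R V))\<^sup>2 \<le> 1 * (norm V)\<^sup>2"
    unfolding norm_scaleR power_mult_distrib using \<kappa> by (intro mult_right_mono) (auto simp: power_le_one)
  finally have YV: "(norm (Y - \<kappa> *\<^sub>R V))\<^sup>2 \<le> 2 * (norm Y)\<^sup>2 + 2 * (d * I)" using VI by simp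
  have S2: "(norm S)\<^sup>2 \<le> g\<^sup>2 * w\<^sup>2"
    using power_mono[OF S norm_ge_zero, of 2] by (simp add: power_mult_distrib)
  have "2 * ((e *\<^sub>R (Y - \<kappa> *\<^sub>R V)) \<bullet> S) \<le> \<epsilon> * (norm (e *\<^sub>R (Y - \<kappa> *\<^sub>R V)))\<^sup>2 + (norm S)\<^sup>2 / \<epsilon>"
    by (rule inner_Young[OF \<epsilon>])
  also have "(norm (e *\<^sub>R (Y - \<kappa> *\<^sub>R V)))\<^sup>2 = e\<^sup>2 * (norm (Y - \<kappa> *\<^sub>R V))\<^sup>2" by (simp add: power_mult_distrib)
  also have "\<epsilon> * (e\<^sup>2 * (norm (Y - \<kappa> *\<^sub>R V))\<^sup>2) \<le> \<epsilon> * (e\<^sup>2 * (2 * (norm Y)\<^sup>2 + 2 * (d * I)))"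
    using YV \<epsilon> by (intro mult_left_mono) auto
  also have "(norm S)\<^sup>2 / \<epsilon> \<le> g\<^sup>2 * w\<^sup>2 / \<epsilon>" using S2 \<epsilon> by (simp add: divide_right_mono)
  finally have E1: "2 * e * ((Y - \<kappa> *\<^sub>R V) \<bullet> S) \<le> \<epsilon> * (e\<^sup>2 * (2 * (norm Y)\<^sup>2 + 2 * (d * I))) + g\<^sup>2 * w\<^sup>2 / \<epsilon>" by simp
  have J0: "0 \<le> J" using QJ zero_le_power2 order_trans by blast
  have E2: "- (1 - \<kappa>) * (2 * e * R) \<le> \<epsilon> * (e\<^sup>2 * I) + g\<^sup>2 * w\<^sup>2 / \<epsilon>"
  proof -
    have "\<bar>R\<bar> \<le> sqrt ((g * w)\<^sup>2 * J)" using R by (simp add: real_le_rsqrt)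
    then have R': "\<bar>R\<bar> \<le> \<bar>g * w\<bar> * sqrt J" by (simp add: real_sqrt_mult)
    have "- (1 - \<kappa>) * (2 * e * R) \<le> \<bar>(1 - \<kappa>) * (2 * e * R)\<bar>" by (metis abs_ge_minus_self mult_minus_left)
    also have "\<dots> = (1 - \<kappa>) * (2 * \<bar>e\<bar> * \<bar>R\<bar>)" using \<kappa> by (simp add: abs_mult)
    also have "\<dots> \<le> 1 * (2 * \<bar>e\<bar> * \<bar>R\<bar>)" using \<kappa> by (intro mult_right_mono) auto
    also have "\<dots> \<le> 2 * \<bar>e\<bar> * (\<bar>g * w\<bar> * sqrt J)" using R' by (simp add: mult_left_mono)
    also have "\<dots> = 2 * ((\<bar>e\<bar> * sqrt J) \<bullet> \<bar>g * w\<bar>)" by (simp add: mult_ac)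
    also have "\<dots> \<le> \<epsilon> * (norm (\<bar>e\<bar> * sqrt J))\<^sup>2 + (norm \<bar>g * w\<bar>)\<^sup>2 / \<epsilon>" by (rule inner_Young[OF \<epsilon>])
    also have "\<dots> = \<epsilon> * (e\<^sup>2 * J) + g\<^sup>2 * w\<^sup>2 / \<epsilon>" using J0 by (simp add: power_mult_distrib)
    also have "\<dots> \<le> \<epsilon> * (e\<^sup>2 * I) + g\<^sup>2 * w\<^sup>2 / \<epsilon>" using JI \<epsilon> by (intro add_right_mono mult_left_mono) auto
    finally show ?thesis .
  qed
  have "(norm (V - Y))\<^sup>2 \<le> 2 * (d * I) + 2 * (norm Y)\<^sup>2" using dbl[of V Y] VI by linarith
  then have E3: "\<epsilon> * (e\<^sup>2 * (norm (V - Y))\<^sup>2) \<le> \<epsilon> * (e\<^sup>2 * (2 * (d * I) + 2 * (norm Y)\<^sup>2))"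
    using \<epsilon> by (intro mult_left_mono) auto
  have "(Y - \<kappa> *\<^sub>R V) \<bullet> (e\<^sup>2 *\<^sub>R (V + m *\<^sub>R Q) + (2 * e) *\<^sub>R S) - (1 - \<kappa>) * (e\<^sup>2 * (I + m * J) + 2 * e * R)
    = e\<^sup>2 * ((Y - \<kappa> *\<^sub>R V) \<bullet> (V + m *\<^sub>R Q) - (1 - \<kappa>) * (I + m * J)) + 2 * e * ((Y - \<kappa> *\<^sub>R V) \<bullet> S) + - (1 - \<kappa>) * (2 * e * R)"
    by (simp only: inner_add_right[of "Y - \<kappa> *\<^sub>R V" "e\<^sup>2 *\<^sub>R _"] inner_scaleR_right) (simp add: algebra_simps)
  also have "\<dots> \<le> e\<^sup>2 * ((q - 1) / (2 * \<beta>) * (norm Y)\<^sup>2 - (q - 1) / 2 * \<beta> * J - (1 - \<beta>) * I)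
    + (\<epsilon> * (e\<^sup>2 * (2 * (norm Y)\<^sup>2 + 2 * (d * I))) + g\<^sup>2 * w\<^sup>2 / \<epsilon>) + (\<epsilon> * (e\<^sup>2 * I) + g\<^sup>2 * w\<^sup>2 / \<epsilon>)
    + (\<epsilon> * (e\<^sup>2 * (2 * (d * I) + 2 * (norm Y)\<^sup>2)) - \<epsilon> * (e\<^sup>2 * (norm (V - Y))\<^sup>2))"
    using core E1 E2 E3 by linarith
  also have "\<dots> = e\<^sup>2 * (((q - 1) / (2 * \<beta>) + 4 * \<epsilon>) * (norm Y)\<^sup>2 - (q - 1) / 2 * \<beta> * J - (1 - \<beta> - \<epsilon> * (4 * d + 1)) * I - \<epsilon> * (norm (V - Y))\<^sup>2)
      + 2 / \<epsilon> * (g\<^sup>2 * w\<^sup>2)"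
    by (simp add: algebra_simps)
  finally show ?thesis .
qed

section \<open>Rate of change of the localized energy\<close>

context cutoff_energy
begin

text \<open>Where w is nonzero, \<open>sgn w\<close> times the i-th derivative of w is the i-th
  derivative of |w|. So \<open>JJ\<close> is |grad |w||^2, the part of the second-order term that
  the form bound sees, and \<open>II\<close> is the full squared Hessian. The functions
  \<open>fB\<close>, \<open>fJ\<close>, \<open>fI\<close>, \<open>fP\<close> and \<open>fE\<close>
  are the localized densities of drift, \<open>JJ\<close>, \<open>II\<close>, time derivative and
  cutoff error.\<close>

definition N :: "real \<times> (real^'d) \<Rightarrow> real" where "N z = norm (W z) powr (q - 2)"
definition JJ :: "real \<times> (real^'d) \<Rightarrow> real" where "JJ z = (\<Sum>i\<in>UNIV. (sgn (W z) \<bullet> HH i z)\<^sup>2)"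
definition II :: "real \<times> (real^'d) \<Rightarrow> real" where "II z = (\<Sum>i\<in>UNIV. (norm (HH i z))\<^sup>2)"

definition fB :: "real \<times> (real^'d) \<Rightarrow> real" where "fB z = (norm (B z))\<^sup>2 * ((\<eta> (snd z))\<^sup>2 * norm (W z) powr q)"
definition fJ :: "real \<times> (real^'d) \<Rightarrow> real" where "fJ z = (\<eta> (snd z))\<^sup>2 * (N z * JJ z)"
definition fI :: "real \<times> (real^'d) \<Rightarrow> real" where "fI z = (\<eta> (snd z))\<^sup>2 * (N z * II z)"
definition fP :: "real \<times> (real^'d) \<Rightarrow> real" where "fP z = (\<eta> (snd z))\<^sup>2 * (N z * (norm (P z))\<^sup>2)"
definition fE :: "real \<times> (real^'d) \<Rightarrow> real" where "fE z = (norm (d\<eta> (snd z)))\<^sup>2 * norm (W z) powr q"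

lemma cN: "continuous_on ST N"
  unfolding N_def[abs_def] using q2 by (intro continuous_on_norm_powr cW) auto

lemma cfB: "continuous_on ST fB"
  unfolding fB_def[abs_def] by (intro continuous_intros cB' \<Phi>_cont_integrand)

lemma cfI: "continuous_on ST fI"
  unfolding fI_def[abs_def] II_def by (intro continuous_intros c\<eta>' cN cHH)

lemma cfP: "continuous_on ST fP"
  unfolding fP_def[abs_def] by (intro continuous_intros c\<eta>' cN cP)

lemma cfE: "continuous_on ST fE"
  unfolding fE_def[abs_def] using q2 by (intro continuous_intros cd\<eta>' continuous_on_norm_powr cW) auto

lemma N_half: "N z = (norm (W z) powr ((q - 2) / 2))\<^sup>2"
proof -
  have "(norm (W z) powr ((q - 2) / 2))\<^sup>2 = norm (W z) powr ((q - 2) / 2 + (q - 2) / 2)"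
    unfolding power2_eq_square by (rule powr_add[symmetric])
  then show ?thesis by (simp add: N_def)
qed

lemma N_norm: "N z * (norm (W z))\<^sup>2 = norm (W z) powr q"
proof (cases "W z = 0")
  case False
  have "N z * (norm (W z))\<^sup>2 = norm (W z) powr (q - 2) * norm (W z) powr 2"
    using False by (simp add: N_def powr_numeral)
  also have "\<dots> = norm (W z) powr (q - 2 + 2)" by (rule powr_add[symmetric])
  finally show ?thesis by simp
qed (use q2 in simp)

lemma N_nonneg: "0 \<le> N z" by (simp add: N_def)

text \<open>\<open>JJ\<close> is discontinuous at the zeros of w. Half of the weight is moved inside
  the square, next to the sign, where it restores continuity.\<close>

lemma cfJ: "continuous_on ST fJ"
proof -
  have eq: "fJ = (\<lambda>z. (\<eta> (snd z))\<^sup>2 * (\<Sum>i\<in>UNIV. (norm (W z) powr ((q - 2) / 2) * (sgn (W z) \<bullet> HH i z))\<^sup>2))"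
    by (auto simp: fun_eq_iff fJ_def N_half JJ_def power_mult_distrib sum_distrib_left)
  have c: "continuous_on ST (\<lambda>z. (norm (W z) powr ((q - 2) / 2) * (sgn (W z) \<bullet> HH i z))\<^sup>2)" for i
    using q2 by (intro continuous_on_power continuous_on_norm_powr_sgn(1) cW cHH) simp
  show ?thesis
    unfolding eq by (rule continuous_on_mult[OF continuous_on_power[OF c\<eta>'] continuous_on_sum[OF c]])
qed

lemma f_supp:
  assumes "snd z \<notin> cbox a b"
  shows "fB z = 0" "fJ z = 0" "fI z = 0" "fP z = 0" "fE z = 0"
  using supp\<eta>[OF assms] d\<eta>_supp[OF assms] by (simp_all add: fB_def fJ_def fI_def fP_def fE_def)

lemma JJ_le_II: "JJ z \<le> II z"
  unfolding JJ_def II_def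
proof (rule sum_mono)
  fix i
  have "\<bar>sgn (W z) \<bullet> HH i z\<bar> \<le> norm (sgn (W z)) * norm (HH i z)" by (rule Cauchy_Schwarz_ineq2)
  also have "\<dots> \<le> 1 * norm (HH i z)" by (intro mult_right_mono) (auto simp: norm_sgn)
  finally show "(sgn (W z) \<bullet> HH i z)\<^sup>2 \<le> (norm (HH i z))\<^sup>2"
    by (metis abs_le_square_iff abs_norm_cancel mult_1)
qed

lemma V_II: "(norm (V z))\<^sup>2 \<le> real CARD('d) * II z"
proof -
  have "V z = (\<Sum>i\<in>UNIV. (\<chi> i. (1::real)) $ i *\<^sub>R (\<chi> i. HH i z $ i) $ i)" by (simp add: V_def)
  also have "norm \<dots> \<le> norm (\<chi> i::'d. (1::real)) * norm (\<chi> i. HH i z $ i)" by (rule norm_sum_scaleR_le)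
  finally have nV: "norm (V z) \<le> norm (\<chi> i::'d. (1::real)) * norm (\<chi> i. HH i z $ i)" .
  have "(norm (V z))\<^sup>2 \<le> (norm (\<chi> i::'d. (1::real)))\<^sup>2 * (norm (\<chi> i. HH i z $ i))\<^sup>2"
    using power_mono[OF nV norm_ge_zero, of 2] by (simp only: power_mult_distrib)
  also have "(norm (\<chi> i::'d. (1::real)))\<^sup>2 = real CARD('d)"
    by (simp add: norm_vec_def L2_set_def)
  also have "(norm (\<chi> i. HH i z $ i))\<^sup>2 = (\<Sum>i\<in>UNIV. (norm (HH i z $ i))\<^sup>2)"
    by (simp add: norm_vec_def L2_set_def sum_nonneg)
  also have "\<dots> \<le> II z"
    unfolding II_def by (intro sum_mono power_mono Finite_Cartesian_Product.norm_nth_le norm_ge_zero)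
  finally show ?thesis by (simp add: mult_left_mono)
qed

text \<open>The difference of the two sides of \<open>laplacian_divergence\<close> is zero, so any
  multiple of it may be added. With the multiple 1 - \<kappa> the integrand becomes the combination
  that \<open>energy_density_bound\<close> controls pointwise.\<close>

lemma \<Phi>_rate:
  assumes \<beta>: "0 < \<beta>" "\<beta> < 1" and \<epsilon>: "0 < \<epsilon>" and t: "s < \<tau>"
  shows "- q * integral UNIV (\<lambda>x. Dv (\<tau>, x) \<bullet> P (\<tau>, x)) \<le>
    q * (((q - 1) / (2 * \<beta>) + 4 * \<epsilon>) * integral UNIV (\<lambda>x. fB (\<tau>, x)) - (q - 1) / 2 * \<beta> * integral UNIV (\<lambda>x. fJ (\<tau>, x))
      - (1 - \<beta> - \<epsilon> * (4 * real CARD('d) + 1)) * integral UNIV (\<lambda>x. fI (\<tau>, x)) - \<epsilon> * integral UNIV (\<lambda>x. fP (\<tau>, x))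
      + 2 / \<epsilon> * integral UNIV (\<lambda>x. fE (\<tau>, x)))"
proof -
  define \<kappa> where "\<kappa> = \<beta> / q"
  define \<rho> where "\<rho> z = (\<Sum>i\<in>UNIV. HH i z \<bullet> dX i z)" for z
  have c\<rho>: "continuous_on ST \<rho>" unfolding \<rho>_def[abs_def] by (intro continuous_intros cHH cdX)
  have s\<rho>: "snd z \<notin> cbox a b \<Longrightarrow> \<rho> z = 0" for z by (simp add: \<rho>_def dX_supp)
  have iP: "(\<lambda>x. Dv (\<tau>, x) \<bullet> P (\<tau>, x)) integrable_on UNIV"
    using int[OF continuous_on_inner[OF cDv cP] t] Dv_supp by simp
  have iV: "(\<lambda>x. V (\<tau>, x) \<bullet> Dv (\<tau>, x)) integrable_on UNIV"
    using int[OF continuous_on_inner[OF cV cDv] t] Dv_supp by simp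
  have i\<rho>: "(\<lambda>x. \<rho> (\<tau>, x)) integrable_on UNIV" by (rule int[OF c\<rho> t s\<rho>])
  note iF = int[OF cfB t f_supp(1)] int[OF cfJ t f_supp(2)] int[OF cfI t f_supp(3)] int[OF cfP t f_supp(4)] int[OF cfE t f_supp(5)]
  define A where "A = (q - 1) / (2 * \<beta>) + 4 * \<epsilon>"
  define A2 where "A2 = (q - 1) / 2 * \<beta>"
  define c where "c = 1 - \<beta> - \<epsilon> * (4 * real CARD('d) + 1)"
  have A0: "0 \<le> A" using q2 \<beta> \<epsilon> by (simp add: A_def)
  have "- integral UNIV (\<lambda>x. Dv (\<tau>, x) \<bullet> P (\<tau>, x)) = - integral UNIV (\<lambda>x. Dv (\<tau>, x) \<bullet> P (\<tau>, x))
     + (1 - \<kappa>) * (integral UNIV (\<lambda>x. V (\<tau>, x) \<bullet> Dv (\<tau>, x)) - integral UNIV (\<lambda>x. \<rho> (\<tau>, x)))"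
    unfolding \<rho>_def laplacian_divergence[OF t] by simp
  also have "\<dots> = integral UNIV (\<lambda>x. - (Dv (\<tau>, x) \<bullet> P (\<tau>, x)) + (1 - \<kappa>) * (V (\<tau>, x) \<bullet> Dv (\<tau>, x) - \<rho> (\<tau>, x)))"
    using integral_add[OF integrable_neg[OF iP] integrable_cmul[OF integrable_diff[OF iV i\<rho>], of "1 - \<kappa>"]]
      integral_diff[OF iV i\<rho>] by simp
  also have "\<dots> \<le> integral UNIV (\<lambda>x. A * fB (\<tau>, x) - A2 * fJ (\<tau>, x) - c * fI (\<tau>, x) - \<epsilon> * fP (\<tau>, x) + 2 / \<epsilon> * fE (\<tau>, x))"
  proof (rule integral_le)
    show "(\<lambda>x. - (Dv (\<tau>, x) \<bullet> P (\<tau>, x)) + (1 - \<kappa>) * (V (\<tau>, x) \<bullet> Dv (\<tau>, x) - \<rho> (\<tau>, x))) integrable_on UNIV"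
      using integrable_add[OF integrable_neg[OF iP] integrable_cmul[OF integrable_diff[OF iV i\<rho>], of "1 - \<kappa>"]] by simp
    have cm: "(\<lambda>x. k * F x) integrable_on UNIV" if "F integrable_on UNIV" for k and F :: "real^'d \<Rightarrow> real"
      using integrable_cmul[OF that, of k] by simp
    show "(\<lambda>x. A * fB (\<tau>, x) - A2 * fJ (\<tau>, x) - c * fI (\<tau>, x) - \<epsilon> * fP (\<tau>, x) + 2 / \<epsilon> * fE (\<tau>, x)) integrable_on UNIV"
      by (intro integrable_add integrable_diff cm iF)
    fix x :: "real^'d"
    define z where "z = (\<tau>, x)"
    define Q where "Q = (\<Sum>i\<in>UNIV. (sgn (W z) \<bullet> HH i z) *\<^sub>R sgn (W z) $ i)"
    define S where "S = (\<Sum>i\<in>UNIV. d\<eta> x $ i *\<^sub>R W z $ i)"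
    define R where "R = (\<Sum>i\<in>UNIV. d\<eta> x $ i * (HH i z \<bullet> W z))"
    \<comment> \<open>Divergence and second-order density both contain the weight \<open>N\<close>
      as a factor, and what remains is purely algebraic. At zeros of w the weight vanishes.\<close>
    have D: "Dv z = N z *\<^sub>R ((\<eta> x)\<^sup>2 *\<^sub>R (V z + (q - 2) *\<^sub>R Q) + (2 * \<eta> x) *\<^sub>R S)"
      unfolding Dv_def dX_def V_def Q_def S_def N_def z_def
      by (simp add: sum.distrib scaleR_sum_right scaleR_add_right mult_ac)
    have r: "\<rho> z = N z * ((\<eta> x)\<^sup>2 * (II z + (q - 2) * JJ z) + 2 * \<eta> x * R)"
      unfolding \<rho>_def dX_def II_def JJ_def R_def N_def z_def power2_norm_eq_inner
      by (simp add: sum.distrib sum_distrib_left inner_add_right inner_commute[of "sgn _"] power2_eq_square distrib_left mult_ac)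
    have PV: "P z = V z - BW z" using pde'[of z] t by (simp add: z_def)
    have QJ: "(norm Q)\<^sup>2 \<le> JJ z"
    proof -
      have "norm Q \<le> norm (\<chi> i. sgn (W z) \<bullet> HH i z) * norm (sgn (W z))"
        unfolding Q_def using norm_sum_scaleR_le[of "\<chi> i. sgn (W z) \<bullet> HH i z" "sgn (W z)"] by simp
      also have "\<dots> \<le> norm (\<chi> i. sgn (W z) \<bullet> HH i z) * 1" by (intro mult_left_mono) (auto simp: norm_sgn)
      finally have "(norm Q)\<^sup>2 \<le> (norm (\<chi> i. sgn (W z) \<bullet> HH i z))\<^sup>2" by (simp add: power_mono)
      then show ?thesis by (simp add: norm_vec_def L2_set_def JJ_def sum_nonneg)
    qed
    have Sb: "norm S \<le> norm (d\<eta> x) * norm (W z)" unfolding S_def by (rule norm_sum_scaleR_le)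
    have Rb: "R\<^sup>2 \<le> (norm (d\<eta> x) * norm (W z))\<^sup>2 * JJ z"
    proof -
      have "HH i z \<bullet> W z = norm (W z) * (sgn (W z) \<bullet> HH i z)" for i
        by (cases "W z = 0") (auto simp: sgn_div_norm inner_commute)
      then have "R = norm (W z) * (\<Sum>i\<in>UNIV. d\<eta> x $ i *\<^sub>R (\<chi> i. sgn (W z) \<bullet> HH i z) $ i)"
        by (simp add: R_def sum_distrib_left mult_ac)
      then have "\<bar>R\<bar> = norm (W z) * norm (\<Sum>i\<in>UNIV. d\<eta> x $ i *\<^sub>R (\<chi> i. sgn (W z) \<bullet> HH i z) $ i)"
        by (simp add: abs_mult)
      also have "\<dots> \<le> norm (W z) * (norm (d\<eta> x) * norm (\<chi> i. sgn (W z) \<bullet> HH i z))"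
        by (intro mult_left_mono norm_sum_scaleR_le) auto
      finally have "\<bar>R\<bar>\<^sup>2 \<le> (norm (W z) * (norm (d\<eta> x) * norm (\<chi> i. sgn (W z) \<bullet> HH i z)))\<^sup>2"
        by (intro power_mono) auto
      moreover have "(norm (\<chi> i. sgn (W z) \<bullet> HH i z))\<^sup>2 = JJ z" by (simp add: norm_vec_def L2_set_def JJ_def sum_nonneg)
      ultimately show ?thesis by (simp add: power_mult_distrib mult_ac)
    qed
    have "(BW z - (\<beta> / (q - 2 + 2)) *\<^sub>R V z) \<bullet> ((\<eta> x)\<^sup>2 *\<^sub>R (V z + (q - 2) *\<^sub>R Q) + (2 * \<eta> x) *\<^sub>R S)
       - (1 - \<beta> / (q - 2 + 2)) * ((\<eta> x)\<^sup>2 * (II z + (q - 2) * JJ z) + 2 * \<eta> x * R)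
      \<le> (\<eta> x)\<^sup>2 * (((q - 2 + 2 - 1) / (2 * \<beta>) + 4 * \<epsilon>) * (norm (BW z))\<^sup>2 - (q - 2 + 2 - 1) / 2 * \<beta> * JJ z
         - (1 - \<beta> - \<epsilon> * (4 * real CARD('d) + 1)) * II z - \<epsilon> * (norm (V z - BW z))\<^sup>2)
      + 2 / \<epsilon> * ((norm (d\<eta> x))\<^sup>2 * (norm (W z))\<^sup>2)"
      by (rule energy_density_bound[OF _ \<beta> QJ JJ_le_II V_II Sb Rb \<epsilon>]) (use q2 in simp)
    then have key: "(BW z - \<kappa> *\<^sub>R V z) \<bullet> ((\<eta> x)\<^sup>2 *\<^sub>R (V z + (q - 2) *\<^sub>R Q) + (2 * \<eta> x) *\<^sub>R S)
       - (1 - \<kappa>) * ((\<eta> x)\<^sup>2 * (II z + (q - 2) * JJ z) + 2 * \<eta> x * R)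
      \<le> (\<eta> x)\<^sup>2 * (A * (norm (BW z))\<^sup>2 - A2 * JJ z - c * II z - \<epsilon> * (norm (P z))\<^sup>2)
      + 2 / \<epsilon> * ((norm (d\<eta> x))\<^sup>2 * (norm (W z))\<^sup>2)" (is "?l \<le> ?r")
      unfolding \<kappa>_def A_def A2_def c_def PV by simp
    have BWb: "N z * (norm (BW z))\<^sup>2 \<le> (norm (B z))\<^sup>2 * norm (W z) powr q"
    proof -
      have "norm (BW z) \<le> norm (B z) * norm (W z)" unfolding BW_def by (rule norm_sum_scaleR_le)
      then have "(norm (BW z))\<^sup>2 \<le> (norm (B z) * norm (W z))\<^sup>2" by (intro power_mono) auto
      then have "N z * (norm (BW z))\<^sup>2 \<le> N z * (norm (B z) * norm (W z))\<^sup>2" by (intro mult_left_mono N_nonneg)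
      also have "\<dots> = (norm (B z))\<^sup>2 * (N z * (norm (W z))\<^sup>2)" by (simp add: power_mult_distrib mult_ac)
      finally show ?thesis by (simp only: N_norm)
    qed
    have "- (Dv z \<bullet> P z) + (1 - \<kappa>) * (V z \<bullet> Dv z - \<rho> z) = (BW z - \<kappa> *\<^sub>R V z) \<bullet> Dv z - (1 - \<kappa>) * \<rho> z"
      unfolding PV by (simp add: inner_diff_left inner_diff_right inner_commute algebra_simps)
    also have "\<dots> = N z * ?l"
      unfolding D r by (simp only: inner_scaleR_right right_diff_distrib mult_ac)
    also have "\<dots> \<le> N z * ?r" using key N_nonneg by (rule mult_left_mono)
    also have "\<dots> = (A * (\<eta> x)\<^sup>2) * (N z * (norm (BW z))\<^sup>2) - A2 * fJ z - c * fI z - \<epsilon> * fP z + 2 / \<epsilon> * ((norm (d\<eta> x))\<^sup>2 * (N z * (norm (W z))\<^sup>2))"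
      unfolding fJ_def fI_def fP_def z_def snd_conv by (simp only: algebra_simps)
    also have "\<dots> \<le> (A * (\<eta> x)\<^sup>2) * ((norm (B z))\<^sup>2 * norm (W z) powr q) - A2 * fJ z - c * fI z - \<epsilon> * fP z + 2 / \<epsilon> * ((norm (d\<eta> x))\<^sup>2 * (N z * (norm (W z))\<^sup>2))"
      using mult_left_mono[OF BWb, of "A * (\<eta> x)\<^sup>2"] A0 by simp
    also have "\<dots> = A * fB z - A2 * fJ z - c * fI z - \<epsilon> * fP z + 2 / \<epsilon> * fE z"
      unfolding N_norm by (simp add: fB_def fE_def z_def mult_ac)
    finally show "- (Dv (\<tau>, x) \<bullet> P (\<tau>, x)) + (1 - \<kappa>) * (V (\<tau>, x) \<bullet> Dv (\<tau>, x) - \<rho> (\<tau>, x)) \<le>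
      A * fB (\<tau>, x) - A2 * fJ (\<tau>, x) - c * fI (\<tau>, x) - \<epsilon> * fP (\<tau>, x) + 2 / \<epsilon> * fE (\<tau>, x)"
      unfolding z_def .
  qed
  also have "\<dots> = A * integral UNIV (\<lambda>x. fB (\<tau>, x)) - A2 * integral UNIV (\<lambda>x. fJ (\<tau>, x))
      - c * integral UNIV (\<lambda>x. fI (\<tau>, x)) - \<epsilon> * integral UNIV (\<lambda>x. fP (\<tau>, x))
      + 2 / \<epsilon> * integral UNIV (\<lambda>x. fE (\<tau>, x))"
    using iF integrable_cmul[OF iF(1), of A] integrable_cmul[OF iF(2), of A2] integrable_cmul[OF iF(3), of c]
      integrable_cmul[OF iF(4), of \<epsilon>] integrable_cmul[OF iF(5), of "2 / \<epsilon>"]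
    by (simp add: integral_add integral_diff integrable_add integrable_diff)
  finally have "- integral UNIV (\<lambda>x. Dv (\<tau>, x) \<bullet> P (\<tau>, x)) \<le> A * integral UNIV (\<lambda>x. fB (\<tau>, x)) - A2 * integral UNIV (\<lambda>x. fJ (\<tau>, x))
      - c * integral UNIV (\<lambda>x. fI (\<tau>, x)) - \<epsilon> * integral UNIV (\<lambda>x. fP (\<tau>, x))
      + 2 / \<epsilon> * integral UNIV (\<lambda>x. fE (\<tau>, x))" .
  from mult_left_mono[OF this, of q] q2 show ?thesis unfolding A_def A2_def c_def by simp
qed

end

subsection \<open>The energy estimate\<close>

text \<open>For \<epsilon> = 0 the last condition says that \<delta> q^2/4 \<le> \<beta>^2. It holds
  strictly when \<beta> lies strictly between q sqrt \<delta> / 2 and 1, here the midpoint, and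
  strict inequalities persist for small \<epsilon> > 0.\<close>

lemma energy_constants:
  fixes q \<delta> d :: real
  assumes q: "2 < q" and \<delta>: "0 < \<delta>" and small: "q * sqrt \<delta> / 2 < 1" and d: "0 < d"
  obtains \<beta> \<epsilon> where "0 < \<beta>" "\<beta> < 1" "0 < \<epsilon>" "0 < 1 - \<beta> - \<epsilon> * (4 * d + 1)"
    "((q - 1) / (2 * \<beta>) + 4 * \<epsilon>) * (\<delta> * (1 + \<epsilon>) * (q\<^sup>2 / 4)) \<le> (q - 1) / 2 * \<beta>"
proof -
  define \<beta>0 where "\<beta>0 = q * sqrt \<delta> / 2"
  have \<beta>0: "0 < \<beta>0" "\<beta>0 < 1" using q \<delta> small by (simp_all add: \<beta>0_def)
  have sq: "\<beta>0\<^sup>2 = \<delta> * (q\<^sup>2 / 4)" using \<delta> by (simp add: \<beta>0_def power_mult_distrib power_divide)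
  define \<beta> where "\<beta> = (1 + \<beta>0) / 2"
  have \<beta>: "\<beta>0 < \<beta>" "\<beta> < 1" "0 < \<beta>" using \<beta>0 by (simp_all add: \<beta>_def)
  have lt: "((q - 1) / (2 * \<beta>) + 4 * 0) * (\<delta> * (1 + 0) * (q\<^sup>2 / 4)) < (q - 1) / 2 * \<beta>"
  proof -
    have "\<beta>0\<^sup>2 < \<beta>\<^sup>2" using \<beta> \<beta>0 by (intro power_strict_mono) auto
    then have "(q - 1) / (2 * \<beta>) * \<beta>0\<^sup>2 < (q - 1) / (2 * \<beta>) * \<beta>\<^sup>2"
      using q \<beta> by (intro mult_strict_left_mono) auto
    also have "\<dots> = (q - 1) / 2 * \<beta>" using \<beta> by (simp add: power2_eq_square)
    finally show ?thesis by (simp add: sq)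
  qed
  have "((\<lambda>\<epsilon>. ((q - 1) / (2 * \<beta>) + 4 * \<epsilon>) * (\<delta> * (1 + \<epsilon>) * (q\<^sup>2 / 4))) \<longlongrightarrow> ((q - 1) / (2 * \<beta>) + 4 * 0) * (\<delta> * (1 + 0) * (q\<^sup>2 / 4))) (at_right 0)"
    by (intro tendsto_intros)
  then have e1: "\<forall>\<^sub>F \<epsilon> in at_right 0. ((q - 1) / (2 * \<beta>) + 4 * \<epsilon>) * (\<delta> * (1 + \<epsilon>) * (q\<^sup>2 / 4)) < (q - 1) / 2 * \<beta>"
    using lt by (rule order_tendstoD(2))
  have "((\<lambda>\<epsilon>. 1 - \<beta> - \<epsilon> * (4 * d + 1)) \<longlongrightarrow> 1 - \<beta> - 0 * (4 * d + 1)) (at_right 0)"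
    by (intro tendsto_intros)
  then have e2: "\<forall>\<^sub>F \<epsilon> in at_right 0. 0 < 1 - \<beta> - \<epsilon> * (4 * d + 1)"
    by (rule order_tendstoD(1)) (use \<beta> in simp)
  have e3: "\<forall>\<^sub>F \<epsilon> in at_right 0. (0::real) < \<epsilon>" by (simp add: eventually_at_right_less)
  have "\<forall>\<^sub>F \<epsilon> in at_right 0. 0 < \<epsilon> \<and> 0 < 1 - \<beta> - \<epsilon> * (4 * d + 1) \<and>
     ((q - 1) / (2 * \<beta>) + 4 * \<epsilon>) * (\<delta> * (1 + \<epsilon>) * (q\<^sup>2 / 4)) < (q - 1) / 2 * \<beta>"
    using e1 e2 e3 by eventually_elim auto
  then obtain \<epsilon> where "0 < \<epsilon> \<and> 0 < 1 - \<beta> - \<epsilon> * (4 * d + 1) \<and>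
     ((q - 1) / (2 * \<beta>) + 4 * \<epsilon>) * (\<delta> * (1 + \<epsilon>) * (q\<^sup>2 / 4)) < (q - 1) / 2 * \<beta>"
    using eventually_happens'[OF trivial_limit_at_right_real] by blast
  then show ?thesis using that[of \<beta> \<epsilon>] \<beta> by simp
qed

text \<open>The kernel is only integrable, so the interval is split into pieces on which it has mass at
  most \<open>1/2\<close>, at the cost of a factor \<open>2\<close> for each piece.\<close>

lemma gronwall_integrable_kernel:
  fixes f g :: "real \<Rightarrow> real"
  assumes "a \<le> b" and "continuous_on {a..b} f" and "\<And>t. t \<in> {a..b} \<Longrightarrow> 0 \<le> f t"
    and "\<And>t. 0 \<le> g t" and "g integrable_on {a..b}" and "(\<lambda>t. g t * f t) integrable_on {a..b}"
    and "\<And>t. t \<in> {a..b} \<Longrightarrow> f t \<le> C + integral {a..t} (\<lambda>r. g r * f r)"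
    and "integral {a..b} g \<le> real N / 2"
    and "t \<in> {a..b}"
  shows "f t \<le> 2 ^ Suc N * C"
  using assms
proof (induction N arbitrary: a C t)
  \<comment> \<open>With kernel mass at most 1/2, the inequality at a maximum point of
    \<open>f\<close> reads f(m) \<le> C + f(m)/2.\<close>
  have short: "f t \<le> 2 * C"
    if ab: "a \<le> b" and cf: "continuous_on {a..b} f" and f0: "\<And>t. t \<in> {a..b} \<Longrightarrow> 0 \<le> f t"
    and g0: "\<And>t. 0 \<le> g t" and gi: "g integrable_on {a..b}" and gfi: "(\<lambda>t. g t * f t) integrable_on {a..b}"
    and ineq: "\<And>t. t \<in> {a..b} \<Longrightarrow> f t \<le> C + integral {a..t} (\<lambda>r. g r * f r)"
    and half: "integral {a..b} g \<le> 1 / 2" and t: "t \<in> {a..b}" for a b C t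
  proof -
    obtain m where m: "m \<in> {a..b}" "\<And>r. r \<in> {a..b} \<Longrightarrow> f r \<le> f m"
      using continuous_attains_sup[OF _ _ cf] ab by auto
    have sub: "{a..m} \<subseteq> {a..b}" using m by auto
    have gi': "g integrable_on {a..m}" and gfi': "(\<lambda>t. g t * f t) integrable_on {a..m}"
      using integrable_on_subinterval[OF gi sub] integrable_on_subinterval[OF gfi sub] by auto
    have "integral {a..m} (\<lambda>r. g r * f r) \<le> integral {a..m} (\<lambda>r. f m * g r)"
    proof (rule integral_le[OF gfi'])
      show "(\<lambda>r. f m * g r) integrable_on {a..m}" using integrable_cmul[OF gi', of "f m"] by simp
      show "g r * f r \<le> f m * g r" if "r \<in> {a..m}" for r
        using mult_right_mono[OF m(2)[of r] g0[of r]] that m(1) by (simp add: mult.commute)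
    qed
    also have "\<dots> = f m * integral {a..m} g" by simp
    also have "\<dots> \<le> f m * (1 / 2)"
    proof (rule mult_left_mono)
      have "integral {a..m} g \<le> integral {a..b} g"
        by (rule integral_subset_le[OF sub gi' gi]) (use g0 in auto)
      then show "integral {a..m} g \<le> 1 / 2" using half by linarith
      show "0 \<le> f m" by (rule f0[OF m(1)])
    qed
    finally have "f m \<le> 2 * C" using ineq[OF m(1)] by simp
    then show ?thesis using m(2)[OF t] by linarith
  qed
  {
    case 0
    then show ?case using short[of a b C t] by simp
  next
    case (Suc N)
    note ab = Suc.prems(1) and cf = Suc.prems(2) and f0 = Suc.prems(3) and g0 = Suc.prems(4)
      and gi = Suc.prems(5) and gfi = Suc.prems(6) and ineq = Suc.prems(7) and N = Suc.prems(8) and t = Suc.prems(9)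
    have C0: "0 \<le> C" using ineq[of a] f0[of a] ab by simp
    show ?case
    proof (cases "integral {a..b} g \<le> 1 / 2")
      case True
      have "f t \<le> 2 * C" by (rule short[OF ab cf f0 g0 gi gfi ineq True t])
      also have "\<dots> \<le> 2 ^ Suc (Suc N) * C"
        using C0 one_le_power[of "2::real" "Suc N"] by (intro mult_right_mono) auto
      finally show ?thesis .
    next
      case False
      have ci: "continuous_on {a..b} (\<lambda>x. integral {a..x} g)" by (rule indefinite_integral_continuous_1[OF gi])
      \<comment> \<open>The point where mass 1/2 has been used up, by the intermediate value
        theorem.\<close>
      obtain m where m: "a \<le> m" "m \<le> b" "integral {a..m} g = 1 / 2"
        using IVT'[of "\<lambda>x. integral {a..x} g" a "1 / 2" b] ci ab False by auto
      have sub1: "{a..m} \<subseteq> {a..b}" and sub2: "{m..b} \<subseteq> {a..b}" using m by auto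
      have i1: "g integrable_on {a..m}" "(\<lambda>t. g t * f t) integrable_on {a..m}"
        using integrable_on_subinterval[OF gi sub1] integrable_on_subinterval[OF gfi sub1] by auto
      have i2: "g integrable_on {m..b}" "(\<lambda>t. g t * f t) integrable_on {m..b}"
        using integrable_on_subinterval[OF gi sub2] integrable_on_subinterval[OF gfi sub2] by auto
      have low: "f r \<le> 2 * C" if r: "r \<in> {a..m}" for r
      proof (rule short[OF m(1) continuous_on_subset[OF cf sub1] _ g0 i1 _ _ r])
        fix r assume "r \<in> {a..m}"
        then have "r \<in> {a..b}" using sub1 by blast
        then show "0 \<le> f r" "f r \<le> C + integral {a..r} (\<lambda>r. g r * f r)" by (rule f0, rule ineq)
      qed (use m in simp)
      \<comment> \<open>On the first piece \<open>f\<close> \<le> 2 C and the mass is 1/2, so this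
        part of the integral adds at most \<open>C\<close>. The inequality restarts at
        \<open>m\<close> with 2 C in place of \<open>C\<close>.\<close>
      have first: "integral {a..m} (\<lambda>r. g r * f r) \<le> C"
      proof -
        have "integral {a..m} (\<lambda>r. g r * f r) \<le> integral {a..m} (\<lambda>r. 2 * C * g r)"
        proof (rule integral_le[OF i1(2)])
          show "(\<lambda>r. 2 * C * g r) integrable_on {a..m}" using integrable_cmul[OF i1(1), of "2 * C"] by simp
          show "g r * f r \<le> 2 * C * g r" if "r \<in> {a..m}" for r
            using mult_right_mono[OF low[OF that] g0[of r]] by (simp add: mult.commute)
        qed
        also have "\<dots> = 2 * C * integral {a..m} g" by simp
        finally show ?thesis by (simp add: m)
      qed
      have split: "integral {a..r} F = integral {a..m} F + integral {m..r} F" if "F integrable_on {a..b}" "r \<in> {m..b}"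
        for F :: "real \<Rightarrow> real" and r
        using Henstock_Kurzweil_Integration.integral_combine[of a m r F] that m integrable_on_subinterval[OF that(1), of a r] by simp
      have second: "f r \<le> 2 ^ Suc N * (2 * C)" if r: "r \<in> {m..b}" for r
      proof (rule Suc.IH[OF m(2) continuous_on_subset[OF cf sub2] _ g0 i2 _ _ r])
        fix r assume r: "r \<in> {m..b}"
        then have r': "r \<in> {a..b}" using sub2 by blast
        show "0 \<le> f r" by (rule f0[OF r'])
        show "f r \<le> 2 * C + integral {m..r} (\<lambda>r. g r * f r)"
          using ineq[OF r'] first split[OF gfi r] by linarith
      next
        show "integral {m..b} g \<le> real N / 2" using split[OF gi, of b] m N by simp
      qed
      show ?thesis
      proof (cases "t \<le> m")
        case True
        then have "f t \<le> 2 * C" using t by (intro low) auto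
        also have "\<dots> \<le> 2 ^ Suc (Suc N) * C"
          using C0 one_le_power[of "2::real" "Suc N"] by (intro mult_right_mono) auto
        finally show ?thesis .
      next
        case False
        then show ?thesis using second[of t] t by simp
      qed
    qed
  }
qed

lemma norm_vec_sq: "(norm (y :: real^'d::finite))\<^sup>2 = (\<Sum>i\<in>UNIV. (y $ i)\<^sup>2)"
  unfolding power2_norm_eq_inner inner_vec_def by (simp add: power2_eq_square)

section \<open>The form bound applied to the localized energy\<close>

context cutoff_energy
begin

lemma c_integral: "continuous_on ST F \<Longrightarrow> (\<And>z. snd z \<notin> cbox a b \<Longrightarrow> F z = 0) \<Longrightarrow> continuous_on {s<..} (\<lambda>\<tau>. integral UNIV (\<lambda>x. F (\<tau>, x)))"
  for F :: "real \<times> (real^'d) \<Rightarrow> real"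
  by (rule continuous_on_integral_supp[of _ F a b]) auto

abbreviation "tint \<equiv> \<lambda>F s1 t1. integral {s1..t1} (\<lambda>\<tau>. integral UNIV (\<lambda>x. F (\<tau>, x :: real^'d)))"

lemma tint_has_integral:
  fixes F :: "real \<times> (real^'d) \<Rightarrow> real"
  assumes "continuous_on ST F" "\<And>z. snd z \<notin> cbox a b \<Longrightarrow> F z = 0" "s < s1"
  shows "((\<lambda>\<tau>. integral UNIV (\<lambda>x. F (\<tau>, x))) has_integral tint F s1 t1) {s1..t1}"
  by (rule integrable_integral[OF integrable_continuous_real[OF continuous_on_subset[OF c_integral[OF assms(1,2)]]]])
    (use assms(3) in auto)

lemma c\<Phi>: "continuous_on {s<..} \<Phi>"
  using c_integral[OF \<Phi>_cont_integrand] supp\<eta> by (simp add: \<Phi>_def[abs_def])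

lemma \<Phi>_nonneg: "0 \<le> \<Phi> \<tau>"
  unfolding \<Phi>_def by (intro integral_nonneg_total) auto

lemma \<Phi>_increment:
  assumes \<beta>: "0 < \<beta>" "\<beta> < 1" and \<epsilon>: "0 < \<epsilon>" and t: "s < s1" "s1 \<le> t1"
  shows "\<Phi> t1 - \<Phi> s1 \<le>
    q * (((q - 1) / (2 * \<beta>) + 4 * \<epsilon>) * tint fB s1 t1 - (q - 1) / 2 * \<beta> * tint fJ s1 t1
      - (1 - \<beta> - \<epsilon> * (4 * real CARD('d) + 1)) * tint fI s1 t1 - \<epsilon> * tint fP s1 t1 + 2 / \<epsilon> * tint fE s1 t1)"
proof (rule has_integral_le)
  show "((\<lambda>\<tau>. - q * integral UNIV (\<lambda>x. Dv (\<tau>, x) \<bullet> P (\<tau>, x))) has_integral \<Phi> t1 - \<Phi> s1) {s1..t1}"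
  proof (rule fundamental_theorem_of_calculus[OF t(2)])
    fix \<tau> assume "\<tau> \<in> {s1..t1}"
    then have "s < \<tau>" using t by auto
    from \<Phi>_derivative[OF this]
    show "(\<Phi> has_vector_derivative - q * integral UNIV (\<lambda>x. Dv (\<tau>, x) \<bullet> P (\<tau>, x))) (at \<tau> within {s1..t1})"
      by (auto simp: has_real_derivative_iff_has_vector_derivative intro: has_vector_derivative_at_within)
  qed
  show "((\<lambda>\<tau>. q * (((q - 1) / (2 * \<beta>) + 4 * \<epsilon>) * integral UNIV (\<lambda>x. fB (\<tau>, x)) - (q - 1) / 2 * \<beta> * integral UNIV (\<lambda>x. fJ (\<tau>, x))
      - (1 - \<beta> - \<epsilon> * (4 * real CARD('d) + 1)) * integral UNIV (\<lambda>x. fI (\<tau>, x)) - \<epsilon> * integral UNIV (\<lambda>x. fP (\<tau>, x))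
      + 2 / \<epsilon> * integral UNIV (\<lambda>x. fE (\<tau>, x)))) has_integral
    q * (((q - 1) / (2 * \<beta>) + 4 * \<epsilon>) * tint fB s1 t1 - (q - 1) / 2 * \<beta> * tint fJ s1 t1
      - (1 - \<beta> - \<epsilon> * (4 * real CARD('d) + 1)) * tint fI s1 t1 - \<epsilon> * tint fP s1 t1 + 2 / \<epsilon> * tint fE s1 t1)) {s1..t1}"
    by (intro has_integral_mult_right has_integral_add has_integral_diff tint_has_integral t cfB cfJ cfI cfP cfE f_supp)
  fix \<tau> assume "\<tau> \<in> {s1..t1}"
  then have "s < \<tau>" using t by auto
  then show "- q * integral UNIV (\<lambda>x. Dv (\<tau>, x) \<bullet> P (\<tau>, x)) \<le> q * (((q - 1) / (2 * \<beta>) + 4 * \<epsilon>) * integral UNIV (\<lambda>x. fB (\<tau>, x)) - (q - 1) / 2 * \<beta> * integral UNIV (\<lambda>x. fJ (\<tau>, x))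
      - (1 - \<beta> - \<epsilon> * (4 * real CARD('d) + 1)) * integral UNIV (\<lambda>x. fI (\<tau>, x)) - \<epsilon> * integral UNIV (\<lambda>x. fP (\<tau>, x))
      + 2 / \<epsilon> * integral UNIV (\<lambda>x. fE (\<tau>, x)))"
    by (rule \<Phi>_rate[OF \<beta> \<epsilon>])
qed

text \<open>The function inserted in the form bound: its square is the energy density, and
  \<open>Dkk\<close> is its spatial gradient, written with \<open>sgn\<close> so that zeros of w do
  no harm.\<close>

definition kk :: "real \<Rightarrow> real^'d \<Rightarrow> real" where "kk \<tau> x = \<eta> x * norm (W (\<tau>, x)) powr (q / 2)"
definition Dkk :: "real \<Rightarrow> real^'d \<Rightarrow> real^'d" where
  "Dkk \<tau> x = (\<chi> i. \<eta> x * (q / 2 * (norm (W (\<tau>, x)) powr ((q - 2) / 2) * (sgn (W (\<tau>, x)) \<bullet> HH i (\<tau>, x)))) +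
     norm (W (\<tau>, x)) powr (q / 2) * d\<eta> x $ i)"

lemma kk_deriv:
  assumes t: "s < \<tau>"
  shows "has_dir_deriv (axis i 1) (kk \<tau>) (\<lambda>x. Dkk \<tau> x $ i)"
  unfolding has_dir_deriv_def
proof
  fix x
  let ?l = "\<lambda>r. x + r *\<^sub>R axis i (1::real)"
  have dw: "((\<lambda>r. W (\<tau>, ?l r)) has_derivative (\<lambda>r. r *\<^sub>R HH i (\<tau>, x))) (at 0)"
    using W_deriv[OF t, of i] unfolding has_dir_deriv_def has_vector_derivative_def by blast
  have de: "((\<lambda>r. \<eta> (?l r)) has_derivative (\<lambda>r. r *\<^sub>R d\<eta> x $ i)) (at 0)"
    using d\<eta>[of i] unfolding has_dir_deriv_def has_vector_derivative_def by blast
  have q1: "1 < q / 2" "q / 2 - 1 = (q - 2) / 2" using q2 by (simp_all add: field_simps)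
  have "((\<lambda>r. norm (W (\<tau>, ?l r)) powr (q / 2)) has_derivative
    (\<lambda>r. q / 2 * norm (W (\<tau>, x)) powr ((q - 2) / 2) * (sgn (W (\<tau>, x)) \<bullet> (r *\<^sub>R HH i (\<tau>, x))))) (at 0)"
    using has_derivative_compose[OF dw has_derivative_norm_powr[OF q1(1)]] by (simp add: q1(2))
  from has_derivative_mult[OF de this]
  show "((\<lambda>r. kk \<tau> (?l r)) has_vector_derivative Dkk \<tau> x $ i) (at 0)"
    unfolding has_vector_derivative_def kk_def Dkk_def
    by (rule has_derivative_eq_rhs) (auto simp: fun_eq_iff algebra_simps)
qed

lemma kk_sq: "(kk \<tau> x)\<^sup>2 = (\<eta> x)\<^sup>2 * norm (W (\<tau>, x)) powr q"
proof -
  have "(norm (W (\<tau>, x)) powr (q / 2))\<^sup>2 = norm (W (\<tau>, x)) powr (q / 2 + q / 2)"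
    unfolding power2_eq_square by (rule powr_add[symmetric])
  then show ?thesis by (simp add: kk_def power_mult_distrib)
qed

text \<open>Differentiating |w|^(q/2) produces the factor q^2/4 in front of \<open>fJ\<close>; this
  is where the condition on q sqrt \<delta> / 2 originates. The share \<epsilon> separates the
  gradient of the cutoff.\<close>

lemma Dkk_sq:
  assumes \<epsilon>: "0 < \<epsilon>"
  shows "(norm (Dkk \<tau> x))\<^sup>2 \<le> (1 + \<epsilon>) * (q\<^sup>2 / 4) * fJ (\<tau>, x) + (1 + 1 / \<epsilon>) * fE (\<tau>, x)"
proof -
  define y1 where "y1 = (\<chi> i. \<eta> x * (q / 2 * (norm (W (\<tau>, x)) powr ((q - 2) / 2) * (sgn (W (\<tau>, x)) \<bullet> HH i (\<tau>, x)))))"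
  define y2 where "y2 = norm (W (\<tau>, x)) powr (q / 2) *\<^sub>R d\<eta> x"
  have "Dkk \<tau> x = y1 + y2" by (simp add: Dkk_def y1_def y2_def vec_eq_iff)
  then have "(norm (Dkk \<tau> x))\<^sup>2 \<le> (1 + \<epsilon>) * (norm y1)\<^sup>2 + (1 + 1 / \<epsilon>) * (norm y2)\<^sup>2"
    using norm_sum_sq_le[OF \<epsilon>] by simp
  moreover have "(norm y1)\<^sup>2 = q\<^sup>2 / 4 * fJ (\<tau>, x)"
  proof -
    have "(norm y1)\<^sup>2 = (\<Sum>i\<in>UNIV. (\<eta> x * (q / 2 * (norm (W (\<tau>, x)) powr ((q - 2) / 2) * (sgn (W (\<tau>, x)) \<bullet> HH i (\<tau>, x)))))\<^sup>2)"
      unfolding norm_vec_sq y1_def by simp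
    also have "\<dots> = (\<Sum>i\<in>UNIV. q\<^sup>2 / 4 * ((\<eta> x)\<^sup>2 * (N (\<tau>, x) * (sgn (W (\<tau>, x)) \<bullet> HH i (\<tau>, x))\<^sup>2)))"
      by (simp add: N_half power_mult_distrib power_divide mult_ac)
    also have "\<dots> = q\<^sup>2 / 4 * fJ (\<tau>, x)" by (simp add: fJ_def JJ_def sum_distrib_left)
    finally show ?thesis .
  qed
  moreover have "(norm y2)\<^sup>2 = fE (\<tau>, x)"
  proof -
    have "(norm (W (\<tau>, x)) powr (q / 2))\<^sup>2 = norm (W (\<tau>, x)) powr (q / 2 + q / 2)"
      unfolding power2_eq_square by (rule powr_add[symmetric])
    then show ?thesis by (simp add: y2_def fE_def power_mult_distrib)
  qed
  ultimately show ?thesis by (simp add: mult.assoc)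
qed

lemma form_bound_energy:
  assumes form: "\<And>f. schwartz f \<Longrightarrow> form_ineq \<delta> g B t f"
    and gm: "g \<in> borel_measurable borel" and g: "\<And>\<tau>. 0 \<le> g \<tau>" and \<delta>: "0 \<le> \<delta>"
    and gfin: "(\<integral>\<^sup>+\<tau>\<in>{0..t}. ennreal (g \<tau>) \<partial>lborel) < \<infinity>"
    and st: "0 \<le> s" "s < s1" "s1 \<le> t1" "t1 \<le> t" and \<epsilon>: "0 < \<epsilon>"
  shows "tint fB s1 t1 \<le> \<delta> * (1 + \<epsilon>) * (q\<^sup>2 / 4) * tint fJ s1 t1 + \<delta> * (1 + 1 / \<epsilon>) * tint fE s1 t1
     + integral {s1..t1} (\<lambda>\<tau>. g \<tau> * \<Phi> \<tau>)"
proof -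
  have sub: "{s1..t1} \<times> (UNIV :: (real^'d) set) \<subseteq> ST" using st by auto
  have ck: "continuous_on ST (\<lambda>z. kk (fst z) (snd z))"
    unfolding kk_def using q2 by (auto intro!: continuous_on_mult c\<eta>' continuous_on_norm_powr cW)
  have cD: "continuous_on ST (\<lambda>z. Dkk (fst z) (snd z))"
  proof -
    have "continuous_on ST (\<lambda>z. norm (W z) powr ((q - 2) / 2) * (sgn (W z) \<bullet> HH i z))" for i
      using q2 by (intro continuous_on_norm_powr_sgn(1) cW cHH) simp
    moreover have "continuous_on ST (\<lambda>z. norm (W z) powr (q / 2))"
      using q2 by (intro continuous_on_norm_powr cW) simp
    ultimately show ?thesis
      unfolding Dkk_def prod.collapse
      by (intro continuous_on_vec_lambda continuous_on_add continuous_on_mult[OF c\<eta>'] continuous_on_mult[OF continuous_on_const]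
          continuous_on_mult[OF _ continuous_on_component[OF cd\<eta>']])
  qed
  have main: "integral {s1..t1} (\<lambda>\<tau>. integral UNIV (\<lambda>x. (norm (B (\<tau>, x)))\<^sup>2 * (kk \<tau> x)\<^sup>2))
     \<le> \<delta> * integral {s1..t1} (\<lambda>\<tau>. integral UNIV (\<lambda>x. (norm (Dkk \<tau> x))\<^sup>2))
       + integral {s1..t1} (\<lambda>\<tau>. g \<tau> * integral UNIV (\<lambda>x. (kk \<tau> x)\<^sup>2))"
  proof (rule form_bound_time_slab[OF form cB gm BM g \<delta> gfin _ st(3,4), where a=a and b=b])
    show "continuous_on ({s1..t1} \<times> UNIV) (\<lambda>(\<tau>, x). kk \<tau> x)"
      using continuous_on_subset[OF ck sub] by (simp add: split_beta)
    show "continuous_on ({s1..t1} \<times> UNIV) (\<lambda>(\<tau>, x). Dkk \<tau> x)"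
      using continuous_on_subset[OF cD sub] by (simp add: split_beta)
    show "has_dir_deriv (axis i 1) (kk \<tau>) (\<lambda>x. Dkk \<tau> x $ i)" if "\<tau> \<in> {s1..t1}" for \<tau> i
      using that st by (intro kk_deriv) auto
    show "kk \<tau> x = 0" if "x \<notin> cbox a b" for \<tau> x using supp\<eta>[OF that] by (simp add: kk_def)
  qed (use st in auto)
  have e1: "integral {s1..t1} (\<lambda>\<tau>. integral UNIV (\<lambda>x. (norm (B (\<tau>, x)))\<^sup>2 * (kk \<tau> x)\<^sup>2)) = tint fB s1 t1"
    by (simp add: fB_def kk_sq)
  have e3: "integral UNIV (\<lambda>x. (kk \<tau> x)\<^sup>2) = \<Phi> \<tau>" for \<tau> by (simp add: \<Phi>_def kk_sq)
  define F where "F z = (norm (Dkk (fst z) (snd z)))\<^sup>2" for z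
  have cF: "continuous_on ST F" unfolding F_def[abs_def] by (intro continuous_intros cD)
  have sF: "F z = 0" if "snd z \<notin> cbox a b" for z
    using supp\<eta>[OF that] d\<eta>_supp[OF that] by (simp add: F_def Dkk_def norm_vec_def L2_set_def)
  have e2: "tint F s1 t1 \<le> (1 + \<epsilon>) * (q\<^sup>2 / 4) * tint fJ s1 t1 + (1 + 1 / \<epsilon>) * tint fE s1 t1"
  proof (rule has_integral_le)
    show "((\<lambda>\<tau>. integral UNIV (\<lambda>x. F (\<tau>, x))) has_integral tint F s1 t1) {s1..t1}"
      by (rule tint_has_integral[OF cF sF st(2)])
    show "((\<lambda>\<tau>. (1 + \<epsilon>) * (q\<^sup>2 / 4) * integral UNIV (\<lambda>x. fJ (\<tau>, x)) + (1 + 1 / \<epsilon>) * integral UNIV (\<lambda>x. fE (\<tau>, x))) has_integral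
       (1 + \<epsilon>) * (q\<^sup>2 / 4) * tint fJ s1 t1 + (1 + 1 / \<epsilon>) * tint fE s1 t1) {s1..t1}"
      by (intro has_integral_mult_right has_integral_add tint_has_integral st cfJ cfE f_supp)
    fix \<tau> assume "\<tau> \<in> {s1..t1}"
    then have t: "s < \<tau>" using st by auto
    have i: "(\<lambda>x. F (\<tau>, x)) integrable_on UNIV" by (rule int[OF cF t sF])
    have i1: "(\<lambda>x. fJ (\<tau>, x)) integrable_on UNIV" by (rule int[OF cfJ t f_supp(2)])
    have i2: "(\<lambda>x. fE (\<tau>, x)) integrable_on UNIV" by (rule int[OF cfE t f_supp(5)])
    note i3 = integrable_cmul[OF i1, of "(1 + \<epsilon>) * (q\<^sup>2 / 4)"] integrable_cmul[OF i2, of "1 + 1 / \<epsilon>"]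
    note i3 = i3[unfolded real_scaleR_def]
    have "integral UNIV (\<lambda>x. F (\<tau>, x)) \<le> integral UNIV (\<lambda>x. (1 + \<epsilon>) * (q\<^sup>2 / 4) * fJ (\<tau>, x) + (1 + 1 / \<epsilon>) * fE (\<tau>, x))"
      by (rule integral_le[OF i integrable_add[OF i3]]) (simp only: F_def fst_conv snd_conv Dkk_sq[OF \<epsilon>])
    also have "\<dots> = (1 + \<epsilon>) * (q\<^sup>2 / 4) * integral UNIV (\<lambda>x. fJ (\<tau>, x)) + (1 + 1 / \<epsilon>) * integral UNIV (\<lambda>x. fE (\<tau>, x))"
      by (simp only: integral_add[OF i3] integral_mult_right)
    finally show "integral UNIV (\<lambda>x. F (\<tau>, x)) \<le> (1 + \<epsilon>) * (q\<^sup>2 / 4) * integral UNIV (\<lambda>x. fJ (\<tau>, x)) + (1 + 1 / \<epsilon>) * integral UNIV (\<lambda>x. fE (\<tau>, x))" .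
  qed
  have "tint fB s1 t1 \<le> \<delta> * tint F s1 t1 + integral {s1..t1} (\<lambda>\<tau>. g \<tau> * \<Phi> \<tau>)"
    using main unfolding e1 e3 by (simp add: F_def)
  also have "\<dots> \<le> \<delta> * ((1 + \<epsilon>) * (q\<^sup>2 / 4) * tint fJ s1 t1 + (1 + 1 / \<epsilon>) * tint fE s1 t1) + integral {s1..t1} (\<lambda>\<tau>. g \<tau> * \<Phi> \<tau>)"
    using e2 \<delta> by (intro add_right_mono mult_left_mono)
  finally show ?thesis by (simp add: algebra_simps)
qed

lemma tint_nonneg:
  fixes F :: "real \<times> (real^'d) \<Rightarrow> real"
  assumes "\<And>z. 0 \<le> F z"
  shows "0 \<le> tint F s1 t1"
  by (intro integral_nonneg_total assms)

lemma f_nonneg: "0 \<le> fJ z" "0 \<le> fI z" "0 \<le> fP z" "0 \<le> fE z"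
  using N_nonneg[of z] by (simp_all add: fJ_def fI_def fP_def fE_def JJ_def II_def sum_nonneg)

text \<open>The bound on the squared gradient of the cutoff has two parts. The one proportional to
  \<eta>^2 joins the Gronwall kernel; the constant one, combined with the sup bound \<open>K\<close>
  and the volume of the box, forms \<open>Err\<close>. Thus \<open>K\<close> occurs in
  \<open>Err\<close> and nowhere else in the conclusion. The count \<open>N0\<close> bounds the
  kernel mass in units of 1/2.\<close>

lemma energy_estimate:
  fixes \<beta> \<epsilon> \<delta> t k1 k2 K :: real and N0 :: nat
  assumes form: "\<And>f. schwartz f \<Longrightarrow> form_ineq \<delta> g B t f"
    and gm: "g \<in> borel_measurable borel" and g: "\<And>\<tau>. 0 \<le> g \<tau>" and \<delta>: "0 \<le> \<delta>"
    and gfin: "(\<integral>\<^sup>+\<tau>\<in>{0..t}. ennreal (g \<tau>) \<partial>lborel) < \<infinity>"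
    and \<beta>: "0 < \<beta>" "\<beta> < 1" and \<epsilon>: "0 < \<epsilon>"
  defines "c1 \<equiv> 1 - \<beta> - \<epsilon> * (4 * real CARD('d) + 1)"
    and "A \<equiv> (q - 1) / (2 * \<beta>) + 4 * \<epsilon>"
  defines "C \<equiv> q * (A * \<delta> * (1 + 1 / \<epsilon>) + 2 / \<epsilon>)"
  assumes c1: "0 < c1" and A\<delta>: "A * (\<delta> * (1 + \<epsilon>) * (q\<^sup>2 / 4)) \<le> (q - 1) / 2 * \<beta>"
    and st: "0 \<le> s" "s < s1" "s1 \<le> t"
    and k: "\<And>x. (norm (d\<eta> x))\<^sup>2 \<le> k1 * (\<eta> x)\<^sup>2 + k2" "0 \<le> k1" "0 \<le> k2"
    and K: "\<And>\<tau> x. s < \<tau> \<Longrightarrow> norm (grad (u \<tau>) x) \<le> K"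
    and N0: "q * A * integral {0..t} g + C * k1 * t \<le> real N0 / 2"
  defines "Err \<equiv> C * (k2 * K powr q * measure lborel (cbox a b)) * t"
  shows "\<And>\<tau>. \<tau> \<in> {s1..t} \<Longrightarrow> \<Phi> \<tau> \<le> 2 ^ Suc N0 * (\<Phi> s1 + Err)"
    "q * c1 * tint fI s1 t + q * \<epsilon> * tint fP s1 t \<le> (1 + 2 ^ N0 * real N0) * (\<Phi> s1 + Err)"
proof -
  have A0: "0 \<le> A" using q2 \<beta> \<epsilon> by (simp add: A_def)
  have C0: "0 \<le> C" unfolding C_def using A0 \<delta> \<epsilon> q2 by (intro mult_nonneg_nonneg add_nonneg_nonneg) auto
  \<comment> \<open>The kernel: the function from the form bound, with the weight it gets through
    \<open>A\<close>, plus the constant caused by the cutoff.\<close>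
  define G where "G \<tau> = q * A * g \<tau> + C * k1" for \<tau>
  have sub: "{s1..t1} \<subseteq> {0..t}" if "t1 \<le> t" for t1 using st that by auto
  have gi0: "g integrable_on {0..t}"
    using integrable_weighted_continuous(1)[OF gm g gfin, of "\<lambda>_. 1"] by simp
  have gfin': "(\<integral>\<^sup>+\<tau>\<in>{s1..t}. ennreal (g \<tau>) \<partial>lborel) < \<infinity>"
    by (rule le_less_trans[OF nn_integral_mono gfin]) (use sub[OF order_refl] in \<open>auto simp: indicator_def\<close>)
  have c\<Phi>': "continuous_on {s1..t} \<Phi>" by (rule continuous_on_subset[OF c\<Phi>]) (use st in auto)
  have g\<Phi>: "(\<lambda>\<tau>. g \<tau> * \<Phi> \<tau>) integrable_on {s1..t}"
    by (rule integrable_weighted_continuous(1)[OF gm g gfin' c\<Phi>' \<Phi>_nonneg])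
  have \<Phi>i: "\<Phi> integrable_on {s1..t}" by (rule integrable_continuous_real[OF c\<Phi>'])
  have G\<Phi>eq: "(\<lambda>\<tau>. G \<tau> * \<Phi> \<tau>) = (\<lambda>\<tau>. (q * A) *\<^sub>R (g \<tau> * \<Phi> \<tau>) + (C * k1) *\<^sub>R \<Phi> \<tau>)"
    by (auto simp: G_def algebra_simps)
  have G\<Phi>: "(\<lambda>\<tau>. G \<tau> * \<Phi> \<tau>) integrable_on {s1..t}"
    unfolding G\<Phi>eq by (intro integrable_add integrable_cmul g\<Phi> \<Phi>i)
  have Gi: "G integrable_on {s1..t}"
    unfolding G_def
    using integrable_add[OF integrable_cmul[OF integrable_on_subinterval[OF gi0 sub[OF order_refl]], of "q * A"] integrable_const_ivl[of "C * k1" s1 t]]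
    by simp
  have G0: "0 \<le> G \<tau>" for \<tau> unfolding G_def using g A0 C0 k(2) q2 by (intro add_nonneg_nonneg mult_nonneg_nonneg) auto
  have Err0: "0 \<le> Err" unfolding Err_def using C0 k(3) st by (intro mult_nonneg_nonneg) auto
  have Gint: "integral {s1..t} G \<le> real N0 / 2"
  proof -
    have "integral {s1..t} G = q * A * integral {s1..t} g + C * k1 * (t - s1)"
      unfolding G_def using integral_add[OF integrable_cmul[OF integrable_on_subinterval[OF gi0 sub[OF order_refl]], of "q * A"] integrable_const_ivl[of "C * k1" s1 t]] st
      by simp
    also have "\<dots> \<le> q * A * integral {0..t} g + C * k1 * t"
    proof (rule add_mono)
      have "integral {s1..t} g \<le> integral {0..t} g"
        by (rule integral_subset_le[OF sub[OF order_refl] integrable_on_subinterval[OF gi0 sub[OF order_refl]] gi0]) (use g in auto)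
      then show "q * A * integral {s1..t} g \<le> q * A * integral {0..t} g" using q2 A0 by (intro mult_left_mono) auto
      show "C * k1 * (t - s1) \<le> C * k1 * t" using C0 k(2) st by (intro mult_left_mono) auto
    qed
    finally show ?thesis using N0 by linarith
  qed
  \<comment> \<open>The hypothesis on \<open>A\<close> and \<delta> lets the \<open>fJ\<close> part
    of the form bound cancel against the \<open>fJ\<close> part of the rate. Only cutoff errors and
    the kernel remain on the right.\<close>
  have main: "\<Phi> t1 + q * c1 * tint fI s1 t1 + q * \<epsilon> * tint fP s1 t1 \<le> (\<Phi> s1 + Err) + integral {s1..t1} (\<lambda>\<tau>. G \<tau> * \<Phi> \<tau>)"
    if t1: "t1 \<in> {s1..t}" for t1
  proof -
    have t1': "s1 \<le> t1" "t1 \<le> t" using t1 by auto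
    have sub1: "{s1..t1} \<subseteq> {s1..t}" using t1' by auto
    define b0 where "b0 = tint fB s1 t1" define j0 where "j0 = tint fJ s1 t1" define e0 where "e0 = tint fE s1 t1"
    define i0 where "i0 = tint fI s1 t1" define p0 where "p0 = tint fP s1 t1"
    define g0 where "g0 = integral {s1..t1} (\<lambda>\<tau>. g \<tau> * \<Phi> \<tau>)"
    have j0: "0 \<le> j0" unfolding j0_def by (rule tint_nonneg[OF f_nonneg(1)])
    have inc: "\<Phi> t1 - \<Phi> s1 \<le> q * (A * b0 - (q - 1) / 2 * \<beta> * j0 - c1 * i0 - \<epsilon> * p0 + 2 / \<epsilon> * e0)"
      unfolding A_def c1_def b0_def j0_def e0_def i0_def p0_def by (rule \<Phi>_increment[OF \<beta> \<epsilon> st(2) t1'(1)])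
    have "b0 \<le> \<delta> * (1 + \<epsilon>) * (q\<^sup>2 / 4) * j0 + \<delta> * (1 + 1 / \<epsilon>) * e0 + g0"
      unfolding b0_def j0_def e0_def g0_def by (rule form_bound_energy[OF form gm g \<delta> gfin st(1,2) t1' \<epsilon>])
    then have "A * b0 \<le> A * (\<delta> * (1 + \<epsilon>) * (q\<^sup>2 / 4) * j0 + \<delta> * (1 + 1 / \<epsilon>) * e0 + g0)" using A0 by (rule mult_left_mono)
    also have "\<dots> = (A * (\<delta> * (1 + \<epsilon>) * (q\<^sup>2 / 4))) * j0 + A * \<delta> * (1 + 1 / \<epsilon>) * e0 + A * g0" by (simp add: algebra_simps)
    also have "\<dots> \<le> ((q - 1) / 2 * \<beta>) * j0 + A * \<delta> * (1 + 1 / \<epsilon>) * e0 + A * g0"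
      using mult_right_mono[OF A\<delta> j0] by linarith
    finally have "A * b0 - (q - 1) / 2 * \<beta> * j0 - c1 * i0 - \<epsilon> * p0 + 2 / \<epsilon> * e0 \<le> (A * \<delta> * (1 + 1 / \<epsilon>) + 2 / \<epsilon>) * e0 + A * g0 - c1 * i0 - \<epsilon> * p0"
      by (simp add: algebra_simps)
    then have "q * (A * b0 - (q - 1) / 2 * \<beta> * j0 - c1 * i0 - \<epsilon> * p0 + 2 / \<epsilon> * e0) \<le> q * ((A * \<delta> * (1 + 1 / \<epsilon>) + 2 / \<epsilon>) * e0 + A * g0 - c1 * i0 - \<epsilon> * p0)"
      using q2 by (intro mult_left_mono) auto
    also have "\<dots> = C * e0 + q * A * g0 - q * c1 * i0 - q * \<epsilon> * p0" by (simp add: C_def algebra_simps)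
    finally have 1: "\<Phi> t1 - \<Phi> s1 \<le> C * e0 + q * A * g0 - q * c1 * i0 - q * \<epsilon> * p0" using inc by linarith
    have "e0 \<le> integral {s1..t1} (\<lambda>\<tau>. k1 * \<Phi> \<tau> + k2 * K powr q * measure lborel (cbox a b))"
      unfolding e0_def
    proof (rule integral_le)
      show "(\<lambda>\<tau>. integral UNIV (\<lambda>x. fE (\<tau>, x))) integrable_on {s1..t1}"
        using tint_has_integral[OF cfE f_supp(5) st(2)] by blast
      show "(\<lambda>\<tau>. k1 * \<Phi> \<tau> + k2 * K powr q * measure lborel (cbox a b)) integrable_on {s1..t1}"
        by (intro integrable_continuous_real continuous_intros continuous_on_subset[OF c\<Phi>' sub1])
      fix \<tau> assume "\<tau> \<in> {s1..t1}"
      then have \<tau>: "s < \<tau>" using st by auto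
      have i\<Phi>: "(\<lambda>x. (\<eta> x)\<^sup>2 * norm (W (\<tau>, x)) powr q) integrable_on UNIV"
        using int[OF \<Phi>_cont_integrand \<tau>] supp\<eta> by simp
      have ic: "((\<lambda>x. if x \<in> cbox a b then k2 * K powr q else 0) has_integral (k2 * K powr q * measure lborel (cbox a b))) UNIV"
        using has_integral_const[of "k2 * K powr q" a b] unfolding has_integral_restrict_UNIV by (simp add: mult.commute)
      have "((\<lambda>x. k1 * ((\<eta> x)\<^sup>2 * norm (W (\<tau>, x)) powr q) + (if x \<in> cbox a b then k2 * K powr q else 0)) has_integral
         k1 * \<Phi> \<tau> + k2 * K powr q * measure lborel (cbox a b)) UNIV"
        unfolding \<Phi>_def by (intro has_integral_add has_integral_mult_right integrable_integral i\<Phi> ic)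
      note hi = this
      have ie: "(\<lambda>x. fE (\<tau>, x)) integrable_on UNIV" by (rule int[OF cfE \<tau> f_supp(5)])
      show "integral UNIV (\<lambda>x. fE (\<tau>, x)) \<le> k1 * \<Phi> \<tau> + k2 * K powr q * measure lborel (cbox a b)"
      proof (rule has_integral_le[OF integrable_integral[OF ie] hi])
        fix x
        show "fE (\<tau>, x) \<le> k1 * ((\<eta> x)\<^sup>2 * norm (W (\<tau>, x)) powr q) + (if x \<in> cbox a b then k2 * K powr q else 0)"
        proof (cases "x \<in> cbox a b")
          case True
          have "norm (W (\<tau>, x)) powr q \<le> K powr q"
            using K[OF \<tau>, of x] q2 by (intro powr_mono2) (auto simp: W_def)
          then have "k2 * norm (W (\<tau>, x)) powr q \<le> k2 * K powr q" using k(3) by (rule mult_left_mono)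
          moreover have "(norm (d\<eta> x))\<^sup>2 * norm (W (\<tau>, x)) powr q \<le> (k1 * (\<eta> x)\<^sup>2 + k2) * norm (W (\<tau>, x)) powr q"
            by (intro mult_right_mono k(1)) auto
          ultimately show ?thesis using True by (simp add: fE_def algebra_simps)
        next
          case False
          then show ?thesis using d\<eta>_supp[OF False] supp\<eta>[OF False] by (simp add: fE_def)
        qed
      qed
    qed
    also have "\<dots> = k1 * integral {s1..t1} \<Phi> + k2 * K powr q * measure lborel (cbox a b) * (t1 - s1)"
      using integral_add[OF integrable_cmul[OF integrable_on_subinterval[OF \<Phi>i sub1], of k1] integrable_const_ivl[of "k2 * K powr q * measure lborel (cbox a b)" s1 t1]] t1'
      by simp
    also have "\<dots> \<le> k1 * integral {s1..t1} \<Phi> + k2 * K powr q * measure lborel (cbox a b) * t"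
      using k(3) t1' st by (intro add_left_mono mult_left_mono) auto
    finally have "C * e0 \<le> C * (k1 * integral {s1..t1} \<Phi> + k2 * K powr q * measure lborel (cbox a b) * t)"
      using C0 by (rule mult_left_mono)
    then have 2: "C * e0 \<le> C * k1 * integral {s1..t1} \<Phi> + Err" by (simp add: Err_def algebra_simps)
    have 3: "integral {s1..t1} (\<lambda>\<tau>. G \<tau> * \<Phi> \<tau>) = q * A * g0 + C * k1 * integral {s1..t1} \<Phi>"
      unfolding G\<Phi>eq g0_def
      using integral_add[OF integrable_cmul[OF integrable_on_subinterval[OF g\<Phi> sub1], of "q * A"]
          integrable_cmul[OF integrable_on_subinterval[OF \<Phi>i sub1], of "C * k1"]] by simp
    show ?thesis using 1 2 3 unfolding i0_def p0_def by linarith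
  qed
  have nI: "0 \<le> q * c1 * tint fI s1 t1" and nP: "0 \<le> q * \<epsilon> * tint fP s1 t1" for t1
    using tint_nonneg[OF f_nonneg(2)] tint_nonneg[OF f_nonneg(3)] q2 c1 \<epsilon> by (auto intro!: mult_nonneg_nonneg)
  show bd: "\<Phi> \<tau> \<le> 2 ^ Suc N0 * (\<Phi> s1 + Err)" if "\<tau> \<in> {s1..t}" for \<tau>
  proof (rule gronwall_integrable_kernel[OF st(3) c\<Phi>' \<Phi>_nonneg G0 Gi G\<Phi> _ Gint that])
    show "\<Phi> t1 \<le> \<Phi> s1 + Err + integral {s1..t1} (\<lambda>r. G r * \<Phi> r)" if "t1 \<in> {s1..t}" for t1
      using main[OF that] nI[of t1] nP[of t1] by linarith
  qed
  \<comment> \<open>The sup bound is put back into the energy inequality; 2^(N0+1) times the mass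
    N0/2 gives the constant of the second claim.\<close>
  have "integral {s1..t} (\<lambda>\<tau>. G \<tau> * \<Phi> \<tau>) \<le> integral {s1..t} (\<lambda>\<tau>. (2 ^ Suc N0 * (\<Phi> s1 + Err)) *\<^sub>R G \<tau>)"
  proof (rule integral_le[OF G\<Phi> integrable_cmul[OF Gi]])
    show "G \<tau> * \<Phi> \<tau> \<le> (2 ^ Suc N0 * (\<Phi> s1 + Err)) *\<^sub>R G \<tau>" if "\<tau> \<in> {s1..t}" for \<tau>
      using mult_left_mono[OF bd[OF that] G0[of \<tau>]] by (simp add: mult.commute)
  qed
  also have "\<dots> = (2 ^ Suc N0 * (\<Phi> s1 + Err)) * integral {s1..t} G" by simp
  also have "\<dots> \<le> (2 ^ Suc N0 * (\<Phi> s1 + Err)) * (real N0 / 2)"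
    using Gint \<Phi>_nonneg[of s1] Err0 by (intro mult_left_mono) auto
  finally have "integral {s1..t} (\<lambda>\<tau>. G \<tau> * \<Phi> \<tau>) \<le> 2 ^ N0 * real N0 * (\<Phi> s1 + Err)" by (simp add: mult_ac)
  then show "q * c1 * tint fI s1 t + q * \<epsilon> * tint fP s1 t \<le> (1 + 2 ^ N0 * real N0) * (\<Phi> s1 + Err)"
    using main[of t] \<Phi>_nonneg[of t] st by (simp add: distrib_right)
qed

end

subsection \<open>Removing the cutoff\<close>

text \<open>Squaring the positive part makes the truncation at a level continuously
  differentiable.\<close>

lemma has_real_derivative_max0_sq: "((\<lambda>t. (max 0 t)\<^sup>2) has_real_derivative 2 * max 0 t) (at t)" for t :: real
proof -
  consider "t > 0" | "t < 0" | "t = 0" by linarith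
  then show ?thesis
  proof cases
    case 1
    have "((\<lambda>t. t\<^sup>2) has_real_derivative 2 * max 0 t) (at t)"
      using 1 by (auto intro!: derivative_eq_intros)
    then show ?thesis
      by (rule DERIV_cong_ev[THEN iffD1, rotated 3])
        (use 1 in \<open>auto simp: eventually_nhds intro!: exI[of _ "{0<..}"]\<close>)
  next
    case 2
    have "((\<lambda>t. 0) has_real_derivative 2 * max 0 t) (at t)" using 2 by simp
    then show ?thesis
      by (rule DERIV_cong_ev[THEN iffD1, rotated 3])
        (use 2 in \<open>auto simp: eventually_nhds intro!: exI[of _ "{..<0}"]\<close>)
  next
    case 3
    have "((\<lambda>h. ((max 0 (0 + h))\<^sup>2 - (max 0 0)\<^sup>2) / h) \<longlongrightarrow> 0) (at (0::real))"
    proof (rule Lim_null_comparison)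
      show "\<forall>\<^sub>F h in at (0::real). norm (((max 0 (0 + h))\<^sup>2 - (max 0 0)\<^sup>2) / h) \<le> \<bar>h\<bar>"
      proof (rule always_eventually, rule allI)
        fix h :: real
        show "norm (((max 0 (0 + h))\<^sup>2 - (max 0 0)\<^sup>2) / h) \<le> \<bar>h\<bar>"
          by (cases "h > 0") (auto simp: max_def power2_eq_square)
      qed
      show "((\<lambda>h. \<bar>h\<bar>) \<longlongrightarrow> 0) (at (0::real))" by (auto intro!: tendsto_eq_intros)
    qed
    then show ?thesis using 3 by (simp add: DERIV_def)
  qed
qed

lemma has_real_derivative_inverse_power:
  fixes r :: real
  assumes "r \<noteq> 0" "0 < n"
  shows "((\<lambda>r. inverse (r ^ n)) has_real_derivative - (real n * inverse (r ^ Suc n))) (at r)"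
proof -
  obtain k where n: "n = Suc k" using assms(2) gr0_implies_Suc by blast
  have "((\<lambda>r. inverse (r ^ n)) has_real_derivative - (inverse (r ^ n) * (real n * r ^ (n - 1)) * inverse (r ^ n))) (at r)"
    using DERIV_inverse'[OF DERIV_pow[of n r UNIV]] assms by simp
  moreover have "inverse (r ^ n) * (real n * r ^ (n - 1)) * inverse (r ^ n) = real n * inverse (r ^ Suc n)"
    using assms(1) by (simp add: n field_simps)
  ultimately show ?thesis by (simp only:)
qed

definition weight_base :: "real \<Rightarrow> real^'d::finite \<Rightarrow> real" where
  "weight_base \<kappa> x = inverse ((1 + \<kappa>\<^sup>2 * (x \<bullet> x)) ^ CARD('d))"

text \<open>The base decays like \<open>|x|\<^sup>-\<^sup>2\<^sup>d\<close>, so that its gradient is at most a multiple of \<open>\<kappa>\<close> times itself. The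
  truncation at level \<open>c\<close> costs an error of order \<open>\<kappa>\<^sup>2 c\<close> on the support, whose volume is smaller than \<open>1/c\<close>.\<close>

definition weight :: "real \<Rightarrow> real \<Rightarrow> real^'d::finite \<Rightarrow> real" where
  "weight \<kappa> c x = (max 0 (weight_base \<kappa> x - c))\<^sup>2"

definition weight_grad :: "real \<Rightarrow> real \<Rightarrow> real^'d::finite \<Rightarrow> real^'d" where
  "weight_grad \<kappa> c x = (- 4 * real CARD('d) * \<kappa>\<^sup>2 * max 0 (weight_base \<kappa> x - c) * inverse ((1 + \<kappa>\<^sup>2 * (x \<bullet> x)) ^ Suc CARD('d))) *\<^sub>R x"

lemma weight_base_pos: "0 < 1 + \<kappa>\<^sup>2 * (x \<bullet> x)" for x :: "'a::real_inner"
  by (intro add_pos_nonneg mult_nonneg_nonneg) auto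

lemma weight_base_bounds: "0 < weight_base \<kappa> x" "weight_base \<kappa> x \<le> 1"
proof -
  show "0 < weight_base \<kappa> x" using weight_base_pos[of \<kappa> x] by (simp add: weight_base_def)
  have "1 \<le> (1 + \<kappa>\<^sup>2 * (x \<bullet> x)) ^ CARD('a)" by (intro one_le_power) auto
  then show "weight_base \<kappa> x \<le> 1" unfolding weight_base_def by (rule inverse_le_1_iff[THEN iffD2, OF disjI2])
qed

lemma has_derivative_weight: "(weight \<kappa> c has_derivative (\<lambda>v. weight_grad \<kappa> c x \<bullet> v)) (at x)"
  for x :: "real^'d::finite"
proof -
  let ?f = "1 + \<kappa>\<^sup>2 * (x \<bullet> x)"
  have nz: "?f \<noteq> 0" using weight_base_pos[of \<kappa> x] by simp
  have df: "((\<lambda>x. 1 + \<kappa>\<^sup>2 * (x \<bullet> x)) has_derivative (\<lambda>v. 2 * \<kappa>\<^sup>2 * (x \<bullet> v))) (at x)"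
    by (auto intro!: derivative_eq_intros simp: inner_commute algebra_simps)
  have di: "((\<lambda>r. inverse (r ^ CARD('d))) has_real_derivative - (real CARD('d) * inverse (?f ^ Suc CARD('d)))) (at ?f)"
    by (rule has_real_derivative_inverse_power[OF nz]) simp
  have dZ: "(weight_base \<kappa> has_derivative (\<lambda>v. - (real CARD('d) * inverse (?f ^ Suc CARD('d))) * (2 * \<kappa>\<^sup>2 * (x \<bullet> v)))) (at x)"
    unfolding weight_base_def[abs_def]
    by (rule has_derivative_compose[OF df di[unfolded has_field_derivative_def]])
  have "((\<lambda>x. weight_base \<kappa> x - c) has_derivative (\<lambda>v. - (real CARD('d) * inverse (?f ^ Suc CARD('d))) * (2 * \<kappa>\<^sup>2 * (x \<bullet> v)))) (at x)"
    using has_derivative_diff[OF dZ has_derivative_const[of c]] by simp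
  from has_derivative_compose[OF this has_real_derivative_max0_sq[unfolded has_field_derivative_def]]
  show ?thesis
    unfolding weight_def[abs_def] by (rule has_derivative_eq_rhs) (simp add: weight_grad_def fun_eq_iff mult_ac)
qed

lemma weight_dir_deriv: "has_dir_deriv (axis i 1) (weight \<kappa> c) (\<lambda>x. weight_grad \<kappa> c x $ i)"
proof -
  have "has_dir_deriv (axis i 1) (weight \<kappa> c) (\<lambda>x. weight_grad \<kappa> c x \<bullet> axis i 1)"
    by (rule has_dir_deriv_from_derivative[OF has_derivative_weight])
  then show ?thesis by (simp add: inner_axis)
qed

lemma continuous_weight:
  "continuous_on UNIV (weight \<kappa> c :: real^'a::finite \<Rightarrow> real)"
  "continuous_on UNIV (weight_grad \<kappa> c :: real^'a \<Rightarrow> real^'a)"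
proof -
  have nz: "(1 + \<kappa>\<^sup>2 * (x \<bullet> x)) ^ k \<noteq> 0" for x :: "real^'a" and k using weight_base_pos[of \<kappa> x] by simp
  have cb: "continuous_on UNIV (weight_base \<kappa> :: real^'a \<Rightarrow> real)"
    unfolding weight_base_def[abs_def] by (intro continuous_intros ballI nz)
  show "continuous_on UNIV (weight \<kappa> c :: real^'a \<Rightarrow> real)"
    unfolding weight_def[abs_def] by (intro continuous_intros cb)
  show "continuous_on UNIV (weight_grad \<kappa> c :: real^'a \<Rightarrow> real^'a)"
    unfolding weight_grad_def[abs_def] by (intro continuous_intros cb ballI nz)
qed

lemma weight_bounds:
  assumes "0 \<le> c"
  shows "0 \<le> weight \<kappa> c x" "weight \<kappa> c x \<le> 1"
proof -
  show "0 \<le> weight \<kappa> c x" by (simp add: weight_def)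
  have "max 0 (weight_base \<kappa> x - c) \<le> 1" using weight_base_bounds[of \<kappa> x] assms by simp
  then show "weight \<kappa> c x \<le> 1" unfolding weight_def by (intro power_le_one) auto
qed

text \<open>From 2 \<kappa> |x| \<le> 1 + \<kappa>^2 |x|^2 the gradient of the base is at most d
  \<kappa> times the base \<open>Z\<close>. The square of the weight's gradient then contains (Z -
  c)^2 Z^2 instead of (Z - c)^4; the difference is at most 2 c, as \<open>Z\<close> \<le> 1.\<close>

lemma weight_grad_bound:
  fixes x :: "real^'d::finite"
  assumes c: "0 \<le> c" and \<kappa>: "0 \<le> \<kappa>"
  shows "(norm (weight_grad \<kappa> c x))\<^sup>2 \<le> 4 * (real CARD('d))\<^sup>2 * \<kappa>\<^sup>2 * (weight \<kappa> c x)\<^sup>2 + 8 * (real CARD('d))\<^sup>2 * \<kappa>\<^sup>2 * c"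
proof (cases "weight_base \<kappa> x \<le> c")
  case True
  then show ?thesis using c by (simp add: weight_grad_def)
next
  case False
  let ?f = "1 + \<kappa>\<^sup>2 * (x \<bullet> x)" let ?d = "real CARD('d)"
  define Z where "Z = weight_base \<kappa> x"
  have Z: "0 < Z" "Z \<le> 1" "c < Z" using weight_base_bounds[of \<kappa> x] False by (auto simp: Z_def)
  have f: "0 < ?f" by (rule weight_base_pos)
  have "0 \<le> (\<kappa> * norm x - 1)\<^sup>2" by simp
  then have "2 * \<kappa> * norm x \<le> ?f" by (simp add: power2_diff power_mult_distrib power2_norm_eq_inner)
  then have fx: "2 * \<kappa> * norm x * inverse ?f \<le> 1" using f by (simp add: field_simps)
  have "norm (weight_grad \<kappa> c x) = 4 * ?d * \<kappa>\<^sup>2 * (Z - c) * inverse (?f ^ Suc CARD('d)) * norm x"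
    using Z f by (simp add: weight_grad_def Z_def[symmetric] abs_mult)
  also have "\<dots> = (2 * ?d * \<kappa> * (Z - c) * Z) * (2 * \<kappa> * norm x * inverse ?f)"
    by (simp add: Z_def weight_base_def power2_eq_square mult_ac)
  also have "\<dots> \<le> (2 * ?d * \<kappa> * (Z - c) * Z) * 1"
    using fx Z \<kappa> by (intro mult_left_mono mult_nonneg_nonneg) auto
  finally have "(norm (weight_grad \<kappa> c x))\<^sup>2 \<le> (2 * ?d * \<kappa> * (Z - c) * Z)\<^sup>2" by (intro power_mono) auto
  also have "\<dots> = 4 * ?d\<^sup>2 * \<kappa>\<^sup>2 * ((Z - c)\<^sup>2 * Z\<^sup>2)" by (simp add: power_mult_distrib)
  also have "\<dots> \<le> 4 * ?d\<^sup>2 * \<kappa>\<^sup>2 * (((Z - c)\<^sup>2)\<^sup>2 + 2 * c)"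
  proof (rule mult_left_mono)
    have "(Z - c)\<^sup>2 * (2 * c * Z) \<le> 1 * (2 * c * 1)"
      using Z c by (intro mult_mono power_le_one) auto
    moreover have "(Z - c)\<^sup>2 * Z\<^sup>2 = (Z - c)\<^sup>2 * (Z - c)\<^sup>2 + (Z - c)\<^sup>2 * (2 * c * Z) - (Z - c)\<^sup>2 * c\<^sup>2"
      by (simp add: power2_eq_square algebra_simps)
    moreover have "0 \<le> (Z - c)\<^sup>2 * c\<^sup>2" by simp
    ultimately show "(Z - c)\<^sup>2 * Z\<^sup>2 \<le> ((Z - c)\<^sup>2)\<^sup>2 + 2 * c"
      unfolding power2_eq_square[of "(Z - c)\<^sup>2"] by linarith
  qed auto
  also have "\<dots> = 4 * ?d\<^sup>2 * \<kappa>\<^sup>2 * (weight \<kappa> c x)\<^sup>2 + 8 * ?d\<^sup>2 * \<kappa>\<^sup>2 * c"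
    using Z by (simp add: weight_def Z_def[symmetric] algebra_simps)
  finally show ?thesis .
qed

text \<open>The value of the base at \<open>|x| = m\<^sup>4\<close> for \<open>\<kappa> = 1/m\<close>.\<close>

definition weight_level :: "nat \<Rightarrow> nat \<Rightarrow> real" where
  "weight_level d m = inverse ((1 + real m ^ 6) ^ d)"

lemma weight_level_nonneg: "0 \<le> weight_level d m"
  by (simp add: weight_level_def add_nonneg_nonneg)

lemma weight_support:
  fixes x :: "real^'d::finite"
  assumes m: "0 < m" and x: "x \<notin> cbox (- (real m ^ 4) *\<^sub>R One) (real m ^ 4 *\<^sub>R One)"
  shows "weight (1 / real m) (weight_level CARD('d) m) x = 0"
proof -
  have "real m ^ 4 \<le> norm x"
  proof (rule ccontr)
    assume "\<not> real m ^ 4 \<le> norm x"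
    then have "\<bar>x \<bullet> i\<bar> \<le> real m ^ 4" if "i \<in> Basis" for i using Basis_le_norm[OF that, of x] by linarith
    then show False using x by (fastforce simp: mem_box abs_le_iff)
  qed
  then have "(real m ^ 4)\<^sup>2 \<le> x \<bullet> x" unfolding power2_norm_eq_inner[symmetric] by (intro power_mono) auto
  then have "(1 / real m)\<^sup>2 * (real m ^ 4)\<^sup>2 \<le> (1 / real m)\<^sup>2 * (x \<bullet> x)" by (intro mult_left_mono) auto
  moreover have "(1 / real m)\<^sup>2 * (real m ^ 4)\<^sup>2 = real m ^ 6"
    using m by (simp add: power_divide power_mult[symmetric] field_simps power_add[symmetric])
  ultimately have "(1 + real m ^ 6) ^ CARD('d) \<le> (1 + (1 / real m)\<^sup>2 * (x \<bullet> x)) ^ CARD('d)"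
    by (intro power_mono) auto
  moreover have "0 < (1 + real m ^ 6) ^ CARD('d)" by (simp add: add_pos_nonneg)
  ultimately have "weight_base (1 / real m) x \<le> weight_level CARD('d) m"
    unfolding weight_base_def weight_level_def by (rule le_imp_inverse_le)
  then show ?thesis by (simp add: weight_def)
qed

text \<open>The level is of order m^(-6d) and the supporting box has volume (2 m^4)^d, so their
  product still decays like m^(-2d). This kills the cutoff error.\<close>

lemma weight_level_tendsto:
  assumes "0 < d"
  shows "(\<lambda>m. weight_level d m) \<longlonglongrightarrow> 0"
    "(\<lambda>m. weight_level d m * (2 * real m ^ 4) ^ d) \<longlonglongrightarrow> 0"
proof -
  have a: "(\<lambda>m. inverse (1 + real m ^ 6)) \<longlonglongrightarrow> 0" by real_asymp
  have b: "(\<lambda>m. inverse (1 + real m ^ 6) * (2 * real m ^ 4)) \<longlonglongrightarrow> 0" by real_asymp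
  show "(\<lambda>m. weight_level d m) \<longlonglongrightarrow> 0"
    using tendsto_power[OF a, of d] assms by (simp add: weight_level_def power_inverse zero_power)
  show "(\<lambda>m. weight_level d m * (2 * real m ^ 4) ^ d) \<longlonglongrightarrow> 0"
    using tendsto_power[OF b, of d] assms by (simp add: weight_level_def power_mult_distrib power_inverse zero_power)
qed

lemma weight_tendsto: "(\<lambda>m. weight (1 / real m) (weight_level CARD('d) m) x) \<longlonglongrightarrow> 1" for x :: "real^'d::finite"
proof -
  have "(\<lambda>m. 1 / real m) \<longlonglongrightarrow> 0" by real_asymp
  then have "(\<lambda>m. weight_base (1 / real m) x) \<longlonglongrightarrow> inverse ((1 + 0\<^sup>2 * (x \<bullet> x)) ^ CARD('d))"
    unfolding weight_base_def by (intro tendsto_intros) auto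
  then have "(\<lambda>m. weight (1 / real m) (weight_level CARD('d) m) x) \<longlonglongrightarrow> (max 0 (inverse ((1 + 0\<^sup>2 * (x \<bullet> x)) ^ CARD('d)) - 0))\<^sup>2"
    unfolding weight_def by (intro tendsto_intros weight_level_tendsto(1)) auto
  then show ?thesis by simp
qed

section \<open>Passage to the limit in cutoff and initial time\<close>

lemma nn_integral_le_of_tendsto:
  assumes [measurable]: "\<And>m. f m \<in> borel_measurable M" and lim: "\<And>x. x \<in> space M \<Longrightarrow> (\<lambda>m. f m x) \<longlonglongrightarrow> F x"
    and bound: "\<forall>\<^sub>F m in sequentially. (\<integral>\<^sup>+x. f m x \<partial>M) \<le> b m" and bl: "b \<longlonglongrightarrow> (L :: ennreal)"
  shows "(\<integral>\<^sup>+x. F x \<partial>M) \<le> L"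
proof -
  have "(\<integral>\<^sup>+x. F x \<partial>M) = (\<integral>\<^sup>+x. liminf (\<lambda>m. f m x) \<partial>M)"
    by (rule nn_integral_cong) (use lim lim_imp_Liminf[OF trivial_limit_sequentially] in metis)
  also have "\<dots> \<le> liminf (\<lambda>m. \<integral>\<^sup>+x. f m x \<partial>M)" by (rule nn_integral_liminf) measurable
  also have "\<dots> \<le> liminf b" by (rule Liminf_mono[OF bound])
  also have "\<dots> = L" using lim_imp_Liminf[OF trivial_limit_sequentially bl] .
  finally show ?thesis .
qed

text \<open>Fatou's lemma with the cutoff tending to 1 and the starting times tending to
  \<open>s\<close> simultaneously. Every point with time in (s, t] eventually belongs to the
  slabs.\<close>

lemma nn_integral_slab_limit:
  fixes F :: "real \<times> (real^'d::finite) \<Rightarrow> real" and \<eta> :: "nat \<Rightarrow> real^'d \<Rightarrow> real"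
  assumes cF: "continuous_on ({s<..} \<times> UNIV) F"
    and c\<eta>: "\<And>m. continuous_on UNIV (\<eta> m)" and \<eta>: "\<And>x. (\<lambda>m. \<eta> m x) \<longlonglongrightarrow> 1"
    and \<sigma>: "\<And>m. m0 \<le> m \<Longrightarrow> s < \<sigma> m \<and> \<sigma> m < s + 1 / real m"
    and bound: "\<And>m. m0 \<le> m \<Longrightarrow> ennreal k * (\<integral>\<^sup>+z\<in>{\<sigma> m..t} \<times> UNIV. ennreal ((\<eta> m (snd z))\<^sup>2 * F z) \<partial>lborel) \<le> b m"
    and b: "b \<longlonglongrightarrow> L"
  shows "ennreal k * (\<integral>\<^sup>+\<tau>\<in>{s..t}. (\<integral>\<^sup>+x. ennreal (F (\<tau>, x)) \<partial>lborel) \<partial>lborel) \<le> L"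
proof -
  let ?ST = "{s<..} \<times> (UNIV :: (real^'d) set)"
  \<comment> \<open>\<open>F\<close> is regular only after time \<open>s\<close>; extended by zero
    it is measurable on the whole space-time.\<close>
  define G where "G z = indicator ?ST z *\<^sub>R F z" for z
  have [measurable]: "?ST \<in> sets borel" by (intro borel_open open_Times) auto
  have [measurable]: "G \<in> borel_measurable borel"
    unfolding G_def[abs_def] by (rule borel_measurable_continuous_on_indicator[OF _ cF]) measurable
  have [measurable]: "{\<sigma> m..t} \<times> (UNIV :: (real^'d) set) \<in> sets borel" for m
    by (intro borel_closed closed_Times) auto
  have [measurable]: "{s..t} \<times> (UNIV :: (real^'d) set) \<in> sets borel"
    by (intro borel_closed closed_Times) auto
  have [measurable]: "(\<lambda>z :: real \<times> (real^'d). \<eta> m (snd z)) \<in> borel_measurable borel" for m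
    by (intro borel_measurable_continuous_onI continuous_on_compose2[OF c\<eta>] continuous_intros) auto
  have "(\<integral>\<^sup>+z. ennreal k * (ennreal (G z) * indicator ({s..t} \<times> UNIV) z) \<partial>lborel) \<le> L"
  proof (rule nn_integral_le_of_tendsto[where f="\<lambda>m z. ennreal k * (ennreal ((\<eta> m (snd z))\<^sup>2 * G z) * indicator ({\<sigma> m..t} \<times> UNIV) z)", OF _ _ _ b])
    fix z :: "real \<times> (real^'d)"
    have lim: "(\<lambda>m. ennreal ((\<eta> m (snd z))\<^sup>2 * G z)) \<longlonglongrightarrow> ennreal (1\<^sup>2 * G z)"
      by (intro tendsto_ennrealI tendsto_intros \<eta>)
    show "(\<lambda>m. ennreal k * (ennreal ((\<eta> m (snd z))\<^sup>2 * G z) * indicator ({\<sigma> m..t} \<times> UNIV) z)) \<longlonglongrightarrow> ennreal k * (ennreal (G z) * indicator ({s..t} \<times> UNIV) z)"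
    proof (cases "s < fst z \<and> fst z \<le> t")
      case True
      obtain N :: nat where N: "1 / (fst z - s) < real N" using reals_Archimedean2 by blast
      have "\<sigma> m \<le> fst z" if "max m0 (Suc N) \<le> m" for m
      proof -
        have "1 / (fst z - s) < real m" using N that by linarith
        then have "1 / real m < fst z - s" using True that by (simp add: field_simps)
        then show ?thesis using \<sigma>[of m] that by auto
      qed
      then have "\<forall>\<^sub>F m in sequentially. ennreal k * (ennreal ((\<eta> m (snd z))\<^sup>2 * G z)) = ennreal k * (ennreal ((\<eta> m (snd z))\<^sup>2 * G z) * indicator ({\<sigma> m..t} \<times> UNIV) z)"
        unfolding eventually_sequentially using True
        by (intro exI[of _ "max m0 (Suc N)"]) (auto simp: indicator_def mem_Times_iff)
      moreover have "(\<lambda>m. ennreal k * (ennreal ((\<eta> m (snd z))\<^sup>2 * G z))) \<longlonglongrightarrow> ennreal k * ennreal (1\<^sup>2 * G z)"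
        by (rule ennreal_tendsto_cmult[OF _ lim]) simp
      ultimately show ?thesis
        using True by (simp add: indicator_def mem_Times_iff tendsto_cong)
    next
      case False
      then have zero: "ennreal (c * G z) * indicator ({\<sigma> m..t} \<times> UNIV) z = 0" "ennreal (G z) * indicator ({s..t} \<times> UNIV) z = 0" for m c
        by (auto simp: G_def indicator_def mem_Times_iff)
      then show ?thesis unfolding zero by simp
    qed
  next
    show "\<forall>\<^sub>F m in sequentially. (\<integral>\<^sup>+z. ennreal k * (ennreal ((\<eta> m (snd z))\<^sup>2 * G z) * indicator ({\<sigma> m..t} \<times> UNIV) z) \<partial>lborel) \<le> b m"
      unfolding eventually_sequentially
    proof (intro exI[of _ m0] allI impI)
      fix m assume m: "m0 \<le> m"
      have "(\<integral>\<^sup>+z. ennreal k * (ennreal ((\<eta> m (snd z))\<^sup>2 * G z) * indicator ({\<sigma> m..t} \<times> UNIV) z) \<partial>lborel) =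
        ennreal k * (\<integral>\<^sup>+z\<in>{\<sigma> m..t} \<times> UNIV. ennreal ((\<eta> m (snd z))\<^sup>2 * G z) \<partial>lborel)"
        by (rule nn_integral_cmult) measurable
      also have "(\<integral>\<^sup>+z\<in>{\<sigma> m..t} \<times> UNIV. ennreal ((\<eta> m (snd z))\<^sup>2 * G z) \<partial>lborel) = (\<integral>\<^sup>+z\<in>{\<sigma> m..t} \<times> UNIV. ennreal ((\<eta> m (snd z))\<^sup>2 * F z) \<partial>lborel)"
        by (rule nn_integral_cong) (use \<sigma>[OF m] in \<open>auto simp: G_def indicator_def\<close>)
      finally show "(\<integral>\<^sup>+z. ennreal k * (ennreal ((\<eta> m (snd z))\<^sup>2 * G z) * indicator ({\<sigma> m..t} \<times> UNIV) z) \<partial>lborel) \<le> b m"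
        using bound[OF m] by simp
    qed
  qed measurable
  also have "(\<integral>\<^sup>+z. ennreal k * (ennreal (G z) * indicator ({s..t} \<times> UNIV) z) \<partial>lborel) = ennreal k * (\<integral>\<^sup>+z\<in>{s..t} \<times> UNIV. ennreal (G z) \<partial>lborel)"
    by (rule nn_integral_cmult) measurable
  also have "(\<integral>\<^sup>+z\<in>{s..t} \<times> UNIV. ennreal (G z) \<partial>lborel) = (\<integral>\<^sup>+\<tau>\<in>{s..t}. (\<integral>\<^sup>+x. ennreal (G (\<tau>, x)) \<partial>lborel) \<partial>lborel)"
    by (rule nn_integral_space_time) auto
  also have "\<dots> = (\<integral>\<^sup>+\<tau>\<in>{s..t}. (\<integral>\<^sup>+x. ennreal (F (\<tau>, x)) \<partial>lborel) \<partial>lborel)"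
  proof (rule nn_integral_cong_AE)
    \<comment> \<open>The time slice at \<open>s\<close>, where \<open>F\<close> is not controlled,
      has measure zero.\<close>
    have "AE \<tau> in lborel. \<tau> \<noteq> s" by (rule AE_lborel_singleton)
    then show "AE \<tau> in lborel. (\<integral>\<^sup>+x. ennreal (G (\<tau>, x)) \<partial>lborel) * indicator {s..t} \<tau> = (\<integral>\<^sup>+x. ennreal (F (\<tau>, x)) \<partial>lborel) * indicator {s..t} \<tau>"
      by eventually_elim (auto simp: G_def indicator_def)
  qed
  finally show ?thesis .
qed

context cutoff_energy
begin

text \<open>A starting time after \<open>s\<close> with almost no excess energy. The tangent
  inequality at w bounds |w|^q by |grad h|^q plus a multiple of the uniform distance of the two
  gradients, which tends to zero.\<close>

lemma initial_energy:
  assumes e: "0 < e"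
  shows "\<exists>\<sigma>. s < \<sigma> \<and> \<sigma> < s + e \<and> \<Phi> \<sigma> \<le> integral UNIV (\<lambda>x. (\<eta> x)\<^sup>2 * norm (grad h x) powr q) + e"
proof -
  obtain K where K: "\<And>\<tau> x. s < \<tau> \<Longrightarrow> norm (grad (u \<tau>) x) \<le> K" using grad_bounded by blast
  define L where "L = q * K powr (q - 1) * integral UNIV (\<lambda>x. (\<eta> x)\<^sup>2)"
  have L0: "0 \<le> L" unfolding L_def using q2 by (intro mult_nonneg_nonneg integral_nonneg_total) auto
  \<comment> \<open>The required distance of the gradients; adding 1 to \<open>L\<close> avoids
    division by zero and still gives L \<omega> \<le> e.\<close>
  define \<omega> where "\<omega> = e / (L + 1)"
  have \<omega>: "0 < \<omega>" "L * \<omega> \<le> e" using e L0 by (simp_all add: \<omega>_def field_simps)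
  obtain d where d: "0 < d" "\<And>\<tau> x. s < \<tau> \<Longrightarrow> \<tau> < s + d \<Longrightarrow> norm (grad (u \<tau>) x - grad h x) \<le> \<omega>"
    using grad_initial_uniform[OF \<omega>(1)] by blast
  define \<sigma> where "\<sigma> = s + min d e / 2"
  have \<sigma>: "s < \<sigma>" "\<sigma> < s + e" "\<sigma> < s + d" using d e by (auto simp: \<sigma>_def min_def)
  have pt: "norm (W (\<sigma>, x)) powr q \<le> norm (grad h x) powr q + q * K powr (q - 1) * \<omega>" for x
  proof -
    let ?w = "W (\<sigma>, x)"
    have w: "norm ?w \<le> K" "norm (grad h x - ?w) \<le> \<omega>"
      using K[OF \<sigma>(1), of x] d(2)[OF \<sigma>(1,3), of x] by (simp_all add: W_def norm_minus_commute)
    have n1: "norm (norm ?w powr (q - 2) *\<^sub>R ?w) \<le> K powr (q - 1)"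
    proof -
      have "norm (norm ?w powr (q - 2) *\<^sub>R ?w) = norm ?w powr (q - 1)"
        using powr_mult_base[of "norm ?w" "q - 2"] by (simp add: mult.commute)
      also have "\<dots> \<le> K powr (q - 1)" using w(1) q2 by (intro powr_mono2) auto
      finally show ?thesis .
    qed
    have "norm ?w powr q - norm (grad h x) powr q \<le> - (q * ((norm ?w powr (q - 2) *\<^sub>R ?w) \<bullet> (grad h x - ?w)))"
      using norm_powr_convex[OF q2, of ?w "grad h x"] by linarith
    also have "\<dots> = q * - ((norm ?w powr (q - 2) *\<^sub>R ?w) \<bullet> (grad h x - ?w))" by simp
    also have "\<dots> \<le> q * (norm (norm ?w powr (q - 2) *\<^sub>R ?w) * norm (grad h x - ?w))"
      using Cauchy_Schwarz_ineq2[of "norm ?w powr (q - 2) *\<^sub>R ?w" "grad h x - ?w"] q2 by (intro mult_left_mono) auto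
    also have "\<dots> \<le> q * (K powr (q - 1) * \<omega>)"
      using n1 w(2) q2 by (intro mult_left_mono mult_mono) auto
    finally show ?thesis by (simp add: mult.assoc)
  qed
  have ch: "continuous_on UNIV (\<lambda>x. norm (grad h x) powr q)"
    using q2 by (intro continuous_on_norm_powr h_facts(2)) auto
  have i1: "(\<lambda>x. (\<eta> x)\<^sup>2 * norm (grad h x) powr q) integrable_on UNIV"
    by (rule integrable_supp[where a=a and b=b]) (auto intro!: continuous_intros c\<eta> ch simp: supp\<eta>)
  have i2: "(\<lambda>x. (\<eta> x)\<^sup>2) integrable_on UNIV"
    by (rule integrable_supp[where a=a and b=b]) (auto intro!: continuous_intros c\<eta> simp: supp\<eta>)
  have i3: "(\<lambda>x. (\<eta> x)\<^sup>2 * norm (W (\<sigma>, x)) powr q) integrable_on UNIV"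
    using int[OF \<Phi>_cont_integrand \<sigma>(1)] supp\<eta> by simp
  note i4 = integrable_cmul[OF i2, of "q * K powr (q - 1) * \<omega>", unfolded real_scaleR_def]
  have "\<Phi> \<sigma> \<le> integral UNIV (\<lambda>x. (\<eta> x)\<^sup>2 * norm (grad h x) powr q + (q * K powr (q - 1) * \<omega>) * (\<eta> x)\<^sup>2)"
    unfolding \<Phi>_def
  proof (rule integral_le[OF i3 integrable_add[OF i1 i4]])
    fix x
    show "(\<eta> x)\<^sup>2 * norm (W (\<sigma>, x)) powr q \<le> (\<eta> x)\<^sup>2 * norm (grad h x) powr q + (q * K powr (q - 1) * \<omega>) * (\<eta> x)\<^sup>2"
      using mult_left_mono[OF pt[of x], of "(\<eta> x)\<^sup>2"] by (simp add: algebra_simps)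
  qed
  also have "\<dots> = integral UNIV (\<lambda>x. (\<eta> x)\<^sup>2 * norm (grad h x) powr q) + L * \<omega>"
    using integral_add[OF i1 i4] by (simp add: L_def mult_ac)
  finally show ?thesis using \<sigma> \<omega>(2) by (intro exI[of _ \<sigma>]) auto
qed

end

context cauchy_solution
begin

lemma cutoff_energy_weight:
  assumes "2 < q" "0 < m"
  shows "cutoff_energy B s h u M (weight (1 / real m) (weight_level CARD('d) m)) (weight_grad (1 / real m) (weight_level CARD('d) m))
    (- (real m ^ 4) *\<^sub>R One) (real m ^ 4 *\<^sub>R One) q"
  by unfold_locales (use assms in \<open>auto intro: weight_dir_deriv continuous_weight weight_support\<close>)

lemma grad_h_integral:
  assumes q: "0 < q"
  shows "Lp_norm_pow q (grad h) = ennreal (integral UNIV (\<lambda>x. norm (grad h x) powr q))"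
    "(\<lambda>x. norm (grad h x) powr q) integrable_on UNIV"
proof -
  obtain a b where ab: "\<And>x. x \<notin> cbox a b \<Longrightarrow> h x = 0" using h_facts(3) by blast
  have supp: "grad h x = 0" if "x \<notin> cbox a b" for x
    unfolding vec_eq_iff
    using has_dir_deriv_outside_support[OF has_dir_deriv_partial[OF h_facts(1)] ab that] by (simp add: grad_nth)
  have c: "continuous_on UNIV (\<lambda>x. norm (grad h x) powr q)"
    using q by (intro continuous_on_norm_powr h_facts(2)) auto
  show "Lp_norm_pow q (grad h) = ennreal (integral UNIV (\<lambda>x. norm (grad h x) powr q))"
    unfolding Lp_norm_pow_def by (rule nn_integral_continuous_supp[OF c]) (use supp in auto)
  show "(\<lambda>x. norm (grad h x) powr q) integrable_on UNIV"
    by (rule integrable_supp[OF c, of a b]) (use supp in auto)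
qed

text \<open>For each m the localized estimate is applied with the m-th weight from a starting time
  close to \<open>s\<close>. The right sides tend to the power of the norm of grad h, and the left
  sides are treated by Fatou's lemma. The factors contain neither \<open>M\<close> nor the sup bound
  of the gradient.\<close>

lemma global_estimate:
  fixes \<beta> \<epsilon> \<delta> t q :: real and N0 :: nat
  assumes form: "\<And>f. schwartz f \<Longrightarrow> form_ineq \<delta> g B t f"
    and gm: "g \<in> borel_measurable borel" and g: "\<And>\<tau>. 0 \<le> g \<tau>" and \<delta>: "0 \<le> \<delta>"
    and gfin: "(\<integral>\<^sup>+\<tau>\<in>{0..t}. ennreal (g \<tau>) \<partial>lborel) < \<infinity>"
    and q: "2 < q" and \<beta>: "0 < \<beta>" "\<beta> < 1" and \<epsilon>: "0 < \<epsilon>"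
  defines "c1 \<equiv> 1 - \<beta> - \<epsilon> * (4 * real CARD('d) + 1)"
    and "A \<equiv> (q - 1) / (2 * \<beta>) + 4 * \<epsilon>"
  defines "C \<equiv> q * (A * \<delta> * (1 + 1 / \<epsilon>) + 2 / \<epsilon>)"
  assumes c1: "0 < c1" and A\<delta>: "A * (\<delta> * (1 + \<epsilon>) * (q\<^sup>2 / 4)) \<le> (q - 1) / 2 * \<beta>"
    and st: "0 \<le> s" "s < t"
    and N0: "q * A * integral {0..t} g + C * t \<le> real N0 / 2"
  defines "D \<equiv> 1 + 2 ^ N0 * real N0"
  shows "\<And>\<tau>. \<tau> \<in> {s..t} \<Longrightarrow> Lp_norm_pow q (grad (u \<tau>)) \<le> ennreal (2 ^ Suc N0) * Lp_norm_pow q (grad h)"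
    "\<And>i. ennreal (q * c1) * (\<integral>\<^sup>+\<tau>\<in>{s..t}. (\<integral>\<^sup>+x. ennreal (norm (partial i (grad (u \<tau>)) x) ^ 2 * norm (grad (u \<tau>) x) powr (q - 2)) \<partial>lborel) \<partial>lborel)
       \<le> ennreal D * Lp_norm_pow q (grad h)"
    "ennreal (q * \<epsilon>) * (\<integral>\<^sup>+\<tau>\<in>{s..t}. Lp_norm_pow 2 (\<lambda>x. norm (grad (u \<tau>) x) powr ((q - 2) / 2) *\<^sub>R time_deriv u \<tau> x) \<partial>lborel)
       \<le> ennreal D * Lp_norm_pow q (grad h)"
proof -
  let ?d = "CARD('d)"
  obtain K where K: "\<And>\<tau> x. s < \<tau> \<Longrightarrow> norm (grad (u \<tau>) x) \<le> K" using grad_bounded by blast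
  define Hr where "Hr = integral UNIV (\<lambda>x. norm (grad h x) powr q)"
  have Hr: "Lp_norm_pow q (grad h) = ennreal Hr" unfolding Hr_def by (rule grad_h_integral) (use q in simp)
  have Hr0: "0 \<le> Hr" unfolding Hr_def by (intro integral_nonneg_total) auto
  define \<eta> :: "nat \<Rightarrow> real^'d \<Rightarrow> real" where "\<eta> m = weight (1 / real m) (weight_level ?d m)" for m
  define k2 where "k2 m = 8 * (real ?d)\<^sup>2 * (1 / real m)\<^sup>2 * weight_level ?d m" for m :: nat
  \<comment> \<open>The only place where the sup bound \<open>K\<close> of the gradient appears; the
    product of level and volume inside it tends to zero.\<close>
  define E where "E m = C * (k2 m * K powr q * (2 * real m ^ 4) ^ ?d) * t" for m :: nat
  define b where "b m = Hr + (1 / real m + E m)" for m :: nat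
  have A0: "0 \<le> A" using q \<beta> \<epsilon> by (simp add: A_def)
  have C0: "0 \<le> C" unfolding C_def using A0 \<delta> \<epsilon> q by (intro mult_nonneg_nonneg add_nonneg_nonneg) auto
  have k20: "0 \<le> k2 m" for m using weight_level_nonneg[of ?d m] by (simp add: k2_def)
  have bl: "b \<longlonglongrightarrow> Hr"
  proof -
    have 1: "(\<lambda>m. 1 / real m) \<longlonglongrightarrow> 0" by real_asymp
    have "E = (\<lambda>m. (C * (8 * (real ?d)\<^sup>2 * K powr q) * t) * ((1 / real m)\<^sup>2 * (weight_level ?d m * (2 * real m ^ 4) ^ ?d)))"
      by (auto simp: E_def k2_def fun_eq_iff mult_ac)
    moreover have "(\<lambda>m. (C * (8 * (real ?d)\<^sup>2 * K powr q) * t) * ((1 / real m)\<^sup>2 * (weight_level ?d m * (2 * real m ^ 4) ^ ?d)))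
       \<longlonglongrightarrow> (C * (8 * (real ?d)\<^sup>2 * K powr q) * t) * (0\<^sup>2 * 0)"
      by (intro tendsto_intros 1 weight_level_tendsto) auto
    ultimately have "E \<longlonglongrightarrow> 0" by simp
    then have "(\<lambda>m. Hr + (1 / real m + E m)) \<longlonglongrightarrow> Hr + (0 + 0)" by (intro tendsto_intros 1)
    then show ?thesis by (simp add: b_def[abs_def])
  qed
  \<comment> \<open>From m = 2 d on the coefficient 4 d^2/m^2 is at most 1, so one count
    \<open>N0\<close> serves all cutoffs.\<close>
  define m0 where "m0 = 2 * ?d"
  define P where "P m \<sigma> \<longleftrightarrow> s < \<sigma> \<and> \<sigma> < s + 1 / real m \<and>
     (\<forall>\<tau>\<in>{\<sigma>..t}. (\<integral>\<^sup>+x. ennreal ((\<eta> m x)\<^sup>2 * norm (grad (u \<tau>) x) powr q) \<partial>lborel) \<le> ennreal (2 ^ Suc N0 * b m)) \<and>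
     (\<forall>i. ennreal (q * c1) * (\<integral>\<^sup>+z\<in>{\<sigma>..t} \<times> UNIV. ennreal ((\<eta> m (snd z))\<^sup>2 * (norm (partial i (grad (u (fst z))) (snd z)) ^ 2 * norm (grad (u (fst z)) (snd z)) powr (q - 2))) \<partial>lborel)
        \<le> ennreal (D * b m)) \<and>
     ennreal (q * \<epsilon>) * (\<integral>\<^sup>+z\<in>{\<sigma>..t} \<times> UNIV. ennreal ((\<eta> m (snd z))\<^sup>2 * (norm (grad (u (fst z)) (snd z)) powr (q - 2) * norm (time_deriv u (fst z) (snd z)) ^ 2)) \<partial>lborel)
        \<le> ennreal (D * b m)" for m \<sigma>
  have step: "\<exists>\<sigma>. P m \<sigma>" if m: "m0 \<le> m" for m
  proof -
    have d1: "0 < ?d" by simp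
    have "0 < m0" unfolding m0_def using d1 by (intro mult_pos_pos) auto
    then have m1: "0 < m" using m by (rule order_less_le_trans)
    have "real m0 \<le> real m" using m by (simp only: of_nat_le_iff)
    then have md: "2 * real ?d \<le> real m" unfolding m0_def of_nat_mult of_nat_numeral .
    let ?a = "- (real m ^ 4) *\<^sub>R One :: real^'d" and ?b = "real m ^ 4 *\<^sub>R One :: real^'d"
    let ?d\<eta> = "weight_grad (1 / real m) (weight_level ?d m) :: real^'d \<Rightarrow> real^'d"
    interpret E: cutoff_energy B s h u M "\<eta> m" ?d\<eta> ?a ?b q
      unfolding \<eta>_def by (rule cutoff_energy_weight[OF q m1])
    have "0 < min (1 / real m) (t - s)" using m1 st by simp
    from E.initial_energy[OF this] obtain \<sigma> where \<sigma>: "s < \<sigma>" "\<sigma> < s + min (1 / real m) (t - s)"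
      "E.\<Phi> \<sigma> \<le> integral UNIV (\<lambda>x. (\<eta> m x)\<^sup>2 * norm (grad h x) powr q) + min (1 / real m) (t - s)" by blast
    have \<sigma>t: "\<sigma> \<le> t" using \<sigma> by linarith
    have ch: "continuous_on UNIV (\<lambda>x. norm (grad h x) powr q)"
      using q by (intro continuous_on_norm_powr h_facts(2)) auto
    have "integral UNIV (\<lambda>x. (\<eta> m x)\<^sup>2 * norm (grad h x) powr q) \<le> Hr"
      unfolding Hr_def
    proof (rule integral_le)
      show "(\<lambda>x. (\<eta> m x)\<^sup>2 * norm (grad h x) powr q) integrable_on UNIV"
        by (rule integrable_supp[where a="?a" and b="?b"]) (auto intro!: continuous_intros E.c\<eta> ch simp: E.supp\<eta>)
      show "(\<lambda>x. norm (grad h x) powr q) integrable_on UNIV" using grad_h_integral(2) q by simp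
      show "(\<eta> m x)\<^sup>2 * norm (grad h x) powr q \<le> norm (grad h x) powr q" for x
        using weight_bounds[OF weight_level_nonneg, of "1 / real m" ?d m x]
        by (intro mult_left_le_one_le) (auto simp: \<eta>_def power_le_one)
    qed
    then have \<Phi>\<sigma>: "E.\<Phi> \<sigma> \<le> Hr + 1 / real m" using \<sigma>(3) by linarith
    define k1 where "k1 = 4 * (real ?d)\<^sup>2 * (1 / real m)\<^sup>2"
    have k1: "0 \<le> k1" "k1 \<le> 1"
    proof -
      have "(2 * real ?d)\<^sup>2 \<le> (real m)\<^sup>2" using md by (intro power_mono) auto
      then show "0 \<le> k1" "k1 \<le> 1" using m1 by (simp_all add: k1_def power_divide power_mult_distrib)
    qed
    have kb: "(norm (?d\<eta> x))\<^sup>2 \<le> k1 * (\<eta> m x)\<^sup>2 + k2 m" for x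
      unfolding k1_def k2_def \<eta>_def by (rule weight_grad_bound[OF weight_level_nonneg]) simp
    have N0': "q * A * integral {0..t} g + C * k1 * t \<le> real N0 / 2"
    proof -
      have "C * k1 * t \<le> C * 1 * t" using C0 k1 st by (intro mult_right_mono mult_left_mono) auto
      then show ?thesis using N0 by linarith
    qed
    have vol: "measure lborel (cbox ?a ?b) = (2 * real m ^ 4) ^ ?d"
    proof -
      have ab: "?a \<bullet> i = - (real m ^ 4)" "?b \<bullet> i = real m ^ 4" if "i \<in> Basis" for i using that by simp_all
      have "measure lborel (cbox ?a ?b) = (\<Prod>i\<in>Basis. ?b \<bullet> i - ?a \<bullet> i)"
        by (rule content_cbox) (simp add: ab)
      also have "\<dots> = (\<Prod>i\<in>(Basis :: (real^'d) set). 2 * real m ^ 4)"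
        by (rule prod.cong[OF refl]) (unfold ab, simp)
      also have "\<dots> = (2 * real m ^ 4) ^ ?d" by simp
      finally show ?thesis .
    qed
    have est: "E.\<Phi> \<sigma> + C * (k2 m * K powr q * measure lborel (cbox ?a ?b)) * t \<le> b m"
      using \<Phi>\<sigma> unfolding vol by (simp add: b_def E_def)
    note EE0 = E.energy_estimate[OF form gm g \<delta> gfin \<beta> \<epsilon> c1[unfolded c1_def] A\<delta>[unfolded A_def] st(1) \<sigma>(1) \<sigma>t kb k1(1) k20 K N0'[unfolded C_def A_def], folded A_def, folded c1_def C_def]
    have EE: "\<And>\<tau>. \<tau> \<in> {\<sigma>..t} \<Longrightarrow> E.\<Phi> \<tau> \<le> 2 ^ Suc N0 * (E.\<Phi> \<sigma> + C * (k2 m * K powr q * measure lborel (cbox ?a ?b)) * t)"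
      "q * c1 * E.tint E.fI \<sigma> t + q * \<epsilon> * E.tint E.fP \<sigma> t \<le> D * (E.\<Phi> \<sigma> + C * (k2 m * K powr q * measure lborel (cbox ?a ?b)) * t)"
      unfolding D_def by (rule EE0; assumption)+
    have p1: "(\<integral>\<^sup>+x. ennreal ((\<eta> m x)\<^sup>2 * norm (grad (u \<tau>) x) powr q) \<partial>lborel) \<le> ennreal (2 ^ Suc N0 * b m)" if \<tau>: "\<tau> \<in> {\<sigma>..t}" for \<tau>
    proof -
      have s\<tau>: "s < \<tau>" using \<tau> \<sigma> by auto
      have "(\<integral>\<^sup>+x. ennreal ((\<eta> m x)\<^sup>2 * norm (grad (u \<tau>) x) powr q) \<partial>lborel) = ennreal (E.\<Phi> \<tau>)"
        unfolding E.\<Phi>_def using E.slice[OF E.\<Phi>_cont_integrand s\<tau>] E.supp\<eta>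
        by (subst nn_integral_continuous_supp[where a="?a" and b="?b", symmetric]) (auto simp: E.W_def)
      also have "\<dots> \<le> ennreal (2 ^ Suc N0 * b m)"
        using order_trans[OF EE(1)[OF \<tau>] mult_left_mono[OF est]] by (intro ennreal_leI) simp
      finally show ?thesis .
    qed
    have D0: "1 \<le> D" by (simp add: D_def)
    have nI: "0 \<le> E.tint E.fI \<sigma> t" and nP: "0 \<le> E.tint E.fP \<sigma> t" by (intro E.tint_nonneg E.f_nonneg)+
    have tot: "q * c1 * E.tint E.fI \<sigma> t + q * \<epsilon> * E.tint E.fP \<sigma> t \<le> D * b m"
      using EE(2) mult_left_mono[OF est, of D] D0 unfolding D_def by linarith
    have nI': "0 \<le> q * c1 * E.tint E.fI \<sigma> t" and nP': "0 \<le> q * \<epsilon> * E.tint E.fP \<sigma> t"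
      using nI nP q c1 \<epsilon> by (auto intro!: mult_nonneg_nonneg)
    have sub: "{\<sigma>..t} \<times> (UNIV :: (real^'d) set) \<subseteq> E.ST" using \<sigma> by auto
    have slabI: "(\<integral>\<^sup>+z\<in>{\<sigma>..t} \<times> UNIV. ennreal (E.fI z) \<partial>lborel) = ennreal (E.tint E.fI \<sigma> t)"
      by (rule nn_integral_space_time_continuous[OF continuous_on_subset[OF E.cfI sub] E.f_nonneg(2), of ?a ?b]) (use E.f_supp(3) in auto)
    have slabP: "(\<integral>\<^sup>+z\<in>{\<sigma>..t} \<times> UNIV. ennreal (E.fP z) \<partial>lborel) = ennreal (E.tint E.fP \<sigma> t)"
      by (rule nn_integral_space_time_continuous[OF continuous_on_subset[OF E.cfP sub] E.f_nonneg(3), of ?a ?b]) (use E.f_supp(4) in auto)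
    have p2: "ennreal (q * c1) * (\<integral>\<^sup>+z\<in>{\<sigma>..t} \<times> UNIV. ennreal ((\<eta> m (snd z))\<^sup>2 * (norm (partial i (grad (u (fst z))) (snd z)) ^ 2 * norm (grad (u (fst z)) (snd z)) powr (q - 2))) \<partial>lborel)
        \<le> ennreal (D * b m)" for i
    proof -
      have le: "(\<eta> m (snd z))\<^sup>2 * (norm (partial i (grad (u (fst z))) (snd z)) ^ 2 * norm (grad (u (fst z)) (snd z)) powr (q - 2)) \<le> E.fI z" for z
      proof -
        have "(norm (E.HH i z))\<^sup>2 \<le> E.II z"
          unfolding E.II_def by (rule member_le_sum) auto
        then have "E.N z * (norm (E.HH i z))\<^sup>2 \<le> E.N z * E.II z" by (intro mult_left_mono E.N_nonneg)
        then have "(\<eta> m (snd z))\<^sup>2 * (E.N z * (norm (E.HH i z))\<^sup>2) \<le> E.fI z" unfolding E.fI_def by (rule mult_left_mono) simp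
        then show ?thesis by (simp add: E.N_def E.HH_def E.W_def mult.commute)
      qed
      have "ennreal (q * c1) * (\<integral>\<^sup>+z\<in>{\<sigma>..t} \<times> UNIV. ennreal ((\<eta> m (snd z))\<^sup>2 * (norm (partial i (grad (u (fst z))) (snd z)) ^ 2 * norm (grad (u (fst z)) (snd z)) powr (q - 2))) \<partial>lborel)
        \<le> ennreal (q * c1) * (\<integral>\<^sup>+z\<in>{\<sigma>..t} \<times> UNIV. ennreal (E.fI z) \<partial>lborel)"
        by (intro mult_left_mono nn_integral_mono mult_right_mono ennreal_leI le) auto
      also have "\<dots> = ennreal (q * c1 * E.tint E.fI \<sigma> t)"
        unfolding slabI using q c1 nI by (simp add: ennreal_mult)
      also have "\<dots> \<le> ennreal (D * b m)" using tot nP' by (intro ennreal_leI) linarith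
      finally show ?thesis .
    qed
    have p3: "ennreal (q * \<epsilon>) * (\<integral>\<^sup>+z\<in>{\<sigma>..t} \<times> UNIV. ennreal ((\<eta> m (snd z))\<^sup>2 * (norm (grad (u (fst z)) (snd z)) powr (q - 2) * norm (time_deriv u (fst z) (snd z)) ^ 2)) \<partial>lborel)
        \<le> ennreal (D * b m)"
    proof -
      have eq: "(\<eta> m (snd z))\<^sup>2 * (norm (grad (u (fst z)) (snd z)) powr (q - 2) * norm (time_deriv u (fst z) (snd z)) ^ 2) = E.fP z" for z
        by (simp add: E.fP_def E.N_def E.W_def E.P_def)
      have "ennreal (q * \<epsilon>) * (\<integral>\<^sup>+z\<in>{\<sigma>..t} \<times> UNIV. ennreal (E.fP z) \<partial>lborel) = ennreal (q * \<epsilon> * E.tint E.fP \<sigma> t)"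
        unfolding slabP using q \<epsilon> nP by (simp add: ennreal_mult)
      also have "\<dots> \<le> ennreal (D * b m)" using tot nI' by (intro ennreal_leI) linarith
      finally show ?thesis unfolding eq .
    qed
    show ?thesis unfolding P_def using \<sigma>(1,2) by (intro exI[of _ \<sigma>] conjI allI ballI p1 p2 p3) auto
  qed
  then have "\<forall>m. \<exists>\<sigma>. m0 \<le> m \<longrightarrow> P m \<sigma>" by blast
  from choice[OF this] obtain \<sigma> where P: "\<And>m. m0 \<le> m \<Longrightarrow> P m (\<sigma> m)" by blast
  then have \<sigma>: "\<And>m. m0 \<le> m \<Longrightarrow> s < \<sigma> m \<and> \<sigma> m < s + 1 / real m"
    and s1: "\<And>m \<tau>. m0 \<le> m \<Longrightarrow> \<tau> \<in> {\<sigma> m..t} \<Longrightarrow> (\<integral>\<^sup>+x. ennreal ((\<eta> m x)\<^sup>2 * norm (grad (u \<tau>) x) powr q) \<partial>lborel) \<le> ennreal (2 ^ Suc N0 * b m)"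
    and s2: "\<And>m i. m0 \<le> m \<Longrightarrow> ennreal (q * c1) * (\<integral>\<^sup>+z\<in>{\<sigma> m..t} \<times> UNIV. ennreal ((\<eta> m (snd z))\<^sup>2 * (norm (partial i (grad (u (fst z))) (snd z)) ^ 2 * norm (grad (u (fst z)) (snd z)) powr (q - 2))) \<partial>lborel)
        \<le> ennreal (D * b m)"
    and s3: "\<And>m. m0 \<le> m \<Longrightarrow> ennreal (q * \<epsilon>) * (\<integral>\<^sup>+z\<in>{\<sigma> m..t} \<times> UNIV. ennreal ((\<eta> m (snd z))\<^sup>2 * (norm (grad (u (fst z)) (snd z)) powr (q - 2) * norm (time_deriv u (fst z) (snd z)) ^ 2)) \<partial>lborel)
        \<le> ennreal (D * b m)"
    unfolding P_def by simp_all
  have c\<eta>: "continuous_on UNIV (\<eta> m)" for m unfolding \<eta>_def by (rule continuous_weight)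
  have \<eta>1: "(\<lambda>m. \<eta> m x) \<longlonglongrightarrow> 1" for x unfolding \<eta>_def by (rule weight_tendsto)
  have lim: "(\<lambda>m. ennreal (k * b m)) \<longlonglongrightarrow> ennreal k * Lp_norm_pow q (grad h)" if "0 \<le> k" for k
    unfolding Hr ennreal_mult[OF that Hr0, symmetric] by (intro tendsto_ennrealI tendsto_intros bl)
  have D0: "0 \<le> D" by (simp add: D_def)
  have cw: "continuous_on ({s<..} \<times> UNIV) (\<lambda>z. grad (u (fst z)) (snd z))"
    using cont_grad by (simp add: split_beta)
  have ch: "continuous_on ({s<..} \<times> UNIV) (\<lambda>z. partial i (grad (u (fst z))) (snd z))" for i
    using cont_hess by (simp add: split_beta)
  have cp: "continuous_on ({s<..} \<times> UNIV) (\<lambda>z. time_deriv u (fst z) (snd z))"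
    using cont_time_deriv by (simp add: split_beta)
  have cq: "continuous_on ({s<..} \<times> UNIV) (\<lambda>z. norm (grad (u (fst z)) (snd z)) powr (q - 2))"
    using q by (intro continuous_on_norm_powr cw) simp
  show "Lp_norm_pow q (grad (u \<tau>)) \<le> ennreal (2 ^ Suc N0) * Lp_norm_pow q (grad h)" if \<tau>: "\<tau> \<in> {s..t}" for \<tau>
  proof (cases "\<tau> = s")
    \<comment> \<open>At the initial time itself no limit is taken: the gradient is that of
      \<open>h\<close>, and the factor is at least 1.\<close>
    case True
    have "1 \<le> ennreal (2 ^ Suc N0)" using one_le_power[of "2::real" "Suc N0"] by (simp only: ennreal_1[symmetric] ennreal_le_iff2) simp
    then show ?thesis using mult_right_mono[of 1 "ennreal (2 ^ Suc N0)" "Lp_norm_pow q (grad h)"] by (simp add: True u_init)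
  next
    case False
    then have s\<tau>: "s < \<tau>" using \<tau> by auto
    have cg: "continuous_on UNIV (\<lambda>x. norm (grad (u \<tau>) x) powr q)"
      using continuous_on_slice_pair[OF cw, of \<tau>] s\<tau> q by (intro continuous_on_norm_powr) auto
    show ?thesis
      unfolding Lp_norm_pow_def[of q "grad (u \<tau>)"]
    proof (rule nn_integral_le_of_tendsto[OF _ _ _ lim])
      show "(\<lambda>x. ennreal ((\<eta> m x)\<^sup>2 * norm (grad (u \<tau>) x) powr q)) \<in> borel_measurable lborel" for m
        using borel_measurable_continuous_onI[OF continuous_on_mult[OF continuous_on_power[OF c\<eta>[of m], of 2] cg]] by simp
      have "(\<lambda>m. ennreal ((\<eta> m x)\<^sup>2 * norm (grad (u \<tau>) x) powr q)) \<longlonglongrightarrow> ennreal (1\<^sup>2 * norm (grad (u \<tau>) x) powr q)" for x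
        by (intro tendsto_ennrealI tendsto_intros \<eta>1)
      then show "(\<lambda>m. ennreal ((\<eta> m x)\<^sup>2 * norm (grad (u \<tau>) x) powr q)) \<longlonglongrightarrow> ennreal (norm (grad (u \<tau>) x) powr q)" for x by simp
      obtain N :: nat where N: "1 / (\<tau> - s) < real N" using reals_Archimedean2 by blast
      have "\<sigma> m \<le> \<tau>" if "max m0 (Suc N) \<le> m" for m
      proof -
        have "1 / (\<tau> - s) < real m" using N that by linarith
        then have "1 / real m < \<tau> - s" using s\<tau> that by (simp add: field_simps)
        then show ?thesis using \<sigma>[of m] that by auto
      qed
      then show "\<forall>\<^sub>F m in sequentially. (\<integral>\<^sup>+x. ennreal ((\<eta> m x)\<^sup>2 * norm (grad (u \<tau>) x) powr q) \<partial>lborel) \<le> ennreal (2 ^ Suc N0 * b m)"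
        unfolding eventually_sequentially using \<tau> by (intro exI[of _ "max m0 (Suc N)"] allI impI s1) auto
    qed simp
  qed
  show "ennreal (q * c1) * (\<integral>\<^sup>+\<tau>\<in>{s..t}. (\<integral>\<^sup>+x. ennreal (norm (partial i (grad (u \<tau>)) x) ^ 2 * norm (grad (u \<tau>) x) powr (q - 2)) \<partial>lborel) \<partial>lborel)
       \<le> ennreal D * Lp_norm_pow q (grad h)" for i
    using nn_integral_slab_limit[of s "\<lambda>z. norm (partial i (grad (u (fst z))) (snd z)) ^ 2 * norm (grad (u (fst z)) (snd z)) powr (q - 2)" \<eta>, OF _ c\<eta> \<eta>1 \<sigma> s2[of _ i] lim[OF D0]]
    by (simp add: continuous_on_mult[OF continuous_on_power[OF continuous_on_norm[OF ch]] cq])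
  have Lp2: "Lp_norm_pow 2 (\<lambda>x. norm (grad (u \<tau>) x) powr ((q - 2) / 2) *\<^sub>R time_deriv u \<tau> x) = (\<integral>\<^sup>+x. ennreal (norm (grad (u \<tau>) x) powr (q - 2) * norm (time_deriv u \<tau> x) ^ 2) \<partial>lborel)" for \<tau>
  proof -
    have "(norm (grad (u \<tau>) x) powr ((q - 2) / 2))\<^sup>2 = norm (grad (u \<tau>) x) powr ((q - 2) / 2 + (q - 2) / 2)" for x
      unfolding power2_eq_square by (rule powr_add[symmetric])
    then show ?thesis by (simp add: Lp_norm_pow_2 power_mult_distrib)
  qed
  show "ennreal (q * \<epsilon>) * (\<integral>\<^sup>+\<tau>\<in>{s..t}. Lp_norm_pow 2 (\<lambda>x. norm (grad (u \<tau>) x) powr ((q - 2) / 2) *\<^sub>R time_deriv u \<tau> x) \<partial>lborel)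
       \<le> ennreal D * Lp_norm_pow q (grad h)"
    unfolding Lp2
    using nn_integral_slab_limit[of s "\<lambda>z. norm (grad (u (fst z)) (snd z)) powr (q - 2) * norm (time_deriv u (fst z) (snd z)) ^ 2" \<eta>, OF _ c\<eta> \<eta>1 \<sigma> s3 lim[OF D0]]
    by (simp add: continuous_on_mult[OF cq continuous_on_power[OF continuous_on_norm[OF cp]]])
qed

end

section \<open>From the smallness conditions to uniform constants\<close>

lemma small_form_bound_low_dim:
  assumes q: "2 < q" and "sqrt \<delta> < (sqrt (q - 1) - (q - 2) / 2) * (2 / q)"
  shows "q * sqrt \<delta> / 2 < (1::real)"
proof -
  \<comment> \<open>This makes the bracket at most q/2 - (q-2)/2 = 1, so sqrt \<delta> <
    2/q.\<close>
  have "q - 1 \<le> (q / 2)\<^sup>2" using zero_le_power2[of "q - 2"] by (simp add: power2_eq_square algebra_simps)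
  then have "sqrt (q - 1) \<le> sqrt ((q / 2)\<^sup>2)" by (rule real_sqrt_le_mono)
  moreover have "sqrt ((q / 2)\<^sup>2) = q / 2" using q by (intro real_sqrt_unique) auto
  ultimately have "sqrt (q - 1) - (q - 2) / 2 \<le> 1" by (simp add: diff_divide_distrib)
  then have "(sqrt (q - 1) - (q - 2) / 2) * (2 / q) \<le> 1 * (2 / q)" using q by (intro mult_right_mono) auto
  then have "sqrt \<delta> < 2 / q" using assms(2) by linarith
  then show ?thesis using q by (simp add: field_simps)
qed

lemma small_form_bound_high_dim:
  assumes q: "3 \<le> q" and \<mu>: "0 < \<mu>" "\<mu> < 1" and "sqrt \<delta> < (1 - \<mu>) * ((q - 1) / (q - 2)) * (1 / q)"
  shows "q * sqrt \<delta> / 2 < (1::real)"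
proof -
  \<comment> \<open>The quotient is at most 2 for q \<ge> 3 and 1 - \<mu> is at most 1, so again
    sqrt \<delta> < 2/q.\<close>
  have "(q - 1) / (q - 2) \<le> 2" using q by (simp add: field_simps)
  then have "(1 - \<mu>) * ((q - 1) / (q - 2)) * (1 / q) \<le> 1 * 2 * (1 / q)"
    using q \<mu> by (intro mult_mono) auto
  then have "sqrt \<delta> < 2 / q" using assms(4) by simp
  then show ?thesis using q by (simp add: field_simps)
qed

lemma regularizing_seq_regular:
  fixes bs :: "nat \<Rightarrow> real \<times> (real^'d::finite) \<Rightarrow> real^'d"
  assumes "bs \<in> regularizing_seqs \<delta> b"
  shows "continuous_on UNIV (bs n)" "\<exists>M. \<forall>z. norm (bs n z) \<le> M"
proof -
  have "smooth (bs n)" and bd: "bounded (range (bs n))" using assms unfolding regularizing_seqs_def by blast+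
  then have "iter_deriv [] (bs n) differentiable_on UNIV" unfolding smooth_def by blast
  then show "continuous_on UNIV (bs n)" by (intro differentiable_imp_continuous_on) simp
  show "\<exists>M. \<forall>z. norm (bs n z) \<le> M" using bd unfolding bounded_iff by blast
qed

text \<open>The supremum over n of the integrals of \<open>G n\<close> is finite, which makes the
  count \<open>N0\<close> independent of n. The functions \<open>G n\<close> and \<open>N0\<close>
  may depend on \<open>t\<close>.\<close>

lemma regularizing_seq_form_bound:
  fixes bs :: "nat \<Rightarrow> real \<times> (real^'d::finite) \<Rightarrow> real^'d"
  assumes "bs \<in> regularizing_seqs \<delta> b" and "0 < t" and k0: "0 \<le> k"
  obtains G N0 where "\<And>n \<tau>. 0 \<le> G n \<tau>" "\<And>n. G n \<in> borel_measurable borel"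
    "\<And>n. (\<integral>\<^sup>+\<tau>\<in>{0..t}. ennreal (G n \<tau>) \<partial>lborel) < \<infinity>"
    "\<And>n f. schwartz f \<Longrightarrow> form_ineq \<delta> (G n) (bs n) t f"
    "\<And>n. k * integral {0..t} (G n) + C * t \<le> real N0 / 2"
proof -
  obtain G where G0: "\<And>n \<tau>. 0 \<le> G n \<tau>" and loc: "\<And>n. Lp_loc 1 (G n)"
    and fin: "(SUP n. \<integral>\<^sup>+\<tau>\<in>{0..t}. ennreal (G n \<tau>) \<partial>lborel) < \<infinity>"
    and form: "\<And>n f. schwartz f \<Longrightarrow> form_ineq \<delta> (G n) (bs n) t f"
    using assms(1,2) unfolding regularizing_seqs_def by blast
  have meas: "G n \<in> borel_measurable borel" for n using loc[of n] unfolding Lp_loc_def by blast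
  define S where "S = enn2real (SUP n. \<integral>\<^sup>+\<tau>\<in>{0..t}. ennreal (G n \<tau>) \<partial>lborel)"
  have S: "(SUP n. \<integral>\<^sup>+\<tau>\<in>{0..t}. ennreal (G n \<tau>) \<partial>lborel) = ennreal S" "0 \<le> S"
    using fin unfolding S_def by simp_all
  have up: "(\<integral>\<^sup>+\<tau>\<in>{0..t}. ennreal (G n \<tau>) \<partial>lborel) \<le> ennreal S" for n
    unfolding S(1)[symmetric] by (rule SUP_upper) simp
  then have gfin: "(\<integral>\<^sup>+\<tau>\<in>{0..t}. ennreal (G n \<tau>) \<partial>lborel) < \<infinity>" for n
    by (rule le_less_trans) simp
  have int: "integral {0..t} (G n) \<le> S" for n
    using integrable_weighted_continuous(2)[OF meas[of n] G0 gfin[of n], of "\<lambda>_. 1"] up[of n] S(2) by simp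
  obtain N0 :: nat where N0: "2 * (k * S + C * t) \<le> real N0" using real_arch_simple by blast
  then have "k * S + C * t \<le> real N0 / 2" by (simp add: mult.commute)
  then have "k * integral {0..t} (G n) + C * t \<le> real N0 / 2" for n
    using mult_left_mono[OF int[of n] k0] by linarith
  then show ?thesis using that[of G N0] G0 meas gfin form by blast
qed

text \<open>Each of the d second-order terms is bounded by the whole of \<open>Y\<close>; the factor
  d lost by adding them up is put into the constant.\<close>

lemma sum_bound_ennreal:
  fixes X :: "'d::finite \<Rightarrow> ennreal"
  assumes k: "0 \<le> k" and X: "\<And>i. ennreal k * X i \<le> Y"
  shows "ennreal (k / real CARD('d)) * (\<Sum>i\<in>UNIV. X i) \<le> Y"
proof -
  let ?d = "real CARD('d)"
  have "ennreal (k / ?d) * (\<Sum>i\<in>UNIV. X i) = (\<Sum>i\<in>UNIV. ennreal (1 / ?d) * (ennreal k * X i))"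
    using k by (simp add: sum_distrib_left mult.assoc[symmetric] ennreal_mult[symmetric])
  also have "\<dots> \<le> (\<Sum>i\<in>(UNIV :: 'd set). ennreal (1 / ?d) * Y)"
    by (intro sum_mono mult_left_mono X) simp
  also have "\<dots> = ennreal (?d * (1 / ?d)) * Y"
    by (simp add: ennreal_mult ennreal_of_nat_eq_real_of_nat mult.assoc del: times_divide_eq_right)
  also have "\<dots> = Y" by simp
  finally show ?thesis .
qed

theorem mainTheorem2:
  fixes b :: "real \<times> (real^'d::finite) \<Rightarrow> real^'d"
    and bs :: "nat \<Rightarrow> real \<times> (real^'d) \<Rightarrow> real^'d"
    and g :: "real \<Rightarrow> real"
    and \<delta> q :: real
  assumes dim: "CARD('d) \<ge> 3"
    and b: "b \<in> form_bounded \<delta> g"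
    and q: "q > real CARD('d)" and \<delta>: "\<delta> > 0"
    and low_dim: "CARD('d) \<in> {3, 4} \<Longrightarrow>
      (\<exists>\<epsilon>. 0 < \<epsilon> \<and> \<epsilon> \<le> 2 * (sqrt 2 - 1) \<and> q = real CARD('d) + \<epsilon>) \<and>
      sqrt \<delta> < (sqrt (q - 1) - (q - 2) / 2) * (2 / q)"
    and high_dim: "CARD('d) \<ge> 5 \<Longrightarrow>
      (\<exists>\<epsilon>. 0 < \<epsilon> \<and> \<epsilon> \<le> 1 \<and> q = real CARD('d) + \<epsilon>) \<and>
      (\<exists>\<mu>. 0 < \<mu> \<and> \<mu> < 1 \<and> 16 * \<mu> > (1 - \<mu>) ^ 4 * ((q - 1) ^ 2 / (q - 2) ^ 4) \<and>
        sqrt \<delta> < (1 - \<mu>) * ((q - 1) / (q - 2)) * (1 / q))"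
    and bs: "bs \<in> regularizing_seqs \<delta> b"
  shows "\<exists>c0 c1 :: real. \<exists>c2 :: real \<Rightarrow> real. c0 > 0 \<and> c1 > 0 \<and>
    (\<forall>n s t h u. 0 \<le> s \<longrightarrow> s < t \<longrightarrow> C1_compact_support h \<longrightarrow>
       bounded_classical_solution (bs n) s h u \<longrightarrow>
       (SUP \<tau>\<in>{s..t}. Lp_norm_pow q (grad (u \<tau>)))
       + ennreal c0 * (\<integral>\<^sup>+\<tau>\<in>{s..t}. Lp_norm_pow 2
           (\<lambda>x. norm (grad (u \<tau>) x) powr ((q - 2) / 2) *\<^sub>R time_deriv u \<tau> x) \<partial>lborel)
       + ennreal c1 * (\<Sum>i\<in>UNIV. \<integral>\<^sup>+\<tau>\<in>{s..t}.
           (\<integral>\<^sup>+x. ennreal (norm (partial i (grad (u \<tau>)) x) ^ 2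
                            * norm (grad (u \<tau>) x) powr (q - 2)) \<partial>lborel) \<partial>lborel)
       \<le> ennreal (exp (c2 t)) * Lp_norm_pow q (grad (u s)))"
proof -
  let ?d = "real CARD('d)"
  have d3: "3 \<le> ?d" using of_nat_mono[OF dim, where 'a=real] by simp
  have q3: "3 \<le> q" and q2: "2 < q" using q d3 by linarith+
  have small: "q * sqrt \<delta> / 2 < 1"
  proof (cases "CARD('d) \<in> {3, 4}")
    case True
    then show ?thesis using small_form_bound_low_dim[OF q2] low_dim by blast
  next
    case False
    then have "CARD('d) \<ge> 5" using dim by auto
    then show ?thesis using small_form_bound_high_dim[OF q3] high_dim by blast
  qed
  have d0: "0 < ?d" using d3 by linarith
  obtain \<beta> \<epsilon> where \<beta>: "0 < \<beta>" "\<beta> < 1" and \<epsilon>: "0 < \<epsilon>" and c1: "0 < 1 - \<beta> - \<epsilon> * (4 * ?d + 1)"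
    and A\<delta>: "((q - 1) / (2 * \<beta>) + 4 * \<epsilon>) * (\<delta> * (1 + \<epsilon>) * (q\<^sup>2 / 4)) \<le> (q - 1) / 2 * \<beta>"
    by (rule energy_constants[OF q2 \<delta> small d0])
  define A where "A = (q - 1) / (2 * \<beta>) + 4 * \<epsilon>"
  define C where "C = q * (A * \<delta> * (1 + 1 / \<epsilon>) + 2 / \<epsilon>)"
  define k where "k = q * (1 - \<beta> - \<epsilon> * (4 * ?d + 1))"
  have A0: "0 \<le> q * A" using q2 \<beta> \<epsilon> by (simp add: A_def)
  have k0: "0 < k" using q2 c1 by (simp add: k_def)
  \<comment> \<open>The majorants belong to a given \<open>t\<close>, so they and the count are
    chosen as functions of \<open>t\<close>. The coefficients of the left side, fixed above from
    \<delta>, q and d, do not see this choice.\<close>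
  have "\<forall>t. \<exists>G N0. 0 < t \<longrightarrow> (\<forall>n \<tau>. 0 \<le> G n \<tau>) \<and> (\<forall>n. G n \<in> borel_measurable borel) \<and>
      (\<forall>n. (\<integral>\<^sup>+\<tau>\<in>{0..t}. ennreal (G n \<tau>) \<partial>lborel) < \<infinity>) \<and>
      (\<forall>n f. schwartz f \<longrightarrow> form_ineq \<delta> (G n) (bs n) t f) \<and>
      (\<forall>n. q * A * integral {0..t} (G n) + C * t \<le> real N0 / 2)"
  proof (intro allI)
    fix t :: real
    show "\<exists>G N0. 0 < t \<longrightarrow> (\<forall>n \<tau>. 0 \<le> G n \<tau>) \<and> (\<forall>n. G n \<in> borel_measurable borel) \<and>
      (\<forall>n. (\<integral>\<^sup>+\<tau>\<in>{0..t}. ennreal (G n \<tau>) \<partial>lborel) < \<infinity>) \<and>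
      (\<forall>n f. schwartz f \<longrightarrow> form_ineq \<delta> (G n) (bs n) t f) \<and>
      (\<forall>n. q * A * integral {0..t} (G n) + C * t \<le> real N0 / 2)"
    proof (cases "0 < t")
      case True
      obtain G N0 where "\<And>n \<tau>. 0 \<le> G n \<tau>" "\<And>n. G n \<in> borel_measurable borel"
        "\<And>n. (\<integral>\<^sup>+\<tau>\<in>{0..t}. ennreal (G n \<tau>) \<partial>lborel) < \<infinity>"
        "\<And>n f. schwartz f \<Longrightarrow> form_ineq \<delta> (G n) (bs n) t f"
        "\<And>n. q * A * integral {0..t} (G n) + C * t \<le> real N0 / 2"
        using regularizing_seq_form_bound[OF bs True A0, of C] by blast
      then show ?thesis by (intro exI[of _ G] exI[of _ N0] impI conjI allI)
    qed simp
  qed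
  from choice[OF this] obtain G where "\<forall>t. \<exists>N0. 0 < t \<longrightarrow> (\<forall>n \<tau>. 0 \<le> G t n \<tau>) \<and> (\<forall>n. G t n \<in> borel_measurable borel) \<and>
      (\<forall>n. (\<integral>\<^sup>+\<tau>\<in>{0..t}. ennreal (G t n \<tau>) \<partial>lborel) < \<infinity>) \<and>
      (\<forall>n f. schwartz f \<longrightarrow> form_ineq \<delta> (G t n) (bs n) t f) \<and>
      (\<forall>n. q * A * integral {0..t} (G t n) + C * t \<le> real N0 / 2)" ..
  from choice[OF this] obtain N0 where
    "\<forall>t. 0 < t \<longrightarrow> (\<forall>n \<tau>. 0 \<le> G t n \<tau>) \<and> (\<forall>n. G t n \<in> borel_measurable borel) \<and>
      (\<forall>n. (\<integral>\<^sup>+\<tau>\<in>{0..t}. ennreal (G t n \<tau>) \<partial>lborel) < \<infinity>) \<and>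
      (\<forall>n f. schwartz f \<longrightarrow> form_ineq \<delta> (G t n) (bs n) t f) \<and>
      (\<forall>n. q * A * integral {0..t} (G t n) + C * t \<le> real (N0 t) / 2)" ..
  then have G: "\<And>n \<tau>. 0 \<le> G t n \<tau>" "\<And>n. G t n \<in> borel_measurable borel"
      "\<And>n. (\<integral>\<^sup>+\<tau>\<in>{0..t}. ennreal (G t n \<tau>) \<partial>lborel) < \<infinity>"
      "\<And>n f. schwartz f \<Longrightarrow> form_ineq \<delta> (G t n) (bs n) t f"
      "\<And>n. q * A * integral {0..t} (G t n) + C * t \<le> real (N0 t) / 2" if "0 < t" for t
    using that by blast+
  define D where "D t = 1 + 2 ^ N0 t * real (N0 t)" for t
  have D0: "1 \<le> D t" for t by (simp add: D_def)
  \<comment> \<open>The three terms on the left are bounded separately: the supremum by 2^(N0+1),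
    each of the two integrals by \<open>D\<close>. The required c2 is the logarithm of the
    sum.\<close>
  define T where "T t = 2 ^ Suc (N0 t) + D t + D t" for t
  have T0: "0 < T t" for t using D0[of t] by (simp add: T_def add_pos_pos)
  show ?thesis
  proof (rule exI[of _ "q * \<epsilon>"], rule exI[of _ "k / ?d"], rule exI[of _ "\<lambda>t. ln (T t)"], intro conjI allI impI)
    show "0 < q * \<epsilon>" "0 < k / ?d" using q2 \<epsilon> k0 d0 by simp_all
    fix n :: nat and s t :: real and h :: "real^'d \<Rightarrow> complex" and u
    assume st: "0 \<le> s" "s < t" and h: "C1_compact_support h" and sol: "bounded_classical_solution (bs n) s h u"
    have t: "0 < t" using st by linarith
    obtain M where M: "\<And>z. norm (bs n z) \<le> M" using regularizing_seq_regular(2)[OF bs, of n] by blast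
    interpret cauchy_solution "bs n" s h u M
      by (rule cauchy_solution.intro[OF sol M regularizing_seq_regular(1)[OF bs] h])
    let ?H = "Lp_norm_pow q (grad h)"
    note est0 = global_estimate[where g="G t n" and t=t, OF G(4)[OF t, of _ n] G(2)[OF t] G(1)[OF t] less_imp_le[OF \<delta>] G(3)[OF t] q2 \<beta> \<epsilon> c1 A\<delta> st G(5)[OF t, of n, unfolded C_def A_def],
      folded D_def k_def]
    have e1: "Lp_norm_pow q (grad (u \<tau>)) \<le> ennreal (2 ^ Suc (N0 t)) * ?H" if "\<tau> \<in> {s..t}" for \<tau>
      using that by (rule est0(1)[rotated])
    have e2: "ennreal k * (\<integral>\<^sup>+\<tau>\<in>{s..t}. (\<integral>\<^sup>+x. ennreal (norm (partial i (grad (u \<tau>)) x) ^ 2 * norm (grad (u \<tau>) x) powr (q - 2)) \<partial>lborel) \<partial>lborel)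
       \<le> ennreal (D t) * ?H" for i
      by (rule est0(2))
    have e3: "ennreal (q * \<epsilon>) * (\<integral>\<^sup>+\<tau>\<in>{s..t}. Lp_norm_pow 2 (\<lambda>x. norm (grad (u \<tau>) x) powr ((q - 2) / 2) *\<^sub>R time_deriv u \<tau> x) \<partial>lborel)
       \<le> ennreal (D t) * ?H"
      by (rule est0(3))
    have "(SUP \<tau>\<in>{s..t}. Lp_norm_pow q (grad (u \<tau>)))
       + ennreal (q * \<epsilon>) * (\<integral>\<^sup>+\<tau>\<in>{s..t}. Lp_norm_pow 2
           (\<lambda>x. norm (grad (u \<tau>) x) powr ((q - 2) / 2) *\<^sub>R time_deriv u \<tau> x) \<partial>lborel)
       + ennreal (k / ?d) * (\<Sum>i\<in>UNIV. \<integral>\<^sup>+\<tau>\<in>{s..t}.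
           (\<integral>\<^sup>+x. ennreal (norm (partial i (grad (u \<tau>)) x) ^ 2
                            * norm (grad (u \<tau>) x) powr (q - 2)) \<partial>lborel) \<partial>lborel)
       \<le> ennreal (2 ^ Suc (N0 t)) * ?H + ennreal (D t) * ?H + ennreal (D t) * ?H"
      by (intro add_mono SUP_least e1 e3 sum_bound_ennreal[OF less_imp_le[OF k0] e2])
    also have "\<dots> = (ennreal (2 ^ Suc (N0 t)) + ennreal (D t) + ennreal (D t)) * ?H"
      by (simp only: distrib_right)
    also have "ennreal (2 ^ Suc (N0 t)) + ennreal (D t) + ennreal (D t) = ennreal (T t)"
    proof -
      have D: "0 \<le> D t" using D0[of t] by linarith
      have p: "0 \<le> (2::real) ^ Suc (N0 t)" by simp
      show ?thesis unfolding T_def ennreal_plus[OF add_nonneg_nonneg[OF p D] D] ennreal_plus[OF p D] ..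
    qed
    also have "ennreal (T t) * ?H = ennreal (exp (ln (T t))) * Lp_norm_pow q (grad (u s))"
      by (simp only: exp_ln[OF T0] u_init)
    finally show "(SUP \<tau>\<in>{s..t}. Lp_norm_pow q (grad (u \<tau>)))
       + ennreal (q * \<epsilon>) * (\<integral>\<^sup>+\<tau>\<in>{s..t}. Lp_norm_pow 2
           (\<lambda>x. norm (grad (u \<tau>) x) powr ((q - 2) / 2) *\<^sub>R time_deriv u \<tau> x) \<partial>lborel)
       + ennreal (k / ?d) * (\<Sum>i\<in>UNIV. \<integral>\<^sup>+\<tau>\<in>{s..t}.
           (\<integral>\<^sup>+x. ennreal (norm (partial i (grad (u \<tau>)) x) ^ 2
                            * norm (grad (u \<tau>) x) powr (q - 2)) \<partial>lborel) \<partial>lborel)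
       \<le> ennreal (exp (ln (T t))) * Lp_norm_pow q (grad (u s))" .
  qed
qed

end
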